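(* Let $X\subset\mathbb{P}^N$ be a decomposable scroll generated by $C_1,\dots,C_n$ over a smooth curve $C$, and assume that $\Phi_2(X)\neq X$. Let $G$ be an irreducible component of $\Phi_2(X)$. Then, up to reordering the curves $C_i$, there is an integer $s\geq 1$ such that either (1) $G=\langle p_1,\dots,p_s\rangle\subseteq f_p=\langle p_1,\dots,p_n\rangle$ for some $p\in C$, or (2) $X$ is rational (i.e. $C\cong\mathbb{P}^1$) and $G=C_1\times\langle p_1,\dots,p_s\rangle$ is the image of $\mathbb{P}^1\times\mathbb{P}^{s-1}$ via the Segre embedding. Moreover, $$\mathrm{Osc}^2_x(X)=\langle \mathrm{Osc}^2_{p_1}(C_1),\mathrm{Osc}^1_{p_2}(C_2),\dots,\mathrm{Osc}^1_{p_n}(C_n)\rangle$$ for all $x\in G$ in case (1), and for all $p \in C$ and all $x\in G\cap f_p$ in case (2). In particular, $\dim \mathrm{Osc}^2_x(X)=2n-1$ for any $x\in G$ in both cases.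
   Context: We work over $\mathbb{C}$. For a vector space $W$, $\mathbb{P}(W)$ is the set of codimension-one subspaces of $W$; $\langle\cdot\rangle$ denotes linear span. Decomposable scroll. Let $C$ be a smooth projective curve. For $i=1,\dots,n$ let $\mathcal{L}_i$ be a very ample line bundle on $C$ and $V_i\subseteq H^0(C,\mathcal{L}_i)$ a subspace such that $|V_i|$ gives an embedding $\varphi_i:C\to\mathbb{P}^{r_i}=\mathbb{P}(V_i)$; put $C_i=\varphi_i(C)$. Let $V=\bigoplus_i V_i$, $\mathcal{E}=\bigoplus_i\mathcal{L}_i$, $P=\mathbb{P}(\mathcal{E})$ and let $L$ be the tautological line bundle on $P$. Identifying $V$ with a subspace of $H^0(P,L)$ one gets an embedding $\varphi:P\to\mathbb{P}^N=\mathbb{P}(V)$, $N=\sum_i r_i+n-1$. Its image $X=\varphi(P)$ is called the decomposable scroll generated by $C_1,\dots,C_n$. For $p\in C$ put $p_i=\varphi_i(p)\in C_i\subset\mathbb{P}^{r_i}\subset \mathbb{P}^N$, the $\mathbb{P}^{r_i}$ being embedded as linearly independent subspaces spanning $\mathbb{P}^N$; the fibre of $X$ over $p$ is $f_p=\langle p_1,\dots,p_n\rangle\cong\mathbb{P}^{n-1}$. Osculating spaces and inflectional loci. For a smooth $Y\subset\mathbb{P}(W)$ with hyperplane bundle $L$ and $y\in Y$, let $j_{k,y}:W\to (J_kL)_y$ be the map sending a section to its $k$-th jet at $y$ ($J_kL$ the $k$-th jet bundle). The $k$-th osculating space is $\mathrm{Osc}^k_y(Y)=\mathbb{P}(\mathrm{Im}\,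 j_{k,y})\subseteq\mathbb{P}(W)$, a linear subspace of dimension $\mathrm{rk}(j_{k,y})-1$. If $Y$ is a scroll of dimension $n$ (a curve if $n=1$), then $\dim\mathrm{Osc}^k_y(Y)\le nk$, and the $k$-th inflectional locus is $\Phi_k(Y)=\{y\in Y:\dim\mathrm{Osc}^k_y(Y)<nk\}$. For a curve $C_i$ the osculating spaces are taken in $\mathbb{P}^{r_i}=\mathbb{P}(V_i)$. In case (2) the notation $G=C_1\times\langle p_1,\dots,p_s\rangle$ means that $C_1,\dots,C_s$ are lines and $G=\bigcup_{p\in C}\langle p_1,\dots,p_s\rangle$ is the sub-scroll of $X$ generated by them, embedded in $\langle C_1,\dots,C_s\rangle=\mathbb{P}^{2s-1}$. *)

theory Defs
  imports "HOL-Analysis.Analysis" "HOL-Library.Function_Algebras"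
begin

section \<open>Linear algebra\<close>

text \<open>All complex vector spaces below are subspaces of function spaces \<open>'x \<Rightarrow> complex\<close>
  with pointwise operations.\<close>

definition cscale :: "complex \<Rightarrow> ('x \<Rightarrow> complex) \<Rightarrow> 'x \<Rightarrow> complex"
  where "cscale c f = (\<lambda>x. c * f x)"

global_interpretation cfun: vector_space cscale
  by unfold_locales (simp_all add: cscale_def fun_eq_iff algebra_simps)

definition fin_dim :: "('x \<Rightarrow> complex) set \<Rightarrow> bool"
  where "fin_dim W \<longleftrightarrow> cfun.subspace W \<and> (\<exists>B. finite B \<and> cfun.span B = W)"

text \<open>The coordinate space \<open>\<complex>\<^sup>I\<close>, as functions vanishing off \<open>I\<close>.\<close>

definition coord_space :: "'x set \<Rightarrow> ('x \<Rightarrow> complex) set"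
  where "coord_space I = {f. \<forall>x. x \<notin> I \<longrightarrow> f x = 0}"

section \<open>Projective spaces and their linear subspaces\<close>

text \<open>\<open>Proj W\<close> is the set of codimension-one subspaces of a finite-dimensional \<open>W\<close>.\<close>

type_synonym 'x point = "('x \<Rightarrow> complex) set"

definition Proj :: "('x \<Rightarrow> complex) set \<Rightarrow> 'x point set"
  where "Proj W = {H. cfun.subspace H \<and> H \<subseteq> W \<and> cfun.dim W = cfun.dim H + 1}"

text \<open>A quotient \<open>W / K\<close> gives the linear subspace \<open>\<P>(W / K)\<close> of \<open>\<P>(W)\<close>.\<close>

definition Proj_quot :: "('x \<Rightarrow> complex) set \<Rightarrow> ('x \<Rightarrow> complex) set \<Rightarrow> 'x point set"
  where "Proj_quot W K = {H \<in> Proj W. K \<subseteq> H}"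

definition proj_linear :: "('x \<Rightarrow> complex) set \<Rightarrow> 'x point set \<Rightarrow> bool"
  where "proj_linear W \<Lambda> \<longleftrightarrow> (\<exists>K. cfun.subspace K \<and> K \<subseteq> W \<and> \<Lambda> = Proj_quot W K)"

definition pspan :: "('x \<Rightarrow> complex) set \<Rightarrow> 'x point set \<Rightarrow> 'x point set"
  where "pspan W S = \<Inter>{\<Lambda>. proj_linear W \<Lambda> \<and> S \<subseteq> \<Lambda>}"

text \<open>For \<open>\<Lambda> = Proj_quot W K\<close> the intersection below is \<open>K\<close>; the empty subspace has dimension \<open>-1\<close>.\<close>

definition pdim :: "('x \<Rightarrow> complex) set \<Rightarrow> 'x point set \<Rightarrow> int"
  where "pdim W \<Lambda> = int (cfun.dim W) - int (cfun.dim (W \<inter> \<Inter>\<Lambda>)) - 1"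

definition proj_line :: "('x \<Rightarrow> complex) set \<Rightarrow> 'x point set \<Rightarrow> bool"
  where "proj_line W \<Lambda> \<longleftrightarrow> proj_linear W \<Lambda> \<and> pdim W \<Lambda> = 1"

section \<open>Zariski topology and regular functions\<close>

text \<open>\<open>homog_poly W d F\<close>: \<open>F\<close> is the function on linear functionals of \<open>W\<close> defined by an
  element of \<open>Sym\<^sup>d W\<close>.\<close>

inductive homog_poly ::
  "('x \<Rightarrow> complex) set \<Rightarrow> nat \<Rightarrow> ((('x \<Rightarrow> complex) \<Rightarrow> complex) \<Rightarrow> complex) \<Rightarrow> bool" for W where
  const: "homog_poly W 0 (\<lambda>l. c)"
| linear: "w \<in> W \<Longrightarrow> homog_poly W 1 (\<lambda>l. l w)"
| add: "homog_poly W d F \<Longrightarrow> homog_poly W d G \<Longrightarrow> homog_poly W d (\<lambda>l. F l + G l)"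
| mult: "homog_poly W d F \<Longrightarrow> homog_poly W e G \<Longrightarrow> homog_poly W (d + e) (\<lambda>l. F l * G l)"

text \<open>Homogeneous coordinates of a point \<open>z\<close>: a linear functional on \<open>W\<close> with kernel \<open>z\<close>.
  It is unique up to a nonzero scalar, and is only used in ways not depending on this scalar.\<close>

definition hcoord :: "('x \<Rightarrow> complex) set \<Rightarrow> 'x point \<Rightarrow> ('x \<Rightarrow> complex) \<Rightarrow> complex"
  where "hcoord W z = (SOME l. Vector_Spaces.linear cscale (*) l \<and> {w \<in> W. l w = 0} = z)"

definition zariski :: "('x \<Rightarrow> complex) set \<Rightarrow> 'x point topology"
  where "zariski W = topology_generated_by
    {U. \<exists>d F. homog_poly W d F \<and> U = {z \<in> Proj W. F (hcoord W z) \<noteq> 0}}"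

definition irreducible_set :: "'a topology \<Rightarrow> 'a set \<Rightarrow> bool"
  where "irreducible_set T S \<longleftrightarrow> S \<subseteq> topspace T \<and> S \<noteq> {} \<and>
    (\<forall>A B. closedin T A \<and> closedin T B \<and> S \<subseteq> A \<union> B \<longrightarrow> S \<subseteq> A \<or> S \<subseteq> B)"

definition irreducible_component :: "'a topology \<Rightarrow> 'a set \<Rightarrow> 'a set \<Rightarrow> bool"
  where "irreducible_component T Y G \<longleftrightarrow> G \<subseteq> Y \<and> irreducible_set T G \<and>
    (\<forall>G'. G \<subseteq> G' \<and> G' \<subseteq> Y \<and> irreducible_set T G' \<longrightarrow> G' = G)"

definition irreducible_chain :: "'a topology \<Rightarrow> nat \<Rightarrow> (nat \<Rightarrow> 'a set) \<Rightarrow> bool"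
  where "irreducible_chain T d Z \<longleftrightarrow>
    (\<forall>i\<le>d. closedin T (Z i) \<and> irreducible_set T (Z i)) \<and> (\<forall>i<d. Z i \<subset> Z (Suc i))"

definition krull_dim_eq :: "'a topology \<Rightarrow> nat \<Rightarrow> bool"
  where "krull_dim_eq T d \<longleftrightarrow>
    (\<exists>Z. irreducible_chain T d Z) \<and> \<not> (\<exists>Z. irreducible_chain T (Suc d) Z)"

text \<open>Regular functions on \<open>Y \<subseteq> \<P>(W)\<close> are locally quotients of forms of equal degree.
  Only the germ of \<open>f\<close> on \<open>Y\<close> at \<open>y\<close> matters.\<close>

definition regular_at ::
  "('x \<Rightarrow> complex) set \<Rightarrow> 'x point set \<Rightarrow> 'x point \<Rightarrow> ('x point \<Rightarrow> complex) \<Rightarrow> bool"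
  where "regular_at W Y y f \<longleftrightarrow>
    (\<exists>U d F G. openin (zariski W) U \<and> y \<in> U \<and> homog_poly W d F \<and> homog_poly W d G \<and>
      (\<forall>z\<in>U \<inter> Y. G (hcoord W z) \<noteq> 0 \<and> f z = F (hcoord W z) / G (hcoord W z)))"

text \<open>\<open>max_ideal_pow W Y y k\<close> consists of the functions whose germ lies in the \<open>k\<close>-th power of the
  maximal ideal of the local ring of \<open>Y\<close> at \<open>y\<close>.\<close>

definition max_ideal_pow ::
  "('x \<Rightarrow> complex) set \<Rightarrow> 'x point set \<Rightarrow> 'x point \<Rightarrow> nat \<Rightarrow> ('x point \<Rightarrow> complex) set"
  where "max_ideal_pow W Y y k = {f. \<exists>(N::nat) a g U.
      (\<forall>i<N. regular_at W Y y (a i)) \<and>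
      (\<forall>i<N. \<forall>j<k. regular_at W Y y (g i j) \<and> g i j y = 0) \<and>
      openin (zariski W) U \<and> y \<in> U \<and>
      (\<forall>z\<in>U \<inter> Y. f z = (\<Sum>i<N. a i z * (\<Prod>j<k. g i j z)))}"

definition morphism :: "('x \<Rightarrow> complex) set \<Rightarrow> 'x point set \<Rightarrow>
    ('y \<Rightarrow> complex) set \<Rightarrow> 'y point set \<Rightarrow> ('x point \<Rightarrow> 'y point) \<Rightarrow> bool"
  where "morphism W Y W' Y' f \<longleftrightarrow>
    continuous_map (subtopology (zariski W) Y) (subtopology (zariski W') Y') f \<and>
    (\<forall>y\<in>Y. \<forall>h. regular_at W' Y' (f y) h \<longrightarrow> regular_at W Y y (h \<circ> f))"

definition isomorphism :: "('x \<Rightarrow> complex) set \<Rightarrow> 'x point set \<Rightarrow>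
    ('y \<Rightarrow> complex) set \<Rightarrow> 'y point set \<Rightarrow> ('x point \<Rightarrow> 'y point) \<Rightarrow> bool"
  where "isomorphism W Y W' Y' f \<longleftrightarrow> morphism W Y W' Y' f \<and>
    (\<exists>g. morphism W' Y' W Y g \<and> (\<forall>y\<in>Y. g (f y) = y) \<and> (\<forall>z\<in>Y'. f (g z) = z))"

definition closed_embedding :: "('x \<Rightarrow> complex) set \<Rightarrow> 'x point set \<Rightarrow>
    ('y \<Rightarrow> complex) set \<Rightarrow> ('x point \<Rightarrow> 'y point) \<Rightarrow> bool"
  where "closed_embedding W Y W' f \<longleftrightarrow>
    closedin (zariski W') (f ` Y) \<and> isomorphism W Y W' (f ` Y) f"

section \<open>Smooth projective curves, line bundles, linear systems\<close>

text \<open>Smoothness in dimension \<open>d\<close>: every cotangent space (maximal ideal modulo its square)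
  has a basis with \<open>d\<close> elements.\<close>

definition smooth_of_dim :: "('x \<Rightarrow> complex) set \<Rightarrow> 'x point set \<Rightarrow> nat \<Rightarrow> bool"
  where "smooth_of_dim W Y d \<longleftrightarrow> krull_dim_eq (subtopology (zariski W) Y) d \<and>
    (\<forall>y\<in>Y. \<exists>t. (\<forall>i\<in>{1..d}. t i \<in> max_ideal_pow W Y y 1) \<and>
      (\<forall>f\<in>max_ideal_pow W Y y 1. \<exists>!c. c \<in> coord_space {1..d} \<and>
        (\<lambda>z. f z - (\<Sum>i=1..d. c i * t i z)) \<in> max_ideal_pow W Y y 2))"

definition smooth_projective_curve :: "('x \<Rightarrow> complex) set \<Rightarrow> 'x point set \<Rightarrow> bool"
  where "smooth_projective_curve M C \<longleftrightarrow> fin_dim M \<and> closedin (zariski M) C \<and>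
    irreducible_set (zariski M) C \<and> smooth_of_dim M C 1"

text \<open>The fibres of a line bundle are one-dimensional, so (choosing a basis vector in each fibre)
  its total space may be taken to be \<open>C \<times> \<complex>\<close> as a set. The algebraic structure is then an atlas of
  local frames \<open>(U, e)\<close>, where \<open>e\<close> is an arbitrary nowhere vanishing function on the open set
  \<open>U\<close>, with regular transition functions. A section is a function \<open>s\<close> such that \<open>s / e\<close> is
  regular on \<open>U\<close> for all frames; sections are extended by \<open>0\<close> off \<open>C\<close>.\<close>

type_synonym 'x frames = "('x point set \<times> ('x point \<Rightarrow> complex)) set"

definition line_bundle :: "('x \<Rightarrow> complex) set \<Rightarrow> 'x point set \<Rightarrow> 'x frames \<Rightarrow> bool"
  where "line_bundle M C A \<longleftrightarrow>
    (\<forall>(U, e)\<in>A. openin (subtopology (zariski M) C) U \<and> (\<forall>p\<in>U. e p \<noteq> 0)) \<and>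
    (\<Union>(U, e)\<in>A. U) = C \<and>
    (\<forall>(U, e)\<in>A. \<forall>(U', e')\<in>A. \<forall>p\<in>U \<inter> U'. regular_at M C p (\<lambda>q. e q / e' q))"

definition global_sections ::
  "('x \<Rightarrow> complex) set \<Rightarrow> 'x point set \<Rightarrow> 'x frames \<Rightarrow> ('x point \<Rightarrow> complex) set"
  where "global_sections M C A = {s.
    (\<forall>(U, e)\<in>A. \<forall>p\<in>U. regular_at M C p (\<lambda>q. s q / e q)) \<and> (\<forall>p. p \<notin> C \<longrightarrow> s p = 0)}"

text \<open>The map \<open>C \<rightarrow> \<P>(V)\<close> of the linear system \<open>|V|\<close>: a point goes to the kernel of evaluation at
  it. It takes values in \<open>Proj V\<close> exactly when \<open>|V|\<close> has no base points.\<close>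

definition linsys_map :: "('x point \<Rightarrow> complex) set \<Rightarrow> 'x point \<Rightarrow> 'x point point"
  where "linsys_map V p = {v \<in> V. v p = 0}"

definition embedding_system :: "('x \<Rightarrow> complex) set \<Rightarrow> 'x point set \<Rightarrow> 'x frames \<Rightarrow>
    ('x point \<Rightarrow> complex) set \<Rightarrow> bool"
  where "embedding_system M C A V \<longleftrightarrow>
    fin_dim V \<and> V \<subseteq> global_sections M C A \<and> closed_embedding M C V (linsys_map V)"

definition very_ample :: "('x \<Rightarrow> complex) set \<Rightarrow> 'x point set \<Rightarrow> 'x frames \<Rightarrow> bool"
  where "very_ample M C A \<longleftrightarrow> (\<exists>V. embedding_system M C A V)"

section \<open>Decomposable scrolls\<close>

text \<open>\<open>V = V\<^sub>1 \<oplus> \<dots> \<oplus> V\<^sub>n\<close>, where \<open>v\<close> has components \<open>\<lambda>p. v (i, p)\<close>.\<close>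

definition sys_sum :: "nat \<Rightarrow> (nat \<Rightarrow> ('x point \<Rightarrow> complex) set) \<Rightarrow>
    (nat \<times> 'x point \<Rightarrow> complex) set"
  where "sys_sum n V = {v. (\<forall>i\<in>{1..n}. (\<lambda>p. v (i, p)) \<in> V i) \<and>
    (\<forall>i p. i \<notin> {1..n} \<longrightarrow> v (i, p) = 0)}"

text \<open>The fibre of the direct sum of the line bundles at each point is \<open>\<complex>\<^sup>n\<close>, so \<open>P\<close> is the set
  of pairs \<open>(p, H)\<close> with \<open>H\<close> a hyperplane of \<open>\<complex>\<^sup>n\<close>. The tautological line bundle has
  fibre \<open>\<complex>\<^sup>n / H\<close> at \<open>(p, H)\<close>, and \<open>v\<close> in \<open>V\<close> gives its section with value
  \<open>(v\<^sub>1(p), \<dots>, v\<^sub>n(p))\<close> mod \<open>H\<close>; \<open>scroll_map\<close> is the map to \<open>\<P>(V)\<close> these sections define.\<close>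

definition proj_bundle :: "nat \<Rightarrow> 'x point set \<Rightarrow> ('x point \<times> nat point) set"
  where "proj_bundle n C = C \<times> Proj (coord_space {1..n})"

definition scroll_map :: "nat \<Rightarrow> (nat \<Rightarrow> ('x point \<Rightarrow> complex) set) \<Rightarrow>
    'x point \<times> nat point \<Rightarrow> (nat \<times> 'x point) point"
  where "scroll_map n V = (\<lambda>(p, H). {v \<in> sys_sum n V. (\<lambda>i. v (i, p)) \<in> H})"

definition decomposable_scroll :: "nat \<Rightarrow> 'x point set \<Rightarrow>
    (nat \<Rightarrow> ('x point \<Rightarrow> complex) set) \<Rightarrow> (nat \<times> 'x point) point set"
  where "decomposable_scroll n C V = scroll_map n V ` proj_bundle n C"

text \<open>The inclusion of \<open>\<P>(V\<^sub>i)\<close> in \<open>\<P>(V)\<close> given by the projection of \<open>V\<close> to \<open>V\<^sub>i\<close>.\<close>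

definition summand_incl :: "nat \<Rightarrow> (nat \<Rightarrow> ('x point \<Rightarrow> complex) set) \<Rightarrow> nat \<Rightarrow>
    'x point point \<Rightarrow> (nat \<times> 'x point) point"
  where "summand_incl n V i H = {v \<in> sys_sum n V. (\<lambda>p. v (i, p)) \<in> H}"

text \<open>The span of the points \<open>p\<^sub>i\<close>, \<open>i \<in> I\<close>; for \<open>I = {1..n}\<close> this is the fibre of the scroll over
  \<open>p\<close>.\<close>

definition point_span :: "nat \<Rightarrow> (nat \<Rightarrow> ('x point \<Rightarrow> complex) set) \<Rightarrow> nat set \<Rightarrow>
    'x point \<Rightarrow> (nat \<times> 'x point) point set"
  where "point_span n V I p =
    pspan (sys_sum n V) ((\<lambda>i. summand_incl n V i (linsys_map (V i) p)) ` I)"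

section \<open>Osculating spaces and inflectional loci\<close>

text \<open>The fibre at \<open>y\<close> of the \<open>k\<close>-th jet bundle of \<open>L\<close> is \<open>L\<^sub>y / \<mm>\<^sup>k\<^sup>+\<^sup>1 L\<^sub>y\<close>, with \<open>L\<^sub>y\<close> the stalk
  and \<open>\<mm>\<close> the maximal ideal at \<open>y\<close>. A section \<open>u \<in> W\<close> of the hyperplane bundle \<open>L\<close> with
  \<open>u \<notin> y\<close> generates \<open>L\<close> near \<open>y\<close>, and \<open>w / u\<close> is the regular function
  \<open>hcoord W z w / hcoord W z u\<close>. So \<open>jet_kernel\<close> is the kernel of the jet map, whose image is
  identified with \<open>W\<close> modulo this kernel.\<close>

definition jet_kernel :: "('x \<Rightarrow> complex) set \<Rightarrow> 'x point set \<Rightarrow> nat \<Rightarrow> 'x point \<Rightarrow>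
    ('x \<Rightarrow> complex) set"
  where "jet_kernel W Y k y = {w \<in> W. \<exists>u\<in>W. u \<notin> y \<and>
    (\<lambda>z. hcoord W z w / hcoord W z u) \<in> max_ideal_pow W Y y (k + 1)}"

definition Osc :: "('x \<Rightarrow> complex) set \<Rightarrow> 'x point set \<Rightarrow> nat \<Rightarrow> 'x point \<Rightarrow> 'x point set"
  where "Osc W Y k y = Proj_quot W (jet_kernel W Y k y)"

text \<open>Here \<open>n\<close> is the dimension of the scroll \<open>Y\<close>.\<close>

definition inflectional_locus ::
  "('x \<Rightarrow> complex) set \<Rightarrow> nat \<Rightarrow> 'x point set \<Rightarrow> nat \<Rightarrow> 'x point set"
  where "inflectional_locus W n Y k = {y \<in> Y. pdim W (Osc W Y k y) < int (n * k)}"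

section \<open>Segre embedding\<close>

text \<open>The tensor product of \<open>coord_space I\<close> and \<open>coord_space J\<close> is \<open>coord_space (I \<times> J)\<close>.\<close>

definition tensor :: "('x \<Rightarrow> complex) \<Rightarrow> ('y \<Rightarrow> complex) \<Rightarrow> 'x \<times> 'y \<Rightarrow> complex"
  where "tensor a b = (\<lambda>(i, j). a i * b j)"

text \<open>For hyperplanes \<open>H\<close> of \<open>A\<close> and \<open>K\<close> of \<open>B\<close>, this is the kernel
  \<open>H \<otimes> B + A \<otimes> K\<close> of \<open>A \<otimes> B \<rightarrow> A/H \<otimes> B/K\<close>.\<close>

definition segre_map :: "('x \<Rightarrow> complex) set \<Rightarrow> ('y \<Rightarrow> complex) set \<Rightarrow>
    'x point \<times> 'y point \<Rightarrow> ('x \<times> 'y) point"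
  where "segre_map A B = (\<lambda>(H, K).
    cfun.span {tensor a b | a b. a \<in> A \<and> b \<in> B \<and> (a \<in> H \<or> b \<in> K)})"

text \<open>\<open>G\<close> is, in suitable homogeneous coordinates on the linear subspace \<open>\<Lambda>\<close> of \<open>\<P>(W)\<close>, the image of
  \<open>\<P>\<^sup>1 \<times> \<P>\<^sup>s\<^sup>-\<^sup>1\<close> under the Segre embedding in \<open>\<P>\<^sup>2\<^sup>s\<^sup>-\<^sup>1\<close>. The coordinates are given by a
  surjection of \<open>W\<close> onto \<open>\<complex>\<^sup>2 \<otimes> \<complex>\<^sup>s\<close>.\<close>

definition segre_image_in :: "('x \<Rightarrow> complex) set \<Rightarrow> 'x point set \<Rightarrow> nat \<Rightarrow> 'x point set \<Rightarrow> bool"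
  where "segre_image_in W \<Lambda> s G \<longleftrightarrow>
    (\<exists>T. Vector_Spaces.linear cscale cscale T \<and>
      T ` W = coord_space ({1..2::nat} \<times> {1..s}) \<and>
      \<Lambda> = (\<lambda>H. {w \<in> W. T w \<in> H}) ` Proj (coord_space ({1..2::nat} \<times> {1..s})) \<and>
      G = (\<lambda>H. {w \<in> W. T w \<in> H}) ` segre_map (coord_space {1..2}) (coord_space {1..s}) `
        (Proj (coord_space {1..2}) \<times> Proj (coord_space {1..s})))"

end

theory Submission
  imports Defs "HOL-Computational_Algebra.Fundamental_Theorem_Algebra"
begin

text \<open>A point of the scroll is a pair of \<open>p \<in> C\<close> and a nonzero \<open>c \<in> \<complex>\<^sup>n\<close> up to scaling, and a section
  \<open>v = (v\<^sub>1, \<dots>, v\<^sub>n)\<close> is locally the function \<open>\<Sum> c\<^sub>i v\<^sub>i(q)\<close> of \<open>q\<close> and \<open>c\<close>. It has zero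
  2-jet at \<open>(p, c)\<close> iff every \<open>v\<^sub>i\<close> vanishes to order 2 at \<open>p\<close> and \<open>\<Sum> c\<^sub>i v\<^sub>i\<close> to order 3. So
  \<open>(p, c)\<close> is inflectional iff \<open>p\<close> is an inflection point of \<open>C\<^sub>i\<close> for all \<open>i\<close> with
  \<open>c\<^sub>i \<noteq> 0\<close>. The non-inflection points of a curve form an open set, which in characteristic zero is empty
  only for a line: if the second derivatives of all sections with respect to a local parameter vanish,
  then the first derivatives are constant by Krull's intersection theorem. Since \<open>C\<close> has dimension 1,
  an irreducible component of the inflectional locus either lies in one fibre or dominates \<open>C\<close>. In the first
  case it is spanned by the inflection points of that fibre. In the second it consists of the points with
  \<open>c\<^sub>i = 0\<close> unless \<open>C\<^sub>i\<close> is a line. The embeddings of \<open>C\<close> as these lines differ by projective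
  transformations, whence the Segre embedding.\<close>

section \<open>Linear algebra\<close>

text \<open>Points are hyperplanes of spaces of sections, and their homogeneous coordinates
  \<open>hcoord\<close> are arbitrary choices, so statements about them are moved to a convenient
  functional with the same kernel, usually evaluation at a point. The local ring of the scroll is
  never described explicitly. A 2-jet on it is tested by restriction to local sections over the
  curve, of the form \<open>c + t e_j\<close> with a local parameter \<open>t\<close>; this detects
  order 2 in each summand. Conversely, functions are pulled back from the curve along the
  projection. The sections of order at least 2 in every summand have codimension
  \<open>2 * n\<close>, which is the source of the value \<open>2 * n - 1\<close> in the conclusion.
  The main obstacle is that openness of non-inflection involves second derivatives at a moving
  point: one parameter has to serve at all nearby points, and derivatives have to be regular again.
  Nakayama's lemma for families of cotangent vectors gives both. Krull's theorem is derived from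
  Hilbert's basis theorem for algebras of functions on affine charts.\<close>

global_interpretation cfunl: vector_space_pair cscale "(*) :: complex \<Rightarrow> complex \<Rightarrow> complex"
  by unfold_locales (auto simp: algebra_simps)

abbreviation lin :: "(('x \<Rightarrow> complex) \<Rightarrow> complex) \<Rightarrow> bool"
  where "lin l \<equiv> Vector_Spaces.linear cscale (*) l"

lemma lin_iff: "lin l \<longleftrightarrow> (\<forall>f g. l (f + g) = l f + l g) \<and> (\<forall>c f. l (cscale c f) = c * l f)"
  unfolding Vector_Spaces.linear_iff
  using cfun.vector_space_axioms vector_space_over_itself.vector_space_axioms by auto

lemma lin_add: "lin l \<Longrightarrow> l (f + g) = l f + l g"
  and lin_scale: "lin l \<Longrightarrow> l (cscale c f) = c * l f"
  by (simp_all add: lin_iff)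

lemma lin_zero: "lin l \<Longrightarrow> l 0 = 0"
  using lin_scale[of l 0 0] by simp

lemma lin_diff: "lin l \<Longrightarrow> l (f - g) = l f - l g"
  using lin_add[of l "f - g" g] by (simp add: algebra_simps)

lemma lin_sum: "lin l \<Longrightarrow> l (\<Sum>i\<in>I. f i) = (\<Sum>i\<in>I. l (f i))"
  by (induction I rule: infinite_finite_induct) (auto simp: lin_add lin_zero)

lemma lin_eval: "lin (\<lambda>f. f x)"
  by (simp add: lin_iff cscale_def)

lemma lin_lincomb: "(\<And>i. i \<in> I \<Longrightarrow> lin (l i)) \<Longrightarrow> lin (\<lambda>f. \<Sum>i\<in>I. c i * l i f)"
  by (simp add: lin_iff sum.distrib[symmetric] sum_distrib_left algebra_simps cong: sum.cong)

lemma lin_smult: "lin l \<Longrightarrow> lin (\<lambda>f. c * l f)"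
  by (simp add: lin_iff algebra_simps)

lemma lin_plus: "lin l \<Longrightarrow> lin l' \<Longrightarrow> lin (\<lambda>f. l f + l' f)"
  by (simp add: lin_iff algebra_simps)

lemma subspace_ker: "lin l \<Longrightarrow> cfun.subspace W \<Longrightarrow> cfun.subspace {w \<in> W. l w = 0}"
  unfolding cfun.subspace_def by (auto simp: lin_add lin_scale lin_zero)

lemma finite_basis_exists:
  assumes "fin_dim W" "cfun.subspace K" "K \<subseteq> W"
  obtains B where "finite B" "B \<subseteq> K" "cfun.independent B" "cfun.span B = K"
proof -
  obtain S where S: "finite S" "cfun.span S = W" using assms(1) unfolding fin_dim_def by blast
  obtain B where B: "B \<subseteq> K" "cfun.independent B" "K \<subseteq> cfun.span B"
    by (rule cfun.basis_exists[of K]) blast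
  have "finite B" using cfun.independent_span_bound[OF S(1) B(2)] B(1) S(2) assms(3) by blast
  moreover have "cfun.span B = K" using B assms(2) by (meson cfun.span_subspace)
  ultimately show ?thesis using B that by blast
qed

lemma fin_dim_subspace:
  assumes "fin_dim W" "cfun.subspace K" "K \<subseteq> W" shows "fin_dim K"
  using finite_basis_exists[OF assms] assms(2) unfolding fin_dim_def by metis

lemma fin_dim_imp_subspace: "fin_dim W \<Longrightarrow> cfun.subspace W"
  by (simp add: fin_dim_def)

lemma dim_span_insert:
  assumes "fin_dim K" "e \<notin> K"
  shows "cfun.dim (cfun.span (insert e K)) = cfun.dim K + 1" "fin_dim (cfun.span (insert e K))"
proof -
  obtain B where B: "finite B" "B \<subseteq> K" "cfun.independent B" "cfun.span B = K"
    using finite_basis_exists[OF assms(1) fin_dim_imp_subspace[OF assms(1)]] by blast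
  have sp: "cfun.span (insert e B) = cfun.span (insert e K)"
    unfolding cfun.span_insert B(4) cfun.span_eq_iff[THEN iffD2, OF fin_dim_imp_subspace[OF assms(1)]] ..
  have "cfun.independent (insert e B)" using B assms(2) by (simp add: cfun.independent_insertI)
  then have "cfun.dim (cfun.span (insert e K)) = card (insert e B)"
    using cfun.dim_span_eq_card_independent sp by metis
  moreover have "e \<notin> B" using B(2) assms(2) by blast
  moreover have "cfun.dim K = card B" using cfun.dim_span_eq_card_independent[OF B(3)] B(4) by simp
  ultimately show "cfun.dim (cfun.span (insert e K)) = cfun.dim K + 1" using B(1) by simp
  show "fin_dim (cfun.span (insert e K))" unfolding fin_dim_def using sp B(1)
    by (metis cfun.subspace_span finite_insert)
qed

lemma dim_mono_fin:
  assumes "fin_dim W" "cfun.subspace K" "K \<subseteq> W" shows "cfun.dim K \<le> cfun.dim W"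
proof -
  obtain B where B: "finite B" "B \<subseteq> K" "cfun.independent B" "cfun.span B = K"
    using finite_basis_exists[OF assms] by blast
  obtain B' where B': "B \<subseteq> B'" "B' \<subseteq> W" "cfun.independent B'" "W \<subseteq> cfun.span B'"
    using cfun.maximal_independent_subset_extend[of B W] B assms(3) by blast
  obtain S where S: "finite S" "cfun.span S = W" using assms(1) unfolding fin_dim_def by blast
  have "finite B'" using cfun.independent_span_bound[OF S(1) B'(3)] B'(2) S(2) by blast
  have "cfun.dim K = card B" using cfun.dim_span_eq_card_independent[OF B(3)] B(4) by simp
  moreover have "cfun.dim W = card B'" using cfun.basis_card_eq_dim B' by metis
  ultimately show ?thesis using card_mono[OF \<open>finite B'\<close> B'(1)] by simp
qed

lemma dim_strict_mono_fin:
  assumes "fin_dim W" "cfun.subspace K" "K \<subset> W" shows "cfun.dim K < cfun.dim W"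
proof -
  obtain e where e: "e \<in> W" "e \<notin> K" using assms(3) by blast
  have K: "fin_dim K" using fin_dim_subspace assms by blast
  have "cfun.span (insert e K) \<subseteq> W"
    using e assms by (intro cfun.span_minimal) (auto simp: fin_dim_def)
  then show ?thesis
    using dim_mono_fin[OF assms(1) cfun.subspace_span] dim_span_insert(1)[OF K e(2)] by fastforce
qed

text \<open>Replaces the dimension of a quotient space: the \<open>e i\<close> represent a basis of
  \<open>W\<close> modulo \<open>K\<close>. The induction moves them into \<open>K\<close> one at a
  time.\<close>

lemma dim_complement:
  assumes "finite I" "fin_dim W" "cfun.subspace K" "K \<subseteq> W" "\<And>i. i \<in> I \<Longrightarrow> e i \<in> W"
    and "\<And>w. w \<in> W \<Longrightarrow> \<exists>c. w - (\<Sum>i\<in>I. cscale (c i) (e i)) \<in> K"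
    and "\<And>c. (\<Sum>i\<in>I. cscale (c i) (e i)) \<in> K \<Longrightarrow> \<forall>i\<in>I. c i = 0"
  shows "cfun.dim W = cfun.dim K + card I"
  using assms(1,3-)
proof (induction I arbitrary: K rule: finite_induct)
  case empty
  then have "W = K" by auto
  then show ?case by simp
next
  case (insert j I)
  let ?K = "cfun.span (insert (e j) K)"
  have spK: "cfun.span K = K" using insert.prems(1) by simp
  have fK: "fin_dim K" using fin_dim_subspace assms(2) insert.prems by blast
  have ej: "e j \<notin> K"
  proof
    assume "e j \<in> K"
    then have "(\<Sum>i\<in>insert j I. cscale (if i = j then 1 else 0) (e i)) \<in> K"
      using insert.hyps by (simp add: if_distrib[of "\<lambda>c. cscale c _"] sum.delta cong: if_cong)
    then show False using insert.prems(5)[of "\<lambda>i. if i = j then 1 else 0"] by auto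
  qed
  \<comment> \<open>The induction hypothesis is applied to the larger subspace spanned by
    \<open>K\<close> and \<open>e j\<close>.\<close>
  have "cfun.dim W = cfun.dim ?K + card I"
  proof (rule insert.IH)
    show "cfun.subspace ?K" by simp
    show "?K \<subseteq> W" using insert.prems assms(2) by (intro cfun.span_minimal) (auto simp: fin_dim_def)
    show "\<And>i. i \<in> I \<Longrightarrow> e i \<in> W" using insert.prems by auto
  next
    fix w assume "w \<in> W"
    then obtain c where c: "w - (\<Sum>i\<in>insert j I. cscale (c i) (e i)) \<in> K" using insert.prems by blast
    have "w - (\<Sum>i\<in>I. cscale (c i) (e i)) \<in> ?K" unfolding cfun.span_insert spK
      using c insert.hyps by (auto intro!: exI[of _ "c j"] simp: algebra_simps)
    then show "\<exists>c. w - (\<Sum>i\<in>I. cscale (c i) (e i)) \<in> ?K" by (rule exI[of _ c])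
  next
    fix c assume "(\<Sum>i\<in>I. cscale (c i) (e i)) \<in> ?K"
    then obtain k where "(\<Sum>i\<in>I. cscale (c i) (e i)) - cscale k (e j) \<in> K"
      unfolding cfun.span_insert spK by auto
    moreover have "(\<Sum>i\<in>insert j I. cscale ((c(j := -k)) i) (e i)) = (\<Sum>i\<in>I. cscale (c i) (e i)) - cscale k (e j)"
    proof -
      have "(\<Sum>i\<in>I. cscale ((c(j := -k)) i) (e i)) = (\<Sum>i\<in>I. cscale (c i) (e i))"
        using insert.hyps by (intro sum.cong) auto
      then show ?thesis using insert.hyps by (simp add: algebra_simps)
    qed
    ultimately have "(\<Sum>i\<in>insert j I. cscale ((c(j := -k)) i) (e i)) \<in> K" by (simp only:)
    then have "\<forall>i\<in>insert j I. (c(j := -k)) i = 0" by (rule insert.prems(5))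
    then show "\<forall>i\<in>I. c i = 0" using insert.hyps by (metis fun_upd_other insert_iff)
  qed
  then show ?case using dim_span_insert(1)[OF fK ej] insert.hyps by simp
qed

text \<open>A basis of \<open>K\<close> stays independent when \<open>e\<close> is added, so values
  on it can be prescribed. All hyperplanes separating a vector from a subspace come from
  here.\<close>

lemma functional_exists:
  assumes "cfun.subspace K" "e \<notin> K"
  obtains l where "lin l" "\<And>w. w \<in> K \<Longrightarrow> l w = 0" "l e = 1"
proof -
  obtain B where B: "B \<subseteq> K" "cfun.independent B" "K \<subseteq> cfun.span B"
    by (rule cfun.basis_exists[of K]) blast
  have sp: "cfun.span B = K" using B assms(1) by (meson cfun.span_subspace)
  have "cfun.independent (insert e B)" using B assms(2) sp by (simp add: cfun.independent_insertI)
  then obtain l where l: "lin l" "\<forall>x\<in>insert e B. l x = (if x = e then 1 else 0)"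
    using cfunl.linear_independent_extend[of "insert e B" "\<lambda>x. if x = e then 1 else 0"] by blast
  have "l w = 0" if "w \<in> K" for w
  proof -
    have "e \<notin> B" using B assms by blast
    then have "\<And>b. b \<in> B \<Longrightarrow> l b = 0" using l(2) by auto
    moreover have "w \<in> cfun.span B" using that sp by simp
    moreover have "lin (\<lambda>x. 0)" by (simp add: lin_iff)
    ultimately show ?thesis using cfunl.linear_eq_on[OF l(1), of "\<lambda>x. 0" w B] by auto
  qed
  then show ?thesis using that l by simp
qed

lemma dim_ker:
  assumes "fin_dim W" "lin l" "e \<in> W" "l e \<noteq> 0"
  shows "cfun.dim W = cfun.dim {w \<in> W. l w = 0} + 1"
proof -
  have "cfun.dim W = cfun.dim {w \<in> W. l w = 0} + card {0::nat}"
  proof (rule dim_complement[where e = "\<lambda>i. e"])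
    show "\<And>w. w \<in> W \<Longrightarrow> \<exists>c. w - (\<Sum>i\<in>{0::nat}. cscale (c i) e) \<in> {w \<in> W. l w = 0}"
    proof -
      fix w assume "w \<in> W"
      then have "w - cscale (l w / l e) e \<in> {w \<in> W. l w = 0}"
        using assms by (auto simp: lin_diff lin_scale fin_dim_def cfun.subspace_diff cfun.subspace_scale)
      then show "\<exists>c. w - (\<Sum>i\<in>{0::nat}. cscale (c i) e) \<in> {w \<in> W. l w = 0}"
        by (intro exI[of _ "\<lambda>i. l w / l e"]) simp
    qed
  qed (use assms in \<open>auto simp: subspace_ker fin_dim_imp_subspace lin_scale\<close>)
  then show ?thesis by simp
qed

text \<open>A functional that kills \<open>H\<close> but not some \<open>e\<close> has a kernel
  containing \<open>H\<close> and of the same dimension, hence equal to \<open>H\<close>.\<close>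

lemma Proj_iff:
  assumes "fin_dim W"
  shows "H \<in> Proj W \<longleftrightarrow> (\<exists>l. lin l \<and> (\<exists>w\<in>W. l w \<noteq> 0) \<and> H = {w \<in> W. l w = 0})"
proof
  assume "H \<in> Proj W"
  then have H: "cfun.subspace H" "H \<subseteq> W" "cfun.dim W = cfun.dim H + 1" unfolding Proj_def by auto
  then have "H \<noteq> W" by auto
  then obtain e where e: "e \<in> W" "e \<notin> H" using H(2) by blast
  obtain l where l: "lin l" "\<And>w. w \<in> H \<Longrightarrow> l w = 0" "l e = 1"
    using functional_exists[OF H(1) e(2)] by blast
  let ?K = "{w \<in> W. l w = 0}"
  have sK: "cfun.subspace ?K" using subspace_ker l(1) assms fin_dim_imp_subspace by blast
  have "cfun.dim W = cfun.dim ?K + 1" using dim_ker[OF assms l(1) e(1)] l(3) by simp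
  moreover have "H \<subseteq> ?K" using H l by auto
  moreover have "fin_dim ?K" using fin_dim_subspace[OF assms sK] by auto
  ultimately have "H = ?K" using dim_strict_mono_fin[of ?K H] H(1,3) by fastforce
  moreover have "\<exists>w\<in>W. l w \<noteq> 0" using l(3) e(1) by (intro bexI[of _ e]) auto
  ultimately show "\<exists>l. lin l \<and> (\<exists>w\<in>W. l w \<noteq> 0) \<and> H = {w \<in> W. l w = 0}" using l(1) by blast
next
  assume "\<exists>l. lin l \<and> (\<exists>w\<in>W. l w \<noteq> 0) \<and> H = {w \<in> W. l w = 0}"
  then show "H \<in> Proj W" unfolding Proj_def
    using dim_ker[OF assms] subspace_ker fin_dim_imp_subspace[OF assms] by auto
qed

text \<open>Any functional with kernel \<open>z\<close> may stand for the homogeneous coordinates of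
  \<open>z\<close>. This frees the computations from the particular choice made in
  \<open>hcoord\<close>.\<close>

definition functional_of :: "('x \<Rightarrow> complex) set \<Rightarrow> 'x point \<Rightarrow> (('x \<Rightarrow> complex) \<Rightarrow> complex) \<Rightarrow> bool"
  where "functional_of W z l \<longleftrightarrow> lin l \<and> (\<exists>w\<in>W. l w \<noteq> 0) \<and> {w \<in> W. l w = 0} = z"

lemma functional_of_Proj: "fin_dim W \<Longrightarrow> functional_of W z l \<Longrightarrow> z \<in> Proj W"
  unfolding Proj_iff functional_of_def by blast

lemma Proj_proper: "z \<in> Proj W \<Longrightarrow> \<exists>w\<in>W. w \<notin> z"
proof -
  assume "z \<in> Proj W"
  then have "z \<subseteq> W" "cfun.dim W = cfun.dim z + 1" unfolding Proj_def by auto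
  moreover from this(2) have "z \<noteq> W" by auto
  ultimately show ?thesis by blast
qed

lemma hcoord_functional:
  assumes "fin_dim W" "z \<in> Proj W" shows "functional_of W z (hcoord W z)"
proof -
  have "\<exists>l. lin l \<and> {w \<in> W. l w = 0} = z" using assms(2) unfolding Proj_iff[OF assms(1)] by blast
  then have *: "lin (hcoord W z) \<and> {w \<in> W. hcoord W z w = 0} = z"
    unfolding hcoord_def by (rule someI_ex)
  then show ?thesis unfolding functional_of_def using Proj_proper[OF assms(2)] by blast
qed

lemma functional_of_unique:
  assumes W: "cfun.subspace W" and l: "functional_of W z l" and l': "functional_of W z l'"
  obtains c where "c \<noteq> 0" "\<And>w. w \<in> W \<Longrightarrow> l' w = c * l w"
proof -
  have lin: "lin l" "lin l'" using l l' unfolding functional_of_def by auto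
  have ker: "l w = 0 \<longleftrightarrow> l' w = 0" if "w \<in> W" for w
    using l l' that unfolding functional_of_def by blast
  obtain e where e: "e \<in> W" "l e \<noteq> 0" using l unfolding functional_of_def by auto
  have "l' w = l' e / l e * l w" if "w \<in> W" for w
  proof -
    have "w - cscale (l w / l e) e \<in> W" using that e W by (simp add: cfun.subspace_diff cfun.subspace_scale)
    moreover have "l (w - cscale (l w / l e) e) = 0" using lin e by (simp add: lin_diff lin_scale)
    ultimately have "l' (w - cscale (l w / l e) e) = 0" using ker by blast
    then show ?thesis using lin by (simp add: lin_diff lin_scale)
  qed
  moreover have "l' e / l e \<noteq> 0" using e ker by auto
  ultimately show ?thesis using that by blast
qed

text \<open>Each vector outside \<open>K\<close> is missed by some hyperplane containing
  \<open>K\<close>. For \<open>K = W\<close> there are no such hyperplanes, and the intersection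
  with \<open>W\<close> still gives \<open>W\<close>.\<close>

lemma Inter_Proj_quot:
  assumes "fin_dim W" "cfun.subspace K" "K \<subseteq> W"
  shows "W \<inter> \<Inter>(Proj_quot W K) = K"
proof
  show "W \<inter> \<Inter>(Proj_quot W K) \<subseteq> K"
  proof
    fix e assume e: "e \<in> W \<inter> \<Inter>(Proj_quot W K)"
    show "e \<in> K"
    proof (rule ccontr)
      assume "e \<notin> K"
      then obtain l where l: "lin l" "\<And>w. w \<in> K \<Longrightarrow> l w = 0" "l e = 1"
        using functional_exists[OF assms(2)] by blast
      have "{w \<in> W. l w = 0} \<in> Proj_quot W K"
        unfolding Proj_quot_def using Proj_iff[OF assms(1)] l e assms(3)
        by (auto intro!: exI[of _ l] bexI[of _ e])
      then show False using e l by auto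
    qed
  qed
  show "K \<subseteq> W \<inter> \<Inter>(Proj_quot W K)" using assms unfolding Proj_quot_def by auto
qed

lemma pdim_Proj_quot:
  assumes "fin_dim W" "cfun.subspace K" "K \<subseteq> W"
  shows "pdim W (Proj_quot W K) = int (cfun.dim W) - int (cfun.dim K) - 1"
  unfolding pdim_def Inter_Proj_quot[OF assms] ..

text \<open>Larger subspaces of \<open>W\<close> define smaller linear subspaces, so the span
  belongs to the largest subspace contained in all the given hyperplanes.\<close>

lemma pspan_eq:
  assumes "fin_dim W" "S \<subseteq> Proj W"
  shows "pspan W S = Proj_quot W (W \<inter> \<Inter>S)"
proof -
  have sub: "cfun.subspace (W \<inter> \<Inter>S)"
    using assms by (intro cfun.subspace_inter cfun.subspace_Inter) (auto simp: fin_dim_def Proj_def)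
  show ?thesis
  proof
    have "proj_linear W (Proj_quot W (W \<inter> \<Inter>S))" using sub unfolding proj_linear_def by auto
    moreover have "S \<subseteq> Proj_quot W (W \<inter> \<Inter>S)" using assms(2) unfolding Proj_quot_def by auto
    ultimately show "pspan W S \<subseteq> Proj_quot W (W \<inter> \<Inter>S)" unfolding pspan_def by blast
    show "Proj_quot W (W \<inter> \<Inter>S) \<subseteq> pspan W S"
      unfolding pspan_def proj_linear_def Proj_quot_def by auto
  qed
qed

section \<open>Forms and the Zariski topology\<close>

lemma homog_poly_scale:
  assumes "homog_poly W d F" "\<And>w. w \<in> W \<Longrightarrow> l' w = c * l w"
  shows "F l' = c ^ d * F l"
  using assms(1) by (induction rule: homog_poly.induct) (auto simp: assms(2) power_add algebra_simps)

lemma homog_poly_pullback: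
  assumes "homog_poly W d F" "\<And>w. w \<in> W \<Longrightarrow> T w \<in> W'"
  shows "homog_poly W' d (\<lambda>l. F (\<lambda>w. l (T w)))"
  using assms(1)
proof (induction rule: homog_poly.induct)
  case (linear w)
  then show ?case using homog_poly.linear[of "T w" W'] assms(2) by simp
qed (auto intro: homog_poly.intros)

text \<open>Reduces questions about forms to polynomials in one variable, which have only finitely
  many roots.\<close>

lemma homog_poly_line:
  assumes "homog_poly W d F"
  obtains P where "\<And>c. F (\<lambda>w. l w + c * l' w) = poly P c"
proof -
  have "\<exists>P. \<forall>c. F (\<lambda>w. l w + c * l' w) = poly P c"
    using assms
  proof (induction rule: homog_poly.induct)
    case (const c)
    show ?case by (rule exI[of _ "[:c:]"]) simp
  next
    case (linear w)
    show ?case by (rule exI[of _ "[:l w, l' w:]"]) simp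
  next
    case (add d F G)
    then obtain P Q where "\<forall>c. F (\<lambda>w. l w + c * l' w) = poly P c" "\<forall>c. G (\<lambda>w. l w + c * l' w) = poly Q c"
      by auto
    then show ?case by (intro exI[of _ "P + Q"]) simp
  next
    case (mult d F e G)
    then obtain P Q where "\<forall>c. F (\<lambda>w. l w + c * l' w) = poly P c" "\<forall>c. G (\<lambda>w. l w + c * l' w) = poly Q c"
      by auto
    then show ?case by (intro exI[of _ "P * Q"]) simp
  qed
  then show ?thesis using that by blast
qed

lemma homog_poly_functional:
  assumes "homog_poly W d F" "cfun.subspace W" "functional_of W z l" "functional_of W z l'"
  shows "F l = 0 \<longleftrightarrow> F l' = 0"
proof -
  obtain c where "c \<noteq> 0" "\<And>w. w \<in> W \<Longrightarrow> l' w = c * l w"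
    using functional_of_unique[OF assms(2-4)] by blast
  then show ?thesis using homog_poly_scale[OF assms(1), of l' c l] by simp
qed

lemma homog_poly_quotient_functional:
  assumes "homog_poly W d F" "homog_poly W d G" "cfun.subspace W" "functional_of W z l" "functional_of W z l'"
  shows "F l / G l = F l' / G l'"
proof -
  obtain c where "c \<noteq> 0" "\<And>w. w \<in> W \<Longrightarrow> l' w = c * l w"
    using functional_of_unique[OF assms(3-5)] by blast
  then show ?thesis
    using homog_poly_scale[OF assms(1), of l' c l] homog_poly_scale[OF assms(2), of l' c l] by simp
qed

lemma quotient_functional:
  assumes "cfun.subspace W" "functional_of W z l" "functional_of W z l'" "v \<in> W" "u \<in> W"
  shows "l v / l u = l' v / l' u"
  using homog_poly_quotient_functional[OF homog_poly.linear homog_poly.linear assms(1-3)] assms(4,5) by blast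

section \<open>Basic open sets of the Zariski topology\<close>

definition nonzero_locus :: "('x \<Rightarrow> complex) set \<Rightarrow> ((('x \<Rightarrow> complex) \<Rightarrow> complex) \<Rightarrow> complex) \<Rightarrow> 'x point set"
  where "nonzero_locus W F = {z \<in> Proj W. F (hcoord W z) \<noteq> 0}"

lemma mem_nonzero_locus:
  assumes "fin_dim W" "homog_poly W d F" "functional_of W z l"
  shows "z \<in> nonzero_locus W F \<longleftrightarrow> F l \<noteq> 0"
proof -
  have z: "z \<in> Proj W" using functional_of_Proj assms by blast
  show ?thesis unfolding nonzero_locus_def
    using homog_poly_functional[OF assms(2) _ hcoord_functional[OF assms(1) z] assms(3)] z assms(1)
    by (auto simp: fin_dim_def)
qed

lemma openin_nonzero_locus: "homog_poly W d F \<Longrightarrow> openin (zariski W) (nonzero_locus W F)"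
  unfolding zariski_def nonzero_locus_def by (rule topology_generated_by_Basis) auto

lemma topspace_zariski [simp]: "topspace (zariski W) = Proj W"
proof -
  have "Proj W = nonzero_locus W (\<lambda>l. 1)" unfolding nonzero_locus_def by simp
  then have "\<exists>d F. homog_poly W d F \<and> Proj W = {z \<in> Proj W. F (hcoord W z) \<noteq> 0}"
    using homog_poly.const[of W 1] unfolding nonzero_locus_def by blast
  then show ?thesis unfolding zariski_def topology_generated_by_topspace by blast
qed

text \<open>The topology is generated by the nonvanishing loci as a subbasis; they already form a
  basis, because the locus of a product is the intersection of the loci.\<close>

lemma zariski_base:
  assumes "openin (zariski W) U" "z \<in> U"
  obtains d F where "homog_poly W d F" "z \<in> nonzero_locus W F" "nonzero_locus W F \<subseteq> U"
proof -
  have "generate_topology_on {U. \<exists>d F. homog_poly W d F \<and> U = {z \<in> Proj W. F (hcoord W z) \<noteq> 0}} U"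
    using openin_topology_generated_by assms(1) unfolding zariski_def by blast
  then have "\<forall>z\<in>U. \<exists>d F. homog_poly W d F \<and> z \<in> nonzero_locus W F \<and> nonzero_locus W F \<subseteq> U"
  proof (induction rule: generate_topology_on.induct)
    case (Int a b)
    show ?case
    proof
      fix z assume z: "z \<in> a \<inter> b"
      obtain d F where F: "homog_poly W d F" "z \<in> nonzero_locus W F" "nonzero_locus W F \<subseteq> a"
        using Int.IH z by blast
      obtain e G where G: "homog_poly W e G" "z \<in> nonzero_locus W G" "nonzero_locus W G \<subseteq> b"
        using Int.IH z by blast
      have "nonzero_locus W (\<lambda>l. F l * G l) = nonzero_locus W F \<inter> nonzero_locus W G"
        unfolding nonzero_locus_def by auto
      then show "\<exists>d F. homog_poly W d F \<and> z \<in> nonzero_locus W F \<and> nonzero_locus W F \<subseteq> a \<inter> b"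
        using homog_poly.mult[OF F(1) G(1)] F G by blast
    qed
  next
    case (UN K)
    then show ?case by (meson Sup_upper UnionE order_trans)
  next
    case (Basis s)
    then show ?case unfolding nonzero_locus_def by blast
  qed auto
  then show ?thesis using assms(2) that by blast
qed

text \<open>Germs are handled through the filter of neighbourhoods. In this form continuity allows
  an equation valid near \<open>f y\<close> to be pulled back to one valid near
  \<open>y\<close>.\<close>

lemma morphism_filterlim:
  assumes "morphism W Y W' Y' f" "y \<in> Y" "Y \<subseteq> Proj W" "Y' \<subseteq> Proj W'"
  shows "filterlim f (nhdsin (subtopology (zariski W') Y') (f y)) (nhdsin (subtopology (zariski W) Y) y)"
proof -
  have cont: "continuous_map (subtopology (zariski W) Y) (subtopology (zariski W') Y') f"
    using assms(1) unfolding morphism_def by blast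
  have ts: "topspace (subtopology (zariski W) Y) = Y" "topspace (subtopology (zariski W') Y') = Y'"
    using assms(3,4) by auto
  show ?thesis unfolding filterlim_iff
  proof (intro allI impI)
    fix P assume "eventually P (nhdsin (subtopology (zariski W') Y') (f y))"
    moreover have "f y \<in> Y'" using cont assms(2) ts unfolding continuous_map_def by blast
    ultimately obtain S where S: "openin (subtopology (zariski W') Y') S" "f y \<in> S" "\<forall>x\<in>S. P x"
      unfolding eventually_nhdsin ts by blast
    let ?S = "{x \<in> Y. f x \<in> S}"
    have "openin (subtopology (zariski W) Y) ?S"
      using cont S(1) unfolding continuous_map_def ts by blast
    then show "eventually (\<lambda>x. P (f x)) (nhdsin (subtopology (zariski W) Y) y)"
      unfolding eventually_nhdsin using S assms(2) by (intro disjI2 exI[of _ ?S]) auto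
  qed
qed

section \<open>Local rings\<close>

lemma sum_lessThan_add: "(\<Sum>i<m + n. f i) = (\<Sum>i<m. f i) + (\<Sum>i<n. f (m + i :: nat))"
  for f :: "nat \<Rightarrow> 'b::comm_monoid_add"
  by (induction n) (auto simp: add.assoc)

lemma prod_lessThan_add: "(\<Prod>i<m + n. f i) = (\<Prod>i<m. f i) * (\<Prod>i<n. f (m + i :: nat))"
  for f :: "nat \<Rightarrow> 'b::comm_monoid_mult"
  by (induction n) (auto simp: mult.assoc)

text \<open>Interpreted for the curve, its images under the linear systems, the scroll, and whole
  projective spaces.\<close>

locale quasiproj =
  fixes W :: "('x \<Rightarrow> complex) set" and Y :: "'x point set"
  assumes fin_dim: "fin_dim W" and subset_Proj: "Y \<subseteq> Proj W"
begin

abbreviation germs :: "'x point \<Rightarrow> 'x point filter"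
  where "germs y \<equiv> nhdsin (subtopology (zariski W) Y) y"

abbreviation regular :: "'x point \<Rightarrow> ('x point \<Rightarrow> complex) \<Rightarrow> bool"
  where "regular \<equiv> regular_at W Y"

abbreviation mpow :: "'x point \<Rightarrow> nat \<Rightarrow> ('x point \<Rightarrow> complex) set"
  where "mpow \<equiv> max_ideal_pow W Y"

lemma topspace_sub: "topspace (subtopology (zariski W) Y) = Y"
  using subset_Proj by auto

lemma subspace: "cfun.subspace W"
  using fin_dim by (rule fin_dim_imp_subspace)

lemma hcoord: "y \<in> Y \<Longrightarrow> functional_of W y (hcoord W y)"
  using hcoord_functional fin_dim subset_Proj by blast

lemma hcoord_lin: "y \<in> Y \<Longrightarrow> lin (hcoord W y)"
  using hcoord unfolding functional_of_def by blast

lemma hcoord_eq_0_iff: "y \<in> Y \<Longrightarrow> w \<in> W \<Longrightarrow> hcoord W y w = 0 \<longleftrightarrow> w \<in> y"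
  using hcoord unfolding functional_of_def by blast

lemma eventually_germs:
  assumes "y \<in> Y"
  shows "eventually P (germs y) \<longleftrightarrow> (\<exists>U. openin (zariski W) U \<and> y \<in> U \<and> (\<forall>z\<in>U \<inter> Y. P z))"
  unfolding eventually_nhdsin topspace_sub openin_subtopology using assms by blast

lemma eventually_self: "y \<in> Y \<Longrightarrow> eventually P (germs y) \<Longrightarrow> P y"
  using eventually_germs by auto

lemma eventually_in: "y \<in> Y \<Longrightarrow> eventually (\<lambda>z. z \<in> Y) (germs y)"
  unfolding eventually_germs by (rule exI[of _ "Proj W"]) (metis IntD2 openin_topspace subset_Proj subsetD topspace_zariski)

lemma eventually_eventually: "y \<in> Y \<Longrightarrow> eventually P (germs y) \<Longrightarrow> eventually (\<lambda>z. eventually P (germs z)) (germs y)"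
  unfolding eventually_germs[of y] by (metis IntD1 IntD2 eventually_germs)

lemma eventually_nonzero_locus:
  assumes "y \<in> Y" "homog_poly W d F" "F (hcoord W y) \<noteq> 0"
  shows "eventually (\<lambda>z. F (hcoord W z) \<noteq> 0) (germs y)"
  unfolding eventually_germs[OF assms(1)]
  using openin_nonzero_locus[OF assms(2)] assms subset_Proj
  by (intro exI[of _ "nonzero_locus W F"]) (auto simp: nonzero_locus_def)

lemma eventually_notin:
  assumes "y \<in> Y" "u \<in> W" "u \<notin> y" shows "eventually (\<lambda>z. u \<notin> z) (germs y)"
proof -
  have "eventually (\<lambda>z. hcoord W z u \<noteq> 0) (germs y)"
    using eventually_nonzero_locus[OF assms(1) homog_poly.linear[OF assms(2)]] hcoord_eq_0_iff assms by simp
  with eventually_in[OF assms(1)] show ?thesis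
    by eventually_elim (use hcoord_eq_0_iff assms in auto)
qed

section \<open>The ring of regular germs\<close>

lemma regular_iff:
  assumes "y \<in> Y"
  shows "regular y f \<longleftrightarrow> (\<exists>d F G. homog_poly W d F \<and> homog_poly W d G \<and>
    eventually (\<lambda>z. G (hcoord W z) \<noteq> 0 \<and> f z = F (hcoord W z) / G (hcoord W z)) (germs y))"
  unfolding regular_at_def eventually_germs[OF assms] by blast

lemma regular_const: "y \<in> Y \<Longrightarrow> regular y (\<lambda>z. c)"
  unfolding regular_iff
  by (intro exI[of _ 0] exI[of _ "\<lambda>l. c"] exI[of _ "\<lambda>l. 1"]) (auto intro: homog_poly.const)

lemma regular_add:
  assumes y: "y \<in> Y" and "regular y f" "regular y g" shows "regular y (\<lambda>z. f z + g z)"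
proof -
  obtain d F G where F: "homog_poly W d F" "homog_poly W d G"
    "eventually (\<lambda>z. G (hcoord W z) \<noteq> 0 \<and> f z = F (hcoord W z) / G (hcoord W z)) (germs y)"
    using assms(2) unfolding regular_iff[OF y] by blast
  obtain e F' G' where F': "homog_poly W e F'" "homog_poly W e G'"
    "eventually (\<lambda>z. G' (hcoord W z) \<noteq> 0 \<and> g z = F' (hcoord W z) / G' (hcoord W z)) (germs y)"
    using assms(3) unfolding regular_iff[OF y] by blast
  have "homog_poly W (d + e) (\<lambda>l. F l * G' l + G l * F' l)"
    "homog_poly W (d + e) (\<lambda>l. G l * G' l)"
    using F F' by (auto intro!: homog_poly.add homog_poly.mult)
  moreover have "eventually (\<lambda>z. G (hcoord W z) * G' (hcoord W z) \<noteq> 0 \<and> f z + g z =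
    (F (hcoord W z) * G' (hcoord W z) + G (hcoord W z) * F' (hcoord W z)) / (G (hcoord W z) * G' (hcoord W z))) (germs y)"
    using F(3) F'(3) by eventually_elim (auto simp: add_frac_eq mult.commute)
  ultimately show ?thesis unfolding regular_iff[OF y] by blast
qed

lemma regular_mult:
  assumes y: "y \<in> Y" and "regular y f" "regular y g" shows "regular y (\<lambda>z. f z * g z)"
proof -
  obtain d F G where F: "homog_poly W d F" "homog_poly W d G"
    "eventually (\<lambda>z. G (hcoord W z) \<noteq> 0 \<and> f z = F (hcoord W z) / G (hcoord W z)) (germs y)"
    using assms(2) unfolding regular_iff[OF y] by blast
  obtain e F' G' where F': "homog_poly W e F'" "homog_poly W e G'"
    "eventually (\<lambda>z. G' (hcoord W z) \<noteq> 0 \<and> g z = F' (hcoord W z) / G' (hcoord W z)) (germs y)"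
    using assms(3) unfolding regular_iff[OF y] by blast
  have "homog_poly W (d + e) (\<lambda>l. F l * F' l)" "homog_poly W (d + e) (\<lambda>l. G l * G' l)"
    using F F' by (auto intro!: homog_poly.mult)
  moreover have "eventually (\<lambda>z. G (hcoord W z) * G' (hcoord W z) \<noteq> 0 \<and> f z * g z =
    (F (hcoord W z) * F' (hcoord W z)) / (G (hcoord W z) * G' (hcoord W z))) (germs y)"
    using F(3) F'(3) by eventually_elim auto
  ultimately show ?thesis unfolding regular_iff[OF y] by blast
qed

lemma regular_cong:
  assumes y: "y \<in> Y" and "regular y f" "eventually (\<lambda>z. f z = g z) (germs y)" shows "regular y g"
proof -
  obtain d F G where F: "homog_poly W d F" "homog_poly W d G"
    "eventually (\<lambda>z. G (hcoord W z) \<noteq> 0 \<and> f z = F (hcoord W z) / G (hcoord W z)) (germs y)"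
    using assms(2) unfolding regular_iff[OF y] by blast
  have "eventually (\<lambda>z. G (hcoord W z) \<noteq> 0 \<and> g z = F (hcoord W z) / G (hcoord W z)) (germs y)"
    using F(3) assms(3) by eventually_elim auto
  then show ?thesis unfolding regular_iff[OF y] using F(1,2) by blast
qed

lemma regular_uminus: "y \<in> Y \<Longrightarrow> regular y f \<Longrightarrow> regular y (\<lambda>z. - f z)"
  using regular_mult[OF _ regular_const[of y "-1"], of f] by simp

lemma regular_diff: "y \<in> Y \<Longrightarrow> regular y f \<Longrightarrow> regular y g \<Longrightarrow> regular y (\<lambda>z. f z - g z)"
  using regular_add[OF _ _ regular_uminus, of y f g] by simp

lemma regular_sum:
  "y \<in> Y \<Longrightarrow> (\<And>i. i \<in> I \<Longrightarrow> regular y (f i)) \<Longrightarrow> regular y (\<lambda>z. \<Sum>i\<in>I. f i z)"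
  by (induction I rule: infinite_finite_induct) (auto intro: regular_const regular_add)

lemma regular_prod:
  "y \<in> Y \<Longrightarrow> (\<And>i. i \<in> I \<Longrightarrow> regular y (f i)) \<Longrightarrow> regular y (\<lambda>z. \<Prod>i\<in>I. f i z)"
  by (induction I rule: infinite_finite_induct) (auto intro: regular_const regular_mult)

lemma regular_power: "y \<in> Y \<Longrightarrow> regular y f \<Longrightarrow> regular y (\<lambda>z. f z ^ k)"
  using regular_prod[of y "{..<k}" "\<lambda>_. f"] by simp

lemma eventually_regular:
  assumes y: "y \<in> Y" and "regular y f" shows "eventually (\<lambda>z. regular z f) (germs y)"
proof -
  obtain d F G where F: "homog_poly W d F" "homog_poly W d G"
    "eventually (\<lambda>z. G (hcoord W z) \<noteq> 0 \<and> f z = F (hcoord W z) / G (hcoord W z)) (germs y)"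
    using assms(2) unfolding regular_iff[OF y] by blast
  show ?thesis using eventually_eventually[OF y F(3)] eventually_in[OF y]
    by eventually_elim (use F(1,2) regular_iff in blast)
qed

text \<open>Where the quotient is defined, it vanishes only with its numerator, and the numerator is
  a form, whose nonvanishing locus is open.\<close>

lemma eventually_neq_0:
  assumes y: "y \<in> Y" and "regular y f" "f y \<noteq> 0" shows "eventually (\<lambda>z. f z \<noteq> 0) (germs y)"
proof -
  obtain d F G where F: "homog_poly W d F" "homog_poly W d G"
    "eventually (\<lambda>z. G (hcoord W z) \<noteq> 0 \<and> f z = F (hcoord W z) / G (hcoord W z)) (germs y)"
    using assms(2) unfolding regular_iff[OF y] by blast
  have "F (hcoord W y) \<noteq> 0" using eventually_self[OF y F(3)] assms(3) by auto
  from eventually_nonzero_locus[OF y F(1) this] F(3) show ?thesis by eventually_elim auto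
qed

lemma regular_inverse:
  assumes y: "y \<in> Y" and "regular y f" "f y \<noteq> 0" shows "regular y (\<lambda>z. inverse (f z))"
proof -
  obtain d F G where F: "homog_poly W d F" "homog_poly W d G"
    "eventually (\<lambda>z. G (hcoord W z) \<noteq> 0 \<and> f z = F (hcoord W z) / G (hcoord W z)) (germs y)"
    using assms(2) unfolding regular_iff[OF y] by blast
  have "F (hcoord W y) \<noteq> 0" using eventually_self[OF y F(3)] assms(3) by auto
  from eventually_nonzero_locus[OF y F(1) this] F(3)
  have "eventually (\<lambda>z. F (hcoord W z) \<noteq> 0 \<and> inverse (f z) = G (hcoord W z) / F (hcoord W z)) (germs y)"
    by eventually_elim auto
  then show ?thesis unfolding regular_iff[OF y] using F(1,2) by blast
qed

lemma regular_divide: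
  "y \<in> Y \<Longrightarrow> regular y f \<Longrightarrow> regular y g \<Longrightarrow> g y \<noteq> 0 \<Longrightarrow> regular y (\<lambda>z. f z / g z)"
  unfolding divide_inverse by (intro regular_mult regular_inverse)

lemma regular_linear_quotient:
  assumes "y \<in> Y" "w \<in> W" "u \<in> W" "u \<notin> y"
  shows "regular y (\<lambda>z. hcoord W z w / hcoord W z u)"
proof -
  have "hcoord W y u \<noteq> 0" using hcoord_eq_0_iff assms by blast
  from eventually_nonzero_locus[OF assms(1) homog_poly.linear[OF assms(3)] this]
  have "eventually (\<lambda>z. hcoord W z u \<noteq> 0 \<and> hcoord W z w / hcoord W z u = hcoord W z w / hcoord W z u) (germs y)"
    by simp
  then show ?thesis unfolding regular_iff[OF assms(1)]
    using homog_poly.linear[OF assms(2)] homog_poly.linear[OF assms(3)] by blast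
qed

lemma regular_form:
  assumes "y \<in> Y" "homog_poly W' d F" "\<And>w. w \<in> W' \<Longrightarrow> regular y (\<lambda>z. l z w)"
  shows "regular y (\<lambda>z. F (l z))"
  using assms(2)
  by (induction rule: homog_poly.induct) (auto intro: assms regular_const regular_add regular_mult)

section \<open>Powers of the maximal ideal\<close>

lemma mpow_iff:
  assumes "y \<in> Y"
  shows "f \<in> mpow y k \<longleftrightarrow> (\<exists>(N::nat) a g. (\<forall>i<N. regular y (a i)) \<and>
      (\<forall>i<N. \<forall>j<k. regular y (g i j) \<and> g i j y = 0) \<and>
      eventually (\<lambda>z. f z = (\<Sum>i<N. a i z * (\<Prod>j<k. g i j z))) (germs y))"
  unfolding max_ideal_pow_def eventually_germs[OF assms] by blast

lemma mpow_cong: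
  assumes y: "y \<in> Y" and "f \<in> mpow y k" "eventually (\<lambda>z. f z = g z) (germs y)" shows "g \<in> mpow y k"
proof -
  obtain N :: nat and a h where h: "\<forall>i<N. regular y (a i)" "\<forall>i<N. \<forall>j<k. regular y (h i j) \<and> h i j y = 0"
    "eventually (\<lambda>z. f z = (\<Sum>i<N. a i z * (\<Prod>j<k. h i j z))) (germs y)"
    using assms(2) unfolding mpow_iff[OF y] by blast
  have "eventually (\<lambda>z. g z = (\<Sum>i<N. a i z * (\<Prod>j<k. h i j z))) (germs y)"
    using h(3) assms(3) by eventually_elim auto
  then show ?thesis unfolding mpow_iff[OF y] using h(1,2) by blast
qed

lemma mpow_term:
  assumes y: "y \<in> Y" and "regular y a" "\<And>j. j < k \<Longrightarrow> regular y (g j) \<and> g j y = 0"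
  shows "(\<lambda>z. a z * (\<Prod>j<k. g j z)) \<in> mpow y k"
  unfolding mpow_iff[OF y]
  by (intro exI[of _ "1::nat"] exI[of _ "\<lambda>_. a"] exI[of _ "\<lambda>_. g"]) (use assms in auto)

lemma mpow_add:
  assumes y: "y \<in> Y" and "f \<in> mpow y k" "g \<in> mpow y k" shows "(\<lambda>z. f z + g z) \<in> mpow y k"
proof -
  obtain N :: nat and a h where h: "\<forall>i<N. regular y (a i)" "\<forall>i<N. \<forall>j<k. regular y (h i j) \<and> h i j y = 0"
    "eventually (\<lambda>z. f z = (\<Sum>i<N. a i z * (\<Prod>j<k. h i j z))) (germs y)"
    using assms(2) unfolding mpow_iff[OF y] by blast
  obtain N' :: nat and a' h' where h': "\<forall>i<N'. regular y (a' i)" "\<forall>i<N'. \<forall>j<k. regular y (h' i j) \<and> h' i j y = 0"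
    "eventually (\<lambda>z. g z = (\<Sum>i<N'. a' i z * (\<Prod>j<k. h' i j z))) (germs y)"
    using assms(3) unfolding mpow_iff[OF y] by blast
  let ?a = "\<lambda>i. if i < N then a i else a' (i - N)" and ?h = "\<lambda>i. if i < N then h i else h' (i - N)"
  show ?thesis unfolding mpow_iff[OF y]
  proof (intro exI[of _ "N + N'"] exI[of _ ?a] exI[of _ ?h] conjI)
    show "eventually (\<lambda>z. f z + g z = (\<Sum>i<N + N'. ?a i z * (\<Prod>j<k. ?h i j z))) (germs y)"
      using h(3) h'(3) by eventually_elim (simp add: sum_lessThan_add)
  qed (use h(1,2) h'(1,2) in auto)
qed

lemma mpow_zero: "y \<in> Y \<Longrightarrow> (\<lambda>z. 0) \<in> mpow y k"
  unfolding mpow_iff by (rule exI[of _ 0]) simp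

lemma mpow_sum: "y \<in> Y \<Longrightarrow> (\<And>i. i \<in> I \<Longrightarrow> f i \<in> mpow y k) \<Longrightarrow> (\<lambda>z. \<Sum>i\<in>I. f i z) \<in> mpow y k"
  by (induction I rule: infinite_finite_induct) (auto intro: mpow_zero mpow_add)

lemma mpow_mult:
  assumes y: "y \<in> Y" and "f \<in> mpow y k" "g \<in> mpow y l" shows "(\<lambda>z. f z * g z) \<in> mpow y (k + l)"
proof -
  obtain N :: nat and a h where h: "\<forall>i<N. regular y (a i)" "\<forall>i<N. \<forall>j<k. regular y (h i j) \<and> h i j y = 0"
    "eventually (\<lambda>z. f z = (\<Sum>i<N. a i z * (\<Prod>j<k. h i j z))) (germs y)"
    using assms(2) unfolding mpow_iff[OF y] by blast
  obtain N' :: nat and a' h' where h': "\<forall>i<N'. regular y (a' i)" "\<forall>i<N'. \<forall>j<l. regular y (h' i j) \<and> h' i j y = 0"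
    "eventually (\<lambda>z. g z = (\<Sum>i<N'. a' i z * (\<Prod>j<l. h' i j z))) (germs y)"
    using assms(3) unfolding mpow_iff[OF y] by blast
  have "(\<lambda>z. \<Sum>i\<in>{..<N}. \<Sum>i'\<in>{..<N'}. (a i z * (\<Prod>j<k. h i j z)) * (a' i' z * (\<Prod>j<l. h' i' j z))) \<in> mpow y (k + l)"
  proof (intro mpow_sum[OF y])
    fix i i' assume i: "i \<in> {..<N}" "i' \<in> {..<N'}"
    let ?g = "\<lambda>j. if j < k then h i j else h' i' (j - k)"
    have "(\<lambda>z. (a i z * a' i' z) * (\<Prod>j<k + l. ?g j z)) \<in> mpow y (k + l)"
      by (rule mpow_term[OF y]) (use i h(1,2) h'(1,2) in \<open>auto intro: regular_mult[OF y]\<close>)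
    moreover have "(\<lambda>z. (a i z * a' i' z) * (\<Prod>j<k + l. ?g j z))
      = (\<lambda>z. (a i z * (\<Prod>j<k. h i j z)) * (a' i' z * (\<Prod>j<l. h' i' j z)))"
      by (simp add: prod_lessThan_add mult_ac)
    ultimately show "(\<lambda>z. (a i z * (\<Prod>j<k. h i j z)) * (a' i' z * (\<Prod>j<l. h' i' j z))) \<in> mpow y (k + l)"
      by simp
  qed
  then show ?thesis
    by (rule mpow_cong[OF y]) (use h(3) h'(3) in \<open>eventually_elim, simp add: sum_product\<close>)
qed

lemma mpow_0_iff: "y \<in> Y \<Longrightarrow> f \<in> mpow y 0 \<longleftrightarrow> regular y f"
proof
  assume y: "y \<in> Y" and "regular y f"
  then show "f \<in> mpow y 0" using mpow_term[OF y, of f 0] by simp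
next
  assume y: "y \<in> Y" and "f \<in> mpow y 0"
  then obtain N :: nat and a where a: "\<forall>i<N. regular y (a i)" "eventually (\<lambda>z. f z = (\<Sum>i<N::nat. a i z)) (germs y)"
    unfolding mpow_iff[OF y] by auto
  have "regular y (\<lambda>z. \<Sum>i<N. a i z)" using a(1) by (intro regular_sum[OF y]) auto
  then show "regular y f" by (rule regular_cong[OF y]) (use a(2) in eventually_elim, simp)
qed

lemma mpow_regular: assumes y: "y \<in> Y" and "f \<in> mpow y k" shows "regular y f"
proof -
  obtain N :: nat and a h where h: "\<forall>i<N. regular y (a i)" "\<forall>i<N. \<forall>j<k. regular y (h i j) \<and> h i j y = 0"
    "eventually (\<lambda>z. f z = (\<Sum>i<N. a i z * (\<Prod>j<k. h i j z))) (germs y)"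
    using assms(2) unfolding mpow_iff[OF y] by blast
  have "regular y (\<lambda>z. \<Sum>i<N. a i z * (\<Prod>j<k. h i j z))" using h(1,2)
    by (intro regular_sum[OF y] regular_mult[OF y] regular_prod[OF y]) auto
  then show "regular y f" by (rule regular_cong[OF y]) (use h(3) in eventually_elim, simp)
qed

lemma mpow_regular_mult: "y \<in> Y \<Longrightarrow> regular y a \<Longrightarrow> f \<in> mpow y k \<Longrightarrow> (\<lambda>z. a z * f z) \<in> mpow y k"
  using mpow_mult[of y a 0 f k] mpow_0_iff by simp

lemma mpow_scale: "y \<in> Y \<Longrightarrow> f \<in> mpow y k \<Longrightarrow> (\<lambda>z. c * f z) \<in> mpow y k"
  by (simp add: mpow_regular_mult regular_const)

lemma mpow_uminus: "y \<in> Y \<Longrightarrow> f \<in> mpow y k \<Longrightarrow> (\<lambda>z. - f z) \<in> mpow y k"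
  using mpow_scale[of y f k "-1"] by simp

lemma mpow_diff: "y \<in> Y \<Longrightarrow> f \<in> mpow y k \<Longrightarrow> g \<in> mpow y k \<Longrightarrow> (\<lambda>z. f z - g z) \<in> mpow y k"
  using mpow_add[OF _ _ mpow_uminus, of y f k g] by simp

lemma mpow_1_iff: "y \<in> Y \<Longrightarrow> f \<in> mpow y 1 \<longleftrightarrow> regular y f \<and> f y = 0"
proof
  assume y: "y \<in> Y" and "regular y f \<and> f y = 0"
  then show "f \<in> mpow y 1" using mpow_term[OF y regular_const[OF y, of 1], of 1 "\<lambda>_. f"] by simp
next
  assume y: "y \<in> Y" and f: "f \<in> mpow y 1"
  then obtain N :: nat and a h where h: "\<forall>i<N. regular y (a i)" "\<forall>i<N. \<forall>j<1::nat. regular y (h i j) \<and> h i j y = 0"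
    "eventually (\<lambda>z. f z = (\<Sum>i<N::nat. a i z * (\<Prod>j<1. h i j z))) (germs y)"
    unfolding mpow_iff[OF y] by blast
  then have "f y = 0" using eventually_self[OF y h(3)] by simp
  then show "regular y f \<and> f y = 0" using mpow_regular[OF y f] by simp
qed

lemma mpow_Suc_subset: "y \<in> Y \<Longrightarrow> mpow y (Suc k) \<subseteq> mpow y k"
proof
  fix f assume y: "y \<in> Y" and "f \<in> mpow y (Suc k)"
  then obtain N :: nat and a h where h: "\<forall>i<N. regular y (a i)" "\<forall>i<N. \<forall>j<Suc k. regular y (h i j) \<and> h i j y = 0"
    "eventually (\<lambda>z. f z = (\<Sum>i<N. a i z * (\<Prod>j<Suc k. h i j z))) (germs y)"
    unfolding mpow_iff[OF y] by blast
  show "f \<in> mpow y k" unfolding mpow_iff[OF y]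
    by (intro exI[of _ N] exI[of _ "\<lambda>i z. a i z * h i k z"] exI[of _ h])
      (use h in \<open>auto intro: regular_mult[OF y] simp: mult_ac\<close>)
qed

lemma mpow_antimono: assumes "y \<in> Y" "k \<le> l" shows "mpow y l \<subseteq> mpow y k"
  using assms(2) by (induction l rule: dec_induct) (use mpow_Suc_subset assms(1) in auto)

lemma mpow_eval: "y \<in> Y \<Longrightarrow> f \<in> mpow y k \<Longrightarrow> k \<ge> 1 \<Longrightarrow> f y = 0"
  using mpow_antimono[of y 1 k] mpow_1_iff by blast

lemma mpow_power: "y \<in> Y \<Longrightarrow> regular y t \<Longrightarrow> t y = 0 \<Longrightarrow> (\<lambda>z. t z ^ k) \<in> mpow y k"
  using mpow_term[of y "\<lambda>_. 1" k "\<lambda>_. t"] regular_const by simp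

lemma mpow_unit_cancel:
  assumes y: "y \<in> Y" and "regular y u" "u y \<noteq> 0" "(\<lambda>z. u z * f z) \<in> mpow y k" shows "f \<in> mpow y k"
proof -
  have "(\<lambda>z. inverse (u z) * (u z * f z)) \<in> mpow y k"
    by (rule mpow_regular_mult[OF y regular_inverse[OF y assms(2,3)] assms(4)])
  then show ?thesis
    by (rule mpow_cong[OF y]) (use eventually_neq_0[OF y assms(2,3)] in eventually_elim, simp)
qed

end

text \<open>A local homomorphism respects powers of maximal ideals. Only the behaviour of
  \<open>\<theta>\<close> near \<open>y\<close> enters, so this applies to local sections of the
  scroll and its projection as well as to the embeddings of curves.\<close>

lemma mpow_pullback:
  assumes "quasiproj W Y" "quasiproj W' Y'" "y \<in> Y" "\<theta> y \<in> Y'"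
    and lim: "filterlim \<theta> (nhdsin (subtopology (zariski W') Y') (\<theta> y)) (nhdsin (subtopology (zariski W) Y) y)"
    and reg: "\<And>h. regular_at W' Y' (\<theta> y) h \<Longrightarrow> regular_at W Y y (\<lambda>z. h (\<theta> z))"
    and f: "f \<in> max_ideal_pow W' Y' (\<theta> y) k"
  shows "(\<lambda>z. f (\<theta> z)) \<in> max_ideal_pow W Y y k"
proof -
  interpret A: quasiproj W Y by fact
  interpret B: quasiproj W' Y' by fact
  obtain N :: nat and a h where h: "\<forall>i<N. B.regular (\<theta> y) (a i)" "\<forall>i<N. \<forall>j<k. B.regular (\<theta> y) (h i j) \<and> h i j (\<theta> y) = 0"
    "eventually (\<lambda>z. f z = (\<Sum>i<N. a i z * (\<Prod>j<k. h i j z))) (B.germs (\<theta> y))"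
    using f unfolding B.mpow_iff[OF assms(4)] by blast
  have "eventually (\<lambda>z. f (\<theta> z) = (\<Sum>i<N. a i (\<theta> z) * (\<Prod>j<k. h i j (\<theta> z)))) (A.germs y)"
    using lim h(3) unfolding filterlim_iff by blast
  then show ?thesis unfolding A.mpow_iff[OF assms(3)] using h(1,2) reg
    by (intro exI[of _ N] exI[of _ "\<lambda>i z. a i (\<theta> z)"] exI[of _ "\<lambda>i j z. h i j (\<theta> z)"]) auto
qed

section \<open>Algebras of functions and the Hilbert basis theorem\<close>

text \<open>Coordinate rings of affine charts are realised as algebras of functions, so relations
  between generators are simply equalities of functions.\<close>

definition function_algebra :: "('p \<Rightarrow> complex) set \<Rightarrow> bool"
  where "function_algebra S \<longleftrightarrow> (\<forall>c. (\<lambda>z. c) \<in> S) \<and>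
    (\<forall>f\<in>S. \<forall>g\<in>S. (\<lambda>z. f z + g z) \<in> S \<and> (\<lambda>z. f z * g z) \<in> S)"

lemma
  assumes "function_algebra S"
  shows function_algebra_const: "(\<lambda>z. c) \<in> S"
    and function_algebra_add: "f \<in> S \<Longrightarrow> g \<in> S \<Longrightarrow> (\<lambda>z. f z + g z) \<in> S"
    and function_algebra_mult: "f \<in> S \<Longrightarrow> g \<in> S \<Longrightarrow> (\<lambda>z. f z * g z) \<in> S"
  using assms unfolding function_algebra_def by auto

lemma function_algebra_sum:
  "function_algebra S \<Longrightarrow> (\<And>i. i \<in> I \<Longrightarrow> f i \<in> S) \<Longrightarrow> (\<lambda>z. \<Sum>i\<in>I. f i z) \<in> S"
  by (induction I rule: infinite_finite_induct) (auto intro: function_algebra_const function_algebra_add)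

lemma function_algebra_power:
  assumes "function_algebra S" "f \<in> S" shows "(\<lambda>z. f z ^ k) \<in> S"
  by (induction k) (use assms function_algebra_const function_algebra_mult in auto)

definition seq_ideal :: "('p \<Rightarrow> complex) set \<Rightarrow> (nat \<Rightarrow> 'p \<Rightarrow> complex) \<Rightarrow> nat \<Rightarrow> ('p \<Rightarrow> complex) set"
  where "seq_ideal S f n = {h. \<exists>a. (\<forall>k<n. a k \<in> S) \<and> h = (\<lambda>z. \<Sum>k<n. a k z * f k z)}"

text \<open>The ascending chain condition in sequential form: some member of any sequence lies in
  the ideal generated by its predecessors. This is the form that the proof of Krull's theorem
  consumes.\<close>

definition noetherian :: "('p \<Rightarrow> complex) set \<Rightarrow> bool"
  where "noetherian S \<longleftrightarrow> function_algebra S \<and> (\<forall>f. (\<forall>n. f n \<in> S) \<longrightarrow> (\<exists>n. f n \<in> seq_ideal S f n))"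

lemma seq_ideal_add:
  assumes "function_algebra S" "f \<in> seq_ideal S p n" "g \<in> seq_ideal S p n"
  shows "(\<lambda>z. f z + g z) \<in> seq_ideal S p n"
proof -
  obtain a b where "\<forall>k<n. a k \<in> S" "f = (\<lambda>z. \<Sum>k<n. a k z * p k z)"
    "\<forall>k<n. b k \<in> S" "g = (\<lambda>z. \<Sum>k<n. b k z * p k z)"
    using assms(2,3) unfolding seq_ideal_def by auto
  then show ?thesis unfolding seq_ideal_def mem_Collect_eq
    by (intro exI[of _ "\<lambda>k z. a k z + b k z"])
      (auto simp: function_algebra_add[OF assms(1)] sum.distrib[symmetric] algebra_simps)
qed

lemma seq_ideal_mult:
  assumes "function_algebra S" "f \<in> S" "g \<in> seq_ideal S p n"
  shows "(\<lambda>z. f z * g z) \<in> seq_ideal S p n"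
proof -
  obtain b where "\<forall>k<n. b k \<in> S" "g = (\<lambda>z. \<Sum>k<n. b k z * p k z)"
    using assms(3) unfolding seq_ideal_def by auto
  then show ?thesis unfolding seq_ideal_def mem_Collect_eq
    by (intro exI[of _ "\<lambda>k z. f z * b k z"])
      (auto simp: function_algebra_mult[OF assms(1,2)] sum_distrib_left mult.assoc)
qed

lemma seq_ideal_zero: "function_algebra S \<Longrightarrow> (\<lambda>z. 0) \<in> seq_ideal S p n"
  unfolding seq_ideal_def by (auto intro!: exI[of _ "\<lambda>_ _. 0"] simp: function_algebra_const)

lemma seq_ideal_sum:
  "function_algebra S \<Longrightarrow> (\<And>i. i \<in> I \<Longrightarrow> f i \<in> seq_ideal S p n) \<Longrightarrow> (\<lambda>z. \<Sum>i\<in>I. f i z) \<in> seq_ideal S p n"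
  by (induction I rule: infinite_finite_induct) (auto intro: seq_ideal_zero seq_ideal_add)

lemma seq_ideal_gen:
  assumes "function_algebra S" "k < n" shows "p k \<in> seq_ideal S p n"
proof -
  have "p k = (\<lambda>z. \<Sum>i<n. (if i = k then 1 else 0) * p i z)"
    using assms(2) by (auto simp: fun_eq_iff if_distrib[of "\<lambda>c. c * _"] sum.delta cong: if_cong)
  then show ?thesis unfolding seq_ideal_def mem_Collect_eq
    by (intro exI[of _ "\<lambda>i z. if i = k then 1 else 0"]) (auto intro: function_algebra_const[OF assms(1)])
qed

lemma seq_ideal_subset:
  assumes S: "function_algebra S" and "\<And>k. k < n \<Longrightarrow> p k \<in> seq_ideal S q m"
  shows "seq_ideal S p n \<subseteq> seq_ideal S q m"
proof
  fix h assume "h \<in> seq_ideal S p n"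
  then obtain a where a: "\<forall>k<n. a k \<in> S" "h = (\<lambda>z. \<Sum>k<n. a k z * p k z)"
    unfolding seq_ideal_def by auto
  show "h \<in> seq_ideal S q m" unfolding a(2)
    by (intro seq_ideal_sum[OF S] seq_ideal_mult[OF S]) (use a(1) assms(2) in auto)
qed

text \<open>Polynomials in \<open>x\<close> of degree strictly below \<open>d\<close>, so that
  \<open>d = 0\<close> leaves only the zero function. They are taken as functions, so one element
  may have several expressions.\<close>

primrec poly_upto :: "('p \<Rightarrow> complex) set \<Rightarrow> ('p \<Rightarrow> complex) \<Rightarrow> nat \<Rightarrow> ('p \<Rightarrow> complex) set" where
  "poly_upto S x 0 = {\<lambda>z. 0}"
| "poly_upto S x (Suc d) = {\<lambda>z. g z + c z * x z ^ d | g c. g \<in> poly_upto S x d \<and> c \<in> S}"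

context
  fixes S :: "('p \<Rightarrow> complex) set" and x :: "'p \<Rightarrow> complex"
  assumes S: "function_algebra S"
begin

lemma poly_upto_SucI: "g \<in> poly_upto S x d \<Longrightarrow> c \<in> S \<Longrightarrow> (\<lambda>z. g z + c z * x z ^ d) \<in> poly_upto S x (Suc d)"
  by auto

lemma poly_upto_mono: assumes "d \<le> e" shows "poly_upto S x d \<subseteq> poly_upto S x e"
  using assms
proof (induction e rule: dec_induct)
  case (step e)
  have "g \<in> poly_upto S x (Suc e)" if "g \<in> poly_upto S x e" for g
    using poly_upto_SucI[OF that function_algebra_const[OF S, of 0]] by simp
  then show ?case using step by blast
qed auto

lemma poly_upto_add: "f \<in> poly_upto S x d \<Longrightarrow> g \<in> poly_upto S x d \<Longrightarrow> (\<lambda>z. f z + g z) \<in> poly_upto S x d"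
proof (induction d arbitrary: f g)
  case (Suc d)
  then obtain f' a g' b where *: "f = (\<lambda>z. f' z + a z * x z ^ d)" "f' \<in> poly_upto S x d" "a \<in> S"
    "g = (\<lambda>z. g' z + b z * x z ^ d)" "g' \<in> poly_upto S x d" "b \<in> S" by auto
  have "(\<lambda>z. f z + g z) = (\<lambda>z. (f' z + g' z) + (a z + b z) * x z ^ d)"
    by (simp add: * algebra_simps)
  then show ?case using poly_upto_SucI[OF Suc.IH[OF *(2,5)] function_algebra_add[OF S *(3,6)]] by simp
qed auto

lemma poly_upto_mult_S: "f \<in> poly_upto S x d \<Longrightarrow> c \<in> S \<Longrightarrow> (\<lambda>z. c z * f z) \<in> poly_upto S x d"
proof (induction d arbitrary: f)
  case (Suc d)
  then obtain f' a where *: "f = (\<lambda>z. f' z + a z * x z ^ d)" "f' \<in> poly_upto S x d" "a \<in> S" by auto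
  have "(\<lambda>z. c z * f z) = (\<lambda>z. c z * f' z + (c z * a z) * x z ^ d)"
    by (simp add: * algebra_simps)
  then show ?case using poly_upto_SucI[OF Suc.IH[OF *(2)] function_algebra_mult[OF S Suc.prems(2) *(3)]] Suc.prems by simp
qed auto

lemma poly_upto_mult_x: "f \<in> poly_upto S x d \<Longrightarrow> (\<lambda>z. x z ^ k * f z) \<in> poly_upto S x (k + d)"
proof (induction d arbitrary: f)
  case 0
  then show ?case using poly_upto_mono[of 0 k] by auto
next
  case (Suc d)
  then obtain f' a where *: "f = (\<lambda>z. f' z + a z * x z ^ d)" "f' \<in> poly_upto S x d" "a \<in> S" by auto
  have "(\<lambda>z. x z ^ k * f z) = (\<lambda>z. x z ^ k * f' z + a z * x z ^ (k + d))"
    by (simp add: * algebra_simps power_add)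
  then show ?case using poly_upto_SucI[OF Suc.IH[OF *(2)] *(3)] by simp
qed

lemma poly_upto_sum:
  "(\<And>i. i \<in> I \<Longrightarrow> f i \<in> poly_upto S x d) \<Longrightarrow> (\<lambda>z. \<Sum>i\<in>I. f i z) \<in> poly_upto S x d"
  by (induction I rule: infinite_finite_induct) (use poly_upto_add poly_upto_mono[of 0 d] in auto)

lemma poly_upto_mult: "f \<in> poly_upto S x d \<Longrightarrow> g \<in> poly_upto S x e \<Longrightarrow> (\<lambda>z. f z * g z) \<in> poly_upto S x (e + d)"
proof (induction e arbitrary: g)
  case 0
  then show ?case using poly_upto_mono[of 0 d] by auto
next
  case (Suc e)
  then obtain g' a where *: "g = (\<lambda>z. g' z + a z * x z ^ e)" "g' \<in> poly_upto S x e" "a \<in> S" by auto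
  have "(\<lambda>z. f z * g' z) \<in> poly_upto S x (Suc e + d)"
    using Suc.IH[OF Suc.prems(1) *(2)] poly_upto_mono[of "e + d" "Suc e + d"] by auto
  moreover have "(\<lambda>z. x z ^ e * (a z * f z)) \<in> poly_upto S x (Suc e + d)"
    using poly_upto_mult_x[OF poly_upto_mult_S[OF Suc.prems(1) *(3)], of e] poly_upto_mono[of "e + d" "Suc e + d"] by auto
  ultimately have "(\<lambda>z. f z * g' z + x z ^ e * (a z * f z)) \<in> poly_upto S x (Suc e + d)"
    by (rule poly_upto_add)
  moreover have "(\<lambda>z. f z * g z) = (\<lambda>z. f z * g' z + x z ^ e * (a z * f z))"
    by (simp add: * algebra_simps)
  ultimately show ?case by (simp only:)
qed

lemma S_subset_poly_upto: "S \<subseteq> poly_upto S x 1"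
  using poly_upto_SucI[of "\<lambda>z. 0" 0] by auto

lemma x_in_poly_upto: "x \<in> poly_upto S x 2"
proof -
  have "(\<lambda>z. 1) \<in> poly_upto S x 1" using S_subset_poly_upto function_algebra_const[OF S] by blast
  from poly_upto_mult_x[OF this, of 1] show ?thesis by (simp add: numeral_2_eq_2)
qed

lemma function_algebra_poly_upto: "function_algebra (\<Union>d. poly_upto S x d)"
proof -
  have sum: "(\<lambda>z. f z + g z) \<in> (\<Union>d. poly_upto S x d)"
    if "f \<in> poly_upto S x d" "g \<in> poly_upto S x e" for f g d e
    using poly_upto_add[of f "max d e" g] that poly_upto_mono[of d "max d e"] poly_upto_mono[of e "max d e"] by auto
  have prod: "(\<lambda>z. f z * g z) \<in> (\<Union>d. poly_upto S x d)"
    if "f \<in> poly_upto S x d" "g \<in> poly_upto S x e" for f g d e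
    using poly_upto_mult[OF that] by auto
  have "(\<lambda>z. c) \<in> (\<Union>d. poly_upto S x d)" for c
    using S_subset_poly_upto function_algebra_const[OF S] by blast
  then show ?thesis unfolding function_algebra_def by (intro conjI allI ballI) (auto simp only: UN_iff intro: sum[unfolded UN_iff] prod[unfolded UN_iff])
qed

end

text \<open>Elements of minimal degree are successively chosen outside the ideal generated by the
  previous ones; a relation between their leading coefficients then lowers the degree.\<close>

theorem hilbert_basis:
  assumes "noetherian S" shows "noetherian (\<Union>d. poly_upto S x d)"
proof -
  have S: "function_algebra S" using assms unfolding noetherian_def by blast
  define T where "T = (\<Union>d. poly_upto S x d)"
  have T: "function_algebra T" unfolding T_def by (rule function_algebra_poly_upto[OF S])
  have "\<exists>n. f n \<in> seq_ideal T f n" if f: "\<forall>n. f n \<in> T" for f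
  proof (rule ccontr)
    assume no: "\<nexists>n. f n \<in> seq_ideal T f n"
    \<comment> \<open>Under the assumption \<open>no\<close> this union of ideals is an ideal not
      generated by finitely many of its elements.\<close>
    define I where "I = (\<Union>n. seq_ideal T f n)"
    have mono: "seq_ideal T f m \<subseteq> seq_ideal T f n" if "m \<le> n" for m n
      using that by (intro seq_ideal_subset[OF T] seq_ideal_gen[OF T]) auto
    have IT: "I \<subseteq> T" unfolding I_def seq_ideal_def using f
      by (auto intro!: function_algebra_sum[OF T] function_algebra_mult[OF T])
    have I_closed: "(\<lambda>z. g z - h z) \<in> I" if "g \<in> I" "h \<in> I" for g h
    proof -
      obtain m n where "g \<in> seq_ideal T f m" "h \<in> seq_ideal T f n" using \<open>g \<in> I\<close> \<open>h \<in> I\<close> unfolding I_def by blast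
      then have "g \<in> seq_ideal T f (max m n)" "h \<in> seq_ideal T f (max m n)"
        using mono[of m "max m n"] mono[of n "max m n"] by auto
      then have "(\<lambda>z. g z + (- 1) * h z) \<in> seq_ideal T f (max m n)"
        by (intro seq_ideal_add[OF T] seq_ideal_mult[OF T, of "\<lambda>z. - 1"] function_algebra_const[OF T])
      then show ?thesis unfolding I_def by auto
    qed
    have I_fin: "\<exists>m. \<forall>k<n. p k \<in> seq_ideal T f m" if "\<forall>k<n. p k \<in> I" for p :: "nat \<Rightarrow> 'a \<Rightarrow> complex" and n
      using that
    proof (induction n)
      case (Suc n)
      then obtain m m' where "\<forall>k<n. p k \<in> seq_ideal T f m" "p n \<in> seq_ideal T f m'" unfolding I_def by auto
      then have "\<forall>k<Suc n. p k \<in> seq_ideal T f (max m m')"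
        using mono[of m "max m m'"] mono[of m' "max m m'"] by (auto simp: less_Suc_eq)
      then show ?case by blast
    qed simp
    have I_sub: "seq_ideal T p n \<subseteq> I" if p: "\<forall>k<n. p k \<in> I" for p n
      using I_fin[OF p] seq_ideal_subset[OF T] unfolding I_def by blast
    have I_big: "\<exists>h\<in>I. h \<notin> seq_ideal T p n" if p: "\<forall>k<n. p k \<in> I" for p n
    proof -
      obtain m where "\<forall>k<n. p k \<in> seq_ideal T f m" using I_fin[OF p] by blast
      then have "seq_ideal T p n \<subseteq> seq_ideal T f m" by (intro seq_ideal_subset[OF T]) auto
      moreover have "f m \<in> I" unfolding I_def using seq_ideal_gen[OF T, of m "Suc m" f] by blast
      ultimately show ?thesis using no by blast
    qed
    \<comment> \<open>The least bound over all expressions of \<open>h\<close>. It is one more than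
      a degree, because \<open>poly_upto\<close> has a strict bound, and only the zero function gets
      0.\<close>
    define deg where "deg h = (LEAST d. h \<in> poly_upto S x d)" for h
    have deg: "h \<in> poly_upto S x (deg h)" if "h \<in> I" for h
      unfolding deg_def by (rule LeastI_ex) (use that IT T_def in blast)
    define P where "P p n r \<longleftrightarrow> r \<in> I \<and> r \<notin> seq_ideal T p n \<and>
      (\<forall>h\<in>I. h \<notin> seq_ideal T p n \<longrightarrow> deg r \<le> deg h)" for p :: "nat \<Rightarrow> 'a \<Rightarrow> complex" and n r
    have "\<exists>p. \<forall>n. P p n (p n)"
    proof (rule dependent_wellorder_choice)
      fix r n and g h :: "nat \<Rightarrow> 'a \<Rightarrow> complex" assume "\<And>k. k < n \<Longrightarrow> g k = h k"
      then have "seq_ideal T g n = seq_ideal T h n" unfolding seq_ideal_def by auto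
      then show "P g n r = P h n r" unfolding P_def by simp
    next
      fix n :: nat and p assume "\<And>k. k < n \<Longrightarrow> P p k (p k)"
      then obtain h where "h \<in> I \<and> h \<notin> seq_ideal T p n" using I_big[of n p] unfolding P_def by blast
      from ex_has_least_nat[of "\<lambda>h. h \<in> I \<and> h \<notin> seq_ideal T p n",  OF this, of deg]
      show "\<exists>r. P p n r" unfolding P_def by blast
    qed
    then obtain p where p: "\<And>n. P p n (p n)" by blast
    then have pI: "p n \<in> I" and pnot: "p n \<notin> seq_ideal T p n"
      and pmin: "h \<in> I \<Longrightarrow> h \<notin> seq_ideal T p n \<Longrightarrow> deg (p n) \<le> deg h" for n h
      unfolding P_def by auto
    have "deg (p n) \<noteq> 0" for n
      using deg[OF pI, of n] seq_ideal_zero[OF T, of p n] pnot by (metis poly_upto.simps(1) singletonD)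
    then have "\<exists>g c. p n = (\<lambda>z. g z + c z * x z ^ (deg (p n) - 1)) \<and> g \<in> poly_upto S x (deg (p n) - 1) \<and> c \<in> S" for n
      using deg[OF pI, of n] \<open>\<And>n. deg (p n) \<noteq> 0\<close>[of n] by (cases "deg (p n)") auto
    then obtain g c where gc: "\<And>n. p n = (\<lambda>z. g n z + c n z * x z ^ (deg (p n) - 1))"
      "\<And>n. g n \<in> poly_upto S x (deg (p n) - 1)" "\<And>n. c n \<in> S" by metis
    \<comment> \<open>The noetherian property of \<open>S\<close> is applied to the leading
      coefficients.\<close>
    obtain n where "c n \<in> seq_ideal S c n" using assms gc(3) unfolding noetherian_def by blast
    then obtain a where a: "\<forall>k<n. a k \<in> S" "c n = (\<lambda>z. \<Sum>k<n. a k z * c k z)" unfolding seq_ideal_def by auto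
    have dle: "deg (p k) \<le> deg (p n)" if "k < n" for k
    proof (rule pmin[OF pI])
      have "seq_ideal T p k \<subseteq> seq_ideal T p n"
        using that by (intro seq_ideal_subset[OF T] seq_ideal_gen[OF T]) auto
      then show "p n \<notin> seq_ideal T p k" using pnot by blast
    qed
    \<comment> \<open>Powers of \<open>x\<close> lift the leading terms of the earlier
      \<open>p k\<close> to the degree of \<open>p n\<close>. By the relation \<open>a\<close>
      between leading coefficients, \<open>r\<close> and \<open>p n\<close> have the same leading
      term, so the difference \<open>q\<close> has a smaller bound although it lies outside the same
      ideal.\<close>
    define r where "r = (\<lambda>z. \<Sum>k<n. (x z ^ (deg (p n) - deg (p k)) * a k z) * p k z)"
    have xT: "x \<in> T" and ST: "S \<subseteq> T"
      using x_in_poly_upto[OF S] S_subset_poly_upto[OF S] unfolding T_def by blast+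
    have r: "r \<in> seq_ideal T p n" unfolding r_def seq_ideal_def mem_Collect_eq
      by (rule exI[of _ "\<lambda>k z. x z ^ (deg (p n) - deg (p k)) * a k z"])
        (use a(1) ST xT in \<open>auto intro!: function_algebra_mult[OF T] function_algebra_power[OF T]\<close>)
    define q where "q = (\<lambda>z. p n z - r z)"
    have "q \<in> I" unfolding q_def using I_closed pI I_sub[of n p] r by blast
    moreover have "q \<notin> seq_ideal T p n"
    proof
      assume "q \<in> seq_ideal T p n"
      from seq_ideal_add[OF T this r] have "p n \<in> seq_ideal T p n" unfolding q_def by simp
      then show False using pnot by blast
    qed
    ultimately have "deg (p n) \<le> deg q" using pmin by blast
    have "q = (\<lambda>z. g n z + (-1) * (\<Sum>k<n. a k z * (x z ^ (deg (p n) - deg (p k)) * g k z)))"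
    proof
      fix z
      have "r z = (\<Sum>k<n. a k z * (x z ^ (deg (p n) - deg (p k)) * g k z)) + (\<Sum>k<n. a k z * c k z) * x z ^ (deg (p n) - 1)"
        unfolding r_def sum_distrib_right sum.distrib[symmetric]
      proof (rule sum.cong)
        fix k assume "k \<in> {..<n}"
        then have "deg (p n) - 1 = (deg (p n) - deg (p k)) + (deg (p k) - 1)"
          using dle[of k] \<open>\<And>n. deg (p n) \<noteq> 0\<close>[of k] by simp
        then have e: "x z ^ (deg (p n) - 1) = x z ^ (deg (p n) - deg (p k)) * x z ^ (deg (p k) - 1)"
          by (simp add: power_add)
        have pk: "p k z = g k z + c k z * x z ^ (deg (p k) - 1)" using gc(1)[of k] by metis
        show "x z ^ (deg (p n) - deg (p k)) * a k z * p k z =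
          a k z * (x z ^ (deg (p n) - deg (p k)) * g k z) + a k z * c k z * x z ^ (deg (p n) - 1)"
          unfolding pk e by (simp add: algebra_simps)
      qed simp
      moreover have "p n z = g n z + (\<Sum>k<n. a k z * c k z) * x z ^ (deg (p n) - 1)" using gc(1)[of n] a(2) by metis
      ultimately show "q z = g n z + (-1) * (\<Sum>k<n. a k z * (x z ^ (deg (p n) - deg (p k)) * g k z))"
        unfolding q_def by simp
    qed
    also have "\<dots> \<in> poly_upto S x (deg (p n) - 1)"
    proof (rule poly_upto_add[OF S gc(2) poly_upto_mult_S[OF S poly_upto_sum[OF S] function_algebra_const[OF S]]])
      fix k assume k: "k \<in> {..<n}"
      then have e: "deg (p n) - 1 = (deg (p n) - deg (p k)) + (deg (p k) - 1)"
        using dle[of k] \<open>\<And>n. deg (p n) \<noteq> 0\<close>[of k] by simp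
      have "(\<lambda>z. x z ^ (deg (p n) - deg (p k)) * g k z) \<in> poly_upto S x (deg (p n) - 1)"
        unfolding e by (rule poly_upto_mult_x[OF S gc(2)])
      then show "(\<lambda>z. a k z * (x z ^ (deg (p n) - deg (p k)) * g k z)) \<in> poly_upto S x (deg (p n) - 1)"
        by (rule poly_upto_mult_S[OF S]) (use a(1) k in auto)
    qed
    finally have "deg q \<le> deg (p n) - 1" unfolding deg_def by (rule Least_le)
    then show False using \<open>deg (p n) \<le> deg q\<close> \<open>\<And>n. deg (p n) \<noteq> 0\<close>[of n] by simp
  qed
  then show ?thesis unfolding noetherian_def using T T_def by blast
qed

section \<open>Finitely generated algebras of functions\<close>

inductive_set polyalg :: "('p \<Rightarrow> complex) set \<Rightarrow> ('p \<Rightarrow> complex) set" for X where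
  const: "(\<lambda>z. c) \<in> polyalg X"
| gen: "x \<in> X \<Longrightarrow> x \<in> polyalg X"
| add: "f \<in> polyalg X \<Longrightarrow> g \<in> polyalg X \<Longrightarrow> (\<lambda>z. f z + g z) \<in> polyalg X"
| mult: "f \<in> polyalg X \<Longrightarrow> g \<in> polyalg X \<Longrightarrow> (\<lambda>z. f z * g z) \<in> polyalg X"

lemma function_algebra_polyalg: "function_algebra (polyalg X)"
  unfolding function_algebra_def by (auto intro: polyalg.intros)

lemma polyalg_mono: "X \<subseteq> X' \<Longrightarrow> polyalg X \<subseteq> polyalg X'"
proof
  fix f assume "X \<subseteq> X'" "f \<in> polyalg X"
  from this(2,1) show "f \<in> polyalg X'" by (induction rule: polyalg.induct) (auto intro: polyalg.intros)
qed

text \<open>Adjoining one generator amounts to forming polynomials in it, which turns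
  \<open>hilbert_basis\<close> into an induction step over finite sets of generators.\<close>

lemma polyalg_insert: "polyalg (insert x X) = (\<Union>d. poly_upto (polyalg X) x d)"
proof
  let ?T = "\<Union>d. poly_upto (polyalg X) x d"
  have T: "function_algebra ?T" by (rule function_algebra_poly_upto[OF function_algebra_polyalg])
  show "polyalg (insert x X) \<subseteq> ?T"
  proof
    fix f assume "f \<in> polyalg (insert x X)"
    then show "f \<in> ?T"
    proof (induction rule: polyalg.induct)
      case (gen y)
      then show ?case
        using x_in_poly_upto[OF function_algebra_polyalg, of x X] S_subset_poly_upto[OF function_algebra_polyalg, of X x]
          polyalg.gen[of y X] by blast
    next
      case (add f g)
      show ?case by (rule function_algebra_add[OF T add.IH])
    next
      case (mult f g)
      show ?case by (rule function_algebra_mult[OF T mult.IH])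
    qed (rule function_algebra_const[OF T])
  qed
  have "poly_upto (polyalg X) x d \<subseteq> polyalg (insert x X)" for d
  proof (induction d)
    case (Suc d)
    show ?case
    proof
      fix f assume "f \<in> poly_upto (polyalg X) x (Suc d)"
      then obtain g c where *: "f = (\<lambda>z. g z + c z * x z ^ d)" "g \<in> poly_upto (polyalg X) x d" "c \<in> polyalg X" by auto
      have "c \<in> polyalg (insert x X)" using *(3) polyalg_mono[of X "insert x X"] by blast
      with subsetD[OF Suc.IH *(2)] show "f \<in> polyalg (insert x X)" unfolding *(1)
        by (rule polyalg.add[OF _ polyalg.mult[OF _ function_algebra_power[OF function_algebra_polyalg polyalg.gen[OF insertI1]]]])
    qed
  qed (auto intro: polyalg.const)
  then show "?T \<subseteq> polyalg (insert x X)" by blast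
qed

lemma noetherian_polyalg: "finite X \<Longrightarrow> noetherian (polyalg X)"
proof (induction X rule: finite_induct)
  case empty
  have "\<exists>n. f n \<in> seq_ideal (polyalg {}) f n" if f: "\<forall>n. f n \<in> polyalg {}" for f :: "nat \<Rightarrow> 'a \<Rightarrow> complex"
  proof -
    have c: "\<exists>c. g = (\<lambda>z. c)" if "g \<in> polyalg {}" for g :: "'a \<Rightarrow> complex"
      using that by (induction rule: polyalg.induct) auto
    obtain a b where ab: "f 0 = (\<lambda>z. a)" "f 1 = (\<lambda>z. b)"
      using c[OF f[rule_format, of 0]] c[OF f[rule_format, of 1]] by auto
    \<comment> \<open>The algebra consists of constants. Of two constants, either the first is zero
      and lies in the ideal with no generators, or it is a unit and divides the second.\<close>
    show ?thesis
    proof (cases "a = 0")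
      case True
      then show ?thesis using seq_ideal_zero[OF function_algebra_polyalg, of "{}" f 0] ab by metis
    next
      case False
      then have "f 1 = (\<lambda>z. \<Sum>k<1. (b / a) * f k z)" using ab by simp
      then have "f 1 \<in> seq_ideal (polyalg {}) f 1" unfolding seq_ideal_def mem_Collect_eq
        by (intro exI[of _ "\<lambda>_ _. b / a"]) (auto intro: polyalg.const)
      then show ?thesis ..
    qed
  qed
  then show ?case unfolding noetherian_def using function_algebra_polyalg by blast
next
  case (insert x X)
  then show ?case unfolding polyalg_insert by (intro hilbert_basis)
qed

section \<open>Charts and Nakayama's lemma\<close>

context quasiproj
begin

text \<open>Dehomogenisation with respect to \<open>u\<close>: on the part of \<open>Y\<close> where
  \<open>u\<close> does not vanish, forms divided by the right power of \<open>u\<close> are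
  polynomials in the affine coordinates \<open>X\<close>.\<close>

definition chart :: "('x \<Rightarrow> complex) \<Rightarrow> ('x point \<Rightarrow> complex) set \<Rightarrow> bool"
  where "chart u X \<longleftrightarrow> u \<in> W \<and> finite X \<and> (\<forall>x\<in>X. \<exists>b\<in>W. x = (\<lambda>z. hcoord W z b / hcoord W z u)) \<and>
    (\<forall>d F. homog_poly W d F \<longrightarrow>
      (\<exists>s\<in>polyalg X. \<forall>z\<in>Y. u \<notin> z \<longrightarrow> F (hcoord W z) = hcoord W z u ^ d * s z))"

text \<open>The hyperplane \<open>y\<close> is also the space of linear forms vanishing at the point
  \<open>y\<close>. A finite spanning set of it, divided by a form \<open>u\<close> outside it,
  gives affine coordinates centred at the point.\<close>

lemma chart_exists:
  assumes y: "y \<in> Y"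
  obtains u X where "chart u X" "u \<notin> y" "\<And>x. x \<in> X \<Longrightarrow> x y = 0"
    "\<And>x. x \<in> X \<Longrightarrow> \<exists>b\<in>y. x = (\<lambda>z. hcoord W z b / hcoord W z u)"
proof -
  have sub: "cfun.subspace y" "y \<subseteq> W" using y subset_Proj unfolding Proj_def by auto
  obtain B where B: "finite B" "B \<subseteq> y" "cfun.span B = y" using finite_basis_exists[OF fin_dim sub] by metis
  obtain u where u: "u \<in> W" "u \<notin> y" using Proj_proper y subset_Proj by blast
  define x where "x b = (\<lambda>z. hcoord W z b / hcoord W z u)" for b
  have "\<exists>s\<in>polyalg (x ` B). \<forall>z\<in>Y. u \<notin> z \<longrightarrow> F (hcoord W z) = hcoord W z u ^ d * s z" if "homog_poly W d F" for d F
    using that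
  proof (induction rule: homog_poly.induct)
    case (const c)
    show ?case by (rule bexI[of _ "\<lambda>z. c"]) (auto intro: polyalg.const)
  next
    case (linear w)
    \<comment> \<open>The value of \<open>w / u\<close> at \<open>y\<close>; subtracting this
      multiple of \<open>u\<close> leaves a form vanishing at \<open>y\<close>, a combination of
      \<open>B\<close>.\<close>
    define a where "a = hcoord W y w / hcoord W y u"
    have "hcoord W y (w - cscale a u) = 0"
      using hcoord_lin[OF y] hcoord_eq_0_iff[OF y u(1)] u by (simp add: lin_diff lin_scale a_def)
    moreover have "w - cscale a u \<in> W" using subspace linear u by (simp add: cfun.subspace_diff cfun.subspace_scale)
    ultimately have "w - cscale a u \<in> cfun.span B" using hcoord_eq_0_iff[OF y] B(3) by blast
    then obtain c where c: "w - cscale a u = (\<Sum>b\<in>B. cscale (c b) b)" unfolding cfun.span_finite[OF B(1)] by blast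
    show ?case
    proof (rule bexI, intro ballI impI)
      show "(\<lambda>z. a + (\<Sum>b\<in>B. c b * x b z)) \<in> polyalg (x ` B)"
        by (intro polyalg.add polyalg.const function_algebra_sum[OF function_algebra_polyalg] polyalg.mult polyalg.gen) auto
      fix z assume z: "z \<in> Y" "u \<notin> z"
      have l: "lin (hcoord W z)" using hcoord_lin z by blast
      have u0: "hcoord W z u \<noteq> 0" using hcoord_eq_0_iff z u by blast
      have "hcoord W z w = hcoord W z (cscale a u) + hcoord W z (w - cscale a u)"
        using lin_add[OF l, of "cscale a u" "w - cscale a u"] by simp
      also have "\<dots> = a * hcoord W z u + (\<Sum>b\<in>B. c b * hcoord W z b)"
        unfolding c by (simp add: lin_sum[OF l] lin_scale[OF l])
      also have "\<dots> = hcoord W z u ^ 1 * (a + (\<Sum>b\<in>B. c b * x b z))"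
        using u0 by (simp add: x_def algebra_simps sum_distrib_left)
      finally show "hcoord W z w = hcoord W z u ^ 1 * (a + (\<Sum>b\<in>B. c b * x b z))" .
    qed
  next
    case (add d F G)
    then obtain s s' where "s \<in> polyalg (x ` B)" "\<forall>z\<in>Y. u \<notin> z \<longrightarrow> F (hcoord W z) = hcoord W z u ^ d * s z"
      "s' \<in> polyalg (x ` B)" "\<forall>z\<in>Y. u \<notin> z \<longrightarrow> G (hcoord W z) = hcoord W z u ^ d * s' z" by blast
    then show ?case by (intro bexI[of _ "\<lambda>z. s z + s' z"] polyalg.add) (auto simp: algebra_simps)
  next
    case (mult d F e G)
    then obtain s s' where "s \<in> polyalg (x ` B)" "\<forall>z\<in>Y. u \<notin> z \<longrightarrow> F (hcoord W z) = hcoord W z u ^ d * s z"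
      "s' \<in> polyalg (x ` B)" "\<forall>z\<in>Y. u \<notin> z \<longrightarrow> G (hcoord W z) = hcoord W z u ^ e * s' z" by blast
    then show ?case by (intro bexI[of _ "\<lambda>z. s z * s' z"] polyalg.mult) (auto simp: algebra_simps power_add)
  qed
  then have c1: "chart u (x ` B)" unfolding chart_def using u B sub x_def by blast
  have c2: "f y = 0" if f: "f \<in> x ` B" for f
  proof -
    obtain b where b: "b \<in> B" "f = x b" using f by blast
    then have "hcoord W y b = 0" using hcoord_eq_0_iff[OF y, of b] B(2) sub(2) by blast
    then show ?thesis using b(2) x_def by simp
  qed
  have c3: "\<exists>b\<in>y. f = (\<lambda>z. hcoord W z b / hcoord W z u)" if "f \<in> x ` B" for f
    using that B(2) unfolding x_def by blast
  show ?thesis by (rule that[OF c1 u(2)]) (fact c2, fact c3)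
qed

lemma chart_regular: "chart u X \<Longrightarrow> q \<in> Y \<Longrightarrow> u \<notin> q \<Longrightarrow> x \<in> X \<Longrightarrow> regular q x"
proof -
  assume "chart u X" and q: "q \<in> Y" "u \<notin> q" and "x \<in> X"
  then obtain b where "u \<in> W" "b \<in> W" "x = (\<lambda>z. hcoord W z b / hcoord W z u)" unfolding chart_def by blast
  then show "regular q x" using regular_linear_quotient[OF q(1), of b u] q(2) by simp
qed

lemma polyalg_regular:
  assumes q: "q \<in> Y" and "\<And>x. x \<in> X \<Longrightarrow> regular q x" and "s \<in> polyalg X" shows "regular q s"
  using assms(3)
  by (induction rule: polyalg.induct) (auto intro: assms regular_const regular_add regular_mult)

text \<open>Numerator and denominator have the same degree, so the powers of \<open>u\<close>
  cancel. The local ring is thus obtained from \<open>polyalg X\<close> by admitting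
  denominators.\<close>

lemma chart_fraction:
  assumes ch: "chart u X" and q: "q \<in> Y" "u \<notin> q" and f: "regular q f"
  obtains s r where "s \<in> polyalg X" "r \<in> polyalg X" "r q \<noteq> 0" "eventually (\<lambda>z. r z \<noteq> 0 \<and> f z = s z / r z) (germs q)"
proof -
  obtain d F G where F: "homog_poly W d F" "homog_poly W d G"
    "eventually (\<lambda>z. G (hcoord W z) \<noteq> 0 \<and> f z = F (hcoord W z) / G (hcoord W z)) (germs q)"
    using f unfolding regular_iff[OF q(1)] by blast
  obtain s where s: "s \<in> polyalg X" "\<forall>z\<in>Y. u \<notin> z \<longrightarrow> F (hcoord W z) = hcoord W z u ^ d * s z"
    using ch F(1) unfolding chart_def by blast
  obtain r where r: "r \<in> polyalg X" "\<forall>z\<in>Y. u \<notin> z \<longrightarrow> G (hcoord W z) = hcoord W z u ^ d * r z"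
    using ch F(2) unfolding chart_def by blast
  have u: "u \<in> W" using ch unfolding chart_def by blast
  have ev: "eventually (\<lambda>z. r z \<noteq> 0 \<and> f z = s z / r z) (germs q)"
    using eventually_notin[OF q(1) u q(2)] eventually_in[OF q(1)] F(3)
    by eventually_elim (use s(2) r(2) hcoord_eq_0_iff[OF _ u] in auto)
  have "r q \<noteq> 0" using eventually_self[OF q(1) ev] by blast
  then show ?thesis using that s(1) r(1) ev by blast
qed

text \<open>The coefficients \<open>c x\<close> are formal partial derivatives of an expression of
  \<open>s\<close> as a polynomial in \<open>X\<close>. They are chosen once for all base points
  \<open>q\<close>, so the linear parts vary algebraically with \<open>q\<close>.\<close>

lemma polyalg_taylor:
  assumes "s \<in> polyalg X" "finite X"
  shows "\<exists>c. (\<forall>x\<in>X. c x \<in> polyalg X) \<and> (\<forall>q\<in>Y. (\<forall>x\<in>X. regular q x) \<longrightarrow>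
    (\<lambda>z. s z - s q - (\<Sum>x\<in>X. c x q * (x z - x q))) \<in> mpow q 2)"
  using assms(1)
proof (induction rule: polyalg.induct)
  case (const c)
  show ?case by (intro exI[of _ "\<lambda>_ _. 0"]) (auto intro: mpow_zero polyalg.const)
next
  case (gen y)
  have "(\<Sum>x\<in>X. (if x = y then 1 else 0) * (x z - x q)) = y z - y q" for z q
    using gen assms(2) by (simp add: if_distrib[of "\<lambda>c. c * _"] sum.delta cong: if_cong)
  then show ?case
    by (intro exI[of _ "\<lambda>x _. if x = y then 1 else 0"]) (auto intro: mpow_zero polyalg.const)
next
  case (add f g)
  obtain a where a: "\<forall>x\<in>X. a x \<in> polyalg X" "\<And>q. q \<in> Y \<Longrightarrow> (\<forall>x\<in>X. regular q x) \<Longrightarrow>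
    (\<lambda>z. f z - f q - (\<Sum>x\<in>X. a x q * (x z - x q))) \<in> mpow q 2" using add.IH(1) by blast
  obtain b where b: "\<forall>x\<in>X. b x \<in> polyalg X" "\<And>q. q \<in> Y \<Longrightarrow> (\<forall>x\<in>X. regular q x) \<Longrightarrow>
    (\<lambda>z. g z - g q - (\<Sum>x\<in>X. b x q * (x z - x q))) \<in> mpow q 2" using add.IH(2) by blast
  show ?case
  proof (intro exI[of _ "\<lambda>x z. a x z + b x z"] conjI ballI impI)
    fix q assume q: "q \<in> Y" "\<forall>x\<in>X. regular q x"
    show "(\<lambda>z. f z + g z - (f q + g q) - (\<Sum>x\<in>X. (a x q + b x q) * (x z - x q))) \<in> mpow q 2"
      using mpow_add[OF q(1) a(2)[OF q] b(2)[OF q]]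
      by (simp add: sum.distrib sum_subtractf algebra_simps)
  qed (use a(1) b(1) polyalg.add in blast)
next
  case (mult f g)
  obtain a where a: "\<forall>x\<in>X. a x \<in> polyalg X" "\<And>q. q \<in> Y \<Longrightarrow> (\<forall>x\<in>X. regular q x) \<Longrightarrow>
    (\<lambda>z. f z - f q - (\<Sum>x\<in>X. a x q * (x z - x q))) \<in> mpow q 2" using mult.IH(1) by blast
  obtain b where b: "\<forall>x\<in>X. b x \<in> polyalg X" "\<And>q. q \<in> Y \<Longrightarrow> (\<forall>x\<in>X. regular q x) \<Longrightarrow>
    (\<lambda>z. g z - g q - (\<Sum>x\<in>X. b x q * (x z - x q))) \<in> mpow q 2" using mult.IH(2) by blast
  show ?case
  proof (intro exI[of _ "\<lambda>x z. f z * b x z + g z * a x z"] conjI ballI impI)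
    fix x assume "x \<in> X"
    then show "(\<lambda>z. f z * b x z + g z * a x z) \<in> polyalg X"
      using a(1) b(1) mult.hyps by (intro polyalg.add polyalg.mult) auto
  next
    fix q assume q: "q \<in> Y" "\<forall>x\<in>X. regular q x"
    \<comment> \<open>The error term in the product rule is a product of two functions vanishing at
      \<open>q\<close>.\<close>
    have "(\<lambda>z. (f z - f q) * (g z - g q)) \<in> mpow q (1 + 1)"
      by (intro mpow_mult[OF q(1)] mpow_1_iff[OF q(1), THEN iffD2] conjI regular_diff regular_const)
        (use polyalg_regular[of q X] q mult.hyps in auto)
    then have m: "(\<lambda>z. (f z - f q) * (g z - g q)) \<in> mpow q 2" by (simp only: one_add_one)
    have "(\<lambda>z. f z * g z - f q * g q - (\<Sum>x\<in>X. (f q * b x q + g q * a x q) * (x z - x q))) =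
      (\<lambda>z. (f z - f q) * (g z - g q) + (f q * (g z - g q - (\<Sum>x\<in>X. b x q * (x z - x q)))
        + g q * (f z - f q - (\<Sum>x\<in>X. a x q * (x z - x q)))))"
    proof
      fix z
      have "(\<Sum>x\<in>X. (f q * b x q + g q * a x q) * (x z - x q)) =
        f q * (\<Sum>x\<in>X. b x q * (x z - x q)) + g q * (\<Sum>x\<in>X. a x q * (x z - x q))"
        unfolding sum_distrib_left sum.distrib[symmetric] by (intro sum.cong) (auto simp: algebra_simps)
      then show "f z * g z - f q * g q - (\<Sum>x\<in>X. (f q * b x q + g q * a x q) * (x z - x q)) =
        (f z - f q) * (g z - g q) + (f q * (g z - g q - (\<Sum>x\<in>X. b x q * (x z - x q)))
        + g q * (f z - f q - (\<Sum>x\<in>X. a x q * (x z - x q))))" by algebra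
    qed
    then show "(\<lambda>z. f z * g z - f q * g q - (\<Sum>x\<in>X. (f q * b x q + g q * a x q) * (x z - x q))) \<in> mpow q 2"
      using mpow_add[OF q(1) m mpow_add[OF q(1) mpow_scale[OF q(1) b(2)[OF q], of "f q"] mpow_scale[OF q(1) a(2)[OF q], of "g q"]]]
      by simp
  qed
qed

text \<open>Extends \<open>polyalg_taylor\<close> from polynomials to fractions. The conclusion
  holds with the same coefficient functions at all points near the given one.\<close>

lemma chart_taylor:
  assumes ch: "chart u X" and q: "q \<in> Y" "u \<notin> q" and f: "regular q f"
  obtains c where "\<And>x. x \<in> X \<Longrightarrow> regular q (c x)"
    "eventually (\<lambda>q. (\<lambda>z. f z - f q - (\<Sum>x\<in>X. c x q * (x z - x q))) \<in> mpow q 2) (germs q)"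
proof -
  have fin: "finite X" and u: "u \<in> W" using ch unfolding chart_def by auto
  obtain s r where s: "s \<in> polyalg X" and r: "r \<in> polyalg X" "r q \<noteq> 0"
    and ev: "eventually (\<lambda>z. r z \<noteq> 0 \<and> f z = s z / r z) (germs q)" using chart_fraction[OF ch q f] by blast
  obtain a where a: "\<forall>x\<in>X. a x \<in> polyalg X" "\<And>q. q \<in> Y \<Longrightarrow> (\<forall>x\<in>X. regular q x) \<Longrightarrow>
    (\<lambda>z. s z - s q - (\<Sum>x\<in>X. a x q * (x z - x q))) \<in> mpow q 2" using polyalg_taylor[OF s fin] by blast
  obtain b where b: "\<forall>x\<in>X. b x \<in> polyalg X" "\<And>q. q \<in> Y \<Longrightarrow> (\<forall>x\<in>X. regular q x) \<Longrightarrow>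
    (\<lambda>z. r z - r q - (\<Sum>x\<in>X. b x q * (x z - x q))) \<in> mpow q 2" using polyalg_taylor[OF r(1) fin] by blast
  have reg: "regular q g" if "g \<in> polyalg X" "q \<in> Y" "u \<notin> q" for g q
    using polyalg_regular[OF that(2) _ that(1)] chart_regular[OF ch that(2,3)] by blast
  \<comment> \<open>The quotient rule for \<open>f = s / r\<close>: the numerator
    \<open>a - f * b\<close> absorbs one factor of \<open>r\<close>.\<close>
  define c where "c x = (\<lambda>z. (a x z - f z * b x z) / r z)" for x
  show ?thesis
  proof (rule that[of c])
    fix x assume "x \<in> X"
    then show "regular q (c x)" unfolding c_def
      using a(1) b(1) reg[OF _ q] f r by (intro regular_divide regular_diff regular_mult q) auto
  next
    show "eventually (\<lambda>q. (\<lambda>z. f z - f q - (\<Sum>x\<in>X. c x q * (x z - x q))) \<in> mpow q 2) (germs q)"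
      using eventually_eventually[OF q(1) ev] eventually_in[OF q(1)] eventually_notin[OF q(1) u q(2)] eventually_regular[OF q(1) f]
    proof eventually_elim
      case (elim p)
      have xr: "\<forall>x\<in>X. regular p x" using chart_regular[OF ch elim(2,3)] by blast
      have rp: "r p \<noteq> 0" "f p = s p / r p" using eventually_self[OF elim(2,1)] by auto
      have "(\<lambda>z. (f z - f p) * (r z - r p)) \<in> mpow p (1 + 1)"
        by (intro mpow_mult mpow_1_iff[THEN iffD2] conjI regular_diff regular_const elim(2,4) reg[OF r(1) elim(2,3)]) auto
      then have m: "(\<lambda>z. (f z - f p) * (r z - r p)) \<in> mpow p 2" by (simp only: one_add_one)
      have "(\<lambda>z. inverse (r p) * (((s z - s p - (\<Sum>x\<in>X. a x p * (x z - x p)))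
          - f p * (r z - r p - (\<Sum>x\<in>X. b x p * (x z - x p)))) - (f z - f p) * (r z - r p))) \<in> mpow p 2"
        by (intro mpow_scale mpow_diff elim(2) m a(2) b(2) xr)
      then show ?case
      proof (rule mpow_cong[OF elim(2)])
        show "eventually (\<lambda>z. inverse (r p) * (((s z - s p - (\<Sum>x\<in>X. a x p * (x z - x p)))
          - f p * (r z - r p - (\<Sum>x\<in>X. b x p * (x z - x p)))) - (f z - f p) * (r z - r p))
          = f z - f p - (\<Sum>x\<in>X. c x p * (x z - x p))) (germs p)"
          using elim(1)
        proof eventually_elim
          case (elim z)
          have "(\<Sum>x\<in>X. c x p * (x z - x p)) = inverse (r p) * ((\<Sum>x\<in>X. a x p * (x z - x p)) - f p * (\<Sum>x\<in>X. b x p * (x z - x p)))"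
            unfolding sum_distrib_left sum_subtractf[symmetric] c_def by (intro sum.cong) (auto simp: divide_inverse algebra_simps)
          moreover have "s z = f z * r z" "s p = f p * r p" "inverse (r p) * r p = 1" using elim rp by auto
          ultimately show ?case by algebra
        qed
      qed
    qed
  qed
qed

text \<open>For coordinates centred at \<open>y\<close>, every monomial other than the constant one
  contains a member of \<open>X\<close>.\<close>

lemma polyalg_vanishing:
  assumes "s \<in> polyalg X" "finite X" "\<And>x. x \<in> X \<Longrightarrow> x y = 0"
  shows "\<exists>c. (\<forall>x\<in>X. c x \<in> polyalg X) \<and> (\<forall>z. s z = s y + (\<Sum>x\<in>X. c x z * x z))"
  using assms(1)
proof (induction rule: polyalg.induct)
  case (const c)
  show ?case by (intro exI[of _ "\<lambda>_ _. 0"]) (auto intro: polyalg.const)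
next
  case (gen x)
  have "(\<Sum>x'\<in>X. (if x' = x then 1 else 0) * x' z) = x z" for z
    using gen assms(2) by (simp add: if_distrib[of "\<lambda>c. c * _"] sum.delta cong: if_cong)
  then show ?case using gen assms(3)
    by (intro exI[of _ "\<lambda>x' _. if x' = x then 1 else 0"]) (auto intro: polyalg.const)
next
  case (add f g)
  obtain a where a: "\<forall>x\<in>X. a x \<in> polyalg X" "\<And>z. f z = f y + (\<Sum>x\<in>X. a x z * x z)"
    using add.IH(1) by blast
  obtain b where b: "\<forall>x\<in>X. b x \<in> polyalg X" "\<And>z. g z = g y + (\<Sum>x\<in>X. b x z * x z)"
    using add.IH(2) by blast
  have "f z + g z = f y + g y + (\<Sum>x\<in>X. (a x z + b x z) * x z)" for z
  proof -
    have "(\<Sum>x\<in>X. (a x z + b x z) * x z) = (\<Sum>x\<in>X. a x z * x z) + (\<Sum>x\<in>X. b x z * x z)"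
      by (simp add: distrib_right sum.distrib)
    then show ?thesis using a(2)[of z] b(2)[of z] by algebra
  qed
  then show ?case using a(1) b(1) polyalg.add by (intro exI[of _ "\<lambda>x z. a x z + b x z"]) blast
next
  case (mult f g)
  obtain a where a: "\<forall>x\<in>X. a x \<in> polyalg X" "\<And>z. f z = f y + (\<Sum>x\<in>X. a x z * x z)"
    using mult.IH(1) by blast
  obtain b where b: "\<forall>x\<in>X. b x \<in> polyalg X" "\<And>z. g z = g y + (\<Sum>x\<in>X. b x z * x z)"
    using mult.IH(2) by blast
  have "f z * g z = f y * g y + (\<Sum>x\<in>X. (f y * b x z + a x z * g z) * x z)" for z
  proof -
    have "(\<Sum>x\<in>X. (f y * b x z + a x z * g z) * x z) = f y * (\<Sum>x\<in>X. b x z * x z) + g z * (\<Sum>x\<in>X. a x z * x z)"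
      unfolding sum_distrib_left sum.distrib[symmetric] by (intro sum.cong) (auto simp: algebra_simps)
    then show ?thesis using a(2)[of z] b(2)[of z] by algebra
  qed
  moreover have "\<forall>x\<in>X. (\<lambda>z. f y * b x z + a x z * g z) \<in> polyalg X"
    using a(1) b(1) mult.hyps by (auto intro!: polyalg.add polyalg.mult polyalg.const)
  ultimately show ?case by (intro exI[of _ "\<lambda>x z. f y * b x z + a x z * g z"]) blast
qed

text \<open>A germ vanishing at \<open>y\<close> has a numerator vanishing at \<open>y\<close>, to
  which \<open>polyalg_vanishing\<close> applies.\<close>

lemma max_ideal_generators:
  assumes ch: "chart u X" and y: "y \<in> Y" "u \<notin> y" and X: "\<And>x. x \<in> X \<Longrightarrow> x y = 0" and g: "g \<in> mpow y 1"
  shows "\<exists>c. (\<forall>x\<in>X. regular y (c x)) \<and> eventually (\<lambda>z. g z = (\<Sum>x\<in>X. c x z * x z)) (germs y)"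
proof -
  have gy: "regular y g" "g y = 0" using g mpow_1_iff y by auto
  obtain s r where s: "s \<in> polyalg X" and r: "r \<in> polyalg X" "r y \<noteq> 0"
    and ev: "eventually (\<lambda>z. r z \<noteq> 0 \<and> g z = s z / r z) (germs y)" using chart_fraction[OF ch y gy(1)] by blast
  have "s y = 0" using eventually_self[OF y(1) ev] gy(2) r(2) by simp
  obtain c where c: "\<forall>x\<in>X. c x \<in> polyalg X" "\<forall>z. s z = s y + (\<Sum>x\<in>X. c x z * x z)"
    using polyalg_vanishing[OF s, of y] X ch unfolding chart_def by blast
  have reg: "regular y h" if "h \<in> polyalg X" for h
    using polyalg_regular[OF y(1) _ that] chart_regular[OF ch y] by blast
  have sz: "s z = (\<Sum>x\<in>X. c x z * x z)" for z
    using c(2)[rule_format, of z] unfolding \<open>s y = 0\<close> by simp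
  show ?thesis
  proof (intro exI[of _ "\<lambda>x z. c x z / r z"] conjI ballI)
    show "eventually (\<lambda>z. g z = (\<Sum>x\<in>X. c x z / r z * x z)) (germs y)"
      using ev by eventually_elim (simp add: sz sum_divide_distrib)
  qed (use c(1) reg r y in \<open>auto intro: regular_divide\<close>)
qed

text \<open>In each product of \<open>k + 1\<close> factors the last one is expanded in the
  generators \<open>X\<close> of the maximal ideal; the other \<open>k\<close> factors form the
  coefficients.\<close>

lemma mpow_Suc_generators:
  assumes ch: "chart u X" and y: "y \<in> Y" "u \<notin> y" and X: "\<And>x. x \<in> X \<Longrightarrow> x y = 0" and f: "f \<in> mpow y (Suc k)"
  shows "\<exists>A. (\<forall>x\<in>X. A x \<in> mpow y k) \<and> eventually (\<lambda>z. f z = (\<Sum>x\<in>X. A x z * x z)) (germs y)"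
proof -
  obtain N :: nat and a g where g: "\<forall>i<N. regular y (a i)" "\<forall>i<N. \<forall>j<Suc k. regular y (g i j) \<and> g i j y = 0"
    "eventually (\<lambda>z. f z = (\<Sum>i<N. a i z * (\<Prod>j<Suc k. g i j z))) (germs y)"
    using f unfolding mpow_iff[OF y(1)] by blast
  have "\<forall>i<N. \<exists>c. (\<forall>x\<in>X. regular y (c x)) \<and> eventually (\<lambda>z. g i k z = (\<Sum>x\<in>X. c x z * x z)) (germs y)"
  proof (intro allI impI)
    fix i assume "i < N"
    then have gi: "g i k \<in> mpow y 1" using mpow_1_iff[OF y(1)] g(2) by blast
    show "\<exists>c. (\<forall>x\<in>X. regular y (c x)) \<and> eventually (\<lambda>z. g i k z = (\<Sum>x\<in>X. c x z * x z)) (germs y)"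
      by (rule max_ideal_generators[OF ch y _ gi]) (fact X)
  qed
  then have "\<exists>c. \<forall>i. i < N \<longrightarrow> (\<forall>x\<in>X. regular y (c i x)) \<and> eventually (\<lambda>z. g i k z = (\<Sum>x\<in>X. c i x z * x z)) (germs y)"
    by (intro choice) simp
  then obtain c where c: "\<forall>i. i < N \<longrightarrow> (\<forall>x\<in>X. regular y (c i x)) \<and> eventually (\<lambda>z. g i k z = (\<Sum>x\<in>X. c i x z * x z)) (germs y)"
    by (rule exE)
  have ev: "eventually (\<lambda>z. \<forall>i\<in>{..<N}. g i k z = (\<Sum>x\<in>X. c i x z * x z)) (germs y)"
    by (intro eventually_ball_finite) (use c in auto)
  show ?thesis
  proof (intro exI[of _ "\<lambda>x z. \<Sum>i<N. c i x z * (a i z * (\<Prod>j<k. g i j z))"] conjI ballI)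
    fix x assume "x \<in> X"
    then show "(\<lambda>z. \<Sum>i<N. c i x z * (a i z * (\<Prod>j<k. g i j z))) \<in> mpow y k"
      using g c by (intro mpow_sum mpow_regular_mult mpow_term y) auto
  next
    show "eventually (\<lambda>z. f z = (\<Sum>x\<in>X. (\<Sum>i<N. c i x z * (a i z * (\<Prod>j<k. g i j z))) * x z)) (germs y)"
      using g(3) ev
    proof eventually_elim
      case (elim z)
      have "f z = (\<Sum>i<N. \<Sum>x\<in>X. c i x z * (a i z * (\<Prod>j<k. g i j z)) * x z)"
        unfolding elim(1) using elim(2) by (intro sum.cong) (auto simp: sum_distrib_left sum_distrib_right mult_ac intro!: sum.cong)
      also have "\<dots> = (\<Sum>x\<in>X. \<Sum>i<N. c i x z * (a i z * (\<Prod>j<k. g i j z)) * x z)" by (rule sum.swap)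
      finally show ?case by (simp add: sum_distrib_right)
    qed
  qed
qed

text \<open>A form of Nakayama's lemma, used both for ideals (with \<open>N = 0\<close>) and for families of
  cotangent vectors (with \<open>N q\<close> the square of the maximal ideal at \<open>q\<close>).\<close>

lemma elimination:
  assumes y: "y \<in> Y" and "finite I"
    and zero: "\<And>q. q \<in> Y \<Longrightarrow> (\<lambda>z. 0) \<in> N q"
    and add: "\<And>q f g. q \<in> Y \<Longrightarrow> f \<in> N q \<Longrightarrow> g \<in> N q \<Longrightarrow> (\<lambda>z. f z + g z) \<in> N q"
    and scale: "\<And>q f c. q \<in> Y \<Longrightarrow> f \<in> N q \<Longrightarrow> (\<lambda>z. c * f z) \<in> N q"
    and "\<And>i. i \<in> I \<Longrightarrow> regular y (\<beta> i)"
    and "\<And>i j. i \<in> I \<Longrightarrow> j \<in> I \<Longrightarrow> regular y (A i j) \<and> A i j y = 0"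
    and "\<And>i. i \<in> I \<Longrightarrow> eventually (\<lambda>q. (\<lambda>z. e i q z - \<beta> i q * e0 q z - (\<Sum>j\<in>I. A i j q * e j q z)) \<in> N q) (germs y)"
  shows "\<exists>\<gamma>. \<forall>i\<in>I. regular y (\<gamma> i) \<and> eventually (\<lambda>q. (\<lambda>z. e i q z - \<gamma> i q * e0 q z :: complex) \<in> N q) (germs y)"
  using assms(2,6-)
proof (induction I arbitrary: \<beta> A rule: finite_induct)
  case (insert k I)
  \<comment> \<open>Gaussian elimination: since \<open>A k k\<close> vanishes at \<open>y\<close>,
    the germ \<open>1 - A k k\<close> is a unit, and the relation with index \<open>k\<close> can be
    solved for \<open>e k\<close>.\<close>
  define r where "r = (\<lambda>q. inverse (1 - A k k q))"
  have Akk: "regular y (A k k)" "A k k y = 0" using insert.prems(2) by auto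
  have reg1: "regular y (\<lambda>q. 1 - A k k q)" using Akk y by (intro regular_diff regular_const)
  have rr: "regular y r" unfolding r_def using Akk y by (intro regular_inverse reg1) auto
  have ne: "eventually (\<lambda>q. 1 - A k k q \<noteq> 0) (germs y)" using Akk by (intro eventually_neq_0[OF y reg1]) simp
  \<comment> \<open>The coefficients after substituting the solution for \<open>e k\<close> in the
    other relations; those of \<open>A'\<close> still vanish at \<open>y\<close>.\<close>
  define \<beta>' where "\<beta>' i = (\<lambda>q. \<beta> i q + A i k q * (r q * \<beta> k q))" for i
  define A' where "A' i j = (\<lambda>q. A i j q + A i k q * (r q * A k j q))" for i j
  have sumk: "(\<Sum>j\<in>insert k I. A i j q * e j q z) = A i k q * e k q z + (\<Sum>j\<in>I. A i j q * e j q z)" for i q z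
    using insert.hyps by simp
  have "\<exists>\<gamma>. \<forall>i\<in>I. regular y (\<gamma> i) \<and> eventually (\<lambda>q. (\<lambda>z. e i q z - \<gamma> i q * e0 q z) \<in> N q) (germs y)"
  proof (rule insert.IH[of \<beta>' A'])
    fix i assume i: "i \<in> I"
    show "regular y (\<beta>' i)" unfolding \<beta>'_def
      using insert.prems i by (intro regular_add regular_mult rr y) auto
    show "eventually (\<lambda>q. (\<lambda>z. e i q z - \<beta>' i q * e0 q z - (\<Sum>j\<in>I. A' i j q * e j q z)) \<in> N q) (germs y)"
      using insert.prems(3)[OF insertI2[OF i]] insert.prems(3)[OF insertI1] ne eventually_in[OF y]
    proof eventually_elim
      case (elim q)
      have eq: "e i q z - \<beta>' i q * e0 q z - (\<Sum>j\<in>I. A' i j q * e j q z) =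
        (e i q z - \<beta> i q * e0 q z - (\<Sum>j\<in>insert k I. A i j q * e j q z)) +
        (A i k q * r q) * (e k q z - \<beta> k q * e0 q z - (\<Sum>j\<in>insert k I. A k j q * e j q z))" for z
      proof -
        have "(\<Sum>j\<in>I. A' i j q * e j q z) = (\<Sum>j\<in>I. A i j q * e j q z) + A i k q * r q * (\<Sum>j\<in>I. A k j q * e j q z)"
          unfolding A'_def sum_distrib_left sum.distrib[symmetric] by (intro sum.cong) (auto simp: algebra_simps)
        moreover have "r q * (1 - A k k q) = 1" using elim(3) unfolding r_def by simp
        ultimately show ?thesis unfolding sumk \<beta>'_def by algebra
      qed
      show ?case unfolding eq by (rule add[OF elim(4,1) scale[OF elim(4,2), of "A i k q * r q"]])
    qed
    fix j assume j: "j \<in> I"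
    show "regular y (A' i j) \<and> A' i j y = 0" unfolding A'_def
      using insert.prems(2) i j by (auto intro!: regular_add regular_mult rr y)
  qed
  then obtain \<gamma> where \<gamma>: "\<forall>i\<in>I. regular y (\<gamma> i) \<and> eventually (\<lambda>q. (\<lambda>z. e i q z - \<gamma> i q * e0 q z) \<in> N q) (germs y)"
    by blast
  \<comment> \<open>Back substitution of the multiples found for the remaining indices.\<close>
  define \<gamma>k where "\<gamma>k = (\<lambda>q. r q * (\<beta> k q + (\<Sum>j\<in>I. A k j q * \<gamma> j q)))"
  have "regular y \<gamma>k" unfolding \<gamma>k_def
    using insert.prems \<gamma> by (intro regular_mult regular_add regular_sum rr y) auto
  moreover have "eventually (\<lambda>q. \<forall>i\<in>I. (\<lambda>z. e i q z - \<gamma> i q * e0 q z) \<in> N q) (germs y)"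
    by (intro eventually_ball_finite insert.hyps) (use \<gamma> in blast)
  then have "eventually (\<lambda>q. (\<lambda>z. e k q z - \<gamma>k q * e0 q z) \<in> N q) (germs y)"
    using insert.prems(3)[OF insertI1] ne eventually_in[OF y]
  proof eventually_elim
    case (elim q)
    have sumN: "finite J \<Longrightarrow> J \<subseteq> I \<Longrightarrow> (\<lambda>z. \<Sum>j\<in>J. A k j q * (e j q z - \<gamma> j q * e0 q z)) \<in> N q" for J
      by (induction J rule: finite_induct) (use zero add scale elim(1,4) in auto)
    have eq: "e k q z - \<gamma>k q * e0 q z =
      r q * (e k q z - \<beta> k q * e0 q z - (\<Sum>j\<in>insert k I. A k j q * e j q z)) +
      r q * (\<Sum>j\<in>I. A k j q * (e j q z - \<gamma> j q * e0 q z))" for z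
    proof -
      have "(\<Sum>j\<in>I. A k j q * (e j q z - \<gamma> j q * e0 q z)) = (\<Sum>j\<in>I. A k j q * e j q z) - (\<Sum>j\<in>I. A k j q * \<gamma> j q) * e0 q z"
        unfolding sum_distrib_right sum_subtractf[symmetric] by (intro sum.cong) (auto simp: algebra_simps)
      moreover have "r q * (1 - A k k q) = 1" using elim(3) unfolding r_def by simp
      ultimately show ?thesis unfolding sumk \<gamma>k_def by algebra
    qed
    show ?case unfolding eq
      by (rule add[OF elim(4) scale[OF elim(4,2), of "r q"] scale[OF elim(4) sumN[OF insert.hyps(1) order_refl], of "r q"]])
  qed
  ultimately show ?case using \<gamma> insert.hyps
    by (intro exI[of _ "\<lambda>i. if i = k then \<gamma>k else \<gamma> i"]) auto
qed auto

end

section \<open>Local parameters and differentiation on smooth curves\<close>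

locale smooth_curve = quasiproj M C for M :: "('x \<Rightarrow> complex) set" and C :: "'x point set" +
  assumes irreducible: "irreducible_set (zariski M) C" and smooth: "smooth_of_dim M C 1"
begin

section \<open>Local parameters and the structure of the local ring\<close>

lemma mpow_1I: "p \<in> C \<Longrightarrow> regular p f \<Longrightarrow> f p = 0 \<Longrightarrow> f \<in> mpow p 1"
  using mpow_1_iff by blast

lemma mpow_1_diffI: "p \<in> C \<Longrightarrow> regular p f \<Longrightarrow> (\<lambda>z. f z - f p) \<in> mpow p 1"
  by (rule mpow_1I) (auto intro: regular_diff regular_const)

text \<open>The value \<open>t p\<close> is left arbitrary, so that one function can be a parameter
  at all nearby points, with \<open>t z - t q\<close> as the coordinate centred at
  \<open>q\<close>.\<close>

definition local_param :: "'x point \<Rightarrow> ('x point \<Rightarrow> complex) \<Rightarrow> bool"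
  where "local_param p t \<longleftrightarrow> regular p t \<and> (\<lambda>z. t z - t p) \<notin> mpow p 2"

lemma cotangent_generator:
  assumes p: "p \<in> C"
  obtains t where "t \<in> mpow p 1" "t \<notin> mpow p 2" "\<forall>f\<in>mpow p 1. \<exists>c. (\<lambda>z. f z - c * t z) \<in> mpow p 2"
proof -
  obtain t where t: "\<forall>i\<in>{1..1::nat}. t i \<in> mpow p 1"
    and ex: "\<forall>f\<in>mpow p 1. \<exists>!c. c \<in> coord_space {1..1::nat} \<and> (\<lambda>z. f z - (\<Sum>i=1..1. c i * t i z)) \<in> mpow p 2"
    using smooth p unfolding smooth_of_dim_def by blast
  \<comment> \<open>Otherwise the zero germ would have the two coordinates 0 and 1, against the
    uniqueness demanded by smoothness.\<close>
  have "t 1 \<notin> mpow p 2"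
  proof
    assume *: "t 1 \<in> mpow p 2"
    define Q where "Q c \<longleftrightarrow> c \<in> coord_space {1..1::nat} \<and> (\<lambda>z. 0 - (\<Sum>i=1..1. c i * t i z)) \<in> mpow p 2" for c
    have "\<exists>!c. Q c" unfolding Q_def using bspec[OF ex mpow_zero[OF p]] .
    moreover have "Q (\<lambda>i. 0)" unfolding Q_def using mpow_zero[OF p] by (simp add: coord_space_def)
    moreover have "Q (\<lambda>i. if i = 1 then 1 else 0)" unfolding Q_def using mpow_uminus[OF p *] by (simp add: coord_space_def)
    ultimately have "(\<lambda>i. 0::complex) = (\<lambda>i. if i = (1::nat) then 1 else 0)" by blast
    then show False by (metis zero_neq_one)
  qed
  moreover have "\<forall>f\<in>mpow p 1. \<exists>c. (\<lambda>z. f z - c * t 1 z) \<in> mpow p 2"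
  proof
    fix f assume "f \<in> mpow p 1"
    then obtain c where "(\<lambda>z. f z - (\<Sum>i=1..1. c i * t i z)) \<in> mpow p 2" using ex by blast
    then show "\<exists>c. (\<lambda>z. f z - c * t 1 z) \<in> mpow p 2" by (intro exI[of _ "c 1"]) simp
  qed
  ultimately show ?thesis using that t by auto
qed

lemma local_param_diff: "p \<in> C \<Longrightarrow> local_param p t \<Longrightarrow> (\<lambda>z. t z - t p) \<in> mpow p 1"
  unfolding local_param_def by (blast intro: mpow_1_diffI)

lemma local_param_exists: "p \<in> C \<Longrightarrow> \<exists>t. local_param p t \<and> t p = 0"
proof -
  assume p: "p \<in> C"
  obtain t where t: "t \<in> mpow p 1" "t \<notin> mpow p 2" using cotangent_generator[OF p] by blast
  then have "regular p t" "t p = 0" using mpow_1_iff[OF p] by auto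
  then show ?thesis using t(2) unfolding local_param_def by (intro exI[of _ t]) simp
qed

lemma local_param_cotangent:
  assumes p: "p \<in> C" and t: "local_param p t" and f: "f \<in> mpow p 1"
  shows "\<exists>c. (\<lambda>z. f z - c * (t z - t p)) \<in> mpow p 2"
proof -
  obtain s where s: "\<forall>f\<in>mpow p 1. \<exists>c. (\<lambda>z. f z - c * s z) \<in> mpow p 2" by (rule cotangent_generator[OF p])
  obtain a where a: "(\<lambda>z. (t z - t p) - a * s z) \<in> mpow p 2" using bspec[OF s local_param_diff[OF p t]] by (rule exE)
  obtain b where b: "(\<lambda>z. f z - b * s z) \<in> mpow p 2" using bspec[OF s f] by (rule exE)
  have "a \<noteq> 0"
  proof
    assume "a = 0"
    then show False using a t unfolding local_param_def by simp
  qed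
  have "(\<lambda>z. (f z - b * s z) - (b / a) * ((t z - t p) - a * s z)) \<in> mpow p 2"
    by (intro mpow_diff mpow_scale p a b)
  moreover have "(\<lambda>z. (f z - b * s z) - (b / a) * ((t z - t p) - a * s z)) = (\<lambda>z. f z - (b / a) * (t z - t p))"
    using \<open>a \<noteq> 0\<close> by (simp add: field_simps)
  ultimately show ?thesis by (intro exI[of _ "b / a"]) simp
qed

text \<open>Up to order 2 each coordinate is a multiple of \<open>t - t p\<close>, and the error is
  a combination of the coordinates with coefficients vanishing at \<open>p\<close>. By elimination
  \<open>t - t p\<close> generates the maximal ideal.\<close>

lemma local_param_coordinates:
  assumes p: "p \<in> C" and t: "local_param p t" and ch: "chart u X" "u \<notin> p" and X: "\<forall>x\<in>X. x p = 0"
  shows "\<exists>b. \<forall>x\<in>X. regular p (b x) \<and> eventually (\<lambda>z. x z = b x z * (t z - t p)) (germs p)"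
proof -
  have fin: "finite X" using ch unfolding chart_def by blast
  have "\<forall>x\<in>X. \<exists>c A. (\<forall>x'\<in>X. A x' \<in> mpow p 1) \<and>
    eventually (\<lambda>z. x z - c * (t z - t p) = (\<Sum>x'\<in>X. A x' z * x' z)) (germs p)"
  proof
    fix x assume "x \<in> X"
    then have "x \<in> mpow p 1" using X chart_regular[OF ch(1) p ch(2)] mpow_1_iff[OF p] by blast
    then obtain c where "(\<lambda>z. x z - c * (t z - t p)) \<in> mpow p (Suc 1)"
      using local_param_cotangent[OF p t, of x] by (auto simp: numeral_2_eq_2)
    from mpow_Suc_generators[OF ch(1) p ch(2) _ this] X
    show "\<exists>c A. (\<forall>x'\<in>X. A x' \<in> mpow p 1) \<and>
      eventually (\<lambda>z. x z - c * (t z - t p) = (\<Sum>x'\<in>X. A x' z * x' z)) (germs p)" by blast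
  qed
  from bchoice[OF this] obtain c where "\<forall>x\<in>X. \<exists>A. (\<forall>x'\<in>X. A x' \<in> mpow p 1) \<and>
    eventually (\<lambda>z. x z - c x * (t z - t p) = (\<Sum>x'\<in>X. A x' z * x' z)) (germs p)" by (rule exE)
  from bchoice[OF this] obtain A where A: "\<forall>x\<in>X. (\<forall>x'\<in>X. A x x' \<in> mpow p 1) \<and>
    eventually (\<lambda>z. x z - c x * (t z - t p) = (\<Sum>x'\<in>X. A x x' z * x' z)) (germs p)" by (rule exE)
  \<comment> \<open>Functions on \<open>unit\<close> stand for single values here. With
    \<open>N q\<close> containing only zero, \<open>elimination\<close> yields an honest equation
    between germs.\<close>
  have "\<exists>\<gamma>. \<forall>x\<in>X. regular p (\<gamma> x) \<and>
    eventually (\<lambda>q. (\<lambda>_::unit. x q - \<gamma> x q * (t q - t p)) \<in> {\<lambda>_. 0}) (germs p)"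
  proof (rule elimination[OF p fin, where \<beta> = "\<lambda>x q. c x" and A = A])
    fix x assume x: "x \<in> X"
    show "regular p (\<lambda>q. c x)" by (rule regular_const[OF p])
    show "eventually (\<lambda>q. (\<lambda>_::unit. x q - c x * (t q - t p) - (\<Sum>j\<in>X. A x j q * j q)) \<in> {\<lambda>_. 0}) (germs p)"
      using A[rule_format, OF x, THEN conjunct2] by eventually_elim simp
    fix y assume "y \<in> X"
    then show "regular p (A x y) \<and> A x y p = 0" using A x mpow_1_iff[OF p] by blast
  qed auto
  then obtain \<gamma> where \<gamma>: "\<forall>x\<in>X. regular p (\<gamma> x) \<and>
    eventually (\<lambda>q. (\<lambda>_::unit. x q - \<gamma> x q * (t q - t p)) \<in> {\<lambda>_. 0}) (germs p)" by (rule exE)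
  show ?thesis
  proof (intro exI[of _ \<gamma>] ballI conjI)
    fix x assume x: "x \<in> X"
    show "eventually (\<lambda>z. x z = \<gamma> x z * (t z - t p)) (germs p)"
      using \<gamma>[rule_format, OF x, THEN conjunct2] by eventually_elim (auto dest: fun_cong)
  qed (use \<gamma> in blast)
qed

text \<open>Each factor from the maximal ideal contributes one factor \<open>t - t p\<close>, since
  that ideal is principal.\<close>

lemma mpow_principal:
  assumes p: "p \<in> C" and t: "local_param p t" and f: "f \<in> mpow p k"
  shows "\<exists>a. regular p a \<and> eventually (\<lambda>z. f z = a z * (t z - t p) ^ k) (germs p)"
  using f
proof (induction k arbitrary: f)
  case 0
  then show ?case using mpow_0_iff[OF p] by (intro exI[of _ f]) auto
next
  case (Suc k)
  obtain u X where ch: "chart u X" "u \<notin> p" and X: "\<And>x. x \<in> X \<Longrightarrow> x p = 0" by (rule chart_exists[OF p], rule that) blast+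
  have X0: "\<forall>x\<in>X. x p = 0" by (rule ballI) (fact X)
  have fin: "finite X" using ch unfolding chart_def by blast
  obtain A where A: "\<forall>x\<in>X. A x \<in> mpow p k" "eventually (\<lambda>z. f z = (\<Sum>x\<in>X. A x z * x z)) (germs p)"
  proof -
    have "\<exists>A. (\<forall>x\<in>X. A x \<in> mpow p k) \<and> eventually (\<lambda>z. f z = (\<Sum>x\<in>X. A x z * x z)) (germs p)"
      by (rule mpow_Suc_generators[OF ch(1) p ch(2) _ Suc.prems]) (fact X)
    then show ?thesis using that by (elim exE conjE)
  qed
  obtain b where b: "\<forall>x\<in>X. regular p (b x) \<and> eventually (\<lambda>z. x z = b x z * (t z - t p)) (germs p)"
    using local_param_coordinates[OF p t ch X0] by (rule exE)
  have "\<forall>x\<in>X. \<exists>a. regular p a \<and> eventually (\<lambda>z. A x z = a z * (t z - t p) ^ k) (germs p)"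
    using A(1) Suc.IH by blast
  from bchoice[OF this] obtain a where a: "\<forall>x\<in>X. regular p (a x) \<and> eventually (\<lambda>z. A x z = a x z * (t z - t p) ^ k) (germs p)"
    by (rule exE)
  have e1: "eventually (\<lambda>z. \<forall>x\<in>X. A x z = a x z * (t z - t p) ^ k) (germs p)"
    by (intro eventually_ball_finite[OF fin]) (use a in blast)
  have e2: "eventually (\<lambda>z. \<forall>x\<in>X. x z = b x z * (t z - t p)) (germs p)"
    by (intro eventually_ball_finite[OF fin]) (use b in blast)
  show ?case
  proof (intro exI[of _ "\<lambda>z. \<Sum>x\<in>X. a x z * b x z"] conjI)
    show "regular p (\<lambda>z. \<Sum>x\<in>X. a x z * b x z)" using a b by (intro regular_sum regular_mult p) auto
    show "eventually (\<lambda>z. f z = (\<Sum>x\<in>X. a x z * b x z) * (t z - t p) ^ Suc k) (germs p)"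
      using A(2) e1 e2
    proof eventually_elim
      case (elim z)
      have "A x z * x z = a x z * b x z * (t z - t p) ^ Suc k" if "x \<in> X" for x
      proof -
        have "A x z = a x z * (t z - t p) ^ k" "x z = b x z * (t z - t p)" using elim that by blast+
        then show ?thesis by (simp only: power_Suc mult_ac)
      qed
      then show ?case unfolding elim(1) sum_distrib_right by (intro sum.cong) auto
    qed
  qed
qed

text \<open>Values lie in a field: if \<open>a\<close> were nonzero near \<open>p\<close>, then
  \<open>t - t p\<close> would vanish near \<open>p\<close> and would lie in every power of the
  maximal ideal.\<close>

lemma local_param_cancel:
  assumes p: "p \<in> C" and t: "local_param p t" and a: "regular p a"
    and ev: "eventually (\<lambda>z. a z * (t z - t p) ^ k = 0) (germs p)"
  shows "a p = 0"
proof (rule ccontr)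
  assume "a p \<noteq> 0"
  from eventually_neq_0[OF p a this] ev have "eventually (\<lambda>z. 0 = t z - t p) (germs p)" by eventually_elim simp
  then have "(\<lambda>z. t z - t p) \<in> mpow p 2" by (rule mpow_cong[OF p mpow_zero[OF p]])
  then show False using t unfolding local_param_def by blast
qed

text \<open>A factor \<open>(t - t p) ^ k\<close> is cancelled from the comparison with a multiple
  of \<open>(t - t p) ^ Suc k\<close>. Expansions in powers of a parameter therefore have
  well-defined leading coefficients.\<close>

lemma local_param_leading:
  assumes p: "p \<in> C" and t: "local_param p t" and a: "regular p a"
    and "(\<lambda>z. a z * (t z - t p) ^ k) \<in> mpow p (Suc k)"
  shows "a p = 0"
proof -
  obtain b where b: "regular p b" "eventually (\<lambda>z. a z * (t z - t p) ^ k = b z * (t z - t p) ^ Suc k) (germs p)"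
    using mpow_principal[OF p t assms(4)] by blast
  have "regular p t" using t unfolding local_param_def by blast
  have "(\<lambda>z. a z - b z * (t z - t p)) p = 0"
  proof (rule local_param_cancel[OF p t, of "\<lambda>z. a z - b z * (t z - t p)" k])
    show "regular p (\<lambda>z. a z - b z * (t z - t p))"
      by (intro regular_diff regular_mult regular_const p a b \<open>regular p t\<close>)
    show "eventually (\<lambda>z. (a z - b z * (t z - t p)) * (t z - t p) ^ k = 0) (germs p)"
      using b(2) by eventually_elim (simp add: algebra_simps)
  qed
  then show ?thesis by simp
qed

lemma mpow_Suc_local_param:
  assumes p: "p \<in> C" and t: "local_param p t" and a: "regular p a" "a p = 0"
  shows "(\<lambda>z. a z * (t z - t p) ^ k) \<in> mpow p (Suc k)"
proof -
  have "(\<lambda>z. (t z - t p) ^ k) \<in> mpow p k"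
    using t unfolding local_param_def by (intro mpow_power p regular_diff regular_const) auto
  then show ?thesis using mpow_mult[OF p, of a 1 "\<lambda>z. (t z - t p) ^ k" k] a mpow_1_iff[OF p] by simp
qed

text \<open>Dividing \<open>f\<close> by ever higher powers of \<open>t\<close> gives a sequence in
  which each term is \<open>t\<close> times the next. By the noetherian property one term is a
  combination of its predecessors, hence \<open>t\<close> times a multiple of itself, and such a
  germ is zero.\<close>

lemma krull_intersection:
  assumes p: "p \<in> C" and f: "\<And>k. f \<in> mpow p k"
  shows "eventually (\<lambda>z. f z = 0) (germs p)"
proof -
  obtain t where t: "local_param p t" "t p = 0" using local_param_exists[OF p] by blast
  have tr: "regular p t" using t unfolding local_param_def by blast
  obtain u X where ch: "chart u X" "u \<notin> p" by (rule chart_exists[OF p], rule that) blast+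
  have fin: "finite X" using ch unfolding chart_def by blast
  have "\<forall>k. \<exists>a. regular p a \<and> eventually (\<lambda>z. f z = a z * t z ^ Suc k) (germs p)"
    using mpow_principal[OF p t(1) f] unfolding t(2) diff_zero by (rule allI)
  from choice[OF this] obtain g where g: "\<forall>k. regular p (g k) \<and> eventually (\<lambda>z. f z = g k z * t z ^ Suc k) (germs p)"
    by (rule exE)
  \<comment> \<open>The equations for \<open>f\<close> determine \<open>g k\<close> only where
    \<open>t\<close> is nonzero. After multiplication by \<open>t\<close> the relation between
    consecutive terms holds everywhere near \<open>p\<close>.\<close>
  define y where "y k = (\<lambda>z. t z * g k z)" for k
  have yr: "regular p (y k)" for k unfolding y_def using g tr by (intro regular_mult p) auto
  have step: "eventually (\<lambda>z. y k z = t z * y (Suc k) z) (germs p)" for k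
  proof -
    have "eventually (\<lambda>z. f z = g k z * t z ^ Suc k) (germs p)" "eventually (\<lambda>z. f z = g (Suc k) z * t z ^ Suc (Suc k)) (germs p)"
      using g by blast+
    then show ?thesis
    proof eventually_elim
      case (elim z)
      then have "t z = 0 \<or> g k z = t z * g (Suc k) z" by (auto simp: mult_ac)
      then show ?case unfolding y_def by auto
    qed
  qed
  have "\<forall>k. \<exists>s r. s \<in> polyalg X \<and> r \<in> polyalg X \<and> r p \<noteq> 0 \<and> eventually (\<lambda>z. r z \<noteq> 0 \<and> y k z = s z / r z) (germs p)"
    by (intro allI, rule chart_fraction[OF ch(1) p ch(2) yr], intro exI conjI)
  from choice[OF this] obtain s where "\<forall>k. \<exists>r. s k \<in> polyalg X \<and> r \<in> polyalg X \<and> r p \<noteq> 0 \<and> eventually (\<lambda>z. r z \<noteq> 0 \<and> y k z = s k z / r z) (germs p)"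
    by (rule exE)
  from choice[OF this] obtain r where sr: "\<forall>k. s k \<in> polyalg X \<and> r k \<in> polyalg X \<and> r k p \<noteq> 0 \<and> eventually (\<lambda>z. r k z \<noteq> 0 \<and> y k z = s k z / r k z) (germs p)"
    by (rule exE)
  \<comment> \<open>The chart algebra, rather than the local ring, is known to be noetherian, so the
    property is applied to the numerators \<open>s k\<close>.\<close>
  obtain n where n: "s n \<in> seq_ideal (polyalg X) s n"
    using noetherian_polyalg[OF fin] sr unfolding noetherian_def by blast
  then obtain a where a: "\<forall>k<n. a k \<in> polyalg X" "s n = (\<lambda>z. \<Sum>k<n. a k z * s k z)" unfolding seq_ideal_def by blast
  have reg: "regular p h" if "h \<in> polyalg X" for h
    using polyalg_regular[OF p _ that] chart_regular[OF ch(1) p ch(2)] by blast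
  have ev1: "eventually (\<lambda>z. \<forall>k\<in>{..<n}. y k z = t z * y (Suc k) z) (germs p)"
    by (intro eventually_ball_finite) (use step in auto)
  have ev2: "eventually (\<lambda>z. \<forall>k\<in>{..n}. r k z \<noteq> 0 \<and> y k z = s k z / r k z) (germs p)"
    by (intro eventually_ball_finite) (use sr in auto)
  have yk: "y k z = t z ^ (n - k) * y n z" if "\<forall>k\<in>{..<n}. y k z = t z * y (Suc k) z" "k \<le> n" for k z
    using that(2)
  proof (induction k rule: inc_induct)
    case (step m)
    then have "n - m = Suc (n - Suc m)" by simp
    then show ?case using step that(1) by simp
  qed simp
  \<comment> \<open>Collects the relation between the numerators as a multiple of
    \<open>y n\<close>. All subtracted terms contain a positive power of \<open>t\<close>, so
    \<open>b p = r n p\<close> is nonzero and \<open>b\<close> can be cancelled.\<close>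
  define b where "b = (\<lambda>z. r n z - (\<Sum>k<n. a k z * r k z * t z ^ (n - k)))"
  have br: "regular p b" unfolding b_def using a(1) sr tr reg
    by (intro regular_diff regular_sum regular_mult regular_power p) auto
  have "b p = r n p" unfolding b_def using t(2) by (simp add: power_0_left)
  then have "b p \<noteq> 0" using sr by simp
  from eventually_neq_0[OF p br this] ev1 ev2 g[rule_format, of 0, THEN conjunct2] show ?thesis
  proof eventually_elim
    case (elim z)
    have rn: "r k z * y k z = s k z" if "k \<le> n" for k using elim(3) that by auto
    have "r n z * y n z = (\<Sum>k<n. a k z * s k z)" using rn[of n] a(2) by simp
    also have "\<dots> = (\<Sum>k<n. a k z * r k z * t z ^ (n - k)) * y n z"
      unfolding sum_distrib_right
    proof (rule sum.cong)
      fix k assume "k \<in> {..<n}"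
      then have "s k z = r k z * (t z ^ (n - k) * y n z)" using rn[of k] yk[OF elim(2), of k] by simp
      then show "a k z * s k z = a k z * r k z * t z ^ (n - k) * y n z" by simp
    qed simp
    finally have "b z * y n z = 0" unfolding b_def by (simp add: algebra_simps)
    then have "y n z = 0" using elim(1) by simp
    then have "y 0 z = 0" using yk[OF elim(2), of 0] by simp
    then show ?case using elim(4) unfolding y_def by auto
  qed
qed

text \<open>In the coordinates \<open>X\<close> every differential is a combination of the
  differentials of \<open>X\<close>. It suffices that near \<open>p\<close> each of these is a
  multiple of that of \<open>t\<close>, with a coefficient depending regularly on the point.\<close>

lemma eventually_local_param:
  assumes p: "p \<in> C" and t: "local_param p t"
  shows "eventually (\<lambda>q. local_param q t) (germs p)"
    and "regular p f \<Longrightarrow> \<exists>f'. regular p f' \<and> eventually (\<lambda>q. (\<lambda>z. f z - f q - f' q * (t z - t q)) \<in> mpow q 2) (germs p)"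
proof -
  have tr: "regular p t" using t unfolding local_param_def by blast
  obtain u X where ch: "chart u X" "u \<notin> p" and X: "\<And>x. x \<in> X \<Longrightarrow> x p = 0" by (rule chart_exists[OF p], rule that) blast+
  have X0: "\<forall>x\<in>X. x p = 0" by (rule ballI) (fact X)
  have fin: "finite X" and u: "u \<in> M" using ch unfolding chart_def by auto
  obtain b where b: "\<forall>x\<in>X. regular p (b x) \<and> eventually (\<lambda>z. x z = b x z * (t z - t p)) (germs p)"
    using local_param_coordinates[OF p t ch X0] by (rule exE)
  have "\<forall>x\<in>X. \<exists>c. (\<forall>x'\<in>X. regular p (c x')) \<and>
    eventually (\<lambda>q. (\<lambda>z. b x z - b x q - (\<Sum>x'\<in>X. c x' q * (x' z - x' q))) \<in> mpow q 2) (germs p)"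
  proof
    fix x assume "x \<in> X"
    then have "regular p (b x)" using b by blast
    then show "\<exists>c. (\<forall>x'\<in>X. regular p (c x')) \<and>
      eventually (\<lambda>q. (\<lambda>z. b x z - b x q - (\<Sum>x'\<in>X. c x' q * (x' z - x' q))) \<in> mpow q 2) (germs p)"
      by (rule chart_taylor[OF ch(1) p ch(2)], intro exI conjI ballI)
  qed
  from bchoice[OF this] obtain B where B: "\<forall>x\<in>X. (\<forall>x'\<in>X. regular p (B x x')) \<and>
    eventually (\<lambda>q. (\<lambda>z. b x z - b x q - (\<Sum>x'\<in>X. B x x' q * (x' z - x' q))) \<in> mpow q 2) (germs p)" by (rule exE)
  \<comment> \<open>The product rule for \<open>x = b x * (t - t p)\<close> at a moving point
    \<open>q\<close> expresses the differential of \<open>x\<close> by that of \<open>t\<close> and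
    those of the other coordinates. The latter enter with factors \<open>t q - t p\<close>, which
    vanish at \<open>q = p\<close>, as \<open>elimination\<close> demands.\<close>
  have "\<exists>\<gamma>. \<forall>x\<in>X. regular p (\<gamma> x) \<and>
    eventually (\<lambda>q. (\<lambda>z. (x z - x q) - \<gamma> x q * (t z - t q)) \<in> mpow q 2) (germs p)"
  proof (rule elimination[OF p fin, where \<beta> = b and A = "\<lambda>x x' q. (t q - t p) * B x x' q"])
    fix x assume x: "x \<in> X"
    show "regular p (b x)" using b x by blast
    have b': "regular p (b x)" "eventually (\<lambda>z. x z = b x z * (t z - t p)) (germs p)" using b x by auto
    have B': "eventually (\<lambda>q. (\<lambda>z. b x z - b x q - (\<Sum>x'\<in>X. B x x' q * (x' z - x' q))) \<in> mpow q 2) (germs p)" using B x by blast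
    show "eventually (\<lambda>q. (\<lambda>z. (x z - x q) - b x q * (t z - t q) - (\<Sum>j\<in>X. (t q - t p) * B x j q * (j z - j q))) \<in> mpow q 2) (germs p)"
      using eventually_eventually[OF p b'(2)] B' eventually_in[OF p] eventually_regular[OF p b'(1)] eventually_regular[OF p tr]
    proof eventually_elim
      case (elim q)
      have xq: "x q = b x q * (t q - t p)" by (rule eventually_self[OF elim(3,1)])
      have "(\<lambda>z. (t z - t q) * (b x z - b x q)) \<in> mpow q (1 + 1)"
        by (intro mpow_mult mpow_1_iff[THEN iffD2] conjI regular_diff regular_const elim) auto
      then have m: "(\<lambda>z. (t z - t q) * (b x z - b x q)) \<in> mpow q 2" by (simp only: one_add_one)
      show ?case
      proof (rule mpow_cong[OF elim(3) mpow_add[OF elim(3) m mpow_scale[OF elim(3,2), of "t q - t p"]]])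
        show "eventually (\<lambda>z. (t z - t q) * (b x z - b x q) + (t q - t p) * (b x z - b x q - (\<Sum>x'\<in>X. B x x' q * (x' z - x' q)))
          = (x z - x q) - b x q * (t z - t q) - (\<Sum>j\<in>X. (t q - t p) * B x j q * (j z - j q))) (germs q)"
          using elim(1)
        proof eventually_elim
          case (elim z)
          have "(\<Sum>j\<in>X. (t q - t p) * B x j q * (j z - j q)) = (t q - t p) * (\<Sum>x'\<in>X. B x x' q * (x' z - x' q))"
            by (simp add: sum_distrib_left mult.assoc)
          then show ?case using elim xq by algebra
        qed
      qed
    qed
    fix x' assume "x' \<in> X"
    then show "regular p (\<lambda>q. (t q - t p) * B x x' q) \<and> (t p - t p) * B x x' p = 0"
      using B x by (auto intro!: regular_mult regular_diff regular_const p tr)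
  qed (auto intro: mpow_zero mpow_add mpow_scale)
  then obtain \<gamma> where \<gamma>: "\<forall>x\<in>X. regular p (\<gamma> x) \<and>
    eventually (\<lambda>q. (\<lambda>z. (x z - x q) - \<gamma> x q * (t z - t q)) \<in> mpow q 2) (germs p)" by (rule exE)
  have ev: "eventually (\<lambda>q. \<forall>x\<in>X. (\<lambda>z. (x z - x q) - \<gamma> x q * (t z - t q)) \<in> mpow q 2) (germs p)"
    by (intro eventually_ball_finite fin) (use \<gamma> in blast)
  \<comment> \<open>The chain rule: the coefficients \<open>c\<close> of a linear part in the
    coordinates are combined with the derivatives \<open>\<gamma>\<close> of the
    coordinates.\<close>
  have key: "(\<lambda>z. f z - f q - (\<Sum>x\<in>X. c x * \<gamma> x q) * (t z - t q)) \<in> mpow q 2"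
    if q: "q \<in> C" and f: "(\<lambda>z. f z - f q - (\<Sum>x\<in>X. c x * (x z - x q))) \<in> mpow q 2"
      and x: "\<forall>x\<in>X. (\<lambda>z. (x z - x q) - \<gamma> x q * (t z - t q)) \<in> mpow q 2" for f c q
  proof -
    have "(\<lambda>z. (f z - f q - (\<Sum>x\<in>X. c x * (x z - x q))) + (\<Sum>x\<in>X. c x * ((x z - x q) - \<gamma> x q * (t z - t q)))) \<in> mpow q 2"
      by (intro mpow_add mpow_sum mpow_scale q f) (use x in blast)
    moreover have "(f z - f q - (\<Sum>x\<in>X. c x * (x z - x q))) + (\<Sum>x\<in>X. c x * ((x z - x q) - \<gamma> x q * (t z - t q))) =
      f z - f q - (\<Sum>x\<in>X. c x * \<gamma> x q) * (t z - t q)" for z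
    proof -
      have "(\<Sum>x\<in>X. c x * ((x z - x q) - \<gamma> x q * (t z - t q))) =
        (\<Sum>x\<in>X. c x * (x z - x q)) - (\<Sum>x\<in>X. c x * \<gamma> x q) * (t z - t q)"
        unfolding sum_distrib_right sum_subtractf[symmetric] by (intro sum.cong) (auto simp: algebra_simps)
      then show ?thesis by simp
    qed
    ultimately show ?thesis by (simp only:)
  qed
  show "eventually (\<lambda>q. local_param q t) (germs p)"
    using ev eventually_in[OF p] eventually_notin[OF p u ch(2)] eventually_regular[OF p tr]
  proof eventually_elim
    case (elim q)
    \<comment> \<open>If the differential of \<open>t\<close> vanished at \<open>q\<close>, so would
      all differentials there, but smoothness provides a nonzero one.\<close>
    have "(\<lambda>z. t z - t q) \<notin> mpow q 2"
    proof
      assume *: "(\<lambda>z. t z - t q) \<in> mpow q 2"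
      obtain s where s: "s \<in> mpow q 1" "s \<notin> mpow q 2" using cotangent_generator[OF elim(2)] by blast
      then have sr: "regular q s" "s q = 0" using mpow_1_iff[OF elim(2)] by auto
      obtain c where c: "eventually (\<lambda>q. (\<lambda>z. s z - s q - (\<Sum>x\<in>X. c x q * (x z - x q))) \<in> mpow q 2) (germs q)"
        by (rule chart_taylor[OF ch(1) elim(2,3) sr(1)])
      have "(\<lambda>z. s z - s q - (\<Sum>x\<in>X. c x q * \<gamma> x q) * (t z - t q)) \<in> mpow q 2"
        by (rule key[OF elim(2) eventually_self[OF elim(2) c] elim(1)])
      from mpow_add[OF elim(2) this mpow_scale[OF elim(2) *, of "\<Sum>x\<in>X. c x q * \<gamma> x q"]]
      have "s \<in> mpow q 2" using sr(2) by simp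
      then show False using s(2) by blast
    qed
    then show ?case unfolding local_param_def using elim(4) by blast
  qed
  assume f: "regular p f"
  obtain c where c: "\<And>x. x \<in> X \<Longrightarrow> regular p (c x)"
    "eventually (\<lambda>q. (\<lambda>z. f z - f q - (\<Sum>x\<in>X. c x q * (x z - x q))) \<in> mpow q 2) (germs p)"
    by (rule chart_taylor[OF ch(1) p ch(2) f], rule that) blast+
  show "\<exists>f'. regular p f' \<and> eventually (\<lambda>q. (\<lambda>z. f z - f q - f' q * (t z - t q)) \<in> mpow q 2) (germs p)"
  proof (intro exI[of _ "\<lambda>q. \<Sum>x\<in>X. c x q * \<gamma> x q"] conjI)
    show "regular p (\<lambda>q. \<Sum>x\<in>X. c x q * \<gamma> x q)" using c(1) \<gamma> by (intro regular_sum regular_mult p) auto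
    show "eventually (\<lambda>q. (\<lambda>z. f z - f q - (\<Sum>x\<in>X. c x q * \<gamma> x q) * (t z - t q)) \<in> mpow q 2) (germs p)"
      using c(2) ev eventually_in[OF p] by eventually_elim (rule key)
  qed
qed

text \<open>The linear approximation is required at all points near \<open>p\<close>, not only at
  \<open>p\<close>; this makes \<open>f'\<close> a function that can be differentiated
  again.\<close>

definition derivative :: "'x point \<Rightarrow> ('x point \<Rightarrow> complex) \<Rightarrow> ('x point \<Rightarrow> complex) \<Rightarrow> ('x point \<Rightarrow> complex) \<Rightarrow> bool"
  where "derivative p t f f' \<longleftrightarrow> regular p f \<and> regular p f' \<and>
    eventually (\<lambda>q. (\<lambda>z. f z - f q - f' q * (t z - t q)) \<in> mpow q 2) (germs p)"

lemma derivative_exists: "p \<in> C \<Longrightarrow> local_param p t \<Longrightarrow> regular p f \<Longrightarrow> \<exists>f'. derivative p t f f'"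
  unfolding derivative_def using eventually_local_param(2) by blast

lemma derivative_at:
  assumes "p \<in> C" "derivative p t f f'" shows "(\<lambda>z. f z - f p - f' p * (t z - t p)) \<in> mpow p 2"
proof -
  have "eventually (\<lambda>q. (\<lambda>z. f z - f q - f' q * (t z - t q)) \<in> mpow q 2) (germs p)"
    using assms(2) unfolding derivative_def by blast
  from eventually_self[OF assms(1) this] show ?thesis .
qed

lemma eventually_derivative:
  assumes p: "p \<in> C" and "derivative p t f f'" shows "eventually (\<lambda>q. derivative q t f f') (germs p)"
proof -
  have *: "regular p f" "regular p f'" "eventually (\<lambda>q. (\<lambda>z. f z - f q - f' q * (t z - t q)) \<in> mpow q 2) (germs p)"
    using assms(2) unfolding derivative_def by auto
  show ?thesis using eventually_regular[OF p *(1)] eventually_regular[OF p *(2)] eventually_eventually[OF p *(3)]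
    by eventually_elim (simp add: derivative_def)
qed

lemma derivative_const: "p \<in> C \<Longrightarrow> derivative p t (\<lambda>z. c) (\<lambda>z. 0)"
  unfolding derivative_def using eventually_in[of p]
  by (auto intro!: regular_const mpow_zero elim: eventually_mono)

lemma derivative_self: "p \<in> C \<Longrightarrow> regular p t \<Longrightarrow> derivative p t t (\<lambda>z. 1)"
  unfolding derivative_def using eventually_in[of p]
  by (auto intro!: regular_const mpow_zero elim: eventually_mono)

lemma derivative_add:
  assumes p: "p \<in> C" and "derivative p t f f'" "derivative p t g g'"
  shows "derivative p t (\<lambda>z. f z + g z) (\<lambda>z. f' z + g' z)"
proof -
  have f: "regular p f" "regular p f'" "eventually (\<lambda>q. (\<lambda>z. f z - f q - f' q * (t z - t q)) \<in> mpow q 2) (germs p)"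
    using assms(2) unfolding derivative_def by auto
  have g: "regular p g" "regular p g'" "eventually (\<lambda>q. (\<lambda>z. g z - g q - g' q * (t z - t q)) \<in> mpow q 2) (germs p)"
    using assms(3) unfolding derivative_def by auto
  have "eventually (\<lambda>q. (\<lambda>z. f z + g z - (f q + g q) - (f' q + g' q) * (t z - t q)) \<in> mpow q 2) (germs p)"
    using f(3) g(3) eventually_in[OF p]
  proof eventually_elim
    case (elim q)
    have "(\<lambda>z. f z + g z - (f q + g q) - (f' q + g' q) * (t z - t q)) =
      (\<lambda>z. (f z - f q - f' q * (t z - t q)) + (g z - g q - g' q * (t z - t q)))" by (simp add: algebra_simps)
    then show ?case using mpow_add[OF elim(3,1,2)] by (simp only:)
  qed
  then show ?thesis unfolding derivative_def using f g by (auto intro: regular_add p)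
qed

lemma derivative_mult:
  assumes p: "p \<in> C" and "derivative p t f f'" "derivative p t g g'"
  shows "derivative p t (\<lambda>z. f z * g z) (\<lambda>z. f' z * g z + f z * g' z)"
proof -
  have f: "regular p f" "regular p f'" "eventually (\<lambda>q. (\<lambda>z. f z - f q - f' q * (t z - t q)) \<in> mpow q 2) (germs p)"
    using assms(2) unfolding derivative_def by auto
  have g: "regular p g" "regular p g'" "eventually (\<lambda>q. (\<lambda>z. g z - g q - g' q * (t z - t q)) \<in> mpow q 2) (germs p)"
    using assms(3) unfolding derivative_def by auto
  have "eventually (\<lambda>q. (\<lambda>z. f z * g z - f q * g q - (f' q * g q + f q * g' q) * (t z - t q)) \<in> mpow q 2) (germs p)"
    using f(3) g(3) eventually_in[OF p] eventually_regular[OF p f(1)] eventually_regular[OF p g(1)]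
  proof eventually_elim
    case (elim q)
    have "(\<lambda>z. (f z - f q) * (g z - g q)) \<in> mpow q (1 + 1)"
      by (intro mpow_mult mpow_1_iff[THEN iffD2] conjI regular_diff regular_const elim) auto
    then have m: "(\<lambda>z. (f z - f q) * (g z - g q)) \<in> mpow q 2" by (simp only: one_add_one)
    have "(\<lambda>z. f z * g z - f q * g q - (f' q * g q + f q * g' q) * (t z - t q)) =
      (\<lambda>z. (f z - f q) * (g z - g q) + (g q * (f z - f q - f' q * (t z - t q)) + f q * (g z - g q - g' q * (t z - t q))))"
      by (simp add: algebra_simps)
    then show ?case
      using mpow_add[OF elim(3) m mpow_add[OF elim(3) mpow_scale[OF elim(3,1), of "g q"] mpow_scale[OF elim(3,2), of "f q"]]]
      by (simp only:)
  qed
  then show ?thesis unfolding derivative_def using f g by (auto intro!: regular_add regular_mult p)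
qed

lemma derivative_power:
  assumes p: "p \<in> C" and t: "regular p t"
  shows "derivative p t (\<lambda>z. (t z - c) ^ Suc k) (\<lambda>z. of_nat (Suc k) * (t z - c) ^ k)"
proof (induction k)
  case 0
  show ?case using derivative_add[OF p derivative_self[OF p t] derivative_const[OF p, of t "- c"]] by simp
next
  case (Suc k)
  have "derivative p t (\<lambda>z. t z - c) (\<lambda>z. 1)"
    using derivative_add[OF p derivative_self[OF p t] derivative_const[OF p, of t "- c"]] by simp
  from derivative_mult[OF p this Suc.IH] show ?case by (simp add: algebra_simps)
qed

text \<open>At a nearby \<open>q\<close> the two approximations differ by
  \<open>(f1 q - f2 q) * (t - t q)\<close>, which has order 2 only if the factor is zero, because
  \<open>t\<close> is still a parameter at \<open>q\<close>.\<close>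

lemma derivative_unique:
  assumes p: "p \<in> C" and t: "local_param p t" and "derivative p t f f1" "derivative p t g f2"
    and eq: "eventually (\<lambda>z. f z = g z) (germs p)"
  shows "eventually (\<lambda>z. f1 z = f2 z) (germs p)"
proof -
  have f: "eventually (\<lambda>q. (\<lambda>z. f z - f q - f1 q * (t z - t q)) \<in> mpow q 2) (germs p)"
    using assms(3) unfolding derivative_def by auto
  have g: "eventually (\<lambda>q. (\<lambda>z. g z - g q - f2 q * (t z - t q)) \<in> mpow q 2) (germs p)"
    using assms(4) unfolding derivative_def by auto
  show ?thesis using f g eventually_local_param(1)[OF p t] eventually_in[OF p] eventually_eventually[OF p eq]
  proof eventually_elim
    case (elim q)
    show "f1 q = f2 q"
    proof (rule ccontr)
      assume ne: "f1 q \<noteq> f2 q"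
      have "(\<lambda>z. inverse (f1 q - f2 q) * ((g z - g q - f2 q * (t z - t q)) - (f z - f q - f1 q * (t z - t q)))) \<in> mpow q 2"
        by (intro mpow_scale mpow_diff elim)
      then have "(\<lambda>z. t z - t q) \<in> mpow q 2"
      proof (rule mpow_cong[OF elim(4)])
        have gq: "f q = g q" by (rule eventually_self[OF elim(4,5)])
        show "eventually (\<lambda>z. inverse (f1 q - f2 q) * ((g z - g q - f2 q * (t z - t q)) - (f z - f q - f1 q * (t z - t q))) = t z - t q) (germs q)"
          using elim(5)
        proof eventually_elim
          case (elim z)
          have "inverse (f1 q - f2 q) * (f1 q - f2 q) = 1" using ne by simp
          then show ?case using gq elim by algebra
        qed
      qed
      then show False using elim(3) unfolding local_param_def by blast
    qed
  qed
qed

text \<open>Characteristic zero enters here: the derivative of \<open>a * (t - t p) ^ k\<close> starts with \<open>k * a p\<close>.\<close>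

lemma derivative_zero_imp_const:
  assumes p: "p \<in> C" and t: "local_param p t" and d: "derivative p t f f'"
    and zero: "eventually (\<lambda>z. f' z = 0) (germs p)"
  shows "eventually (\<lambda>z. f z = f p) (germs p)"
proof -
  have tr: "regular p t" using t unfolding local_param_def by blast
  have fr: "regular p f" using d unfolding derivative_def by blast
  \<comment> \<open>The order of vanishing is raised step by step: differentiating the expansion of
    order \<open>k + 1\<close> and cancelling \<open>(t - t p) ^ k\<close> shows that its leading
    coefficient is zero.\<close>
  have "(\<lambda>z. f z - f p) \<in> mpow p (Suc k)" for k
  proof (induction k)
    case 0
    show ?case using mpow_1_diffI[OF p fr] by simp
  next
    case (Suc k)
    obtain a where a: "regular p a" "eventually (\<lambda>z. f z - f p = a z * (t z - t p) ^ Suc k) (germs p)"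
      using mpow_principal[OF p t Suc.IH] by blast
    obtain a' where a': "derivative p t a a'" using derivative_exists[OF p t a(1)] by blast
    then have a'r: "regular p a'" unfolding derivative_def by blast
    have "derivative p t (\<lambda>z. f z + - f p) (\<lambda>z. f' z + 0)" by (rule derivative_add[OF p d derivative_const[OF p]])
    then have d1: "derivative p t (\<lambda>z. f z - f p) f'" by simp
    have "eventually (\<lambda>z. f' z = a' z * (t z - t p) ^ Suc k + a z * (of_nat (Suc k) * (t z - t p) ^ k)) (germs p)"
      by (rule derivative_unique[OF p t d1 derivative_mult[OF p a' derivative_power[OF p tr]] a(2)])
    with zero have "eventually (\<lambda>z. (a' z * (t z - t p) + of_nat (Suc k) * a z) * (t z - t p) ^ k = 0) (germs p)"
      by eventually_elim (simp add: algebra_simps)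
    then have "(\<lambda>z. a' z * (t z - t p) + of_nat (Suc k) * a z) p = 0"
      by (intro local_param_cancel[OF p t, of "\<lambda>z. a' z * (t z - t p) + of_nat (Suc k) * a z" k])
        (auto intro!: regular_add regular_mult regular_diff regular_const p a a'r tr)
    then have "a p = 0" by (simp del: of_nat_Suc)
    from mpow_Suc_local_param[OF p t a(1) this, of "Suc k"]
    show ?case by (rule mpow_cong[OF p]) (use a(2) in eventually_elim, simp)
  qed
  then have "(\<lambda>z. f z - f p) \<in> mpow p k" for k using mpow_Suc_subset[OF p, of k] by blast
  from krull_intersection[OF p this] show ?thesis by eventually_elim simp
qed

text \<open>Two divisions by \<open>t - t p\<close> give
  \<open>f = f p + a p * (t - t p) + b * (t - t p) ^ 2\<close>. Differentiation of this shows
  \<open>f' p = a p\<close> and \<open>f'' p = 2 * b p\<close>, whence the factor 1/2.\<close>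

lemma taylor_2_at:
  assumes p: "p \<in> C" and t: "local_param p t" and f': "derivative p t f f'" and f'': "derivative p t f' f''"
  shows "(\<lambda>z. f z - f p - f' p * (t z - t p) - f'' p / 2 * (t z - t p) ^ 2) \<in> mpow p 3"
proof -
  have tr: "regular p t" using t unfolding local_param_def by blast
  have fr: "regular p f" using f' unfolding derivative_def by blast
  have "(\<lambda>z. f z - f p) \<in> mpow p 1" using mpow_1_diffI[OF p fr] by simp
  from mpow_principal[OF p t this] obtain a where a: "regular p a" "eventually (\<lambda>z. f z - f p = a z * (t z - t p)) (germs p)"
    by auto
  have "(\<lambda>z. a z - a p) \<in> mpow p 1" using mpow_1_diffI[OF p a(1)] by simp
  from mpow_principal[OF p t this] obtain b where b: "regular p b" "eventually (\<lambda>z. a z - a p = b z * (t z - t p)) (germs p)"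
    by auto
  obtain b' where b': "derivative p t b b'" using derivative_exists[OF p t b(1)] by blast
  then have b'r: "regular p b'" unfolding derivative_def by blast
  have fe: "eventually (\<lambda>z. f z = (f p + a p * (t z - t p) ^ Suc 0) + b z * (t z - t p) ^ Suc 1) (germs p)"
    using a(2) b(2)
  proof eventually_elim
    case (elim z)
    then have "f z = f p + a z * (t z - t p)" "a z = a p + b z * (t z - t p)" by (simp_all add: algebra_simps)
    then show ?case by (simp add: algebra_simps)
  qed
  have "derivative p t (\<lambda>z. (f p + a p * (t z - t p) ^ Suc 0) + b z * (t z - t p) ^ Suc 1)
    (\<lambda>z. (0 + (0 * (t z - t p) ^ Suc 0 + a p * (of_nat (Suc 0) * (t z - t p) ^ 0))) +
      (b' z * (t z - t p) ^ Suc 1 + b z * (of_nat (Suc 1) * (t z - t p) ^ 1)))"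
    by (intro derivative_add derivative_mult derivative_const derivative_power b' p tr)
  from derivative_unique[OF p t f' this fe]
  have f'e: "eventually (\<lambda>z. f' z = a p + (b' z * (t z - t p) ^ 2 + b z * (2 * (t z - t p)))) (germs p)"
    by eventually_elim (simp add: power2_eq_square)
  have f'p: "f' p = a p" using eventually_self[OF p f'e] by simp
  \<comment> \<open>Two expressions for \<open>f'\<close> up to order 2 are compared: the linear
    approximation defining \<open>f''\<close> and the derivative of the expansion.\<close>
  have "(\<lambda>z. (2 * b z - f'' p) * (t z - t p) ^ 1) \<in> mpow p (Suc 1)"
  proof (rule mpow_cong[OF p])
    have "(\<lambda>z. b' z * (t z - t p) ^ 2) \<in> mpow p 2"
      by (intro mpow_regular_mult mpow_power p b'r regular_diff regular_const tr) simp
    from mpow_diff[OF p derivative_at[OF p f''] this]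
    show "(\<lambda>z. f' z - f' p - f'' p * (t z - t p) - b' z * (t z - t p) ^ 2) \<in> mpow p (Suc 1)"
      by (simp add: numeral_2_eq_2)
    show "eventually (\<lambda>z. f' z - f' p - f'' p * (t z - t p) - b' z * (t z - t p) ^ 2 = (2 * b z - f'' p) * (t z - t p) ^ 1) (germs p)"
      using f'e by eventually_elim (simp add: f'p algebra_simps)
  qed
  then have "(\<lambda>z. 2 * b z - f'' p) p = 0"
    by (intro local_param_leading[OF p t, of "\<lambda>z. 2 * b z - f'' p" 1]) (auto intro!: regular_diff regular_mult regular_const p b)
  then have bp: "b p = f'' p / 2" by (simp add: field_simps)
  have "(\<lambda>z. (b z - b p) * (t z - t p) ^ 2) \<in> mpow p (Suc 2)"
    by (rule mpow_Suc_local_param[OF p t]) (auto intro!: regular_diff regular_const p b(1))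
  then have "(\<lambda>z. (b z - b p) * (t z - t p) ^ 2) \<in> mpow p 3" by (simp add: numeral_3_eq_3)
  then show ?thesis
  proof (rule mpow_cong[OF p])
    show "eventually (\<lambda>z. (b z - b p) * (t z - t p) ^ 2 = f z - f p - f' p * (t z - t p) - f'' p / 2 * (t z - t p) ^ 2) (germs p)"
      using fe by eventually_elim (simp add: f'p bp algebra_simps power2_eq_square)
  qed
qed

end

section \<open>Linear systems embedding a curve\<close>

locale embedded_curve = smooth_curve M C for M :: "('x \<Rightarrow> complex) set" and C :: "'x point set" +
  fixes A :: "'x frames" and V :: "('x point \<Rightarrow> complex) set"
  assumes embedding: "embedding_system M C A V"
begin

abbreviation \<phi> :: "'x point \<Rightarrow> 'x point point"
  where "\<phi> \<equiv> linsys_map V"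

lemma fin_dim_V: "fin_dim V"
  using embedding unfolding embedding_system_def by blast

lemma subspace_V: "cfun.subspace V"
  using fin_dim_V by (rule fin_dim_imp_subspace)

lemma section_outside: "v \<in> V \<Longrightarrow> p \<notin> C \<Longrightarrow> v p = 0"
  using embedding unfolding embedding_system_def global_sections_def by blast

lemma closed_image: "closedin (zariski V) (\<phi> ` C)"
  and morphism_\<phi>: "morphism M C V (\<phi> ` C) \<phi>"
  and inverse_exists: "\<exists>g. morphism V (\<phi> ` C) M C g \<and> (\<forall>y\<in>C. g (\<phi> y) = y)"
  using embedding unfolding embedding_system_def closed_embedding_def isomorphism_def by auto

lemma image_subset: "\<phi> ` C \<subseteq> Proj V"
  using closedin_subset[OF closed_image] by simp

sublocale E: quasiproj V "\<phi> ` C"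
  by unfold_locales (fact fin_dim_V, fact image_subset)

text \<open>The inverse of \<open>\<phi>\<close> on its image; it transports germs on
  \<open>C\<close> to germs on the embedded curve.\<close>

definition \<psi> :: "'x point point \<Rightarrow> 'x point"
  where "\<psi> = (SOME g. morphism V (\<phi> ` C) M C g \<and> (\<forall>y\<in>C. g (\<phi> y) = y))"

lemma morphism_\<psi>: "morphism V (\<phi> ` C) M C \<psi>" and \<psi>_\<phi>: "y \<in> C \<Longrightarrow> \<psi> (\<phi> y) = y"
  using someI_ex[OF inverse_exists] unfolding \<psi>_def by auto

lemma inj_\<phi>: "p \<in> C \<Longrightarrow> q \<in> C \<Longrightarrow> \<phi> p = \<phi> q \<Longrightarrow> p = q"
  using \<psi>_\<phi> by metis

lemma not_mem_\<phi>: "u \<in> V \<Longrightarrow> u \<notin> \<phi> p \<longleftrightarrow> u p \<noteq> 0"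
  unfolding linsys_map_def by simp

lemma section_nonzero: "p \<in> C \<Longrightarrow> \<exists>v\<in>V. v p \<noteq> 0"
  using Proj_proper[of "\<phi> p" V] image_subset not_mem_\<phi>[of _ p] by blast

text \<open>Evaluation at \<open>p\<close> is the natural choice of homogeneous coordinates of
  \<open>\<phi> p\<close>. With it, quotients of linear forms on the image become quotients of
  sections.\<close>

lemma functional_eval: "p \<in> C \<Longrightarrow> functional_of V (\<phi> p) (\<lambda>v. v p)"
  unfolding functional_of_def using lin_eval section_nonzero by (auto simp: linsys_map_def)

lemma filterlim_\<phi>: "p \<in> C \<Longrightarrow> filterlim \<phi> (E.germs (\<phi> p)) (germs p)"
  by (rule morphism_filterlim[OF morphism_\<phi> _ subset_Proj image_subset])

lemma filterlim_\<psi>: "p \<in> C \<Longrightarrow> filterlim \<psi> (germs p) (E.germs (\<phi> p))"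
  using morphism_filterlim[OF morphism_\<psi> _ image_subset subset_Proj, of "\<phi> p"] \<psi>_\<phi> by simp

lemma regular_\<phi>: "p \<in> C \<Longrightarrow> E.regular (\<phi> p) h \<Longrightarrow> regular p (\<lambda>z. h (\<phi> z))"
  using morphism_\<phi> unfolding morphism_def comp_def by blast

lemma regular_\<psi>: "p \<in> C \<Longrightarrow> regular p h \<Longrightarrow> E.regular (\<phi> p) (\<lambda>z. h (\<psi> z))"
proof -
  assume p: "p \<in> C" and h: "regular p h"
  have "regular (\<psi> (\<phi> p)) h" using h \<psi>_\<phi>[OF p] by simp
  moreover have "\<phi> p \<in> \<phi> ` C" using p by blast
  ultimately show ?thesis using morphism_\<psi> unfolding morphism_def comp_def by blast
qed

lemma mpow_\<phi>: "p \<in> C \<Longrightarrow> h \<in> E.mpow (\<phi> p) k \<Longrightarrow> (\<lambda>z. h (\<phi> z)) \<in> mpow p k"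
  by (rule mpow_pullback[OF quasiproj_axioms E.quasiproj_axioms])
    (auto intro: filterlim_\<phi> regular_\<phi>)

lemma mpow_\<psi>: "p \<in> C \<Longrightarrow> h \<in> mpow p k \<Longrightarrow> (\<lambda>z. h (\<psi> z)) \<in> E.mpow (\<phi> p) k"
  by (rule mpow_pullback[OF E.quasiproj_axioms quasiproj_axioms])
    (auto simp: \<psi>_\<phi> intro: filterlim_\<psi> regular_\<psi>)

section \<open>Quotients of sections as local functions\<close>

lemma eventually_section_neq_0:
  assumes "p \<in> C" "u \<in> V" "u p \<noteq> 0" shows "eventually (\<lambda>q. u q \<noteq> 0) (germs p)"
proof -
  have "eventually (\<lambda>z. u \<notin> z) (E.germs (\<phi> p))"
    using E.eventually_notin[of "\<phi> p" u] assms not_mem_\<phi> by blast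
  then have "eventually (\<lambda>q. u \<notin> \<phi> q) (germs p)"
    using filterlim_\<phi>[OF assms(1)] unfolding filterlim_iff by blast
  then show ?thesis using not_mem_\<phi>[OF assms(2)] by simp
qed

lemma hcoord_quotient:
  assumes "q \<in> C" "v \<in> V" "u \<in> V" shows "hcoord V (\<phi> q) v / hcoord V (\<phi> q) u = v q / u q"
  using quotient_functional[OF subspace_V E.hcoord functional_eval] assms by blast

lemma regular_quotient:
  assumes p: "p \<in> C" and "v \<in> V" "u \<in> V" "u p \<noteq> 0" shows "regular p (\<lambda>q. v q / u q)"
proof -
  have "regular p (\<lambda>z. hcoord V (\<phi> z) v / hcoord V (\<phi> z) u)"
    by (rule regular_\<phi>[OF p E.regular_linear_quotient]) (use assms not_mem_\<phi> in auto)
  then show ?thesis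
    by (rule regular_cong[OF p]) (use eventually_in[OF p] in eventually_elim, use assms hcoord_quotient in auto)
qed

text \<open>The order is measured against a section of \<open>V\<close> not vanishing at
  \<open>p\<close>, which plays the part of a local frame of the bundle.\<close>

definition vanish :: "nat \<Rightarrow> 'x point \<Rightarrow> ('x point \<Rightarrow> complex) set"
  where "vanish k p = {v \<in> V. \<exists>u\<in>V. u p \<noteq> 0 \<and> (\<lambda>q. v q / u q) \<in> mpow p k}"

lemma mem_vanish:
  assumes p: "p \<in> C" and u: "u \<in> V" "u p \<noteq> 0"
  shows "v \<in> vanish k p \<longleftrightarrow> v \<in> V \<and> (\<lambda>q. v q / u q) \<in> mpow p k"
proof
  assume "v \<in> vanish k p"
  then obtain u' where u': "v \<in> V" "u' \<in> V" "u' p \<noteq> 0" "(\<lambda>q. v q / u' q) \<in> mpow p k" unfolding vanish_def by blast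
  have "(\<lambda>q. (u' q / u q) * (v q / u' q)) \<in> mpow p k"
    by (rule mpow_regular_mult[OF p regular_quotient[OF p u'(2) u] u'(4)])
  then have "(\<lambda>q. v q / u q) \<in> mpow p k"
    by (rule mpow_cong[OF p]) (use eventually_section_neq_0[OF p u'(2,3)] in eventually_elim, simp)
  then show "v \<in> V \<and> (\<lambda>q. v q / u q) \<in> mpow p k" using u'(1) by blast
qed (use u in \<open>auto simp: vanish_def\<close>)

lemma subspace_vanish: assumes p: "p \<in> C" shows "cfun.subspace (vanish k p)"
proof -
  obtain u where u: "u \<in> V" "u p \<noteq> 0" using section_nonzero[OF p] by blast
  note m = mem_vanish[OF p u]
  show ?thesis unfolding cfun.subspace_def
  proof (intro conjI ballI allI)
    show "0 \<in> vanish k p" unfolding m using cfun.subspace_0[OF subspace_V] mpow_zero[OF p] by simp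
  next
    fix v w assume "v \<in> vanish k p" "w \<in> vanish k p"
    then have vw: "v \<in> V" "w \<in> V" "(\<lambda>q. v q / u q) \<in> mpow p k" "(\<lambda>q. w q / u q) \<in> mpow p k" unfolding m by auto
    then show "v + w \<in> vanish k p" unfolding m
      using cfun.subspace_add[OF subspace_V vw(1,2)] mpow_add[OF p vw(3,4)] by (simp add: add_divide_distrib)
  next
    fix c v assume "v \<in> vanish k p"
    then have v: "v \<in> V" "(\<lambda>q. v q / u q) \<in> mpow p k" unfolding m by auto
    then show "cscale c v \<in> vanish k p" unfolding m
      using cfun.subspace_scale[OF subspace_V v(1)] mpow_scale[OF p v(2), of c] by (simp add: cscale_def)
  qed
qed

lemma vanish_antimono: "p \<in> C \<Longrightarrow> k \<le> l \<Longrightarrow> vanish l p \<subseteq> vanish k p"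
  using mpow_antimono unfolding vanish_def by blast

text \<open>Powers of the maximal ideals correspond under \<open>\<phi>\<close> and
  \<open>\<psi>\<close>. A vanishing \<open>k\<close>-jet means order at least
  \<open>k + 1\<close>.\<close>

lemma jet_kernel_curve:
  assumes p: "p \<in> C"
  shows "jet_kernel V (\<phi> ` C) k (\<phi> p) = vanish (k + 1) p"
proof -
  have "(\<lambda>z. hcoord V z w / hcoord V z u) \<in> E.mpow (\<phi> p) (k + 1) \<longleftrightarrow> (\<lambda>q. w q / u q) \<in> mpow p (k + 1)"
    if w: "w \<in> V" and u: "u \<in> V" for u w
  proof
    assume "(\<lambda>z. hcoord V z w / hcoord V z u) \<in> E.mpow (\<phi> p) (k + 1)"
    from mpow_\<phi>[OF p this] show "(\<lambda>q. w q / u q) \<in> mpow p (k + 1)"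
      by (rule mpow_cong[OF p]) (use eventually_in[OF p] in eventually_elim, use u w hcoord_quotient in auto)
  next
    assume "(\<lambda>q. w q / u q) \<in> mpow p (k + 1)"
    have \<phi>p: "\<phi> p \<in> \<phi> ` C" using p by blast
    from mpow_\<psi>[OF p \<open>(\<lambda>q. w q / u q) \<in> mpow p (k + 1)\<close>]
    show "(\<lambda>z. hcoord V z w / hcoord V z u) \<in> E.mpow (\<phi> p) (k + 1)"
    proof (rule E.mpow_cong[OF \<phi>p])
      show "eventually (\<lambda>z. w (\<psi> z) / u (\<psi> z) = hcoord V z w / hcoord V z u) (E.germs (\<phi> p))"
        using E.eventually_in[OF \<phi>p] by eventually_elim (use \<psi>_\<phi> hcoord_quotient u w in auto)
    qed
  qed
  then show ?thesis unfolding jet_kernel_def vanish_def using not_mem_\<phi>[of _ p] by blast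
qed

text \<open>The linear forms vanishing at \<open>\<phi> p\<close> generate its maximal ideal, so one of them is a
  local parameter.\<close>

lemma local_param_section:
  assumes p: "p \<in> C" and v0: "v0 \<in> V" "v0 p \<noteq> 0"
  obtains u where "u \<in> V" "u p = 0" "local_param p (\<lambda>q. u q / v0 q)"
proof -
  have \<phi>p: "\<phi> p \<in> \<phi> ` C" using p by blast
  obtain t where t: "t \<in> mpow p 1" "t \<notin> mpow p 2" by (rule cotangent_generator[OF p])
  obtain u X where ch: "E.chart u X" "u \<notin> \<phi> p" and X: "\<And>x. x \<in> X \<Longrightarrow> x (\<phi> p) = 0"
    "\<And>x. x \<in> X \<Longrightarrow> \<exists>b\<in>\<phi> p. x = (\<lambda>z. hcoord V z b / hcoord V z u)"
    by (rule E.chart_exists[OF \<phi>p], rule that) blast+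
  have fin: "finite X" and u: "u \<in> V" using ch(1) unfolding E.chart_def by auto
  have up: "u p \<noteq> 0" using ch(2) not_mem_\<phi>[OF u] by blast
  \<comment> \<open>A germ with nonzero differential, carried to the image curve, is a combination
    of linear coordinates there; so these cannot all have order 2.\<close>
  have "\<exists>c. (\<forall>x\<in>X. E.regular (\<phi> p) (c x)) \<and> eventually (\<lambda>z. t (\<psi> z) = (\<Sum>x\<in>X. c x z * x z)) (E.germs (\<phi> p))"
    by (rule E.max_ideal_generators[OF ch(1) \<phi>p ch(2) _ mpow_\<psi>[OF p t(1)]]) (fact X(1))
  then obtain c where c: "\<forall>x\<in>X. E.regular (\<phi> p) (c x)" "eventually (\<lambda>z. t (\<psi> z) = (\<Sum>x\<in>X. c x z * x z)) (E.germs (\<phi> p))"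
    by (elim exE conjE)
  have ev: "eventually (\<lambda>q. t (\<psi> (\<phi> q)) = (\<Sum>x\<in>X. c x (\<phi> q) * x (\<phi> q))) (germs p)"
    using c(2) filterlim_\<phi>[OF p] unfolding filterlim_iff by blast
  have "\<exists>x\<in>X. (\<lambda>q. x (\<phi> q)) \<notin> mpow p 2"
  proof (rule ccontr)
    assume "\<not> ?thesis"
    then have all: "\<And>x. x \<in> X \<Longrightarrow> (\<lambda>q. x (\<phi> q)) \<in> mpow p 2" by blast
    have "(\<lambda>q. \<Sum>x\<in>X. c x (\<phi> q) * x (\<phi> q)) \<in> mpow p 2"
      using c(1) all by (intro mpow_sum mpow_regular_mult regular_\<phi> p) auto
    then have "t \<in> mpow p 2"
      by (rule mpow_cong[OF p]) (use ev eventually_in[OF p] in eventually_elim, simp add: \<psi>_\<phi>)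
    then show False using t(2) by blast
  qed
  then obtain x where x: "x \<in> X" "(\<lambda>q. x (\<phi> q)) \<notin> mpow p 2" by blast
  obtain b where b: "b \<in> \<phi> p" "x = (\<lambda>z. hcoord V z b / hcoord V z u)" using X(2)[OF x(1)] by blast
  have bV: "b \<in> V" "b p = 0" using b(1) unfolding linsys_map_def by auto
  have "(\<lambda>q. b q / u q) \<notin> mpow p 2"
  proof
    assume "(\<lambda>q. b q / u q) \<in> mpow p 2"
    then have "(\<lambda>q. x (\<phi> q)) \<in> mpow p 2" unfolding b(2)
      by (rule mpow_cong[OF p]) (use eventually_in[OF p] in eventually_elim, use bV u hcoord_quotient in auto)
    then show False using x(2) by blast
  qed
  \<comment> \<open>The order of vanishing is the same for the denominators \<open>u\<close> and
    \<open>v0\<close>, both nonzero at \<open>p\<close>.\<close>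
  then have "(\<lambda>q. b q / v0 q) \<notin> mpow p 2" using mem_vanish[OF p u up] mem_vanish[OF p v0] bV by blast
  then have "local_param p (\<lambda>q. b q / v0 q)"
    unfolding local_param_def using regular_quotient[OF p bV(1) v0] bV(2) by simp
  then show ?thesis using that bV by blast
qed

text \<open>Order at least 2 imposes two independent conditions on an embedding system. So this says
  that the second osculating space is no larger than the tangent line.\<close>

definition inflectional :: "'x point \<Rightarrow> bool"
  where "inflectional p \<longleftrightarrow> vanish 2 p \<subseteq> vanish 3 p"

text \<open>\<open>w\<close> is \<open>v\<close> corrected so that \<open>w / v0\<close> is the
  remainder of \<open>f = v / v0\<close> after its linear Taylor polynomial at \<open>p\<close>. The
  coefficient of order 2 of this remainder is \<open>f'' p / 2\<close>.\<close>

lemma second_order: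
  assumes p: "p \<in> C" and v0: "v0 \<in> V" "v0 p \<noteq> 0" and u: "u \<in> V" and t: "local_param p (\<lambda>q. u q / v0 q)"
    and f: "f = (\<lambda>q. v q / v0 q)" and v: "v \<in> V"
    and f': "derivative p (\<lambda>q. u q / v0 q) f f'" and f'': "derivative p (\<lambda>q. u q / v0 q) f' f''"
  defines "w \<equiv> v - cscale (f p - f' p * (u p / v0 p)) v0 - cscale (f' p) u"
  shows "w \<in> vanish 2 p" "w \<in> vanish 3 p \<longleftrightarrow> f'' p = 0"
proof -
  let ?t = "\<lambda>q. u q / v0 q"
  have wV: "w \<in> V" unfolding w_def using v v0 u subspace_V
    by (intro cfun.subspace_diff cfun.subspace_scale)
  have e: "eventually (\<lambda>q. w q / v0 q = f q - f p - f' p * (?t q - ?t p)) (germs p)"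
    using eventually_section_neq_0[OF p v0]
    by eventually_elim (simp add: w_def f cscale_def field_simps)
  have e': "eventually (\<lambda>q. f q - f p - f' p * (?t q - ?t p) = w q / v0 q) (germs p)"
    using e by eventually_elim simp
  have w2: "(\<lambda>q. w q / v0 q) \<in> mpow p 2"
    by (rule mpow_cong[OF p derivative_at[OF p f'] e'])
  then show "w \<in> vanish 2 p" using mem_vanish[OF p v0] wV by blast
  have T: "(\<lambda>z. f z - f p - f' p * (?t z - ?t p) - f'' p / 2 * (?t z - ?t p) ^ 2) \<in> mpow p 3"
    by (rule taylor_2_at[OF p t f' f''])
  have "(\<lambda>q. w q / v0 q) \<in> mpow p 3 \<longleftrightarrow> f'' p = 0"
  proof
    assume "f'' p = 0"
    then have "(\<lambda>z. f z - f p - f' p * (?t z - ?t p)) \<in> mpow p 3" using T by simp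
    then show "(\<lambda>q. w q / v0 q) \<in> mpow p 3" by (rule mpow_cong[OF p _ e'])
  next
    assume "(\<lambda>q. w q / v0 q) \<in> mpow p 3"
    then have "(\<lambda>z. f z - f p - f' p * (?t z - ?t p)) \<in> mpow p 3" by (rule mpow_cong[OF p _ e])
    from mpow_diff[OF p this T] have "(\<lambda>z. f'' p / 2 * (?t z - ?t p) ^ 2) \<in> mpow p (Suc 2)"
      by (simp add: numeral_3_eq_3)
    from local_param_leading[OF p t regular_const[OF p] this] show "f'' p = 0" by simp
  qed
  then show "w \<in> vanish 3 p \<longleftrightarrow> f'' p = 0" using mem_vanish[OF p v0] wV by blast
qed

text \<open>A section of exact order 2 at \<open>p\<close> has \<open>f p = f' p = 0\<close> and
  \<open>f'' p \<noteq> 0\<close>. The last condition is open, and at a nearby \<open>q\<close> the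
  corrected section of \<open>second_order\<close>, which depends on \<open>q\<close>, has exact
  order 2.\<close>

lemma eventually_not_inflectional:
  assumes p: "p \<in> C" and "\<not> inflectional p"
  shows "eventually (\<lambda>q. \<not> inflectional q) (germs p)"
proof -
  obtain v where v: "v \<in> vanish 2 p" "v \<notin> vanish 3 p" using assms(2) unfolding inflectional_def by blast
  obtain v0 where v0: "v0 \<in> V" "v0 p \<noteq> 0" using section_nonzero[OF p] by blast
  obtain u where u: "u \<in> V" "u p = 0" and t: "local_param p (\<lambda>q. u q / v0 q)" by (rule local_param_section[OF p v0])
  have vV: "v \<in> V" and v2: "(\<lambda>q. v q / v0 q) \<in> mpow p 2" using mem_vanish[OF p v0] v(1) by auto
  define f where "f = (\<lambda>q. v q / v0 q)"
  have fr: "regular p f" unfolding f_def by (rule regular_quotient[OF p vV v0])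
  obtain f' where f': "derivative p (\<lambda>q. u q / v0 q) f f'" using derivative_exists[OF p t fr] by blast
  then have "regular p f'" unfolding derivative_def by blast
  then obtain f'' where f'': "derivative p (\<lambda>q. u q / v0 q) f' f''" using derivative_exists[OF p t] by blast
  then have f''r: "regular p f''" unfolding derivative_def by blast
  have fp: "f p = 0" using mpow_eval[OF p v2] unfolding f_def by simp
  have "(\<lambda>z. f' p * (u z / v0 z - u p / v0 p) ^ 1) \<in> mpow p (Suc 1)"
    using mpow_diff[OF p v2 derivative_at[OF p f']] fp u(2) unfolding f_def by (simp add: numeral_2_eq_2)
  from local_param_leading[OF p t regular_const[OF p] this] have f'p: "f' p = 0" .
  have "f'' p \<noteq> 0"
    using second_order(2)[OF p v0 u(1) t f_def vV f' f''] v(2) fp f'p by simp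
  from eventually_neq_0[OF p f''r this] eventually_derivative[OF p f'] eventually_derivative[OF p f'']
    eventually_in[OF p] eventually_section_neq_0[OF p v0] eventually_local_param(1)[OF p t]
  show ?thesis
  proof eventually_elim
    case (elim q)
    show ?case
      using second_order[OF elim(4) v0(1) elim(5) u(1) elim(6) f_def vV elim(2,3)] elim(1)
      unfolding inflectional_def by blast
  qed
qed

section \<open>Sections determined by their germs, and curves with only inflection points\<close>

lemma nonempty_open_dense:
  assumes "openin (subtopology (zariski M) C) U" "openin (subtopology (zariski M) C) U'" "U \<noteq> {}" "U' \<noteq> {}"
  shows "U \<inter> U' \<noteq> {}"
proof
  assume e: "U \<inter> U' = {}"
  obtain T T' where T: "openin (zariski M) T" "U = T \<inter> C" "openin (zariski M) T'" "U' = T' \<inter> C"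
    using assms(1,2) unfolding openin_subtopology by blast
  have "closedin (zariski M) (Proj M - T)" "closedin (zariski M) (Proj M - T')"
    using T(1,3) by (metis closedin_diff closedin_topspace topspace_zariski)+
  moreover have "C \<subseteq> (Proj M - T) \<union> (Proj M - T')" using e T(2,4) subset_Proj by blast
  ultimately have "C \<subseteq> Proj M - T \<or> C \<subseteq> Proj M - T'" using irreducible unfolding irreducible_set_def by blast
  then show False using assms(3,4) T(2,4) by blast
qed

text \<open>A nonzero section is nonzero on a nonempty open set, and on an irreducible curve this
  set meets every neighbourhood of \<open>p\<close>.\<close>

lemma section_eq_0:
  assumes p: "p \<in> C" and w: "w \<in> V" and ev: "eventually (\<lambda>q. w q = 0) (germs p)"
  shows "w = 0"
proof (rule ccontr)
  assume "w \<noteq> 0"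
  then obtain q where "w q \<noteq> 0" by (auto simp: fun_eq_iff)
  then have q: "q \<in> C" using section_outside[OF w] by blast
  obtain U where U: "openin (subtopology (zariski M) C) U" "p \<in> U" "\<forall>z\<in>U. w z = 0"
    using ev unfolding eventually_nhdsin topspace_sub using p by blast
  have "eventually (\<lambda>q. w q \<noteq> 0) (germs q)" by (rule eventually_section_neq_0[OF q w \<open>w q \<noteq> 0\<close>])
  then obtain U' where U': "openin (subtopology (zariski M) C) U'" "q \<in> U'" "\<forall>z\<in>U'. w z \<noteq> 0"
    unfolding eventually_nhdsin topspace_sub using q by blast
  show False using nonempty_open_dense[OF U(1) U'(1)] U U' by blast
qed

text \<open>\<open>derivative_zero_imp_const\<close> is used twice: \<open>f'\<close> is constant
  because \<open>f''\<close> vanishes, and then \<open>f - f' p * t\<close> is constant. The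
  resulting identity near \<open>p\<close> extends to the whole curve.\<close>

lemma inflectional_imp_line:
  assumes all: "\<forall>q\<in>C. inflectional q" and p: "p \<in> C" and v0: "v0 \<in> V" "v0 p \<noteq> 0"
    and u: "u \<in> V" "local_param p (\<lambda>q. u q / v0 q)" and v: "v \<in> V"
  shows "\<exists>a b. v = cscale a v0 + cscale b u"
proof -
  let ?t = "\<lambda>q. u q / v0 q"
  have tr: "regular p ?t" using u(2) unfolding local_param_def by blast
  define f where "f = (\<lambda>q. v q / v0 q)"
  have fr: "regular p f" unfolding f_def by (rule regular_quotient[OF p v v0])
  obtain f' where f': "derivative p ?t f f'" using derivative_exists[OF p u(2) fr] by blast
  then have "regular p f'" unfolding derivative_def by blast
  then obtain f'' where f'': "derivative p ?t f' f''" using derivative_exists[OF p u(2)] by blast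
  \<comment> \<open>Inflection is used at every point near \<open>p\<close>; \<open>t\<close>,
    \<open>f'\<close> and \<open>f''\<close> keep their roles at those points.\<close>
  have "eventually (\<lambda>z. f'' z = 0) (germs p)"
    using eventually_derivative[OF p f'] eventually_derivative[OF p f''] eventually_in[OF p]
      eventually_section_neq_0[OF p v0] eventually_local_param(1)[OF p u(2)]
  proof eventually_elim
    case (elim q)
    have "inflectional q" using all elim(3) by blast
    then show ?case
      using second_order[OF elim(3) v0(1) elim(4) u(1) elim(5) f_def v elim(1,2)]
      unfolding inflectional_def by blast
  qed
  from derivative_zero_imp_const[OF p u(2) f'' this]
  have f'c: "eventually (\<lambda>z. f' z - f' p = 0) (germs p)" by eventually_elim simp
  have d: "derivative p ?t (\<lambda>z. f z + (- f' p) * ?t z) (\<lambda>z. f' z + (0 * ?t z + (- f' p) * 1))"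
    by (intro derivative_add derivative_mult derivative_const derivative_self p tr f')
  have "eventually (\<lambda>z. f z + (- f' p) * ?t z = f p + (- f' p) * ?t p) (germs p)"
    by (rule derivative_zero_imp_const[OF p u(2) d]) (use f'c in eventually_elim, simp)
  with eventually_section_neq_0[OF p v0]
  have "eventually (\<lambda>z. (v - cscale (f p - f' p * ?t p) v0 - cscale (f' p) u) z = 0) (germs p)"
    by eventually_elim (simp add: f_def cscale_def field_simps)
  then have "v - cscale (f p - f' p * ?t p) v0 - cscale (f' p) u = 0"
    using v v0 u subspace_V by (intro section_eq_0[OF p] cfun.subspace_diff cfun.subspace_scale) auto
  then show ?thesis by (intro exI[of _ "f p - f' p * ?t p"] exI[of _ "f' p"]) (simp add: algebra_simps)
qed

end

section \<open>Projective coordinate spaces\<close>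

definition unit_vec :: "'i \<Rightarrow> 'i \<Rightarrow> complex"
  where "unit_vec i = (\<lambda>j. if j = i then 1 else 0)"

lemma coord_space_expand:
  assumes "finite I" "f \<in> coord_space I" shows "f = (\<Sum>i\<in>I. cscale (f i) (unit_vec i))"
proof
  fix x
  have "(\<Sum>i\<in>I. cscale (f i) (unit_vec i)) x = (\<Sum>i\<in>I. if i = x then f i else 0)"
    by (induction I rule: infinite_finite_induct) (auto simp: cscale_def unit_vec_def)
  also have "\<dots> = f x" using assms by (auto simp: sum.delta coord_space_def)
  finally show "f x = (\<Sum>i\<in>I. cscale (f i) (unit_vec i)) x" ..
qed

lemma subspace_coord_space: "cfun.subspace (coord_space I)"
  unfolding cfun.subspace_def coord_space_def cscale_def by auto

lemma unit_vec_coord_space: "i \<in> I \<Longrightarrow> unit_vec i \<in> coord_space I"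
  unfolding coord_space_def unit_vec_def by auto

lemma fin_dim_coord_space:
  assumes "finite I" shows "fin_dim (coord_space I)"
proof -
  have "cfun.span (unit_vec ` I) = coord_space I"
  proof
    show "cfun.span (unit_vec ` I) \<subseteq> coord_space I"
      by (intro cfun.span_minimal subspace_coord_space) (auto intro: unit_vec_coord_space)
    show "coord_space I \<subseteq> cfun.span (unit_vec ` I)"
    proof
      fix f assume f: "f \<in> coord_space I"
      show "f \<in> cfun.span (unit_vec ` I)"
        by (subst coord_space_expand[OF assms f]) (intro cfun.span_sum cfun.span_scale cfun.span_base imageI)
    qed
  qed
  then show ?thesis unfolding fin_dim_def using assms subspace_coord_space by blast
qed

text \<open>The point with homogeneous coordinates \<open>c\<close>.\<close>

definition coord_hyperplane :: "'i set \<Rightarrow> ('i \<Rightarrow> complex) \<Rightarrow> ('i \<Rightarrow> complex) set"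
  where "coord_hyperplane I c = {f \<in> coord_space I. (\<Sum>i\<in>I. c i * f i) = 0}"

lemma functional_coord_hyperplane:
  assumes I: "finite I" and c: "\<exists>i\<in>I. c i \<noteq> 0"
  shows "functional_of (coord_space I) (coord_hyperplane I c) (\<lambda>f. \<Sum>i\<in>I. c i * f i)"
proof -
  obtain i where i: "i \<in> I" "c i \<noteq> 0" using c by blast
  have "(\<Sum>j\<in>I. c j * unit_vec i j) = c i"
    using i I by (simp add: unit_vec_def if_distrib[of "\<lambda>x. _ * x"] sum.delta cong: if_cong)
  then have "\<exists>w\<in>coord_space I. (\<Sum>i\<in>I. c i * w i) \<noteq> 0"
    using i unit_vec_coord_space[OF i(1)] by (intro bexI[of _ "unit_vec i"]) auto
  then show ?thesis unfolding functional_of_def coord_hyperplane_def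
    using lin_lincomb[of I "\<lambda>i f. f i" c, OF lin_eval] by simp
qed

lemma Proj_coord_space:
  assumes I: "finite I"
  shows "Proj (coord_space I) = {coord_hyperplane I c | c. \<exists>i\<in>I. c i \<noteq> 0}"
proof
  show "{coord_hyperplane I c | c. \<exists>i\<in>I. c i \<noteq> 0} \<subseteq> Proj (coord_space I)"
    using functional_coord_hyperplane[OF I] functional_of_Proj[OF fin_dim_coord_space[OF I]] by blast
  show "Proj (coord_space I) \<subseteq> {coord_hyperplane I c | c. \<exists>i\<in>I. c i \<noteq> 0}"
  proof
    fix H assume "H \<in> Proj (coord_space I)"
    then obtain l where l: "lin l" "\<exists>w\<in>coord_space I. l w \<noteq> 0" "H = {w \<in> coord_space I. l w = 0}"
      unfolding Proj_iff[OF fin_dim_coord_space[OF I]] by blast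
    have eq: "l f = (\<Sum>i\<in>I. l (unit_vec i) * f i)" if "f \<in> coord_space I" for f
      by (subst coord_space_expand[OF I that]) (simp add: lin_sum[OF l(1)] lin_scale[OF l(1)] mult.commute)
    have "H = coord_hyperplane I (\<lambda>i. l (unit_vec i))" unfolding l(3) coord_hyperplane_def using eq by auto
    moreover have "\<exists>i\<in>I. l (unit_vec i) \<noteq> 0"
    proof (rule ccontr)
      assume "\<not> ?thesis"
      then have "l f = 0" if "f \<in> coord_space I" for f using eq[OF that] by simp
      then show False using l(2) by blast
    qed
    ultimately show "H \<in> {coord_hyperplane I c | c. \<exists>i\<in>I. c i \<noteq> 0}" by blast
  qed
qed

section \<open>Local structure of decomposable scrolls\<close>

locale scroll = smooth_curve M C for M :: "('x \<Rightarrow> complex) set" and C :: "'x point set" +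
  fixes n :: nat and L :: "nat \<Rightarrow> 'x frames" and V :: "nat \<Rightarrow> ('x point \<Rightarrow> complex) set"
  assumes n: "n \<ge> 1" and systems: "\<And>i. i \<in> {1..n} \<Longrightarrow> embedding_system M C (L i) (V i)"
begin

lemma embedded: "i \<in> {1..n} \<Longrightarrow> embedded_curve M C (L i) (V i)"
  using systems by unfold_locales

abbreviation W :: "(nat \<times> 'x point \<Rightarrow> complex) set"
  where "W \<equiv> sys_sum n V"

abbreviation X :: "(nat \<times> 'x point) point set"
  where "X \<equiv> decomposable_scroll n C V"

abbreviation van :: "nat \<Rightarrow> nat \<Rightarrow> 'x point \<Rightarrow> ('x point \<Rightarrow> complex) set"
  where "van i \<equiv> embedded_curve.vanish M C (V i)"

abbreviation infl :: "nat \<Rightarrow> 'x point \<Rightarrow> bool"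
  where "infl i \<equiv> embedded_curve.inflectional M C (V i)"

section \<open>Sections of the direct sum\<close>

definition incl :: "nat \<Rightarrow> ('x point \<Rightarrow> complex) \<Rightarrow> nat \<times> 'x point \<Rightarrow> complex"
  where "incl i v = (\<lambda>(j, q). if j = i then v q else 0)"

definition component :: "nat \<Rightarrow> (nat \<times> 'x point \<Rightarrow> complex) \<Rightarrow> 'x point \<Rightarrow> complex"
  where "component i v = (\<lambda>q. v (i, q))"

lemma subspace_V: "i \<in> {1..n} \<Longrightarrow> cfun.subspace (V i)"
  using embedded embedded_curve.subspace_V by blast

lemma mem_W: "v \<in> W \<longleftrightarrow> (\<forall>i\<in>{1..n}. component i v \<in> V i) \<and> (\<forall>i p. i \<notin> {1..n} \<longrightarrow> v (i, p) = 0)"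
  unfolding sys_sum_def component_def by simp

lemma component_incl: "component j (incl i v) = (if j = i then v else 0)"
  by (auto simp: component_def incl_def)

lemma incl_in_W: "i \<in> {1..n} \<Longrightarrow> v \<in> V i \<Longrightarrow> incl i v \<in> W"
  unfolding mem_W component_incl using cfun.subspace_0[OF subspace_V] by (auto simp: incl_def)

lemma component_in_V: "v \<in> W \<Longrightarrow> i \<in> {1..n} \<Longrightarrow> component i v \<in> V i"
  unfolding mem_W by blast

lemma component_add: "component i (v + w) = component i v + component i w"
  and component_diff: "component i (v - w) = component i v - component i w"
  and component_scale: "component i (cscale c v) = cscale c (component i v)"
  by (simp_all add: component_def cscale_def fun_eq_iff)

lemma component_zero: "component i 0 = 0"
  by (simp add: component_def fun_eq_iff)

lemma component_sum: "component i (\<Sum>j\<in>J. f j) = (\<Sum>j\<in>J. component i (f j))"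
  by (induction J rule: infinite_finite_induct)
    (simp_all only: sum.infinite sum.empty sum.insert component_add component_zero not_False_eq_True)

lemma subspace_W: "cfun.subspace W"
  unfolding cfun.subspace_def
proof (intro conjI ballI allI)
  show "0 \<in> W" unfolding mem_W component_zero using cfun.subspace_0[OF subspace_V] by simp
  fix v w c assume v: "v \<in> W" and w: "w \<in> W"
  show "v + w \<in> W" unfolding mem_W component_add
    using v[unfolded mem_W] w[unfolded mem_W] cfun.subspace_add[OF subspace_V] by simp
  show "cscale c v \<in> W" unfolding mem_W component_scale
    using v[unfolded mem_W] cfun.subspace_scale[OF subspace_V] by (simp add: cscale_def[of _ v])
qed

lemma W_expand: assumes "v \<in> W" shows "v = (\<Sum>i\<in>{1..n}. incl i (component i v))"
proof
  fix x :: "nat \<times> 'x point"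
  obtain j q where x: "x = (j, q)" by (cases x)
  have "(\<Sum>i\<in>I. incl i (component i v)) (j, q) = (\<Sum>i\<in>I. if i = j then v (j, q) else 0)" for I
    by (induction I rule: infinite_finite_induct) (auto simp: incl_def component_def)
  then have "(\<Sum>i\<in>{1..n}. incl i (component i v)) (j, q) = (\<Sum>i\<in>{1..n}. if i = j then v (j, q) else 0)" .
  also have "\<dots> = v (j, q)" using assms unfolding mem_W by (auto simp: sum.delta)
  finally show "v x = (\<Sum>i\<in>{1..n}. incl i (component i v)) x" unfolding x ..
qed

lemma linear_incl: "Vector_Spaces.linear cscale cscale (incl i)"
  unfolding Vector_Spaces.linear_iff using cfun.vector_space_axioms cfun.vector_space_axioms
  by (auto simp: incl_def cscale_def fun_eq_iff)

lemma fin_dim_W: "fin_dim W"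
proof -
  have "\<forall>i\<in>{1..n}. \<exists>B. finite B \<and> cfun.span B = V i"
    using embedded embedded_curve.fin_dim_V unfolding fin_dim_def by blast
  from bchoice[OF this] obtain B where B: "\<forall>i\<in>{1..n}. finite (B i) \<and> cfun.span (B i) = V i" by (rule exE)
  let ?B = "\<Union>i\<in>{1..n}. incl i ` B i"
  have "cfun.span ?B = W"
  proof
    show "cfun.span ?B \<subseteq> W"
      using B cfun.span_superset by (intro cfun.span_minimal subspace_W) (blast intro: incl_in_W)
    show "W \<subseteq> cfun.span ?B"
    proof
      fix v assume v: "v \<in> W"
      show "v \<in> cfun.span ?B"
      proof (subst W_expand[OF v], rule cfun.span_sum)
        fix i assume i: "i \<in> {1..n}"
        interpret l: Vector_Spaces.linear cscale cscale "incl i" by (rule linear_incl)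
        have "incl i (component i v) \<in> incl i ` cfun.span (B i)" using B i component_in_V[OF v i] by blast
        also have "\<dots> = cfun.span (incl i ` B i)" by (rule l.span_image[symmetric])
        also have "\<dots> \<subseteq> cfun.span ?B" using i by (intro cfun.span_mono) blast
        finally show "incl i (component i v) \<in> cfun.span ?B" .
      qed
    qed
  qed
  moreover have "finite ?B" using B by blast
  ultimately show ?thesis unfolding fin_dim_def using subspace_W by blast
qed

section \<open>Points of the scroll in fibre coordinates\<close>

definition nonzero :: "(nat \<Rightarrow> complex) \<Rightarrow> bool"
  where "nonzero c \<longleftrightarrow> (\<exists>i\<in>{1..n}. c i \<noteq> 0)"

definition fl :: "'x point \<Rightarrow> (nat \<Rightarrow> complex) \<Rightarrow> (nat \<times> 'x point \<Rightarrow> complex) \<Rightarrow> complex"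
  where "fl p c v = (\<Sum>i\<in>{1..n}. c i * v (i, p))"

text \<open>\<open>c\<close> gives homogeneous coordinates in the fibre over \<open>p\<close>,
  relative to the trivialisation in which sections have numbers as values; \<open>fl p c\<close> is
  the corresponding functional.\<close>

definition pt :: "'x point \<Rightarrow> (nat \<Rightarrow> complex) \<Rightarrow> (nat \<times> 'x point) point"
  where "pt p c = {v \<in> W. fl p c v = 0}"

lemma lin_fl: "lin (fl p c)"
  unfolding fl_def by (rule lin_lincomb[of "{1..n}" "\<lambda>i f. f (i, p)" c]) (rule lin_eval)

lemma fl_incl: "i \<in> {1..n} \<Longrightarrow> fl p c (incl i v) = c i * v p"
  unfolding fl_def incl_def by (simp add: if_distrib[of "\<lambda>x. _ * x"] sum.delta cong: if_cong)

lemma base_section_exists: "p \<in> C \<Longrightarrow> \<exists>v. \<forall>i\<in>{1..n}. v i \<in> V i \<and> v i p \<noteq> 0"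
proof -
  assume p: "p \<in> C"
  have "\<forall>i\<in>{1..n}. \<exists>v. v \<in> V i \<and> v p \<noteq> 0"
    using embedded embedded_curve.section_nonzero p by blast
  from bchoice[OF this] show ?thesis .
qed

lemma functional_pt:
  assumes p: "p \<in> C" and c: "nonzero c" shows "functional_of W (pt p c) (fl p c)"
proof -
  obtain i where i: "i \<in> {1..n}" "c i \<noteq> 0" using c unfolding nonzero_def by blast
  obtain v where v: "v \<in> V i" "v p \<noteq> 0" using base_section_exists[OF p] i(1) by blast
  have "fl p c (incl i v) \<noteq> 0" using fl_incl[OF i(1)] i(2) v(2) by simp
  then show ?thesis unfolding functional_of_def pt_def using lin_fl incl_in_W[OF i(1) v(1)] by blast
qed

lemma scroll_eq: "X = {pt p c | p c. p \<in> C \<and> nonzero c}"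
proof -
  have "scroll_map n V (p, coord_hyperplane {1..n} c) = pt p c" for p c
    unfolding scroll_map_def coord_hyperplane_def pt_def fl_def coord_space_def by (auto simp: sys_sum_def)
  then have "scroll_map n V ` (C \<times> {coord_hyperplane {1..n} c | c. nonzero c}) = {pt p c | p c. p \<in> C \<and> nonzero c}"
    by (auto simp: image_iff) blast+
  then show ?thesis
    unfolding decomposable_scroll_def proj_bundle_def Proj_coord_space[OF finite_atLeastAtMost] nonzero_def .
qed

lemma pt_in_X: "p \<in> C \<Longrightarrow> nonzero c \<Longrightarrow> pt p c \<in> X"
  unfolding scroll_eq by blast

lemma X_cases:
  assumes "x \<in> X" obtains p c where "p \<in> C" "nonzero c" "x = pt p c"
  using assms unfolding scroll_eq by blast

lemma X_subset_Proj: "X \<subseteq> Proj W"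
  unfolding scroll_eq using functional_pt functional_of_Proj[OF fin_dim_W] by blast

sublocale X: quasiproj W X
  by unfold_locales (fact fin_dim_W, fact X_subset_Proj)

lemma incl_in_pt: "i \<in> {1..n} \<Longrightarrow> v \<in> V i \<Longrightarrow> incl i v \<in> pt p c \<longleftrightarrow> c i * v p = 0"
  unfolding pt_def using incl_in_W fl_incl by simp

text \<open>For \<open>c i \<noteq> 0\<close> the sections from the \<open>i\<close>-th summand that
  belong to \<open>pt p c\<close> are those vanishing at \<open>p\<close>. They determine the image
  of \<open>p\<close> under the embedding of index \<open>i\<close>, hence \<open>p\<close>.\<close>

lemma pt_inj:
  assumes "p \<in> C" "q \<in> C" "nonzero c" "nonzero d" "pt p c = pt q d" shows "p = q"
proof -
  obtain i where i: "i \<in> {1..n}" "c i \<noteq> 0" using assms(3) unfolding nonzero_def by blast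
  interpret e: embedded_curve M C "L i" "V i" by (rule embedded[OF i(1)])
  have *: "c i * v p = 0 \<longleftrightarrow> d i * v q = 0" if "v \<in> V i" for v
    using incl_in_pt[OF i(1) that] assms(5) by blast
  have "d i \<noteq> 0"
    using e.section_nonzero[OF assms(1)] * i(2) by (metis mult_eq_0_iff)
  then have "e.\<phi> p = e.\<phi> q" unfolding linsys_map_def using * i(2) by auto
  then show ?thesis using e.inj_\<phi> assms by blast
qed

section \<open>The projection of the scroll to the curve\<close>

definition pr :: "(nat \<times> 'x point) point \<Rightarrow> 'x point"
  where "pr x = (SOME p. p \<in> C \<and> (\<exists>c. nonzero c \<and> x = pt p c))"

lemma pr_pt: assumes "p \<in> C" "nonzero c" shows "pr (pt p c) = p"
proof -
  have "pr (pt p c) \<in> C \<and> (\<exists>d. nonzero d \<and> pt p c = pt (pr (pt p c)) d)"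
    unfolding pr_def by (rule someI[of _ p]) (use assms in blast)
  then show ?thesis using pt_inj assms by metis
qed

lemma pr_in_C: "x \<in> X \<Longrightarrow> pr x \<in> C"
  using pr_pt X_cases by metis

lemma hcoord_quotient_pt:
  assumes "p \<in> C" "nonzero c" "v \<in> W" "u \<in> W"
  shows "hcoord W (pt p c) v / hcoord W (pt p c) u = fl p c v / fl p c u"
  by (rule quotient_functional[OF subspace_W X.hcoord[OF pt_in_X] functional_pt]) (use assms in auto)

lemma form_incl:
  assumes "homog_poly (V i) d F" "i \<in> {1..n}"
  shows "homog_poly W d (\<lambda>l. F (\<lambda>w. l (incl i w)))"
    and "F (\<lambda>w. fl p c (incl i w)) = c i ^ d * F (\<lambda>v. v p)"
  using homog_poly_pullback[OF assms(1), of "incl i" W] incl_in_W[OF assms(2)]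
    homog_poly_scale[OF assms(1), of "\<lambda>w. fl p c (incl i w)" "c i" "\<lambda>v. v p"] fl_incl[OF assms(2)]
  by auto

text \<open>A form of degree \<open>d\<close> on \<open>V i\<close> becomes a form on
  \<open>W\<close> through \<open>incl i\<close>; at \<open>pt q b\<close> its value is
  \<open>b i ^ d\<close> times the value at the image of \<open>q\<close>. Open sets in the target
  thus pull back to open sets.\<close>

lemma filterlim_\<phi>_pr:
  assumes p: "p \<in> C" and i: "i \<in> {1..n}" "c i \<noteq> 0"
  shows "filterlim (\<lambda>z. linsys_map (V i) (pr z))
    (nhdsin (subtopology (zariski (V i)) (linsys_map (V i) ` C)) (linsys_map (V i) p)) (X.germs (pt p c))"
proof -
  interpret e: embedded_curve M C "L i" "V i" by (rule embedded[OF i(1)])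
  have c: "nonzero c" using i unfolding nonzero_def by blast
  have x: "pt p c \<in> X" by (rule pt_in_X[OF p c])
  have \<phi>p: "e.\<phi> p \<in> e.\<phi> ` C" using p by blast
  show ?thesis unfolding filterlim_iff
  proof (intro allI impI)
    fix P assume "eventually P (e.E.germs (e.\<phi> p))"
    then obtain U where U: "openin (zariski (V i)) U" "e.\<phi> p \<in> U" "\<forall>z\<in>U \<inter> e.\<phi> ` C. P z"
      unfolding e.E.eventually_germs[OF \<phi>p] by blast
    obtain d F where F: "homog_poly (V i) d F" "e.\<phi> p \<in> nonzero_locus (V i) F" "nonzero_locus (V i) F \<subseteq> U"
      using zariski_base[OF U(1,2)] .
    have locus: "e.\<phi> q \<in> nonzero_locus (V i) F \<longleftrightarrow> F (\<lambda>v. v q) \<noteq> 0" if "q \<in> C" for q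
      by (rule mem_nonzero_locus[OF e.fin_dim_V F(1) e.functional_eval[OF that]])
    obtain w where w: "w \<in> V i" "w p \<noteq> 0" using e.section_nonzero[OF p] by blast
    let ?G = "\<lambda>l. l (incl i w) * F (\<lambda>w. l (incl i w))"
    have G: "homog_poly W (1 + d) ?G"
      by (intro homog_poly.mult homog_poly.linear form_incl(1)[OF F(1) i(1)] incl_in_W i w)
    have Gfl: "?G (fl q b) = b i * w q * (b i ^ d * F (\<lambda>v. v q))" for q b
      using form_incl(2)[OF F(1) i(1), of q b] fl_incl[OF i(1), of q b w] by (simp only:)
    have "?G (fl p c) \<noteq> 0" unfolding Gfl using i w locus[OF p] F(2) by simp
    then have "?G (hcoord W (pt p c)) \<noteq> 0"
      using homog_poly_functional[OF G subspace_W functional_pt[OF p c] X.hcoord[OF x]] by blast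
    from X.eventually_nonzero_locus[OF x G this] X.eventually_in[OF x]
    show "eventually (\<lambda>z. P (e.\<phi> (pr z))) (X.germs (pt p c))"
    proof eventually_elim
      case (elim z)
      obtain q b where q: "q \<in> C" "nonzero b" "z = pt q b" using elim(2) by (rule X_cases)
      have "?G (fl q b) \<noteq> 0"
        using homog_poly_functional[OF G subspace_W functional_pt[OF q(1,2)] X.hcoord[OF pt_in_X[OF q(1,2)]]] elim(1) q(3) by blast
      then have "F (\<lambda>v. v q) \<noteq> 0" unfolding Gfl by simp
      then have "e.\<phi> q \<in> U" using locus[OF q(1)] F(3) by blast
      then show ?case using U(3) q pr_pt by auto
    qed
  qed
qed

lemma filterlim_pr:
  assumes p: "p \<in> C" and c: "nonzero c" shows "filterlim pr (germs p) (X.germs (pt p c))"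
proof -
  obtain i where i: "i \<in> {1..n}" "c i \<noteq> 0" using c unfolding nonzero_def by blast
  interpret e: embedded_curve M C "L i" "V i" by (rule embedded[OF i(1)])
  have lim: "filterlim (\<lambda>z. e.\<psi> (e.\<phi> (pr z))) (germs p) (X.germs (pt p c))"
    by (rule filterlim_compose[OF e.filterlim_\<psi>[OF p] filterlim_\<phi>_pr[OF p i(1), of c, OF i(2)]])
  have eq: "eventually (\<lambda>z. e.\<psi> (e.\<phi> (pr z)) = pr z) (X.germs (pt p c))"
    using X.eventually_in[OF pt_in_X[OF p c]] by eventually_elim (simp add: pr_in_C e.\<psi>_\<phi>)
  show ?thesis using lim filterlim_cong[OF refl refl eq] by blast
qed

lemma regular_pr:
  assumes p: "p \<in> C" and c: "nonzero c" and f: "regular p f"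
  shows "X.regular (pt p c) (\<lambda>z. f (pr z))"
proof -
  obtain i where i: "i \<in> {1..n}" "c i \<noteq> 0" using c unfolding nonzero_def by blast
  interpret e: embedded_curve M C "L i" "V i" by (rule embedded[OF i(1)])
  have \<phi>p: "e.\<phi> p \<in> e.\<phi> ` C" using p by blast
  have x: "pt p c \<in> X" by (rule pt_in_X[OF p c])
  obtain d F G where F: "homog_poly (V i) d F" "homog_poly (V i) d G"
    and ev: "eventually (\<lambda>z. G (hcoord (V i) z) \<noteq> 0 \<and> f (e.\<psi> z) = F (hcoord (V i) z) / G (hcoord (V i) z)) (e.E.germs (e.\<phi> p))"
    using e.regular_\<psi>[OF p f] unfolding e.E.regular_iff[OF \<phi>p] by blast
  have ev': "eventually (\<lambda>z. G (hcoord (V i) (e.\<phi> (pr z))) \<noteq> 0 \<and>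
    f (e.\<psi> (e.\<phi> (pr z))) = F (hcoord (V i) (e.\<phi> (pr z))) / G (hcoord (V i) (e.\<phi> (pr z)))) (X.germs (pt p c))"
    using filterlim_\<phi>_pr[OF p i(1), of c, OF i(2)] ev unfolding filterlim_iff by blast
  let ?F = "\<lambda>l. F (\<lambda>w. l (incl i w))" and ?G = "\<lambda>l. G (\<lambda>w. l (incl i w))"
  obtain w where w: "w \<in> V i" "w p \<noteq> 0" using e.section_nonzero[OF p] by blast
  \<comment> \<open>Near \<open>pt p c\<close> this keeps the fibre coordinate \<open>b i\<close>
    nonzero, so that its powers cancel in the quotient of the two pulled back forms.\<close>
  have "incl i w \<notin> pt p c" using incl_in_pt[OF i(1) w(1)] i w by simp
  from X.eventually_notin[OF x incl_in_W[OF i(1) w(1)] this] ev' X.eventually_in[OF x]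
  have "eventually (\<lambda>z. ?G (hcoord W z) \<noteq> 0 \<and> f (pr z) = ?F (hcoord W z) / ?G (hcoord W z)) (X.germs (pt p c))"
  proof eventually_elim
    case (elim z)
    obtain q b where q: "q \<in> C" "nonzero b" "z = pt q b" using elim(3) by (rule X_cases)
    have prz: "pr z = q" using q pr_pt by simp
    have bi: "b i \<noteq> 0" using elim(1) incl_in_pt[OF i(1) w(1)] q(3) by auto
    have \<phi>q: "e.\<phi> q \<in> e.\<phi> ` C" using q by blast
    have 1: "F (hcoord (V i) (e.\<phi> q)) / G (hcoord (V i) (e.\<phi> q)) = F (\<lambda>v. v q) / G (\<lambda>v. v q)"
      by (rule homog_poly_quotient_functional[OF F e.subspace_V e.E.hcoord[OF \<phi>q] e.functional_eval[OF q(1)]])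
    have 2: "G (\<lambda>v. v q) \<noteq> 0"
      using elim(2) homog_poly_functional[OF F(2) e.subspace_V e.E.hcoord[OF \<phi>q] e.functional_eval[OF q(1)]] prz by simp
    have 3: "?F (hcoord W z) / ?G (hcoord W z) = ?F (fl q b) / ?G (fl q b)"
      unfolding q(3) by (rule homog_poly_quotient_functional[OF form_incl(1)[OF F(1) i(1)] form_incl(1)[OF F(2) i(1)] subspace_W
        X.hcoord[OF pt_in_X[OF q(1,2)]] functional_pt[OF q(1,2)]])
    have 4: "?G (hcoord W z) = 0 \<longleftrightarrow> ?G (fl q b) = 0"
      unfolding q(3) by (rule homog_poly_functional[OF form_incl(1)[OF F(2) i(1)] subspace_W
        X.hcoord[OF pt_in_X[OF q(1,2)]] functional_pt[OF q(1,2)]])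
    have 5: "?F (fl q b) = b i ^ d * F (\<lambda>v. v q)" "?G (fl q b) = b i ^ d * G (\<lambda>v. v q)"
      using form_incl(2)[OF F(1) i(1)] form_incl(2)[OF F(2) i(1)] by auto
    show ?case
    proof
      show "?G (hcoord W z) \<noteq> 0" unfolding 4 5 using 2 bi by simp
      have "f q = F (\<lambda>v. v q) / G (\<lambda>v. v q)" using elim(2) prz 1 e.\<psi>_\<phi>[OF q(1)] by simp
      then show "f (pr z) = ?F (hcoord W z) / ?G (hcoord W z)" unfolding 3 5 prz using bi by simp
    qed
  qed
  then show ?thesis unfolding X.regular_iff[OF x] using form_incl(1)[OF F(1) i(1)] form_incl(1)[OF F(2) i(1)] by blast
qed

lemma mpow_pr:
  assumes p: "p \<in> C" and c: "nonzero c" and f: "f \<in> mpow p k"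
  shows "(\<lambda>z. f (pr z)) \<in> X.mpow (pt p c) k"
proof (rule mpow_pullback[OF X.quasiproj_axioms quasiproj_axioms pt_in_X[OF p c]])
  show "pr (pt p c) \<in> C" using pr_pt p c by simp
qed (use pr_pt p c filterlim_pr regular_pr f in auto)

text \<open>A section of the scroll near a point of the curve, with fibre coordinates
  \<open>m\<close> in the frames given by the sections \<open>v i\<close>. The division makes the
  functional at \<open>q\<close> send \<open>w\<close> to the sum of \<open>m i\<close> times the
  regular quotients \<open>w_i / v i\<close>.\<close>

definition local_section :: "(nat \<Rightarrow> 'x point \<Rightarrow> complex) \<Rightarrow> (nat \<Rightarrow> 'x point \<Rightarrow> complex) \<Rightarrow> 'x point \<Rightarrow> (nat \<times> 'x point) point"
  where "local_section v m q = pt q (\<lambda>i. m i q / v i q)"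

context
  fixes p :: "'x point" and v m :: "nat \<Rightarrow> 'x point \<Rightarrow> complex"
  assumes p: "p \<in> C" and v: "\<And>i. i \<in> {1..n} \<Longrightarrow> v i \<in> V i" "\<And>i. i \<in> {1..n} \<Longrightarrow> v i p \<noteq> 0"
    and m: "\<And>i. i \<in> {1..n} \<Longrightarrow> regular p (m i)" "\<exists>i\<in>{1..n}. m i p \<noteq> 0"
begin

lemma eventually_base_section: "eventually (\<lambda>q. \<forall>i\<in>{1..n}. v i q \<noteq> 0) (germs p)"
proof (intro eventually_ball_finite ballI)
  fix i assume i: "i \<in> {1..n}"
  show "eventually (\<lambda>q. v i q \<noteq> 0) (germs p)"
    by (rule embedded_curve.eventually_section_neq_0[OF embedded[OF i] p v(1)[OF i] v(2)[OF i]])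
qed simp

lemma eventually_nonzero: "eventually (\<lambda>q. nonzero (\<lambda>i. m i q / v i q)) (germs p)"
proof -
  obtain i where i: "i \<in> {1..n}" "m i p \<noteq> 0" using m(2) by blast
  from eventually_neq_0[OF p m(1)[OF i(1)] i(2)] eventually_base_section show ?thesis
    by eventually_elim (use i(1) in \<open>auto simp: nonzero_def\<close>)
qed

lemma section_nonzero_at: "nonzero (\<lambda>i. m i p / v i p)"
  using eventually_self[OF p eventually_nonzero] .

lemma regular_fl: assumes "w \<in> W" shows "regular p (\<lambda>q. fl q (\<lambda>i. m i q / v i q) w)"
proof -
  have "regular p (\<lambda>q. \<Sum>i\<in>{1..n}. m i q * (component i w q / v i q))"
  proof (intro regular_sum regular_mult p)
    fix i assume i: "i \<in> {1..n}"
    show "regular p (\<lambda>q. component i w q / v i q)"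
      by (rule embedded_curve.regular_quotient[OF embedded[OF i] p component_in_V[OF assms i] v(1)[OF i] v(2)[OF i]])
  qed (rule m(1))
  then show ?thesis unfolding fl_def component_def by simp
qed

lemma filterlim_local_section:
  "filterlim (local_section v m) (X.germs (local_section v m p)) (germs p)"
  unfolding filterlim_iff
proof (intro allI impI)
  have x: "local_section v m p \<in> X" unfolding local_section_def by (rule pt_in_X[OF p section_nonzero_at])
  fix P assume "eventually P (X.germs (local_section v m p))"
  then obtain U where U: "openin (zariski W) U" "local_section v m p \<in> U" "\<forall>z\<in>U \<inter> X. P z"
    unfolding X.eventually_germs[OF x] by blast
  obtain d F where F: "homog_poly W d F" "local_section v m p \<in> nonzero_locus W F" "nonzero_locus W F \<subseteq> U"
    using zariski_base[OF U(1,2)] .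
  have locus: "local_section v m q \<in> nonzero_locus W F \<longleftrightarrow> F (fl q (\<lambda>i. m i q / v i q)) \<noteq> 0"
    if "q \<in> C" "nonzero (\<lambda>i. m i q / v i q)" for q
    unfolding local_section_def by (rule mem_nonzero_locus[OF fin_dim_W F(1) functional_pt[OF that]])
  have "regular p (\<lambda>q. F (fl q (\<lambda>i. m i q / v i q)))" by (rule regular_form[OF p F(1) regular_fl])
  from eventually_neq_0[OF p this] locus[OF p section_nonzero_at] F(2)
  have "eventually (\<lambda>q. F (fl q (\<lambda>i. m i q / v i q)) \<noteq> 0) (germs p)" by blast
  with eventually_nonzero eventually_in[OF p]
  show "eventually (\<lambda>q. P (local_section v m q)) (germs p)"
  proof eventually_elim
    case (elim q)
    then have "local_section v m q \<in> U" using locus F(3) by blast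
    moreover have "local_section v m q \<in> X" unfolding local_section_def by (rule pt_in_X[OF elim(2,1)])
    ultimately show ?case using U(3) by blast
  qed
qed

lemma regular_local_section:
  assumes "X.regular (local_section v m p) h" shows "regular p (\<lambda>q. h (local_section v m q))"
proof -
  have x: "local_section v m p \<in> X" unfolding local_section_def by (rule pt_in_X[OF p section_nonzero_at])
  obtain d F G where F: "homog_poly W d F" "homog_poly W d G"
    "eventually (\<lambda>z. G (hcoord W z) \<noteq> 0 \<and> h z = F (hcoord W z) / G (hcoord W z)) (X.germs (local_section v m p))"
    using assms unfolding X.regular_iff[OF x] by blast
  let ?f = "\<lambda>q. fl q (\<lambda>i. m i q / v i q)"
  have ev: "eventually (\<lambda>q. G (hcoord W (local_section v m q)) \<noteq> 0 \<and>
    h (local_section v m q) = F (hcoord W (local_section v m q)) / G (hcoord W (local_section v m q))) (germs p)"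
    using filterlim_local_section F(3) unfolding filterlim_iff by blast
  have G0: "G (hcoord W (local_section v m q)) = 0 \<longleftrightarrow> G (?f q) = 0"
    and quot: "F (hcoord W (local_section v m q)) / G (hcoord W (local_section v m q)) = F (?f q) / G (?f q)"
    if "q \<in> C" "nonzero (\<lambda>i. m i q / v i q)" for q
    unfolding local_section_def
    using homog_poly_functional[OF F(2) subspace_W X.hcoord[OF pt_in_X[OF that]] functional_pt[OF that]]
      homog_poly_quotient_functional[OF F(1,2) subspace_W X.hcoord[OF pt_in_X[OF that]] functional_pt[OF that]] by auto
  have "G (?f p) \<noteq> 0" using eventually_self[OF p ev] G0[OF p section_nonzero_at] by blast
  then have "regular p (\<lambda>q. F (?f q) / G (?f q))"
    by (intro regular_divide regular_form[OF p F(1) regular_fl] regular_form[OF p F(2) regular_fl] p)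
  then show ?thesis
    by (rule regular_cong[OF p]) (use ev eventually_nonzero eventually_in[OF p] in eventually_elim, use quot in auto)
qed

lemma mpow_local_section:
  assumes "h \<in> X.mpow (local_section v m p) k" shows "(\<lambda>q. h (local_section v m q)) \<in> mpow p k"
proof -
  have x: "local_section v m p \<in> X" unfolding local_section_def by (rule pt_in_X[OF p section_nonzero_at])
  show ?thesis
    by (rule mpow_pullback[OF quasiproj_axioms X.quasiproj_axioms p x filterlim_local_section _ assms])
      (rule regular_local_section)
qed

end

end

section \<open>Osculating spaces of decomposable scrolls\<close>

text \<open>As long as the order \<open>j\<close> of \<open>r\<close> is below \<open>k\<close>, its
  leading coefficient is also that of the product at order \<open>j + 1\<close>, where it must
  vanish.\<close>

lemma (in smooth_curve) local_param_divide:
  assumes p: "p \<in> C" and t: "local_param p t" and r: "regular p r"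
    and tr: "(\<lambda>z. r z * (t z - t p)) \<in> mpow p (Suc k)"
  shows "r \<in> mpow p k"
proof -
  have "r \<in> mpow p j" if "j \<le> k" for j
    using that
  proof (induction j)
    case 0
    then show ?case using r mpow_0_iff[OF p] by blast
  next
    case (Suc j)
    then have "r \<in> mpow p j" by simp
    from mpow_principal[OF p t this] obtain a where a: "regular p a" "eventually (\<lambda>z. r z = a z * (t z - t p) ^ j) (germs p)"
      by blast
    have "(\<lambda>z. a z * (t z - t p) ^ Suc j) \<in> mpow p (Suc k)"
      by (rule mpow_cong[OF p tr]) (use a(2) in eventually_elim, simp)
    then have "(\<lambda>z. a z * (t z - t p) ^ Suc j) \<in> mpow p (Suc (Suc j))"
      using mpow_antimono[OF p, of "Suc (Suc j)" "Suc k"] Suc.prems by auto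
    from local_param_leading[OF p t a(1) this] have "a p = 0" .
    from mpow_Suc_local_param[OF p t a(1) this, of j] show ?case
      by (rule mpow_cong[OF p]) (use a(2) in eventually_elim, simp)
  qed
  then show ?thesis by blast
qed

context scroll
begin

lemma pt_cong: "(\<And>i. i \<in> {1..n} \<Longrightarrow> c i = d i) \<Longrightarrow> pt p c = pt p d"
proof -
  assume "\<And>i. i \<in> {1..n} \<Longrightarrow> c i = d i"
  then have "fl p c = fl p d" unfolding fl_def fun_eq_iff by (intro allI sum.cong) auto
  then show ?thesis unfolding pt_def by simp
qed

text \<open>The kernel that defines the span of the tangent lines to the curves at the points over
  \<open>p\<close>.\<close>

definition first_order :: "'x point \<Rightarrow> (nat \<times> 'x point \<Rightarrow> complex) set"
  where "first_order p = {w \<in> W. \<forall>i\<in>{1..n}. component i w \<in> van i 2 p}"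

context
  fixes p :: "'x point" and c :: "nat \<Rightarrow> complex" and v0 :: "nat \<Rightarrow> 'x point \<Rightarrow> complex"
  assumes p: "p \<in> C" and c: "nonzero c"
    and v0: "\<And>i. i \<in> {1..n} \<Longrightarrow> v0 i \<in> V i" "\<And>i. i \<in> {1..n} \<Longrightarrow> v0 i p \<noteq> 0"
begin

lemma regular_component_quotient:
  "i \<in> {1..n} \<Longrightarrow> w \<in> W \<Longrightarrow> regular p (\<lambda>q. component i w q / v0 i q)"
  by (rule embedded_curve.regular_quotient[OF embedded p component_in_V v0])

lemma mem_van: "i \<in> {1..n} \<Longrightarrow> v \<in> van i k p \<longleftrightarrow> v \<in> V i \<and> (\<lambda>q. v q / v0 i q) \<in> mpow p k"
  by (rule embedded_curve.mem_vanish[OF embedded p v0])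

text \<open>Restriction to the local section with coordinates \<open>m\<close> preserves powers of
  the maximal ideal. The prescribed values \<open>m i p\<close> make this section pass through
  \<open>pt p c\<close>.\<close>

lemma jet_kernel_pullback:
  assumes w: "w \<in> jet_kernel W X 2 (pt p c)"
    and m: "\<And>i. i \<in> {1..n} \<Longrightarrow> regular p (m i)" "\<And>i. i \<in> {1..n} \<Longrightarrow> m i p = c i * v0 i p"
  shows "(\<lambda>q. \<Sum>i\<in>{1..n}. m i q * (component i w q / v0 i q)) \<in> mpow p 3"
proof -
  obtain u where u: "w \<in> W" "u \<in> W" "u \<notin> pt p c" "(\<lambda>z. hcoord W z w / hcoord W z u) \<in> X.mpow (pt p c) 3"
    using w unfolding jet_kernel_def by auto
  have m': "\<exists>i\<in>{1..n}. m i p \<noteq> 0" using c m(2) v0(2) unfolding nonzero_def by auto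
  have ls: "local_section v0 m p = pt p c" unfolding local_section_def
    by (rule pt_cong) (use m(2) v0(2) in auto)
  have fleq: "fl q (\<lambda>i. m i q / v0 i q) w = (\<Sum>i\<in>{1..n}. m i q * (component i w q / v0 i q))" for q
    unfolding fl_def component_def by (simp add: algebra_simps)
  note uses = p v0 m(1) m'
  have h: "(\<lambda>z. hcoord W z w / hcoord W z u) \<in> X.mpow (local_section v0 m p) 3" using u(4) ls by simp
  have pull: "(\<lambda>q. hcoord W (local_section v0 m q) w / hcoord W (local_section v0 m q) u) \<in> mpow p 3"
    by (rule mpow_local_section) (fact uses h)+
  have ru: "regular p (\<lambda>q. fl q (\<lambda>i. m i q / v0 i q) u)" by (rule regular_fl) (fact uses u(2))+
  have nz: "eventually (\<lambda>q. nonzero (\<lambda>i. m i q / v0 i q)) (germs p)" by (rule eventually_nonzero) (fact uses)+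
  have "fl p (\<lambda>i. m i p / v0 i p) u \<noteq> 0"
    using u(2,3) ls unfolding local_section_def pt_def by blast
  from eventually_neq_0[OF p ru this] nz eventually_in[OF p]
  have "eventually (\<lambda>q. fl q (\<lambda>i. m i q / v0 i q) u * (hcoord W (local_section v0 m q) w / hcoord W (local_section v0 m q) u)
    = (\<Sum>i\<in>{1..n}. m i q * (component i w q / v0 i q))) (germs p)"
  proof eventually_elim
    case (elim q)
    show ?case unfolding local_section_def hcoord_quotient_pt[OF elim(3,2) u(1,2)] fleq[symmetric] using elim(1) by simp
  qed
  with mpow_regular_mult[OF p ru pull] show ?thesis by (rule mpow_cong[OF p])
qed

text \<open>One inclusion compares restrictions to two sections through the point that differ in
  first order. The other splits \<open>w / u\<close> into a part pulled back from the curve and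
  products of a factor vanishing at the point with one of order 2.\<close>

lemma jet_kernel_scroll:
  "jet_kernel W X 2 (pt p c) = {w \<in> first_order p.
    (\<lambda>q. \<Sum>i\<in>{1..n}. (c i * v0 i p) * (component i w q / v0 i q)) \<in> mpow p 3}"
proof (intro equalityI subsetI)
  fix w assume w: "w \<in> jet_kernel W X 2 (pt p c)"
  then have wW: "w \<in> W" unfolding jet_kernel_def by blast
  obtain t where t: "local_param p t" "t p = 0" using local_param_exists[OF p] by blast
  have tr: "regular p t" using t unfolding local_param_def by blast
  \<comment> \<open>The section with constant fibre coordinates gives the condition of order
    3.\<close>
  have const: "(\<lambda>q. \<Sum>i\<in>{1..n}. (c i * v0 i p) * (component i w q / v0 i q)) \<in> mpow p 3"
    by (rule jet_kernel_pullback[OF w]) (auto intro: regular_const p)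
  have "component j w \<in> van j 2 p" if j: "j \<in> {1..n}" for j
  proof -
    \<comment> \<open>Tilting the section by \<open>t\<close> in the direction \<open>j\<close>
      changes the restriction by \<open>t\<close> times the \<open>j\<close>-th component. The
      difference has order 3, so that component has order 2.\<close>
    have "(\<lambda>q. \<Sum>i\<in>{1..n}. (c i * v0 i p + (if i = j then t q else 0)) * (component i w q / v0 i q)) \<in> mpow p 3"
    proof (rule jet_kernel_pullback[OF w])
      fix i
      show "regular p (\<lambda>q. c i * v0 i p + (if i = j then t q else 0))"
        using tr by (cases "i = j") (auto intro!: regular_add regular_const p)
      show "c i * v0 i p + (if i = j then t p else 0) = c i * v0 i p" using t(2) by simp
    qed
    from mpow_diff[OF p this const]
    have "(\<lambda>q. (\<Sum>i\<in>{1..n}. (c i * v0 i p + (if i = j then t q else 0)) * (component i w q / v0 i q)) -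
      (\<Sum>i\<in>{1..n}. (c i * v0 i p) * (component i w q / v0 i q))) \<in> mpow p 3" .
    moreover have "(\<Sum>i\<in>{1..n}. (c i * v0 i p + (if i = j then t q else 0)) * (component i w q / v0 i q)) -
      (\<Sum>i\<in>{1..n}. (c i * v0 i p) * (component i w q / v0 i q)) = component j w q / v0 j q * (t q - t p)" for q
    proof -
      have "(\<Sum>i\<in>{1..n}. (c i * v0 i p + (if i = j then t q else 0)) * (component i w q / v0 i q)) -
        (\<Sum>i\<in>{1..n}. (c i * v0 i p) * (component i w q / v0 i q)) =
        (\<Sum>i\<in>{1..n}. if i = j then t q * (component j w q / v0 j q) else 0)"
        unfolding sum_subtractf[symmetric] by (intro sum.cong) (auto simp: algebra_simps add_divide_distrib)
      also have "\<dots> = t q * (component j w q / v0 j q)" using j by (simp add: sum.delta)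
      finally show ?thesis using t(2) by simp
    qed
    ultimately have "(\<lambda>q. component j w q / v0 j q * (t q - t p)) \<in> mpow p (Suc 2)"
      by (simp add: numeral_3_eq_3 numeral_2_eq_2)
    from local_param_divide[OF p t(1) regular_component_quotient[OF j wW] this]
    show ?thesis using mem_van[OF j] component_in_V[OF wW j] by blast
  qed
  then show "w \<in> {w \<in> first_order p. (\<lambda>q. \<Sum>i\<in>{1..n}. (c i * v0 i p) * (component i w q / v0 i q)) \<in> mpow p 3}"
    using wW const unfolding first_order_def by blast
next
  fix w assume "w \<in> {w \<in> first_order p. (\<lambda>q. \<Sum>i\<in>{1..n}. (c i * v0 i p) * (component i w q / v0 i q)) \<in> mpow p 3}"
  then have w: "w \<in> W" "\<And>i. i \<in> {1..n} \<Longrightarrow> component i w \<in> van i 2 p"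
    and w3: "(\<lambda>q. \<Sum>i\<in>{1..n}. (c i * v0 i p) * (component i w q / v0 i q)) \<in> mpow p 3"
    unfolding first_order_def by auto
  obtain k where k: "k \<in> {1..n}" "c k \<noteq> 0" using c unfolding nonzero_def by blast
  define x where "x = pt p c"
  have x: "x \<in> X" unfolding x_def by (rule pt_in_X[OF p c])
  define u where "u = incl k (v0 k)"
  have u: "u \<in> W" "u \<notin> x" unfolding u_def x_def using incl_in_W incl_in_pt k v0 by auto
  \<comment> \<open>Affine fibre coordinates on the chart where the \<open>k\<close>-th one is
    nonzero; with them \<open>w / u\<close> is the sum of the \<open>m i\<close> times the pulled
    back quotients \<open>r i\<close>.\<close>
  define m where "m i = (\<lambda>z. hcoord W z (incl i (v0 i)) / hcoord W z u)" for i
  define r where "r i = (\<lambda>q. component i w q / v0 i q)" for i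
  have mr: "X.regular x (m i)" if "i \<in> {1..n}" for i
    unfolding m_def by (rule X.regular_linear_quotient[OF x incl_in_W u]) (use that v0 in auto)
  have mpt: "m i (pt q d) = (d i * v0 i q) / (d k * v0 k q)" if "i \<in> {1..n}" "q \<in> C" "nonzero d" for i q d
    unfolding m_def u_def
    using hcoord_quotient_pt[OF that(2,3) incl_in_W[OF that(1) v0(1)[OF that(1)]] u(1)[unfolded u_def]]
      fl_incl that(1) k(1) by simp
  have r2: "r i \<in> mpow p 2" if "i \<in> {1..n}" for i using w(2)[OF that] mem_van[OF that] unfolding r_def by blast
  \<comment> \<open>The coordinates \<open>m i\<close> are first frozen at their values at
    \<open>x\<close>. The scalar comes from the normalisation by the \<open>k\<close>-th coordinate,
    and the hypothesis of order 3 applies.\<close>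
  have part1: "(\<lambda>z. inverse (c k * v0 k p) * (\<Sum>i\<in>{1..n}. (c i * v0 i p) * r i (pr z))) \<in> X.mpow x 3"
    using X.mpow_scale[OF x mpow_pr[OF p c w3, folded x_def]] unfolding r_def .
  \<comment> \<open>The change of \<open>m i\<close> contributes one order and \<open>r i\<close>
    contributes two.\<close>
  have "(\<lambda>z. \<Sum>i\<in>{1..n}. (m i z - m i x) * r i (pr z)) \<in> X.mpow x (1 + 2)"
  proof (intro X.mpow_sum[OF x] X.mpow_mult[OF x])
    fix i assume i: "i \<in> {1..n}"
    show "(\<lambda>z. m i z - m i x) \<in> X.mpow x 1"
      using X.mpow_1_iff[OF x] X.regular_diff[OF x mr[OF i] X.regular_const[OF x]] by simp
    show "(\<lambda>z. r i (pr z)) \<in> X.mpow x 2" unfolding x_def by (rule mpow_pr[OF p c r2[OF i]])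
  qed
  then have part2: "(\<lambda>z. \<Sum>i\<in>{1..n}. (m i z - m i x) * r i (pr z)) \<in> X.mpow x 3"
    by (simp add: numeral_3_eq_3)
  have ev0: "eventually (\<lambda>q. \<forall>i\<in>{1..n}. v0 i q \<noteq> 0) (germs p)"
  proof (rule eventually_base_section[where m = "\<lambda>i q. 1"])
    show "\<exists>i\<in>{1..n}. (1::complex) \<noteq> 0" using k(1) by auto
    show "\<And>i. regular p (\<lambda>q. 1)" by (rule regular_const[OF p])
  qed (fact p v0)+
  then have "eventually (\<lambda>z. \<forall>i\<in>{1..n}. v0 i (pr z) \<noteq> 0) (X.germs x)"
    using filterlim_pr[OF p c] unfolding filterlim_iff x_def by blast
  with X.eventually_notin[OF x u] X.eventually_in[OF x]
  have "eventually (\<lambda>z. inverse (c k * v0 k p) * (\<Sum>i\<in>{1..n}. (c i * v0 i p) * r i (pr z)) +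
    (\<Sum>i\<in>{1..n}. (m i z - m i x) * r i (pr z)) = hcoord W z w / hcoord W z u) (X.germs x)"
  proof eventually_elim
    case (elim z)
    obtain q d where q: "q \<in> C" "nonzero d" "z = pt q d" using elim(2) by (rule X_cases)
    have prz: "pr z = q" using q pr_pt by simp
    have dk: "d k * v0 k q \<noteq> 0" using elim(1) incl_in_pt[OF k(1) v0(1)[OF k(1)]] q(3) unfolding u_def by auto
    have "inverse (c k * v0 k p) * (\<Sum>i\<in>{1..n}. (c i * v0 i p) * r i (pr z)) = (\<Sum>i\<in>{1..n}. m i x * r i q)"
      unfolding prz sum_distrib_left x_def using mpt[OF _ p c] by (intro sum.cong) (auto simp: divide_inverse mult_ac)
    then have "inverse (c k * v0 k p) * (\<Sum>i\<in>{1..n}. (c i * v0 i p) * r i (pr z)) +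
      (\<Sum>i\<in>{1..n}. (m i z - m i x) * r i (pr z)) = (\<Sum>i\<in>{1..n}. m i z * r i q)"
      unfolding prz by (simp add: sum.distrib[symmetric] algebra_simps)
    also have "\<dots> = (\<Sum>i\<in>{1..n}. d i * w (i, q)) / (d k * v0 k q)"
      unfolding sum_divide_distrib
    proof (rule sum.cong)
      fix i assume i: "i \<in> {1..n}"
      have "v0 i q \<noteq> 0" using elim(3) prz i by blast
      then show "m i z * r i q = d i * w (i, q) / (d k * v0 k q)"
        unfolding q(3) mpt[OF i q(1,2)] r_def component_def by simp
    qed simp
    also have "\<dots> = hcoord W z w / hcoord W z u"
      unfolding q(3) hcoord_quotient_pt[OF q(1,2) w(1) u(1)] unfolding u_def fl_incl[OF k(1)] by (simp only: fl_def)
    finally show ?case .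
  qed
  with X.mpow_add[OF x part1 part2] have "(\<lambda>z. hcoord W z w / hcoord W z u) \<in> X.mpow x 3"
    by (rule X.mpow_cong[OF x])
  then show "w \<in> jet_kernel W X 2 (pt p c)" unfolding jet_kernel_def x_def[symmetric] using w(1) u by auto
qed

end

section \<open>Codimension of the first-order sections and the inflection criterion\<close>

lemma subspace_van: "i \<in> {1..n} \<Longrightarrow> p \<in> C \<Longrightarrow> cfun.subspace (van i k p)"
  by (rule embedded_curve.subspace_vanish[OF embedded])

lemma van_subset: "i \<in> {1..n} \<Longrightarrow> van i k p \<subseteq> V i"
  using embedded_curve.vanish_def[OF embedded] by blast

lemma subspace_components:
  assumes "\<And>i. i \<in> {1..n} \<Longrightarrow> cfun.subspace (K i)"
  shows "cfun.subspace {w \<in> W. \<forall>i\<in>{1..n}. component i w \<in> K i}"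
  unfolding cfun.subspace_def
  using subspace_W assms
  by (auto simp: component_add component_scale component_zero cfun.subspace_add cfun.subspace_scale cfun.subspace_0
     simp del: atLeastAtMost_iff)

lemma subspace_first_order: "p \<in> C \<Longrightarrow> cfun.subspace (first_order p)"
  unfolding first_order_def by (rule subspace_components[OF subspace_van])

text \<open>Each curve contributes two conditions, the value and the first derivative of the
  component at \<open>p\<close>.\<close>

lemma dim_first_order:
  assumes p: "p \<in> C" shows "cfun.dim W = cfun.dim (first_order p) + 2 * n"
proof -
  obtain v0 where "\<forall>i\<in>{1..n}. v0 i \<in> V i \<and> v0 i p \<noteq> 0" using base_section_exists[OF p] by (rule exE)
  then have v0: "\<And>i. i \<in> {1..n} \<Longrightarrow> v0 i \<in> V i" "\<And>i. i \<in> {1..n} \<Longrightarrow> v0 i p \<noteq> 0" by auto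
  have "\<forall>i\<in>{1..n}. \<exists>u. u \<in> V i \<and> u p = 0 \<and> local_param p (\<lambda>q. u q / v0 i q)"
  proof
    fix i assume i: "i \<in> {1..n}"
    show "\<exists>u. u \<in> V i \<and> u p = 0 \<and> local_param p (\<lambda>q. u q / v0 i q)"
      by (rule embedded_curve.local_param_section[OF embedded[OF i] p v0(1)[OF i] v0(2)[OF i]]) blast
  qed
  from bchoice[OF this] obtain u where u: "\<forall>i\<in>{1..n}. u i \<in> V i \<and> u i p = 0 \<and> local_param p (\<lambda>q. u i q / v0 i q)"
    by (rule exE)
  \<comment> \<open>A basis modulo \<open>first_order p\<close>: in each summand a section nonzero
    at \<open>p\<close> and one whose quotient by it is a local parameter.\<close>
  define e where "e = (\<lambda>(i, b). incl i (if b then u i else v0 i))"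
  have comp_e: "component i (\<Sum>x\<in>{1..n} \<times> UNIV. cscale (a x) (e x)) = cscale (a (i, False)) (v0 i) + cscale (a (i, True)) (u i)"
    if i: "i \<in> {1..n}" for a i
  proof -
    have "component i (\<Sum>x\<in>{1..n} \<times> UNIV. cscale (a x) (e x)) = (\<Sum>j\<in>{1..n}. \<Sum>b\<in>UNIV. cscale (a (j, b)) (component i (e (j, b))))"
      unfolding component_sum component_scale sum.cartesian_product by (simp add: case_prod_unfold)
    also have "\<dots> = (\<Sum>j\<in>{1..n}. if j = i then cscale (a (i, False)) (v0 i) + cscale (a (i, True)) (u i) else 0)"
      by (intro sum.cong) (auto simp: UNIV_bool e_def component_incl add.commute simp del: plus_fun_apply)
    also have "\<dots> = cscale (a (i, False)) (v0 i) + cscale (a (i, True)) (u i)" using i by (simp only: sum.delta finite_atLeastAtMost if_True)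
    finally show ?thesis .
  qed
  have "cfun.dim W = cfun.dim (first_order p) + card ({1..n} \<times> (UNIV :: bool set))"
  proof (rule dim_complement[where e = e])
    show "finite ({1..n} \<times> (UNIV :: bool set))" by simp
    show "first_order p \<subseteq> W" unfolding first_order_def by blast
    show "e x \<in> W" if "x \<in> {1..n} \<times> UNIV" for x
      using that v0(1) u incl_in_W unfolding e_def by auto
  next
    fix w assume w: "w \<in> W"
    have "\<forall>i\<in>{1..n}. \<exists>b. component i w - cscale (w (i, p) / v0 i p) (v0 i) - cscale b (u i) \<in> van i 2 p"
    proof
      fix i assume i: "i \<in> {1..n}"
      let ?r = "\<lambda>q. component i w q / v0 i q"
      have ui: "u i \<in> V i" "u i p = 0" "local_param p (\<lambda>q. u i q / v0 i q)" using u i by auto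
      have rr: "regular p ?r" by (rule embedded_curve.regular_quotient[OF embedded[OF i] p component_in_V[OF w i] v0(1)[OF i] v0(2)[OF i]])
      have "(\<lambda>z. ?r z - ?r p) \<in> mpow p 1" by (rule mpow_1_diffI[OF p rr])
      from local_param_cotangent[OF p ui(3) this] obtain b where b: "(\<lambda>z. (?r z - ?r p) - b * (u i z / v0 i z - u i p / v0 i p)) \<in> mpow p 2" by (rule exE)
      have "(\<lambda>q. (component i w - cscale (w (i, p) / v0 i p) (v0 i) - cscale b (u i)) q / v0 i q) \<in> mpow p 2"
      proof (rule mpow_cong[OF p b])
        show "eventually (\<lambda>z. (?r z - ?r p) - b * (u i z / v0 i z - u i p / v0 i p) =
          (component i w - cscale (w (i, p) / v0 i p) (v0 i) - cscale b (u i)) z / v0 i z) (germs p)"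
          using embedded_curve.eventually_section_neq_0[OF embedded[OF i] p v0(1)[OF i] v0(2)[OF i]]
          by eventually_elim (simp add: ui(2) component_def cscale_def diff_divide_distrib)
      qed
      moreover have "component i w - cscale (w (i, p) / v0 i p) (v0 i) - cscale b (u i) \<in> V i"
        by (intro cfun.subspace_diff cfun.subspace_scale subspace_V i component_in_V w v0 ui(1))
      ultimately show "\<exists>b. component i w - cscale (w (i, p) / v0 i p) (v0 i) - cscale b (u i) \<in> van i 2 p"
        using embedded_curve.mem_vanish[OF embedded[OF i] p v0(1)[OF i] v0(2)[OF i]] by blast
    qed
    from bchoice[OF this] obtain b where b: "\<forall>i\<in>{1..n}. component i w - cscale (w (i, p) / v0 i p) (v0 i) - cscale (b i) (u i) \<in> van i 2 p"
      by (rule exE)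
    \<comment> \<open>The value at \<open>p\<close> and the derivative at \<open>p\<close> of each
      component relative to \<open>v0 i\<close>.\<close>
    let ?a = "\<lambda>(i, s). if s then b i else w (i, p) / v0 i p"
    have "(\<Sum>x\<in>{1..n} \<times> UNIV. cscale (?a x) (e x)) \<in> W"
    proof (intro cfun.subspace_sum cfun.subspace_scale subspace_W)
      fix x :: "nat \<times> bool" assume "x \<in> {1..n} \<times> UNIV"
      then show "e x \<in> W" using v0(1) u incl_in_W unfolding e_def by auto
    qed
    then have inW: "w - (\<Sum>x\<in>{1..n} \<times> UNIV. cscale (?a x) (e x)) \<in> W" by (rule cfun.subspace_diff[OF subspace_W w])
    have "component i (w - (\<Sum>x\<in>{1..n} \<times> UNIV. cscale (?a x) (e x))) \<in> van i 2 p" if i: "i \<in> {1..n}" for i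
      unfolding component_diff comp_e[OF i] using b i by (simp add: diff_diff_eq)
    then have "w - (\<Sum>x\<in>{1..n} \<times> UNIV. cscale (?a x) (e x)) \<in> first_order p" using inW unfolding first_order_def by blast
    then show "\<exists>a. w - (\<Sum>x\<in>{1..n} \<times> UNIV. cscale (a x) (e x)) \<in> first_order p" by (rule exI[of _ ?a])
  next
    fix a assume "(\<Sum>x\<in>{1..n} \<times> UNIV. cscale (a x) (e x)) \<in> first_order p"
    then have all: "\<forall>i\<in>{1..n}. component i (\<Sum>x\<in>{1..n} \<times> UNIV. cscale (a x) (e x)) \<in> van i 2 p"
      unfolding first_order_def by blast
    have mem: "cscale (a (i, False)) (v0 i) + cscale (a (i, True)) (u i) \<in> van i 2 p" if i: "i \<in> {1..n}" for i
      using bspec[OF all i] unfolding comp_e[OF i] .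
    have "a (i, False) = 0 \<and> a (i, True) = 0" if i: "i \<in> {1..n}" for i
    proof -
      have ui: "u i \<in> V i" "u i p = 0" "local_param p (\<lambda>q. u i q / v0 i q)" using u i by auto
      have m: "(\<lambda>q. (cscale (a (i, False)) (v0 i) + cscale (a (i, True)) (u i)) q / v0 i q) \<in> mpow p 2"
        using mem[OF i] embedded_curve.mem_vanish[OF embedded[OF i] p v0(1)[OF i] v0(2)[OF i]] by blast
      have "a (i, False) = 0" using mpow_eval[OF p m] v0(2)[OF i] ui(2) by (simp add: cscale_def)
      then have "(\<lambda>q. a (i, True) * (u i q / v0 i q - u i p / v0 i p) ^ 1) \<in> mpow p (Suc 1)"
        using m ui(2) by (simp add: cscale_def numeral_2_eq_2)
      from local_param_leading[OF p ui(3) regular_const[OF p] this] show ?thesis using \<open>a (i, False) = 0\<close> by simp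
    qed
    then have "a (i, s) = 0" if "i \<in> {1..n}" for i s using that by (cases s) auto
    then show "\<forall>x\<in>{1..n} \<times> UNIV. a x = 0" by blast
  qed (fact fin_dim_W, rule subspace_first_order[OF p])
  then show ?thesis by simp
qed

text \<open>On \<open>first_order p\<close> only the condition of order 3 on the weighted sum is
  left. Sections from a single summand show that it is vacuous exactly when each summand with
  nonzero weight satisfies it alone, which is inflection of that curve.\<close>

lemma jet_kernel_subset:
  assumes "p \<in> C" "nonzero c"
  shows "cfun.subspace (jet_kernel W X 2 (pt p c))" "jet_kernel W X 2 (pt p c) \<subseteq> first_order p"
    "jet_kernel W X 2 (pt p c) = first_order p \<longleftrightarrow> (\<forall>i\<in>{1..n}. c i \<noteq> 0 \<longrightarrow> infl i p)"
proof -
  note p = assms(1)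
  obtain v0 where "\<forall>i\<in>{1..n}. v0 i \<in> V i \<and> v0 i p \<noteq> 0" using base_section_exists[OF p] by (rule exE)
  then have v0: "\<And>i. i \<in> {1..n} \<Longrightarrow> v0 i \<in> V i" "\<And>i. i \<in> {1..n} \<Longrightarrow> v0 i p \<noteq> 0" by auto
  have jk: "jet_kernel W X 2 (pt p c) = {w \<in> first_order p. (\<lambda>q. \<Sum>i\<in>{1..n}. (c i * v0 i p) * (component i w q / v0 i q)) \<in> mpow p 3}"
    by (rule jet_kernel_scroll[OF assms v0])
  show "jet_kernel W X 2 (pt p c) \<subseteq> first_order p" unfolding jk by blast
  note sub = subspace_first_order[OF p]
  show "cfun.subspace (jet_kernel W X 2 (pt p c))" unfolding jk cfun.subspace_def
  proof (intro conjI ballI allI; unfold mem_Collect_eq; (intro conjI)?)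
    show "0 \<in> first_order p" by (rule cfun.subspace_0[OF sub])
    show "(\<lambda>q. \<Sum>i\<in>{1..n}. (c i * v0 i p) * (component i 0 q / v0 i q)) \<in> mpow p 3"
      unfolding component_zero using mpow_zero[OF p] by simp
    fix v w a
    assume v: "v \<in> first_order p \<and> (\<lambda>q. \<Sum>i\<in>{1..n}. (c i * v0 i p) * (component i v q / v0 i q)) \<in> mpow p 3"
    show "cscale a v \<in> first_order p" using cfun.subspace_scale[OF sub] v by blast
    show "(\<lambda>q. \<Sum>i\<in>{1..n}. (c i * v0 i p) * (component i (cscale a v) q / v0 i q)) \<in> mpow p 3"
    proof -
      have "(\<Sum>i\<in>{1..n}. (c i * v0 i p) * (component i (cscale a v) q / v0 i q)) =
        a * (\<Sum>i\<in>{1..n}. (c i * v0 i p) * (component i v q / v0 i q))" for q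
        unfolding component_scale sum_distrib_left by (intro sum.cong) (auto simp: cscale_def)
      then show ?thesis using mpow_scale[OF p conjunct2[OF v]] by (simp only:)
    qed
    assume w: "w \<in> first_order p \<and> (\<lambda>q. \<Sum>i\<in>{1..n}. (c i * v0 i p) * (component i w q / v0 i q)) \<in> mpow p 3"
    show "v + w \<in> first_order p" using cfun.subspace_add[OF sub] v w by blast
    show "(\<lambda>q. \<Sum>i\<in>{1..n}. (c i * v0 i p) * (component i (v + w) q / v0 i q)) \<in> mpow p 3"
    proof -
      have "(\<Sum>i\<in>{1..n}. (c i * v0 i p) * (component i (v + w) q / v0 i q)) =
        (\<Sum>i\<in>{1..n}. (c i * v0 i p) * (component i v q / v0 i q)) + (\<Sum>i\<in>{1..n}. (c i * v0 i p) * (component i w q / v0 i q))" for q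
        unfolding component_add sum.distrib[symmetric] by (intro sum.cong) (auto simp: add_divide_distrib algebra_simps)
      then show ?thesis using mpow_add[OF p conjunct2[OF v] conjunct2[OF w]] by (simp only:)
    qed
  qed
  show "jet_kernel W X 2 (pt p c) = first_order p \<longleftrightarrow> (\<forall>i\<in>{1..n}. c i \<noteq> 0 \<longrightarrow> infl i p)"
  proof
    assume eq: "jet_kernel W X 2 (pt p c) = first_order p"
    show "\<forall>i\<in>{1..n}. c i \<noteq> 0 \<longrightarrow> infl i p"
    proof (intro ballI impI)
      fix i assume i: "i \<in> {1..n}" "c i \<noteq> 0"
      interpret e: embedded_curve M C "L i" "V i" by (rule embedded[OF i(1)])
      show "infl i p" unfolding e.inflectional_def
      proof
        fix v assume v: "v \<in> van i 2 p"
        then have vV: "v \<in> V i" using van_subset[OF i(1)] by blast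
        have "component j (incl i v) \<in> van j 2 p" if "j \<in> {1..n}" for j
          using v cfun.subspace_0[OF subspace_van[OF that p]] unfolding component_incl by auto
        then have "incl i v \<in> first_order p" unfolding first_order_def using incl_in_W[OF i(1) vV] by blast
        then have "(\<lambda>q. \<Sum>j\<in>{1..n}. (c j * v0 j p) * (component j (incl i v) q / v0 j q)) \<in> mpow p 3"
          using eq unfolding jk by blast
        moreover have "(\<Sum>j\<in>{1..n}. (c j * v0 j p) * (component j (incl i v) q / v0 j q)) = (c i * v0 i p) * (v q / v0 i q)" for q
        proof -
          have "(\<Sum>j\<in>{1..n}. (c j * v0 j p) * (component j (incl i v) q / v0 j q)) = (\<Sum>j\<in>{1..n}. if j = i then (c i * v0 i p) * (v q / v0 i q) else 0)"
            unfolding component_incl by (intro sum.cong) auto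
          then show ?thesis using i(1) by (simp add: sum.delta)
        qed
        ultimately have "(\<lambda>q. (c i * v0 i p) * (v q / v0 i q)) \<in> mpow p 3" by simp
        from mpow_unit_cancel[OF p regular_const[OF p] _ this] have "(\<lambda>q. v q / v0 i q) \<in> mpow p 3" using i(2) v0(2)[OF i(1)] by simp
        then show "v \<in> van i 3 p" using e.mem_vanish[OF p v0(1)[OF i(1)] v0(2)[OF i(1)]] vV by blast
      qed
    qed
  next
    assume inf: "\<forall>i\<in>{1..n}. c i \<noteq> 0 \<longrightarrow> infl i p"
    have "(\<lambda>q. \<Sum>i\<in>{1..n}. (c i * v0 i p) * (component i w q / v0 i q)) \<in> mpow p 3" if w: "w \<in> first_order p" for w
    proof (rule mpow_sum[OF p])
      fix i assume i: "i \<in> {1..n}"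
      interpret e: embedded_curve M C "L i" "V i" by (rule embedded[OF i])
      show "(\<lambda>q. (c i * v0 i p) * (component i w q / v0 i q)) \<in> mpow p 3"
      proof (cases "c i = 0")
        case True
        then show ?thesis using mpow_zero[OF p] by simp
      next
        case False
        then have "infl i p" using inf i by blast
        moreover have "component i w \<in> van i 2 p" using w i unfolding first_order_def by blast
        ultimately have "component i w \<in> van i 3 p" unfolding e.inflectional_def by blast
        then have "(\<lambda>q. component i w q / v0 i q) \<in> mpow p 3" using e.mem_vanish[OF p v0(1)[OF i] v0(2)[OF i]] by blast
        then show ?thesis by (rule mpow_scale[OF p])
      qed
    qed
    then show "jet_kernel W X 2 (pt p c) = first_order p" unfolding jk by blast
  qed
qed

lemma first_order_subset: "first_order p \<subseteq> W"
  unfolding first_order_def by blast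

lemma pdim_first_order: "p \<in> C \<Longrightarrow> pdim W (Proj_quot W (first_order p)) = 2 * int n - 1"
  using pdim_Proj_quot[OF fin_dim_W subspace_first_order first_order_subset, of p] dim_first_order[of p] by simp

text \<open>\<open>first_order p\<close> has codimension \<open>2 * n\<close>. If it is the whole
  jet kernel, the osculating space has dimension \<open>2 * n - 1\<close>; a smaller jet kernel
  gives at least \<open>2 * n\<close>.\<close>

lemma inflectional_iff:
  assumes p: "p \<in> C" "nonzero c"
  shows "pt p c \<in> inflectional_locus W n X 2 \<longleftrightarrow> (\<forall>i\<in>{1..n}. c i \<noteq> 0 \<longrightarrow> infl i p)"
proof -
  let ?J = "jet_kernel W X 2 (pt p c)"
  note J = jet_kernel_subset[OF p]
  have JW: "?J \<subseteq> W" using J(2) first_order_subset by blast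
  have pd: "pdim W (Osc W X 2 (pt p c)) = int (cfun.dim W) - int (cfun.dim ?J) - 1"
    unfolding Osc_def by (rule pdim_Proj_quot[OF fin_dim_W J(1) JW])
  have fd: "fin_dim (first_order p)"
    by (rule fin_dim_subspace[OF fin_dim_W subspace_first_order[OF p(1)] first_order_subset])
  have "cfun.dim ?J = cfun.dim (first_order p) \<longleftrightarrow> ?J = first_order p"
    using dim_strict_mono_fin[OF fd J(1)] J(2) by fastforce
  moreover have "cfun.dim ?J \<le> cfun.dim (first_order p)" by (rule dim_mono_fin[OF fd J(1,2)])
  ultimately have "pdim W (Osc W X 2 (pt p c)) < int (n * 2) \<longleftrightarrow> ?J = first_order p"
    unfolding pd using dim_first_order[OF p(1)] by auto
  then show ?thesis unfolding inflectional_locus_def using J(3) pt_in_X[OF p] by blast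
qed

lemma Osc_inflectional:
  assumes "p \<in> C" "nonzero c" "pt p c \<in> inflectional_locus W n X 2"
  shows "Osc W X 2 (pt p c) = Proj_quot W (first_order p)"
  unfolding Osc_def using jet_kernel_subset(3)[OF assms(1,2)] inflectional_iff[OF assms(1,2)] assms(3) by simp

section \<open>Spans of osculating spaces and of points\<close>

lemma summand_incl_eq: "summand_incl n V i H = {v \<in> W. component i v \<in> H}"
  unfolding summand_incl_def component_def ..

lemma summand_incl_Proj:
  assumes i: "i \<in> {1..n}" and H: "H \<in> Proj (V i)" shows "summand_incl n V i H \<in> Proj W"
proof -
  interpret e: embedded_curve M C "L i" "V i" by (rule embedded[OF i])
  obtain l where l: "lin l" "\<exists>w\<in>V i. l w \<noteq> 0" "H = {w \<in> V i. l w = 0}"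
    using H unfolding Proj_iff[OF e.fin_dim_V] by blast
  obtain w where w: "w \<in> V i" "l w \<noteq> 0" using l(2) by blast
  have "lin (\<lambda>v. l (component i v))" using l(1) by (simp add: lin_iff component_add component_scale)
  moreover have "\<exists>v\<in>W. l (component i v) \<noteq> 0"
    using incl_in_W[OF i w(1)] w(2) component_incl[of i i w] by (intro bexI[of _ "incl i w"]) auto
  moreover have "summand_incl n V i H = {v \<in> W. l (component i v) = 0}"
    unfolding summand_incl_eq l(3) using component_in_V[OF _ i] by blast
  ultimately show ?thesis unfolding Proj_iff[OF fin_dim_W] by blast
qed

lemma pspan_summands:
  assumes J: "J \<subseteq> {1..n}" and S: "\<And>i. i \<in> J \<Longrightarrow> S i \<subseteq> Proj (V i)"
  shows "pspan W (\<Union>i\<in>J. summand_incl n V i ` S i) = Proj_quot W {w \<in> W. \<forall>i\<in>J. \<forall>H\<in>S i. component i w \<in> H}"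
proof -
  have "(\<Union>i\<in>J. summand_incl n V i ` S i) \<subseteq> Proj W" using summand_incl_Proj J S by blast
  from pspan_eq[OF fin_dim_W this] show ?thesis
    by (rule trans) (rule arg_cong[of _ _ "Proj_quot W"], auto simp: summand_incl_eq)
qed

text \<open>At an inflection point the second osculating space of the curve equals its tangent line,
  so the span is that of all tangent lines, whichever inflectional index comes first.\<close>

lemma pspan_Osc:
  assumes \<sigma>: "\<sigma> permutes {1..n}" and p: "p \<in> C" and inf: "infl (\<sigma> 1) p"
  shows "pspan W (summand_incl n V (\<sigma> 1) ` Osc (V (\<sigma> 1)) (linsys_map (V (\<sigma> 1)) ` C) 2 (linsys_map (V (\<sigma> 1)) p) \<union>
    (\<Union>i\<in>{2..n}. summand_incl n V (\<sigma> i) ` Osc (V (\<sigma> i)) (linsys_map (V (\<sigma> i)) ` C) 1 (linsys_map (V (\<sigma> i)) p)))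
    = Proj_quot W (first_order p)"
proof -
  let ?S = "\<lambda>i. Proj_quot (V i) (van i 2 p)"
  have \<sigma>i: "\<sigma> i \<in> {1..n}" if "i \<in> {1..n}" for i using permutes_in_image[OF \<sigma>] that by blast
  have O: "Osc (V (\<sigma> i)) (linsys_map (V (\<sigma> i)) ` C) k (linsys_map (V (\<sigma> i)) p) = Proj_quot (V (\<sigma> i)) (van (\<sigma> i) (k + 1) p)"
    if "i \<in> {1..n}" for i k
    unfolding Osc_def embedded_curve.jet_kernel_curve[OF embedded[OF \<sigma>i[OF that]] p] ..
  have n1: "1 \<in> {1..n}" using n by simp
  interpret e: embedded_curve M C "L (\<sigma> 1)" "V (\<sigma> 1)" by (rule embedded[OF \<sigma>i[OF n1]])
  have "van (\<sigma> 1) 3 p = van (\<sigma> 1) 2 p" using inf e.vanish_antimono[OF p, of 2 3] unfolding e.inflectional_def by auto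
  then have O1: "Osc (V (\<sigma> 1)) (linsys_map (V (\<sigma> 1)) ` C) 2 (linsys_map (V (\<sigma> 1)) p) = ?S (\<sigma> 1)"
    using O[OF n1, of 2] by simp
  have O2: "Osc (V (\<sigma> i)) (linsys_map (V (\<sigma> i)) ` C) 1 (linsys_map (V (\<sigma> i)) p) = ?S (\<sigma> i)" if "i \<in> {2..n}" for i
    using O[of i 1] that by (simp add: numeral_2_eq_2)
  have U: "{1..n} = insert 1 {2..n}" using n by auto
  have "(\<Union>i\<in>{1..n}. summand_incl n V i ` ?S i) = (\<Union>i\<in>\<sigma> ` {1..n}. summand_incl n V i ` ?S i)"
    unfolding permutes_image[OF \<sigma>] ..
  also have "\<dots> = (\<Union>i\<in>{1..n}. summand_incl n V (\<sigma> i) ` ?S (\<sigma> i))" by (rule UN_simps)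
  also have "\<dots> = summand_incl n V (\<sigma> 1) ` ?S (\<sigma> 1) \<union> (\<Union>i\<in>{2..n}. summand_incl n V (\<sigma> i) ` ?S (\<sigma> i))"
    unfolding U by simp
  finally have eq: "summand_incl n V (\<sigma> 1) ` Osc (V (\<sigma> 1)) (linsys_map (V (\<sigma> 1)) ` C) 2 (linsys_map (V (\<sigma> 1)) p) \<union>
    (\<Union>i\<in>{2..n}. summand_incl n V (\<sigma> i) ` Osc (V (\<sigma> i)) (linsys_map (V (\<sigma> i)) ` C) 1 (linsys_map (V (\<sigma> i)) p))
    = (\<Union>i\<in>{1..n}. summand_incl n V i ` ?S i)" unfolding O1 using O2 by simp
  have "{w \<in> W. \<forall>i\<in>{1..n}. \<forall>H\<in>?S i. component i w \<in> H} = first_order p"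
  proof -
    have "(\<forall>H\<in>?S i. component i w \<in> H) \<longleftrightarrow> component i w \<in> van i 2 p" if "w \<in> W" "i \<in> {1..n}" for i w
      using Inter_Proj_quot[OF embedded_curve.fin_dim_V[OF embedded[OF that(2)]] subspace_van[OF that(2) p] van_subset[OF that(2)], of 2]
        component_in_V[OF that] by blast
    then show ?thesis unfolding first_order_def by blast
  qed
  then show ?thesis unfolding eq using pspan_summands[of "{1..n}" ?S] unfolding Proj_quot_def by auto
qed

lemma point_span_eq:
  assumes I: "I \<subseteq> {1..n}" and p: "p \<in> C"
  shows "point_span n V I p = {pt p c | c. nonzero c \<and> (\<forall>i\<in>{1..n} - I. c i = 0)}"
proof -
  have S: "\<And>i. i \<in> I \<Longrightarrow> {linsys_map (V i) p} \<subseteq> Proj (V i)"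
    using embedded_curve.image_subset[OF embedded] I p by blast
  have "point_span n V I p = pspan W (\<Union>i\<in>I. summand_incl n V i ` {linsys_map (V i) p})"
    unfolding point_span_def by (rule arg_cong[of _ _ "pspan W"]) auto
  also have "\<dots> = Proj_quot W {w \<in> W. \<forall>i\<in>I. \<forall>H\<in>{linsys_map (V i) p}. component i w \<in> H}"
    by (rule pspan_summands[OF I S])
  also have "{w \<in> W. \<forall>i\<in>I. \<forall>H\<in>{linsys_map (V i) p}. component i w \<in> H} = {w \<in> W. \<forall>i\<in>I. w (i, p) = 0}"
    using component_in_V I by (auto simp: linsys_map_def component_def)
  also have "Proj_quot W {w \<in> W. \<forall>i\<in>I. w (i, p) = 0} = {pt p c | c. nonzero c \<and> (\<forall>i\<in>{1..n} - I. c i = 0)}"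
  proof (intro equalityI subsetI)
    fix x assume x: "x \<in> Proj_quot W {w \<in> W. \<forall>i\<in>I. w (i, p) = 0}"
    then obtain l where l: "lin l" "\<exists>w\<in>W. l w \<noteq> 0" "x = {w \<in> W. l w = 0}"
      unfolding Proj_quot_def Proj_iff[OF fin_dim_W] by blast
    have lK: "l w = 0" if "w \<in> W" "\<forall>i\<in>I. w (i, p) = 0" for w
      using x that unfolding Proj_quot_def l(3) by blast
    obtain v0 where v0: "\<forall>i\<in>{1..n}. v0 i \<in> V i \<and> v0 i p \<noteq> 0" using base_section_exists[OF p] by (rule exE)
    \<comment> \<open>The value of the functional on a section of the \<open>i\<close>-th summand
      normalised to be 1 at \<open>p\<close>.\<close>
    define c where "c i = (if i \<in> I then l (incl i (v0 i)) / v0 i p else 0)" for i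
    have lw: "l w = fl p c w" if w: "w \<in> W" for w
    proof -
      \<comment> \<open>A section with the same values as \<open>w\<close> at \<open>p\<close> in
        the summands from \<open>I\<close>; since \<open>l\<close> kills the difference,
        \<open>l w\<close> depends on these values only.\<close>
      let ?s = "\<Sum>i\<in>I. cscale (w (i, p) / v0 i p) (incl i (v0 i))"
      have sW: "?s \<in> W" using v0 I incl_in_W by (intro cfun.subspace_sum cfun.subspace_scale subspace_W) auto
      have finI: "finite I" using I finite_subset by blast
      have s: "?s (j, p) = w (j, p)" if j: "j \<in> I" for j
      proof -
        have "?s (j, p) = (\<Sum>i\<in>I. if i = j then w (j, p) else 0)"
        proof -
          have "?s x = (\<Sum>i\<in>I. cscale (w (i, p) / v0 i p) (incl i (v0 i)) x)" for x
            using finI by (induction I rule: finite_induct) auto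
          then show ?thesis using v0 I by (auto intro!: sum.cong simp: cscale_def incl_def)
        qed
        then show ?thesis using j finI by (simp add: sum.delta)
      qed
      have "l (w - ?s) = 0" by (rule lK) (use s in \<open>auto intro: cfun.subspace_diff[OF subspace_W w sW]\<close>)
      then have "l w = (\<Sum>i\<in>I. c i * w (i, p))" using l(1)
        by (simp add: lin_diff lin_sum lin_scale c_def mult.commute)
      also have "\<dots> = fl p c w" unfolding fl_def using I by (intro sum.mono_neutral_left) (auto simp: c_def)
      finally show ?thesis .
    qed
    have "x = pt p c" unfolding l(3) pt_def using lw by auto
    moreover have "nonzero c"
    proof (rule ccontr)
      assume "\<not> nonzero c"
      then have "fl p c w = 0" for w unfolding nonzero_def fl_def by simp
      then show False using l(2) lw by simp
    qed
    ultimately show "x \<in> {pt p c | c. nonzero c \<and> (\<forall>i\<in>{1..n} - I. c i = 0)}" unfolding c_def by auto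
  next
    fix x assume "x \<in> {pt p c | c. nonzero c \<and> (\<forall>i\<in>{1..n} - I. c i = 0)}"
    then obtain c where c: "x = pt p c" "nonzero c" "\<forall>i\<in>{1..n} - I. c i = 0" by blast
    have "x \<in> Proj W" unfolding c(1) by (rule functional_of_Proj[OF fin_dim_W functional_pt[OF p c(2)]])
    moreover have "fl p c w = 0" if "\<forall>i\<in>I. w (i, p) = 0" for w
      unfolding fl_def by (rule sum.neutral) (use c(3) that in auto)
    ultimately show "x \<in> Proj_quot W {w \<in> W. \<forall>i\<in>I. w (i, p) = 0}" unfolding Proj_quot_def c(1) pt_def by blast
  qed
  finally show ?thesis .
qed

end

section \<open>Components of the inflectional locus\<close>

lemma Proj_subset_eq:
  assumes "fin_dim W" "p \<in> Proj W" "q \<in> Proj W" "p \<subseteq> q" shows "p = q"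
proof (rule ccontr)
  assume "p \<noteq> q"
  then have "p \<subset> q" using assms(4) by blast
  have "fin_dim q" using fin_dim_subspace[OF assms(1)] assms(3) unfolding Proj_def by blast
  then have "cfun.dim p < cfun.dim q"
    using dim_strict_mono_fin[OF _ _ \<open>p \<subset> q\<close>] assms(2) unfolding Proj_def by blast
  then show False using assms(2,3) unfolding Proj_def by auto
qed

section \<open>Irreducible sets and closed sets described by germs\<close>

lemma irreducible_subtopology:
  assumes S: "irreducible_set T S" and "S \<subseteq> Y"
    and A: "closedin (subtopology T Y) A" and B: "closedin (subtopology T Y) B" and "S \<subseteq> A \<union> B"
  shows "S \<subseteq> A \<or> S \<subseteq> B"
proof -
  obtain A' where A': "closedin T A'" "A = A' \<inter> Y" using A unfolding closedin_subtopology by blast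
  obtain B' where B': "closedin T B'" "B = B' \<inter> Y" using B unfolding closedin_subtopology by blast
  have "S \<subseteq> A' \<or> S \<subseteq> B'" using S A'(1) B'(1) assms(5) A'(2) B'(2) unfolding irreducible_set_def by blast
  then show ?thesis using A'(2) B'(2) assms(2) by blast
qed

lemma irreducible_set_subtopology:
  assumes "irreducible_set T S" "S \<subseteq> Y" shows "irreducible_set (subtopology T Y) S"
  unfolding irreducible_set_def
proof (intro conjI allI impI; (elim conjE)?)
  show "S \<subseteq> topspace (subtopology T Y)" "S \<noteq> {}" using assms unfolding irreducible_set_def by auto
  fix A B assume "closedin (subtopology T Y) A" "closedin (subtopology T Y) B" "S \<subseteq> A \<union> B"
  then show "S \<subseteq> A \<or> S \<subseteq> B" by (rule irreducible_subtopology[OF assms])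
qed

lemma irreducible_singleton: "x \<in> topspace T \<Longrightarrow> irreducible_set T {x}"
  unfolding irreducible_set_def by auto

context quasiproj
begin

lemma openin_eventually:
  assumes "U \<subseteq> Y" "\<And>y. y \<in> U \<Longrightarrow> eventually (\<lambda>z. z \<in> U) (germs y)"
  shows "openin (subtopology (zariski W) Y) U"
proof (subst openin_subopen, intro ballI)
  fix y assume y: "y \<in> U"
  then have "y \<in> Y" using assms(1) by blast
  then obtain S where "openin (subtopology (zariski W) Y) S" "y \<in> S" "\<forall>x\<in>S. x \<in> U"
    using assms(2)[OF y] unfolding eventually_nhdsin topspace_sub by blast
  then show "\<exists>T. openin (subtopology (zariski W) Y) T \<and> y \<in> T \<and> T \<subseteq> U" by blast
qed

lemma closedin_eventually:
  assumes "S \<subseteq> Y" "\<And>y. y \<in> Y \<Longrightarrow> y \<notin> S \<Longrightarrow> eventually (\<lambda>z. z \<notin> S) (germs y)"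
  shows "closedin (subtopology (zariski W) Y) S"
  unfolding closedin_def topspace_sub
proof
  show "openin (subtopology (zariski W) Y) (Y - S)"
  proof (rule openin_eventually)
    fix y assume "y \<in> Y - S"
    then have y: "y \<in> Y" "y \<notin> S" by auto
    show "eventually (\<lambda>z. z \<in> Y - S) (germs y)"
      using assms(2)[OF y] eventually_in[OF y(1)] by eventually_elim simp
  qed blast
qed (fact assms(1))

lemma eventually_notin_closed:
  assumes "closedin (subtopology (zariski W) Y) S" "y \<in> Y" "y \<notin> S"
  shows "eventually (\<lambda>z. z \<notin> S) (germs y)"
proof -
  have "openin (subtopology (zariski W) Y) (Y - S)" using assms(1) unfolding closedin_def topspace_sub by blast
  moreover have "y \<in> Y - S" using assms by blast
  ultimately show ?thesis unfolding eventually_nhdsin by blast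
qed

lemma closedin_point:
  assumes "y \<in> Y" shows "closedin (subtopology (zariski W) Y) {y}"
proof (rule closedin_eventually)
  fix q assume q: "q \<in> Y" "q \<notin> {y}"
  then obtain w where w: "w \<in> y" "w \<notin> q" using Proj_subset_eq[OF fin_dim, of y q] assms subset_Proj by blast
  have "w \<in> W" using w(1) assms subset_Proj unfolding Proj_def by blast
  from eventually_notin[OF q(1) this w(2)] show "eventually (\<lambda>z. z \<notin> {y}) (germs q)"
    by eventually_elim (use w(1) in auto)
qed (use assms in auto)

end

text \<open>Any other closed irreducible subset would lie strictly between one of its points and
  \<open>C\<close>, giving a chain too long for dimension 1.\<close>

lemma (in smooth_curve) closed_irreducible_cases:
  assumes B: "closedin (subtopology (zariski M) C) B" "irreducible_set (subtopology (zariski M) C) B"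
  shows "B = C \<or> (\<exists>p\<in>C. B = {p})"
proof (rule ccontr)
  assume no: "\<not> ?thesis"
  have BC: "B \<subseteq> C" "B \<noteq> {}" using B(2) topspace_sub unfolding irreducible_set_def by auto
  then obtain p where p: "p \<in> B" by blast
  define Z where "Z = (\<lambda>i::nat. if i = 0 then {p} else if i = 1 then B else C)"
  have pC: "p \<in> C" using p BC by blast
  have 0: "closedin (subtopology (zariski M) C) {p}" "irreducible_set (subtopology (zariski M) C) {p}"
    using closedin_point[OF pC] irreducible_singleton[of p "subtopology (zariski M) C"] unfolding topspace_sub
    using pC by auto
  have 2: "closedin (subtopology (zariski M) C) C" "irreducible_set (subtopology (zariski M) C) C"
    using closedin_topspace[of "subtopology (zariski M) C"] topspace_sub irreducible_set_subtopology[OF irreducible] by auto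
  have "{p} \<subset> B" "B \<subset> C" using p BC no pC by auto
  then have "irreducible_chain (subtopology (zariski M) C) (Suc 1) Z"
    unfolding irreducible_chain_def Z_def using B 0 2 by (auto simp: less_Suc_eq)
  then show False using smooth unfolding smooth_of_dim_def krull_dim_eq_def by blast
qed

context scroll
begin

text \<open>For a single point \<open>B\<close> this is the span of the points over it with indices
  in \<open>I\<close>; for \<open>B = C\<close> it is the sub-scroll generated by the curves with
  indices in \<open>I\<close>.\<close>

definition stratum :: "'x point set \<Rightarrow> nat set \<Rightarrow> (nat \<times> 'x point) point set"
  where "stratum B I = {pt p c | p c. p \<in> B \<and> nonzero c \<and> (\<forall>i\<in>{1..n} - I. c i = 0)}"

lemma fl_combination: "fl p (\<lambda>i. c i + a * d i) = (\<lambda>w. fl p c w + a * fl p d w)"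
  unfolding fl_def by (simp add: sum_distrib_left sum.distrib[symmetric] algebra_simps)

text \<open>Two points of a fibre outside closed sets \<open>P\<close> and \<open>Q\<close> are joined by a line, whose general
  point lies in neither.\<close>

lemma fibre_irreducible:
  assumes q: "q \<in> C" and c: "nonzero c" "\<forall>i\<in>{1..n} - I. c i = 0" and d: "nonzero d" "\<forall>i\<in>{1..n} - I. d i = 0"
    and P: "closedin (zariski W) P" "pt q c \<notin> P" and Q: "closedin (zariski W) Q" "pt q d \<notin> Q"
  shows "\<exists>e. nonzero e \<and> (\<forall>i\<in>{1..n} - I. e i = 0) \<and> pt q e \<notin> P \<union> Q"
proof -
  have op: "openin (zariski W) (Proj W - S)" if "closedin (zariski W) S" for S
    using that unfolding closedin_def by simp
  have inP: "pt q e \<in> Proj W" if "nonzero e" for e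
    by (rule functional_of_Proj[OF fin_dim_W functional_pt[OF q that]])
  obtain k F where F: "homog_poly W k F" "pt q c \<in> nonzero_locus W F" "nonzero_locus W F \<subseteq> Proj W - P"
    by (rule zariski_base[OF op[OF P(1)], of "pt q c"]) (use P(2) inP[OF c(1)] in auto)
  obtain l G where G: "homog_poly W l G" "pt q d \<in> nonzero_locus W G" "nonzero_locus W G \<subseteq> Proj W - Q"
    by (rule zariski_base[OF op[OF Q(1)], of "pt q d"]) (use Q(2) inP[OF d(1)] in auto)
  obtain p1 where p1: "\<And>a. F (\<lambda>w. fl q c w + a * fl q d w) = poly p1 a"
    by (rule homog_poly_line[OF F(1), of "fl q c" "fl q d"]) (rule that)
  obtain p2 where p2: "\<And>a. G (\<lambda>w. fl q c w + a * fl q d w) = poly p2 a"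
    by (rule homog_poly_line[OF G(1), of "fl q c" "fl q d"]) (rule that)
  \<comment> \<open>The point \<open>d\<close> lies at infinity on the line parametrised by
    \<open>c + b * d\<close>. The reversed parameter shows that \<open>G\<close>, which is nonzero
    at \<open>d\<close>, is not identically zero on the line.\<close>
  obtain p3 where p3: "\<And>a. G (\<lambda>w. fl q d w + a * fl q c w) = poly p3 a"
    by (rule homog_poly_line[OF G(1), of "fl q d" "fl q c"]) (rule that)
  have "F (fl q c) \<noteq> 0" using mem_nonzero_locus[OF fin_dim_W F(1) functional_pt[OF q c(1)]] F(2) by blast
  then have p1n: "p1 \<noteq> 0" using p1[of 0] by auto
  have "G (fl q d) \<noteq> 0" using mem_nonzero_locus[OF fin_dim_W G(1) functional_pt[OF q d(1)]] G(2) by blast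
  then have "p3 \<noteq> 0" using p3[of 0] by auto
  then have "finite ({a. poly p3 a = 0} \<union> {0})" using poly_roots_finite by blast
  then obtain a where a: "a \<notin> {a. poly p3 a = 0} \<union> {0}" using ex_new_if_finite[OF infinite_UNIV_char_0] by blast
  have "G (\<lambda>w. fl q c w + inverse a * fl q d w) = inverse a ^ l * G (\<lambda>w. fl q d w + a * fl q c w)"
    by (rule homog_poly_scale[OF G(1)]) (use a in \<open>simp add: field_simps\<close>)
  then have "poly p2 (inverse a) \<noteq> 0" using p2 p3 a by simp
  then have p2n: "p2 \<noteq> 0" by auto
  obtain j where j: "j \<in> {1..n}" "c j \<noteq> 0" using c(1) unfolding nonzero_def by blast
  \<comment> \<open>The linear factor keeps the \<open>j\<close>-th coordinate of the combination
    nonzero, so that it is a point.\<close>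
  have "p1 * p2 * [:c j, d j:] \<noteq> 0" unfolding mult_eq_0_iff using p1n p2n j(2) by simp
  then have "finite {b. poly (p1 * p2 * [:c j, d j:]) b = 0}" by (rule poly_roots_finite)
  then obtain b where b: "poly (p1 * p2 * [:c j, d j:]) b \<noteq> 0" using ex_new_if_finite[OF infinite_UNIV_char_0] by blast
  have b': "poly p1 b \<noteq> 0" "poly p2 b \<noteq> 0" "c j + b * d j \<noteq> 0"
    using b unfolding poly_mult mult_eq_0_iff by auto
  let ?e = "\<lambda>i. c i + b * d i"
  have e: "nonzero ?e" using b'(3) j(1) unfolding nonzero_def by blast
  have "F (fl q ?e) \<noteq> 0" "G (fl q ?e) \<noteq> 0" unfolding fl_combination p1 p2 using b' by auto
  then have "pt q ?e \<in> nonzero_locus W F" "pt q ?e \<in> nonzero_locus W G"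
    using mem_nonzero_locus[OF fin_dim_W F(1) functional_pt[OF q e]] mem_nonzero_locus[OF fin_dim_W G(1) functional_pt[OF q e]] by auto
  then have "pt q ?e \<notin> P \<union> Q" using F(3) G(3) by blast
  moreover have "\<forall>i\<in>{1..n} - I. ?e i = 0" using c(2) d(2) by simp
  ultimately show ?thesis using e by blast
qed

text \<open>A point of the fibre over \<open>q\<close> outside the closed set \<open>P\<close> is
  moved along a local section, which stays outside \<open>P\<close> for nearby points of the
  curve.\<close>

lemma openin_fibre_not_subset:
  assumes P: "closedin (zariski W) P"
  shows "openin (subtopology (zariski M) C) {q \<in> C. \<exists>c. nonzero c \<and> (\<forall>i\<in>{1..n} - I. c i = 0) \<and> pt q c \<notin> P}"
proof (rule openin_eventually)
  fix q assume "q \<in> {q \<in> C. \<exists>c. nonzero c \<and> (\<forall>i\<in>{1..n} - I. c i = 0) \<and> pt q c \<notin> P}"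
  then obtain c where q: "q \<in> C" and c: "nonzero c" "\<forall>i\<in>{1..n} - I. c i = 0" "pt q c \<notin> P" by blast
  obtain v0 where "\<forall>i\<in>{1..n}. v0 i \<in> V i \<and> v0 i q \<noteq> 0" using base_section_exists[OF q] by (rule exE)
  then have v0: "\<And>i. i \<in> {1..n} \<Longrightarrow> v0 i \<in> V i" "\<And>i. i \<in> {1..n} \<Longrightarrow> v0 i q \<noteq> 0" by auto
  \<comment> \<open>Constant fibre coordinates through \<open>pt q c\<close>: those with index
    outside \<open>I\<close> remain zero.\<close>
  define m where "m i = (\<lambda>z::'x point. c i * v0 i q)" for i
  have m: "\<And>i. i \<in> {1..n} \<Longrightarrow> regular q (m i)" "\<exists>i\<in>{1..n}. m i q \<noteq> 0"
    using regular_const[OF q] c(1) v0(2) unfolding m_def nonzero_def by auto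
  have ls: "local_section v0 m q = pt q c" unfolding local_section_def m_def
    by (rule pt_cong) (use v0(2) in auto)
  have lim: "filterlim (local_section v0 m) (X.germs (local_section v0 m q)) (germs q)"
    by (rule filterlim_local_section) (fact q v0 m)+
  have nz: "eventually (\<lambda>q. nonzero (\<lambda>i. m i q / v0 i q)) (germs q)" by (rule eventually_nonzero) (fact q v0 m)+
  have x: "pt q c \<in> X" by (rule pt_in_X[OF q c(1)])
  have "eventually (\<lambda>z. z \<notin> P) (X.germs (pt q c))"
    unfolding X.eventually_germs[OF x]
    using P c(3) functional_of_Proj[OF fin_dim_W functional_pt[OF q c(1)]]
    by (intro exI[of _ "Proj W - P"]) (auto simp: closedin_def)
  then have "eventually (\<lambda>q'. local_section v0 m q' \<notin> P) (germs q)"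
    using lim unfolding ls filterlim_iff by blast
  with nz eventually_in[OF q]
  show "eventually (\<lambda>z. z \<in> {q \<in> C. \<exists>c. nonzero c \<and> (\<forall>i\<in>{1..n} - I. c i = 0) \<and> pt q c \<notin> P}) (germs q)"
  proof eventually_elim
    case (elim z)
    then show ?case using c(2) unfolding local_section_def by (auto intro!: exI[of _ "\<lambda>i. m i z / v0 i z"] simp: m_def)
  qed
qed blast

text \<open>A family of irreducible fibres over an irreducible base. If the stratum is covered by
  \<open>P\<close> and \<open>Q\<close>, each fibre lies in one of them; the points whose fibre lies
  in \<open>P\<close>, and those whose fibre lies in \<open>Q\<close>, form closed sets covering
  \<open>B\<close>.\<close>

lemma irreducible_stratum:
  assumes B: "irreducible_set (zariski M) B" "B \<subseteq> C" and I: "I \<subseteq> {1..n}" "I \<noteq> {}"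
  shows "irreducible_set (zariski W) (stratum B I)"
  unfolding irreducible_set_def
proof (intro conjI allI impI; (elim conjE)?)
  show "stratum B I \<subseteq> topspace (zariski W)"
    unfolding stratum_def using functional_of_Proj[OF fin_dim_W functional_pt] B(2) by auto
  obtain p where "p \<in> B" using B(1) unfolding irreducible_set_def by blast
  obtain j where j: "j \<in> I" using I(2) by blast
  have "nonzero (\<lambda>i. if i = j then 1 else 0)" using j I(1) unfolding nonzero_def by auto
  then have "pt p (\<lambda>i. if i = j then 1 else 0) \<in> stratum B I"
    unfolding stratum_def using \<open>p \<in> B\<close> j by fastforce
  then show "stratum B I \<noteq> {}" by blast
  fix P Q assume P: "closedin (zariski W) P" and Q: "closedin (zariski W) Q" and sub: "stratum B I \<subseteq> P \<union> Q"
  define U where "U P = {q \<in> C. \<exists>c. nonzero c \<and> (\<forall>i\<in>{1..n} - I. c i = 0) \<and> pt q c \<notin> P}" for P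
  have closed: "closedin (subtopology (zariski M) C) (C - U P)" if "closedin (zariski W) P" for P
  proof -
    have "C - (C - U P) = U P" unfolding U_def by blast
    then show ?thesis unfolding closedin_def topspace_sub using openin_fibre_not_subset[OF that, of I] unfolding U_def by auto
  qed
  have "B \<subseteq> (C - U P) \<union> (C - U Q)"
  proof
    fix q assume q: "q \<in> B"
    show "q \<in> (C - U P) \<union> (C - U Q)"
    proof (rule ccontr)
      assume "\<not> ?thesis"
      then obtain c d where c: "nonzero c" "\<forall>i\<in>{1..n} - I. c i = 0" "pt q c \<notin> P"
        and d: "nonzero d" "\<forall>i\<in>{1..n} - I. d i = 0" "pt q d \<notin> Q"
        unfolding U_def using q B(2) by blast
      obtain e where "nonzero e \<and> (\<forall>i\<in>{1..n} - I. e i = 0) \<and> pt q e \<notin> P \<union> Q"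
        using fibre_irreducible[OF _ c(1,2) d(1,2) P c(3) Q d(3)] q B(2) by blast
      then show False using sub q unfolding stratum_def by blast
    qed
  qed
  from irreducible_subtopology[OF B closed[OF P] closed[OF Q] this]
  show "stratum B I \<subseteq> P \<or> stratum B I \<subseteq> Q"
    unfolding U_def stratum_def by blast
qed

lemma closedin_pr:
  assumes B: "closedin (subtopology (zariski M) C) B"
  shows "closedin (subtopology (zariski W) X) {z \<in> X. pr z \<in> B}"
proof (rule X.closedin_eventually)
  fix y assume y: "y \<in> X" "y \<notin> {z \<in> X. pr z \<in> B}"
  obtain p c where p: "p \<in> C" "nonzero c" "y = pt p c" using y(1) by (rule X_cases)
  have "p \<notin> B" using y pr_pt p by auto
  have "eventually (\<lambda>z. pr z \<notin> B) (X.germs y)"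
    using filterlim_pr[OF p(1,2)] eventually_notin_closed[OF B p(1) \<open>p \<notin> B\<close>] unfolding p(3) filterlim_iff by blast
  then show "eventually (\<lambda>z. z \<notin> {z \<in> X. pr z \<in> B}) (X.germs y)" by eventually_elim simp
qed blast

lemma closedin_stratum: "closedin (subtopology (zariski W) X) (stratum C I)"
proof (rule X.closedin_eventually)
  show "stratum C I \<subseteq> X" unfolding stratum_def using pt_in_X by blast
  fix y assume y: "y \<in> X" "y \<notin> stratum C I"
  obtain p c where p: "p \<in> C" "nonzero c" "y = pt p c" using y(1) by (rule X_cases)
  then obtain i where i: "i \<in> {1..n}" "i \<notin> I" "c i \<noteq> 0" using y(2) unfolding stratum_def by blast
  obtain v where v: "v \<in> V i" "v p \<noteq> 0" using embedded_curve.section_nonzero[OF embedded[OF i(1)] p(1)] by blast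
  have "incl i v \<notin> y" unfolding p(3) using incl_in_pt[OF i(1) v(1)] i v by simp
  from X.eventually_notin[OF y(1) incl_in_W[OF i(1) v(1)] this]
  show "eventually (\<lambda>z. z \<notin> stratum C I) (X.germs y)"
  proof eventually_elim
    case (elim z)
    show ?case
    proof
      assume "z \<in> stratum C I"
      then obtain q d where "z = pt q d" "\<forall>i\<in>{1..n} - I. d i = 0" unfolding stratum_def by blast
      then show False using elim incl_in_pt[OF i(1) v(1)] i by simp
    qed
  qed
qed

section \<open>Components of the inflectional locus: contained in a fibre or dominant\<close>

abbreviation \<Phi> :: "(nat \<times> 'x point) point set"
  where "\<Phi> \<equiv> inflectional_locus W n X 2"

lemma \<Phi>_subset: "\<Phi> \<subseteq> X"
  unfolding inflectional_locus_def by blast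

lemma stratum_subset_\<Phi>:
  assumes "B \<subseteq> C" "\<And>p i. p \<in> B \<Longrightarrow> i \<in> I \<Longrightarrow> infl i p" shows "stratum B I \<subseteq> \<Phi>"
  unfolding stratum_def using inflectional_iff assms by blast

text \<open>In either case \<open>G\<close> lies in an irreducible stratum contained in the
  inflectional locus, and maximality of \<open>G\<close> gives equality.\<close>

lemma inflectional_component_cases:
  assumes G: "irreducible_component (zariski W) \<Phi> G"
  shows "(\<exists>p\<in>C. {i\<in>{1..n}. infl i p} \<noteq> {} \<and> G = stratum {p} {i\<in>{1..n}. infl i p}) \<or>
    {i\<in>{1..n}. \<forall>q\<in>C. infl i q} \<noteq> {} \<and> G = stratum C {i\<in>{1..n}. \<forall>q\<in>C. infl i q}"
proof -
  have G\<Phi>: "G \<subseteq> \<Phi>" and irr: "irreducible_set (zariski W) G"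
    and max: "\<And>G'. G \<subseteq> G' \<Longrightarrow> G' \<subseteq> \<Phi> \<Longrightarrow> irreducible_set (zariski W) G' \<Longrightarrow> G' = G"
    using G unfolding irreducible_component_def by auto
  have GX: "G \<subseteq> X" using G\<Phi> \<Phi>_subset by blast
  have Gne: "G \<noteq> {}" using irr unfolding irreducible_set_def by blast
  let ?T = "subtopology (zariski M) C"
  \<comment> \<open>The closure of the image of an irreducible set is irreducible, so on a curve it
    is a point or everything.\<close>
  define B where "B = ?T closure_of (pr ` G)"
  have prG: "pr ` G \<subseteq> C" using GX pr_in_C by blast
  have prB: "pr ` G \<subseteq> B" unfolding B_def by (rule closure_of_subset) (use prG topspace_sub in simp)
  have Bmin: "B \<subseteq> S" if "closedin ?T S" "pr ` G \<subseteq> S" for S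
    unfolding B_def by (rule closure_of_minimal[OF that(2,1)])
  have img: "pr ` G \<subseteq> P \<or> pr ` G \<subseteq> Q" if "closedin ?T P" "closedin ?T Q" "pr ` G \<subseteq> P \<union> Q" for P Q
    using irreducible_subtopology[OF irr GX closedin_pr[OF that(1)] closedin_pr[OF that(2)]] that(3) GX by blast
  have Birr: "irreducible_set ?T B" unfolding irreducible_set_def
  proof (intro conjI allI impI; (elim conjE)?)
    show "B \<subseteq> topspace ?T" unfolding B_def by (rule closure_of_subset_topspace)
    show "B \<noteq> {}" using prB Gne by blast
    fix P Q assume "closedin ?T P" "closedin ?T Q" "B \<subseteq> P \<union> Q"
    then show "B \<subseteq> P \<or> B \<subseteq> Q" using img[of P Q] Bmin prB by blast
  qed
  have Gpt: "\<exists>p c. p \<in> C \<and> pr z = p \<and> nonzero c \<and> z = pt p c \<and> (\<forall>i\<in>{1..n}. c i \<noteq> 0 \<longrightarrow> infl i p)" if "z \<in> G" for z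
  proof -
    have "z \<in> X" using that GX by blast
    then obtain p c where p: "p \<in> C" "nonzero c" "z = pt p c" by (rule X_cases)
    then have "\<forall>i\<in>{1..n}. c i \<noteq> 0 \<longrightarrow> infl i p" using inflectional_iff that G\<Phi> by blast
    then show ?thesis using p pr_pt by blast
  qed
  have "B = C \<or> (\<exists>p\<in>C. B = {p})" by (rule closed_irreducible_cases[OF _ Birr]) (simp add: B_def)
  then show ?thesis
  proof
    assume "\<exists>p\<in>C. B = {p}"
    then obtain p where p: "p \<in> C" "B = {p}" by blast
    let ?I = "{i\<in>{1..n}. infl i p}"
    have sub: "G \<subseteq> stratum {p} ?I"
    proof
      fix z assume z: "z \<in> G"
      obtain q c where q: "q \<in> C" "pr z = q" "nonzero c" "z = pt q c" "\<forall>i\<in>{1..n}. c i \<noteq> 0 \<longrightarrow> infl i q"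
        using Gpt[OF z] by (elim exE conjE)
      have "q = p" using prB z q(2) p(2) by auto
      then show "z \<in> stratum {p} ?I" unfolding stratum_def using q by blast
    qed
    have ne: "?I \<noteq> {}"
    proof
      assume e: "?I = {}"
      obtain z where "z \<in> stratum {p} ?I" using sub Gne by blast
      then show False unfolding stratum_def e nonzero_def by blast
    qed
    have "irreducible_set (zariski W) (stratum {p} ?I)"
    proof (rule irreducible_stratum[OF irreducible_singleton _ _ ne])
      show "p \<in> topspace (zariski M)" using p(1) subset_Proj by auto
    qed (use p(1) in auto)
    moreover have "stratum {p} ?I \<subseteq> \<Phi>" by (rule stratum_subset_\<Phi>) (use p(1) in auto)
    ultimately show ?thesis using max[OF sub] ne p(1) by blast
  next
    assume BC: "B = C"
    let ?I = "{i\<in>{1..n}. \<forall>q\<in>C. infl i q}"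
    \<comment> \<open>Points of \<open>G\<close> with a nonzero \<open>i\<close>-th coordinate lie
      over inflection points of the \<open>i\<close>-th curve. These form a proper closed subset,
      over which the dominant \<open>G\<close> cannot lie entirely, so by irreducibility the
      coordinate vanishes on all of \<open>G\<close>.\<close>
    have Gi: "G \<subseteq> stratum C ({1..n} - {i})" if i: "i \<in> {1..n}" "i \<notin> ?I" for i
    proof -
      interpret e: embedded_curve M C "L i" "V i" by (rule embedded[OF i(1)])
      let ?S = "{q \<in> C. infl i q}"
      have cl: "closedin ?T ?S"
      proof (rule closedin_eventually)
        fix y assume y: "y \<in> C" "y \<notin> ?S"
        then have "\<not> infl i y" by blast
        from e.eventually_not_inflectional[OF y(1) this] show "eventually (\<lambda>z. z \<notin> ?S) (germs y)"
          by eventually_elim simp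
      qed blast
      have "G \<subseteq> {z \<in> X. pr z \<in> ?S} \<union> stratum C ({1..n} - {i})"
      proof
        fix z assume z: "z \<in> G"
        obtain q c where q: "q \<in> C" "pr z = q" "nonzero c" "z = pt q c" "\<forall>i\<in>{1..n}. c i \<noteq> 0 \<longrightarrow> infl i q"
          using Gpt[OF z] by (elim exE conjE)
        show "z \<in> {z \<in> X. pr z \<in> ?S} \<union> stratum C ({1..n} - {i})"
        proof (cases "c i = 0")
          case True
          then show ?thesis unfolding stratum_def using q by blast
        next
          case False
          then have "infl i q" using q(5) i(1) by blast
          then show ?thesis using q(1,2) z GX by blast
        qed
      qed
      from irreducible_subtopology[OF irr GX closedin_pr[OF cl] closedin_stratum this]
      show ?thesis
      proof
        assume "G \<subseteq> {z \<in> X. pr z \<in> ?S}"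
        then have "C \<subseteq> ?S" using Bmin[OF cl] BC by blast
        then show ?thesis using i by blast
      qed
    qed
    have sub: "G \<subseteq> stratum C ?I"
    proof
      fix z assume z: "z \<in> G"
      obtain q c where q: "q \<in> C" "pr z = q" "nonzero c" "z = pt q c" "\<forall>i\<in>{1..n}. c i \<noteq> 0 \<longrightarrow> infl i q"
        using Gpt[OF z] by (elim exE conjE)
      have "c i = 0" if i: "i \<in> {1..n} - ?I" for i
      proof (rule ccontr)
        assume ci: "c i \<noteq> 0"
        have i': "i \<in> {1..n}" "i \<notin> ?I" using i by auto
        obtain r d where r: "r \<in> C" "z = pt r d" "\<forall>j\<in>{1..n} - ({1..n} - {i}). d j = 0"
          using Gi[OF i'] z unfolding stratum_def by blast
        \<comment> \<open>\<open>pt q c\<close> and \<open>pt r d\<close> describe the same point; a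
          section from the \<open>i\<close>-th summand with \<open>v q \<noteq> 0\<close> shows that
          the \<open>i\<close>-th coordinate of one cannot be zero without that of the
          other.\<close>
        obtain v where v: "v \<in> V i" "v q \<noteq> 0" using embedded_curve.section_nonzero[OF embedded[OF i'(1)] q(1)] by blast
        have "incl i v \<in> z" unfolding r(2) incl_in_pt[OF i'(1) v(1)] using r(3) i' by simp
        then show False unfolding q(4) incl_in_pt[OF i'(1) v(1)] using ci v by simp
      qed
      then show "z \<in> stratum C ?I" unfolding stratum_def using q by blast
    qed
    have ne: "?I \<noteq> {}"
    proof
      assume e: "?I = {}"
      obtain z where "z \<in> stratum C ?I" using sub Gne by blast
      then show False unfolding stratum_def e nonzero_def by blast
    qed
    have "irreducible_set (zariski W) (stratum C ?I)" by (rule irreducible_stratum[OF irreducible _ _ ne]) auto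
    moreover have "stratum C ?I \<subseteq> \<Phi>" by (rule stratum_subset_\<Phi>) auto
    ultimately show ?thesis using max[OF sub] ne by blast
  qed
qed

end

section \<open>Linear isomorphisms of projective spaces\<close>

lemma morphism_compose:
  assumes "morphism W Y W' Y' f" "morphism W' Y' W'' Y'' g" and "Y \<subseteq> Proj W" "Y' \<subseteq> Proj W'"
  shows "morphism W Y W'' Y'' (g \<circ> f)"
proof -
  have "f y \<in> Y'" if "y \<in> Y" for y
    using assms(1,3,4) that unfolding morphism_def continuous_map_def by auto
  then show ?thesis using assms(1,2) continuous_map_compose unfolding morphism_def comp_assoc[symmetric] by auto
qed

lemma isomorphism_compose:
  assumes f: "isomorphism W Y W' Y' f" and g: "isomorphism W' Y' W'' Y'' g"
    and Y: "Y \<subseteq> Proj W" "Y' \<subseteq> Proj W'" "Y'' \<subseteq> Proj W''"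
  shows "isomorphism W Y W'' Y'' (g \<circ> f)"
proof -
  obtain f' where f': "morphism W' Y' W Y f'" "\<forall>y\<in>Y. f' (f y) = y" "\<forall>z\<in>Y'. f (f' z) = z"
    using f unfolding isomorphism_def by blast
  obtain g' where g': "morphism W'' Y'' W' Y' g'" "\<forall>y\<in>Y'. g' (g y) = y" "\<forall>z\<in>Y''. g (g' z) = z"
    using g unfolding isomorphism_def by blast
  have m: "morphism W Y W' Y' f" "morphism W' Y' W'' Y'' g" using f g unfolding isomorphism_def by auto
  have fY: "f y \<in> Y'" if "y \<in> Y" for y
    using m(1) that Y unfolding morphism_def continuous_map_def by auto
  have gY: "g' z \<in> Y'" if "z \<in> Y''" for z
    using g'(1) that Y unfolding morphism_def continuous_map_def by auto
  show ?thesis unfolding isomorphism_def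
    using morphism_compose[OF m Y(1,2)] morphism_compose[OF g'(1) f'(1) Y(3,2)] f'(2,3) g'(2,3) fY gY
    by (intro conjI exI[of _ "f' \<circ> g'"]) auto
qed

lemma functional_of_pullback:
  assumes T: "Vector_Spaces.linear cscale cscale T" and TW: "T ` W' = W" and l: "functional_of W z l"
  shows "functional_of W' {g \<in> W'. T g \<in> z} (\<lambda>g. l (T g))"
proof -
  have "lin (\<lambda>g. l (T g))"
    using T l unfolding functional_of_def lin_iff Vector_Spaces.linear_iff by simp
  moreover have "{g \<in> W'. l (T g) = 0} = {g \<in> W'. T g \<in> z}" using l TW unfolding functional_of_def by blast
  moreover have "\<exists>g\<in>W'. l (T g) \<noteq> 0" using l TW unfolding functional_of_def by blast
  ultimately show ?thesis unfolding functional_of_def by blast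
qed

text \<open>Points are hyperplanes, so a surjection \<open>T\<close> from \<open>W'\<close> onto
  \<open>W\<close> induces a map from \<open>Proj W\<close> to \<open>Proj W'\<close> by taking
  preimages.\<close>

lemma morphism_linear:
  assumes W: "fin_dim W" and W': "fin_dim W'"
    and T: "Vector_Spaces.linear cscale cscale T" and TW: "T ` W' = W"
  shows "morphism W (Proj W) W' (Proj W') (\<lambda>z. {g \<in> W'. T g \<in> z})"
proof -
  interpret A: quasiproj W "Proj W" by unfold_locales (auto intro: W)
  interpret B: quasiproj W' "Proj W'" by unfold_locales (auto intro: W')
  let ?f = "\<lambda>z. {g \<in> W'. T g \<in> z}"
  have fP: "?f z \<in> Proj W'" if "z \<in> Proj W" for z
    using functional_of_Proj[OF W' functional_of_pullback[OF T TW A.hcoord[OF that]]] .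
  have form: "homog_poly W d (\<lambda>l. F (\<lambda>g. l (T g)))" if "homog_poly W' d F" for d F
    by (rule homog_poly_pullback[OF that]) (use TW in blast)
  have locus: "?f z \<in> nonzero_locus W' F \<longleftrightarrow> z \<in> nonzero_locus W (\<lambda>l. F (\<lambda>g. l (T g)))"
    if "z \<in> Proj W" "homog_poly W' d F" for z d F
    using mem_nonzero_locus[OF W' that(2) functional_of_pullback[OF T TW A.hcoord[OF that(1)]]]
      mem_nonzero_locus[OF W form[OF that(2)] A.hcoord[OF that(1)]] by simp
  have lim: "filterlim ?f (B.germs (?f y)) (A.germs y)" if y: "y \<in> Proj W" for y
    unfolding filterlim_iff
  proof (intro allI impI)
    fix P assume "eventually P (B.germs (?f y))"
    then obtain U where U: "openin (zariski W') U" "?f y \<in> U" "\<forall>z\<in>U \<inter> Proj W'. P z"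
      unfolding B.eventually_germs[OF fP[OF y]] by blast
    obtain d F where F: "homog_poly W' d F" "?f y \<in> nonzero_locus W' F" "nonzero_locus W' F \<subseteq> U"
      using zariski_base[OF U(1,2)] .
    show "eventually (\<lambda>z. P (?f z)) (A.germs y)"
      unfolding A.eventually_germs[OF y]
      using openin_nonzero_locus[OF form[OF F(1)]] locus[OF _ F(1)] y F(2,3) U(3) fP
      by (intro exI[of _ "nonzero_locus W (\<lambda>l. F (\<lambda>g. l (T g)))"]) blast
  qed
  show ?thesis unfolding morphism_def
  proof (intro conjI ballI allI impI)
    show "continuous_map (subtopology (zariski W) (Proj W)) (subtopology (zariski W') (Proj W')) ?f"
      unfolding continuous_map_def A.topspace_sub B.topspace_sub
    proof (intro conjI allI impI)
      show "?f \<in> Proj W \<rightarrow> Proj W'" using fP by blast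
      fix U assume U: "openin (subtopology (zariski W') (Proj W')) U"
      show "openin (subtopology (zariski W) (Proj W)) {x \<in> Proj W. ?f x \<in> U}"
      proof (rule A.openin_eventually)
        fix y assume "y \<in> {x \<in> Proj W. ?f x \<in> U}"
        then have y: "y \<in> Proj W" "?f y \<in> U" by auto
        have "eventually (\<lambda>z. z \<in> U) (B.germs (?f y))" unfolding eventually_nhdsin using U y(2) by blast
        then have "eventually (\<lambda>z. ?f z \<in> U) (A.germs y)" using lim[OF y(1)] unfolding filterlim_iff by blast
        with A.eventually_in[OF y(1)] show "eventually (\<lambda>z. z \<in> {x \<in> Proj W. ?f x \<in> U}) (A.germs y)"
          by eventually_elim simp
      qed blast
    qed
  next
    fix y h assume y: "y \<in> Proj W" and "regular_at W' (Proj W') (?f y) h"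
    then obtain d F G where F: "homog_poly W' d F" "homog_poly W' d G"
      and ev: "eventually (\<lambda>z. G (hcoord W' z) \<noteq> 0 \<and> h z = F (hcoord W' z) / G (hcoord W' z)) (B.germs (?f y))"
      unfolding B.regular_iff[OF fP[OF y]] by blast
    have "eventually (\<lambda>z. G (hcoord W' (?f z)) \<noteq> 0 \<and> h (?f z) = F (hcoord W' (?f z)) / G (hcoord W' (?f z))) (A.germs y)"
      using ev lim[OF y] unfolding filterlim_iff by blast
    with A.eventually_in[OF y]
    have "eventually (\<lambda>z. G (\<lambda>g. hcoord W z (T g)) \<noteq> 0 \<and> (h \<circ> ?f) z = F (\<lambda>g. hcoord W z (T g)) / G (\<lambda>g. hcoord W z (T g))) (A.germs y)"
    proof eventually_elim
      case (elim z)
      note pull = functional_of_pullback[OF T TW A.hcoord[OF elim(1)]]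
      show ?case
        using elim(2) homog_poly_functional[OF F(2) B.subspace B.hcoord[OF fP[OF elim(1)]] pull]
          homog_poly_quotient_functional[OF F B.subspace B.hcoord[OF fP[OF elim(1)]] pull] by simp
    qed
    then show "regular_at W (Proj W) y (h \<circ> ?f)"
      unfolding A.regular_iff[OF y] using form[OF F(1)] form[OF F(2)] by blast
  qed
qed

lemma isomorphism_linear:
  assumes W: "fin_dim W" and W': "fin_dim W'"
    and T: "Vector_Spaces.linear cscale cscale T" "T ` W' = W"
    and S: "Vector_Spaces.linear cscale cscale S" "S ` W = W'"
    and inv: "\<And>g. g \<in> W' \<Longrightarrow> S (T g) = g" "\<And>v. v \<in> W \<Longrightarrow> T (S v) = v"
  shows "isomorphism W (Proj W) W' (Proj W') (\<lambda>z. {g \<in> W'. T g \<in> z})"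
proof -
  have "{v \<in> W. S v \<in> {g \<in> W'. T g \<in> y}} = y" if "y \<in> Proj W" for y
  proof -
    have "v \<in> W \<Longrightarrow> S v \<in> W'" for v using S(2) by blast
    moreover have "y \<subseteq> W" using that unfolding Proj_def by blast
    ultimately show ?thesis using inv(2) by auto
  qed
  moreover have "{g \<in> W'. T g \<in> {v \<in> W. S v \<in> z}} = z" if "z \<in> Proj W'" for z
  proof -
    have "g \<in> W' \<Longrightarrow> T g \<in> W" for g using T(2) by blast
    moreover have "z \<subseteq> W'" using that unfolding Proj_def by blast
    ultimately show ?thesis using inv(1) by auto
  qed
  ultimately show ?thesis unfolding isomorphism_def
    using morphism_linear[OF W W' T] morphism_linear[OF W' W S]
    by (intro conjI exI[of _ "\<lambda>z. {v \<in> W. S v \<in> z}"]) auto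
qed

section \<open>Regular functions on the affine line\<close>

text \<open>A generic fraction for \<open>f\<close> with denominator of least degree is valid
  everywhere: at a root of the denominator the comparison with a local fraction would allow a
  cancellation. A denominator without roots is constant by the fundamental theorem of
  algebra.\<close>

lemma locally_rational_imp_polynomial:
  fixes f :: "complex \<Rightarrow> complex"
  assumes loc: "\<And>x0. \<exists>P Q K. poly K x0 \<noteq> 0 \<and> (\<forall>x. poly K x \<noteq> 0 \<longrightarrow> poly Q x \<noteq> 0 \<and> f x = poly P x / poly Q x)"
  obtains P where "\<And>x. f x = poly P x"
proof -
  \<comment> \<open>\<open>K\<close> cuts out the exceptional points, so that the fraction is
    required only on a nonempty open set.\<close>
  define rep where "rep = (\<lambda>(P, Q, K). K \<noteq> 0 \<and> (\<forall>x. poly K x \<noteq> 0 \<longrightarrow> poly Q x \<noteq> 0 \<and> f x = poly P x / poly Q x))"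
  obtain P0 Q0 K0 where 0: "poly K0 0 \<noteq> 0" "\<forall>x. poly K0 x \<noteq> 0 \<longrightarrow> poly Q0 x \<noteq> 0 \<and> f x = poly P0 x / poly Q0 x"
    using loc[of 0] by blast
  then have "rep (P0, Q0, K0)" unfolding rep_def by auto
  from ex_has_least_nat[of rep, OF this, of "\<lambda>(P, Q, K). degree Q"]
  obtain R where R: "rep R" "\<forall>R'. rep R' \<longrightarrow> (\<lambda>(P, Q, K). degree Q) R \<le> (\<lambda>(P, Q, K). degree Q) R'" by blast
  obtain P Q K where PQK: "R = (P, Q, K)" by (cases R)
  have rep: "rep (P, Q, K)" using R(1) PQK by simp
  have least: "degree Q \<le> degree Q'" if "rep (P', Q', K')" for P' Q' K'
    using R(2)[rule_format, OF that] PQK by simp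
  have K: "K \<noteq> 0" "\<And>x. poly K x \<noteq> 0 \<Longrightarrow> poly Q x \<noteq> 0 \<and> f x = poly P x / poly Q x" using rep unfolding rep_def by auto
  obtain x0 where "poly K x0 \<noteq> 0" using K(1) poly_all_0_iff_0 by blast
  then have Q0: "Q \<noteq> 0" using K(2) by auto
  have key: "poly Q x1 \<noteq> 0 \<and> f x1 = poly P x1 / poly Q x1" for x1
  proof -
    obtain P1 Q1 K1 where 1: "poly K1 x1 \<noteq> 0" "\<forall>x. poly K1 x \<noteq> 0 \<longrightarrow> poly Q1 x \<noteq> 0 \<and> f x = poly P1 x / poly Q1 x"
      using loc[of x1] by blast
    have K1: "K1 \<noteq> 0" using 1 by auto
    \<comment> \<open>The fractions agree where both are valid; the factor \<open>K * K1\<close>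
      makes the identity hold at the remaining points as well.\<close>
    have "(P1 * Q - P * Q1) * (K * K1) = 0"
    proof -
      have "poly ((P1 * Q - P * Q1) * (K * K1)) x = 0" for x
      proof (cases "poly K x = 0 \<or> poly K1 x = 0")
        case False
        then have "poly P1 x / poly Q1 x = poly P x / poly Q x" "poly Q1 x \<noteq> 0" "poly Q x \<noteq> 0"
          using K(2)[of x] 1(2)[rule_format, of x] by auto
        then show ?thesis by (simp add: field_simps)
      qed auto
      then show ?thesis using poly_all_0_iff_0 by blast
    qed
    then have eq: "P1 * Q = P * Q1" using K(1) K1 by simp
    have eqx: "poly P1 x1 * poly Q x1 = poly P x1 * poly Q1 x1" using arg_cong[OF eq, of "\<lambda>p. poly p x1"] by simp
    have Q1: "poly Q1 x1 \<noteq> 0" "f x1 = poly P1 x1 / poly Q1 x1" using 1 by auto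
    have "poly Q x1 \<noteq> 0"
    proof
      assume Qx: "poly Q x1 = 0"
      then have "poly P x1 = 0" using eqx Q1(1) by simp
      then obtain P' where P': "P = [:- x1, 1:] * P'" unfolding poly_eq_0_iff_dvd by (rule dvdE)
      obtain Q' where Q': "Q = [:- x1, 1:] * Q'" using Qx unfolding poly_eq_0_iff_dvd by (rule dvdE)
      \<comment> \<open>After cancelling the common root the fraction is claimed only away from
        \<open>x1\<close>, hence the new factor in \<open>K\<close>.\<close>
      have "rep (P', Q', K * [:- x1, 1:])"
        unfolding rep_def prod.case
      proof (intro conjI allI impI)
        show "K * [:- x1, 1:] \<noteq> 0" using K(1) unfolding mult_eq_0_iff by simp
        fix x assume "poly (K * [:- x1, 1:]) x \<noteq> 0"
        then have x: "poly K x \<noteq> 0" "x - x1 \<noteq> 0" by auto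
        have e: "poly P x = (x - x1) * poly P' x" "poly Q x = (x - x1) * poly Q' x"
          unfolding P' Q' poly_mult by simp_all
        show "poly Q' x \<noteq> 0" "f x = poly P' x / poly Q' x" using K(2)[OF x(1)] x(2) unfolding e by simp_all
      qed
      then have "degree Q \<le> degree Q'" by (rule least)
      moreover have "Q' \<noteq> 0" using Q0 Q' by auto
      then have "degree Q = Suc (degree Q')" unfolding Q' by (subst degree_mult_eq) auto
      ultimately show False by simp
    qed
    then show ?thesis using Q1 eqx by (simp add: frac_eq_eq)
  qed
  have "degree Q = 0"
  proof (rule ccontr)
    assume "degree Q \<noteq> 0"
    then have "\<not> constant (poly Q)" by (simp add: constant_degree)
    from fundamental_theorem_of_algebra[OF this] show False using key by blast
  qed
  then obtain q where q: "Q = [:q:]" by (rule degree_eq_zeroE)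
  have "f x = poly (smult (inverse q) P) x" for x using key[of x] q by (simp add: divide_inverse mult.commute)
  then show ?thesis using that by blast
qed

section \<open>Curves all of whose points are inflectional\<close>

text \<open>Points are closed, so a finite curve would be discrete; being irreducible it would be a
  single point, which has no chain of length 1.\<close>

lemma (in smooth_curve) infinite_curve: "infinite C"
proof
  assume fin: "finite C"
  obtain p where p: "p \<in> C" using irreducible unfolding irreducible_set_def by blast
  let ?T = "subtopology (zariski M) C"
  have "closedin ?T S" if "S \<subseteq> C" for S
  proof -
    have "closedin ?T (\<Union>((\<lambda>x. {x}) ` S))"
      by (rule closedin_Union) (use that fin finite_subset closedin_point in auto)
    then show ?thesis by simp
  qed
  then have "closedin ?T {p}" "closedin ?T (C - {p})" using p by auto
  from irreducible_subtopology[OF irreducible subset_refl this] have "C = {p}" using p by blast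
  obtain Z where "irreducible_chain ?T 1 Z" using smooth unfolding smooth_of_dim_def krull_dim_eq_def by blast
  then have Z: "irreducible_set ?T (Z 0)" "irreducible_set ?T (Z 1)" "Z 0 \<subset> Z 1"
    unfolding irreducible_chain_def by auto
  then have "Z 0 \<noteq> {}" "Z 1 \<subseteq> {p}" using topspace_sub \<open>C = {p}\<close> unfolding irreducible_set_def by auto
  then show False using Z(3) by blast
qed

locale line_curve = embedded_curve M C A V for M :: "('x \<Rightarrow> complex) set" and C A V +
  assumes all_inflectional: "\<forall>q\<in>C. inflectional q"
begin

lemma dim_V: "cfun.dim V = 2"
proof -
  obtain p where p: "p \<in> C" using irreducible unfolding irreducible_set_def by blast
  obtain v0 where v0: "v0 \<in> V" "v0 p \<noteq> 0" using section_nonzero[OF p] by blast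
  obtain u where u: "u \<in> V" "u p = 0" "local_param p (\<lambda>q. u q / v0 q)" by (rule local_param_section[OF p v0])
  have "u \<noteq> 0"
  proof
    assume "u = 0"
    then show False using u(3) mpow_zero[OF p] unfolding local_param_def by simp
  qed
  define e where "e b = (if b then u else v0)" for b
  have sum: "(\<Sum>b\<in>UNIV. cscale (c b) (e b)) = cscale (c False) v0 + cscale (c True) u" for c
    by (simp add: UNIV_bool e_def add.commute)
  have "cfun.dim V = cfun.dim {0 :: 'x point \<Rightarrow> complex} + card (UNIV :: bool set)"
  proof (rule dim_complement[where e = e])
    show "\<And>i. e i \<in> V" using u v0 unfolding e_def by simp
    show "{0} \<subseteq> V" using cfun.subspace_0[OF subspace_V] by simp
  next
    fix w assume "w \<in> V"
    then obtain a b where "w = cscale a v0 + cscale b u"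
      using inflectional_imp_line[OF all_inflectional p v0 u(1,3)] by blast
    then have "w - (\<Sum>i\<in>UNIV. cscale ((if i then b else a)) (e i)) \<in> {0}" unfolding sum by simp
    then show "\<exists>c. w - (\<Sum>i\<in>UNIV. cscale (c i) (e i)) \<in> {0}" by (rule exI[of _ "\<lambda>i. if i then b else a"])
  next
    fix c assume "(\<Sum>i\<in>UNIV. cscale (c i) (e i)) \<in> {0}"
    then have z: "cscale (c False) v0 + cscale (c True) u = 0" unfolding sum by simp
    have "c False * v0 p = 0" using fun_cong[OF z, of p] u(2) by (simp add: cscale_def)
    then have "c False = 0" using v0(2) by simp
    moreover from this z have "c True = 0" using \<open>u \<noteq> 0\<close> by simp
    ultimately show "\<forall>i\<in>UNIV. c i = 0" by (metis (full_types))
  qed (auto intro: fin_dim_V)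
  moreover have "cfun.dim {0 :: 'x point \<Rightarrow> complex} = 0"
    using cfun.dim_span_eq_card_independent[OF cfun.independent_empty] by simp
  ultimately show ?thesis by simp
qed

text \<open>\<open>V\<close> has dimension 2, so \<open>H\<close> is a line, spanned by
  \<open>a\<close>. The functionals \<open>\<alpha>\<close> and \<open>\<beta>\<close> are dual to
  \<open>a\<close> and \<open>b\<close>, and the affine coordinate \<open>b / a\<close> on the
  projective line has \<open>H\<close> as its point at infinity.\<close>

lemma hyperplane_basis:
  assumes H: "H \<in> Proj V"
  obtains a b \<alpha> \<beta> where "a \<in> H" "a \<in> V" "b \<in> V" "lin \<alpha>" "lin \<beta>"
    "\<And>v. v \<in> V \<Longrightarrow> v = cscale (\<alpha> v) a + cscale (\<beta> v) b"
    "\<alpha> a = 1" "\<beta> a = 0" "\<alpha> b = 0" "\<beta> b = 1" "H = {v \<in> V. \<beta> v = 0}"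
proof -
  have sH: "cfun.subspace H" "H \<subseteq> V" and dH: "cfun.dim H = 1" using H dim_V unfolding Proj_def by auto
  obtain b where b: "b \<in> V" "b \<notin> H" using Proj_proper[OF H] by blast
  obtain \<beta> where \<beta>: "lin \<beta>" "\<And>w. w \<in> H \<Longrightarrow> \<beta> w = 0" "\<beta> b = 1" using functional_exists[OF sH(1) b(2)] by blast
  obtain B where B: "finite B" "B \<subseteq> H" "cfun.independent B" "cfun.span B = H"
    using finite_basis_exists[OF fin_dim_V sH] by blast
  have "card B = 1" using cfun.dim_span_eq_card_independent[OF B(3)] B(4) dH by simp
  then obtain a where a: "B = {a}" by (rule card_1_singletonE)
  have a0: "a \<noteq> 0" using B(3) a cfun.dependent_single by simp
  have aH: "a \<in> H" using B(2) a by blast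
  have "a \<notin> cfun.span {b}"
  proof
    assume "a \<in> cfun.span {b}"
    then obtain k where k: "a = cscale k b" unfolding cfun.span_singleton by blast
    then have "k = \<beta> a" using lin_scale[OF \<beta>(1)] \<beta>(3) by simp
    then show False using \<beta>(2)[OF aH] k a0 by simp
  qed
  from functional_exists[OF cfun.subspace_span this]
  obtain \<alpha> where \<alpha>: "lin \<alpha>" "\<And>w. w \<in> cfun.span {b} \<Longrightarrow> \<alpha> w = 0" "\<alpha> a = 1" by blast
  have \<alpha>b: "\<alpha> b = 0" by (rule \<alpha>(2)) (simp add: cfun.span_base)
  have ker: "H = {v \<in> V. \<beta> v = 0}"
  proof (rule Proj_subset_eq[OF fin_dim_V H])
    have "functional_of V {v \<in> V. \<beta> v = 0} \<beta>" unfolding functional_of_def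
      using \<beta>(1,3) b(1) by (auto intro!: bexI[of _ b])
    then show "{v \<in> V. \<beta> v = 0} \<in> Proj V" by (rule functional_of_Proj[OF fin_dim_V])
  qed (use \<beta>(2) sH(2) in blast)
  have exp: "v = cscale (\<alpha> v) a + cscale (\<beta> v) b" if v: "v \<in> V" for v
  proof -
    have "v - cscale (\<beta> v) b \<in> V" using v b(1) subspace_V by (intro cfun.subspace_diff cfun.subspace_scale)
    moreover have "\<beta> (v - cscale (\<beta> v) b) = 0" using \<beta> by (simp add: lin_diff lin_scale)
    ultimately have "v - cscale (\<beta> v) b \<in> cfun.span {a}" unfolding B(4)[unfolded a] using ker by blast
    then obtain k where k: "v - cscale (\<beta> v) b = cscale k a" unfolding cfun.span_singleton by blast
    have "\<alpha> (v - cscale (\<beta> v) b) = \<alpha> v" using \<alpha>(1) \<alpha>b by (simp add: lin_diff lin_scale)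
    then have "k = \<alpha> v" using k \<alpha>(1,3) by (simp add: lin_scale)
    have "v = (v - cscale (\<beta> v) b) + cscale (\<beta> v) b" by simp
    then show ?thesis unfolding k \<open>k = \<alpha> v\<close> .
  qed
  show ?thesis
    by (rule that[OF aH _ b(1) \<alpha>(1) \<beta>(1) exp \<alpha>(3) \<beta>(2)[OF aH] \<alpha>b \<beta>(3) ker]) (use aH sH(2) in auto)
qed

lemma eval_expand:
  assumes "\<And>v. v \<in> V \<Longrightarrow> v = cscale (\<alpha> v) a + cscale (\<beta> v) b" "v \<in> V"
  shows "v q = \<alpha> v * a q + \<beta> v * b q"
  using fun_cong[OF assms(1)[OF assms(2)], of q] by (simp add: cscale_def)

text \<open>\<open>v\<close> and \<open>w\<close> generate \<open>V\<close>, so equal ratios of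
  their values at two points make the same sections vanish there.\<close>

lemma point_eq:
  assumes "q \<in> C" "q' \<in> C" "v \<in> V" "w \<in> V" "\<And>x. x \<in> V \<Longrightarrow> \<exists>s r. \<forall>z. x z = s * v z + r * w z"
    and "v q * w q' = v q' * w q" "v q \<noteq> 0" "v q' \<noteq> 0"
  shows "q = q'"
proof (rule inj_\<phi>[OF assms(1,2)])
  have "x q = 0 \<longleftrightarrow> x q' = 0" if xV: "x \<in> V" for x
  proof -
    obtain s r where x: "\<forall>z. x z = s * v z + r * w z" using assms(5)[OF xV] by (elim exE)
    have "x q * v q' = x q' * v q" unfolding x[rule_format] using assms(6) by algebra
    then show ?thesis using assms(7,8) by auto
  qed
  then show "\<phi> q = \<phi> q'" unfolding linsys_map_def by blast
qed

text \<open>The image is closed and infinite. If it missed \<open>H\<close>, some form would vanish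
  on it but not at \<open>H\<close>; in the coordinate \<open>b / a\<close>, which is injective on
  \<open>C\<close>, this form is a nonzero polynomial with infinitely many roots.\<close>

lemma image_eq: "\<phi> ` C = Proj V"
proof (rule ccontr)
  assume "\<phi> ` C \<noteq> Proj V"
  then obtain H where H: "H \<in> Proj V" "H \<notin> \<phi> ` C" using image_subset by blast
  obtain a b \<alpha> \<beta> where bas: "a \<in> H" "a \<in> V" "b \<in> V" "lin \<alpha>" "lin \<beta>"
    "\<And>v. v \<in> V \<Longrightarrow> v = cscale (\<alpha> v) a + cscale (\<beta> v) b"
    "\<alpha> a = 1" "\<beta> a = 0" "\<alpha> b = 0" "\<beta> b = 1" "H = {v \<in> V. \<beta> v = 0}"
    by (rule hyperplane_basis[OF H(1)]) (rule that)
  have exp: "v q = \<alpha> v * a q + \<beta> v * b q" if "v \<in> V" for v q by (rule eval_expand[OF bas(6) that])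
  have aq: "a q \<noteq> 0" if "q \<in> C" for q
  proof
    assume "a q = 0"
    then have "v q = 0" if "v \<in> H" for v using that exp[of v q] unfolding bas(11) by simp
    then have "H \<subseteq> \<phi> q" unfolding bas(11) linsys_map_def by blast
    then have "H = \<phi> q" using Proj_subset_eq[OF fin_dim_V H(1)] image_subset that by blast
    then show False using H(2) that by blast
  qed
  have "openin (zariski V) (Proj V - \<phi> ` C)" using closed_image unfolding closedin_def by simp
  then obtain d F where F: "homog_poly V d F" "H \<in> nonzero_locus V F" "nonzero_locus V F \<subseteq> Proj V - \<phi> ` C"
    by (rule zariski_base) (use H in blast)+
  have fH: "functional_of V H \<beta>" unfolding functional_of_def
    using bas(3,5,10,11) by (auto intro!: bexI[of _ b])
  have F\<beta>: "F \<beta> \<noteq> 0" using mem_nonzero_locus[OF fin_dim_V F(1) fH] F(2) by blast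
  have Fq: "F (\<lambda>v. v q) = 0" if "q \<in> C" for q
    using mem_nonzero_locus[OF fin_dim_V F(1) functional_eval[OF that]] F(3) that by blast
  obtain P where P: "\<And>x. F (\<lambda>v. \<alpha> v + x * \<beta> v) = poly P x" by (rule homog_poly_line[OF F(1), of \<alpha> \<beta>]) (rule that)
  \<comment> \<open>The polynomial in the reciprocal coordinate. Its value at 0 is that of
    \<open>F\<close> at \<open>H\<close>, so it is nonzero, and therefore so is
    \<open>P\<close>.\<close>
  obtain R where R: "\<And>x. F (\<lambda>v. \<beta> v + x * \<alpha> v) = poly R x" by (rule homog_poly_line[OF F(1), of \<beta> \<alpha>]) (rule that)
  have "R \<noteq> 0" using R[of 0] F\<beta> by auto
  then have "finite ({x. poly R x = 0} \<union> {0})" using poly_roots_finite by blast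
  then obtain x where x: "x \<notin> {x. poly R x = 0} \<union> {0}" using ex_new_if_finite[OF infinite_UNIV_char_0] by blast
  have "F (\<lambda>v. \<alpha> v + inverse x * \<beta> v) = inverse x ^ d * F (\<lambda>v. \<beta> v + x * \<alpha> v)"
    by (rule homog_poly_scale[OF F(1)]) (use x in \<open>simp add: field_simps\<close>)
  then have "poly P (inverse x) \<noteq> 0" using P R x by simp
  then have "P \<noteq> 0" by auto
  then have fin: "finite {x. poly P x = 0}" by (rule poly_roots_finite)
  have "(\<lambda>q. b q / a q) ` C \<subseteq> {x. poly P x = 0}"
  proof
    fix x assume "x \<in> (\<lambda>q. b q / a q) ` C"
    then obtain q where q: "q \<in> C" "x = b q / a q" by blast
    have "F (\<lambda>v. v q) = a q ^ d * F (\<lambda>v. \<alpha> v + x * \<beta> v)"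
    proof (rule homog_poly_scale[OF F(1)])
      fix w assume "w \<in> V"
      have "b q = x * a q" using aq[OF q(1)] q(2) by simp
      then show "w q = a q * (\<alpha> w + x * \<beta> w)" using exp[OF \<open>w \<in> V\<close>, of q] by (simp add: algebra_simps)
    qed
    then show "x \<in> {x. poly P x = 0}" using Fq[OF q(1)] aq[OF q(1)] P by simp
  qed
  moreover have "inj_on (\<lambda>q. b q / a q) C"
  proof (rule inj_onI)
    fix q q' assume q: "q \<in> C" "q' \<in> C" "b q / a q = b q' / a q'"
    show "q = q'"
    proof (rule point_eq[OF q(1,2) bas(2,3)])
      show "a q * b q' = a q' * b q" using q(3) aq[OF q(1)] aq[OF q(2)] by (simp add: field_simps)
      show "\<exists>s r. \<forall>z. x z = s * a z + r * b z" if "x \<in> V" for x using exp[OF that] by blast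
    qed (use aq q in auto)
  qed
  ultimately have "finite C" using fin finite_imageD finite_subset by blast
  then show False using infinite_curve by blast
qed

lemma image_is_line: "proj_line V (\<phi> ` C)"
proof -
  have 0: "cfun.subspace {0 :: 'x point \<Rightarrow> complex}" "{0} \<subseteq> V" using cfun.subspace_0[OF subspace_V] by auto
  have eq: "\<phi> ` C = Proj_quot V {0}"
    unfolding image_eq Proj_quot_def Proj_def using cfun.subspace_0 by auto
  have "cfun.dim {0 :: 'x point \<Rightarrow> complex} = 0"
    using cfun.dim_span_eq_card_independent[OF cfun.independent_empty] by simp
  then have "pdim V (\<phi> ` C) = 1" unfolding eq pdim_Proj_quot[OF fin_dim_V 0] dim_V by simp
  then show ?thesis unfolding proj_line_def proj_linear_def using eq 0 by blast
qed

lemma isomorphic_P1: "\<exists>f. isomorphism M C (coord_space {1..2::nat}) (Proj (coord_space {1..2})) f"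
proof -
  obtain p where p: "p \<in> C" using irreducible unfolding irreducible_set_def by blast
  then have "\<phi> p \<in> Proj V" using image_subset by blast
  then obtain a b \<alpha> \<beta> where bas: "a \<in> \<phi> p" "a \<in> V" "b \<in> V" "lin \<alpha>" "lin \<beta>"
    "\<And>v. v \<in> V \<Longrightarrow> v = cscale (\<alpha> v) a + cscale (\<beta> v) b"
    "\<alpha> a = 1" "\<beta> a = 0" "\<alpha> b = 0" "\<beta> b = 1" "\<phi> p = {v \<in> V. \<beta> v = 0}"
    by (rule hyperplane_basis) (rule that)
  let ?K = "coord_space {1..2::nat}"
  define T where "T g = cscale (g 1) a + cscale (g 2) b" for g :: "nat \<Rightarrow> complex"
  define S where "S v = (\<lambda>i::nat. if i = 1 then \<alpha> v else if i = 2 then \<beta> v else 0)" for v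
  have T: "Vector_Spaces.linear cscale cscale T"
    unfolding Vector_Spaces.linear_iff T_def using cfun.vector_space_axioms cfun.vector_space_axioms
    by (auto simp: cscale_def fun_eq_iff algebra_simps)
  have S: "Vector_Spaces.linear cscale cscale S"
    unfolding Vector_Spaces.linear_iff S_def using cfun.vector_space_axioms cfun.vector_space_axioms
    by (auto simp: lin_add[OF bas(4)] lin_add[OF bas(5)] lin_scale[OF bas(4)] lin_scale[OF bas(5)] fun_eq_iff)
      (auto simp: cscale_def)
  have SV: "S v \<in> ?K" for v unfolding S_def coord_space_def by auto
  have TV: "T g \<in> V" for g unfolding T_def using bas subspace_V by (intro cfun.subspace_add cfun.subspace_scale)
  have TS: "T (S v) = v" if "v \<in> V" for v unfolding T_def S_def using bas(6)[OF that] by simp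
  have ST: "S (T g) = g" if g: "g \<in> ?K" for g
  proof
    fix i
    have "\<alpha> (T g) = g 1" "\<beta> (T g) = g 2" unfolding T_def using bas by (simp_all add: lin_add lin_scale)
    moreover have "g i = 0" if "i \<noteq> 1" "i \<noteq> 2" using g that unfolding coord_space_def by auto
    ultimately show "S (T g) i = g i" unfolding S_def by auto
  qed
  have "isomorphism V (Proj V) ?K (Proj ?K) (\<lambda>z. {g \<in> ?K. T g \<in> z})"
  proof (rule isomorphism_linear[OF fin_dim_V fin_dim_coord_space T _ S])
    show "T ` ?K = V" using TV TS SV by (metis (no_types, lifting) image_subset_iff rev_image_eqI subsetI subset_antisym)
    show "S ` V = ?K" using SV ST TV by (metis (no_types, lifting) image_subset_iff rev_image_eqI subsetI subset_antisym)
  qed (use ST TS in auto)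
  moreover have "isomorphism M C V (Proj V) \<phi>"
    using embedding image_eq unfolding embedding_system_def closed_embedding_def by simp
  ultimately show ?thesis using isomorphism_compose[OF _ _ subset_Proj] by blast
qed

text \<open>The affine coordinate \<open>b / a\<close> identifies \<open>C - {p}\<close> with the affine line.\<close>

lemma affine_coordinate:
  assumes p: "p \<in> C"
  obtains a b where "a p = 0" "b p \<noteq> 0" "a \<in> V" "b \<in> V" "\<And>q. q \<in> C - {p} \<Longrightarrow> a q \<noteq> 0"
    "\<And>v. v \<in> V \<Longrightarrow> \<exists>s r. v = cscale s a + cscale r b"
    "\<And>x. \<exists>q\<in>C - {p}. b q / a q = x"
    "\<And>f. \<forall>q\<in>C - {p}. regular q f \<Longrightarrow> \<exists>P. \<forall>q\<in>C - {p}. f q = poly P (b q / a q)"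
proof -
  have H: "\<phi> p \<in> Proj V" using image_subset p by blast
  obtain a b \<alpha> \<beta> where bas: "a \<in> \<phi> p" "a \<in> V" "b \<in> V" "lin \<alpha>" "lin \<beta>"
    "\<And>v. v \<in> V \<Longrightarrow> v = cscale (\<alpha> v) a + cscale (\<beta> v) b"
    "\<alpha> a = 1" "\<beta> a = 0" "\<alpha> b = 0" "\<beta> b = 1" "\<phi> p = {v \<in> V. \<beta> v = 0}"
    by (rule hyperplane_basis[OF H]) (rule that)
  have exp: "v q = \<alpha> v * a q + \<beta> v * b q" if "v \<in> V" for v q by (rule eval_expand[OF bas(6) that])
  have ap: "a p = 0" using bas(1) unfolding linsys_map_def by blast
  have "b \<notin> \<phi> p" using bas(10,11) by auto
  then have bp: "b p \<noteq> 0" using not_mem_\<phi>[OF bas(3)] by blast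
  have aq: "a q \<noteq> 0" if q: "q \<in> C - {p}" for q
  proof
    assume "a q = 0"
    then have "v q = 0" if "v \<in> V" "\<beta> v = 0" for v using that exp[of v q] by simp
    then have "\<phi> p \<subseteq> \<phi> q" unfolding bas(11) by (auto simp: linsys_map_def)
    then have "\<phi> p = \<phi> q" using Proj_subset_eq[OF fin_dim_V H] image_subset q by blast
    then show False using inj_\<phi>[OF p] q by auto
  qed
  \<comment> \<open>The point with affine coordinate \<open>x\<close> is the kernel of
    \<open>\<alpha> + x * \<beta>\<close>; it comes from \<open>C\<close> because the image is the
    whole line.\<close>
  have surj: "\<exists>q\<in>C - {p}. b q / a q = x" for x
  proof -
    have "functional_of V {v \<in> V. \<alpha> v + x * \<beta> v = 0} (\<lambda>v. \<alpha> v + x * \<beta> v)"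
      unfolding functional_of_def using bas by (auto intro!: lin_plus lin_smult bexI[of _ a])
    then have "{v \<in> V. \<alpha> v + x * \<beta> v = 0} \<in> \<phi> ` C" unfolding image_eq by (rule functional_of_Proj[OF fin_dim_V])
    then obtain q where q: "q \<in> C" "{v \<in> V. \<alpha> v + x * \<beta> v = 0} = \<phi> q" by blast
    have "\<alpha> a + x * \<beta> a \<noteq> 0" using bas(7,8) by simp
    then have "a \<notin> \<phi> q" using q(2) by blast
    then have a: "a q \<noteq> 0" using not_mem_\<phi>[OF bas(2)] by blast
    have "b - cscale x a \<in> V" using bas(2,3) subspace_V by (intro cfun.subspace_diff cfun.subspace_scale)
    moreover have "\<alpha> (b - cscale x a) + x * \<beta> (b - cscale x a) = 0" using bas(4-10) by (simp add: lin_diff lin_scale)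
    ultimately have "b - cscale x a \<in> \<phi> q" using q(2) by blast
    then have "b q = x * a q" unfolding linsys_map_def by (simp add: cscale_def)
    then show ?thesis using q(1) a ap by (intro bexI[of _ q]) auto
  qed
  have poly: "\<exists>P. \<forall>q\<in>C - {p}. f q = poly P (b q / a q)" if reg: "\<forall>q\<in>C - {p}. regular q f" for f
  proof -
    obtain g where "\<forall>x. g x \<in> C - {p} \<and> b (g x) / a (g x) = x" using surj by metis
    then have g: "\<And>x. g x \<in> C - {p}" "\<And>x. b (g x) / a (g x) = x" by auto
    \<comment> \<open>The affine coordinate is injective on \<open>C - {p}\<close>, so any right
      inverse is a left inverse.\<close>
    have g_inv: "g (b q / a q) = q" if q: "q \<in> C - {p}" for q
    proof (rule point_eq[OF _ _ bas(2,3)])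
      let ?q = "g (b q / a q)"
      show "a ?q * b q = a q * b ?q" using g(2)[of "b q / a q"] aq[OF q] aq[OF g(1)[of "b q / a q"]] by (simp add: field_simps)
      show "\<exists>s r. \<forall>z. x z = s * a z + r * b z" if "x \<in> V" for x using exp[OF that] by blast
    qed (use g aq q in auto)
    have "\<exists>P Q K. poly K x0 \<noteq> 0 \<and> (\<forall>x. poly K x \<noteq> 0 \<longrightarrow> poly Q x \<noteq> 0 \<and> f (g x) = poly P x / poly Q x)" for x0
    proof -
      define q0 where "q0 = g x0"
      have q0: "q0 \<in> C" "\<phi> q0 \<in> \<phi> ` C" using g(1) unfolding q0_def by auto
      \<comment> \<open>Evaluation at \<open>g x\<close> is \<open>a (g x)\<close> times
        \<open>\<alpha> + x * \<beta>\<close>. Along these functionals forms become polynomials in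
        \<open>x\<close>, so regular functions become local fractions.\<close>
      have fl: "functional_of V (\<phi> (g x)) (\<lambda>v. \<alpha> v + x * \<beta> v)" for x
      proof -
        have "v (g x) = a (g x) * (\<alpha> v + x * \<beta> v)" if "v \<in> V" for v
        proof -
          have "b (g x) = x * a (g x)" using g(2)[of x] aq[OF g(1)[of x]] by (simp add: field_simps)
          then show ?thesis using exp[OF that, of "g x"] by (simp add: algebra_simps)
        qed
        then have "v (g x) = 0 \<longleftrightarrow> \<alpha> v + x * \<beta> v = 0" if "v \<in> V" for v
          using that aq[OF g(1)[of x]] by (metis mult_eq_0_iff)
        then have "\<phi> (g x) = {v \<in> V. \<alpha> v + x * \<beta> v = 0}" unfolding linsys_map_def by blast
        then show ?thesis
          unfolding functional_of_def using bas by (auto intro!: lin_plus lin_smult bexI[of _ a])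
      qed
      obtain d F G where F: "homog_poly V d F" "homog_poly V d G"
        "eventually (\<lambda>z. G (hcoord V z) \<noteq> 0 \<and> f (\<psi> z) = F (hcoord V z) / G (hcoord V z)) (E.germs (\<phi> q0))"
        using regular_\<psi>[OF q0(1) bspec[OF reg]] g(1)[of x0, folded q0_def] unfolding E.regular_iff[OF q0(2)] by blast
      then obtain U where U: "openin (zariski V) U" "\<phi> q0 \<in> U"
        "\<forall>z\<in>U \<inter> \<phi> ` C. G (hcoord V z) \<noteq> 0 \<and> f (\<psi> z) = F (hcoord V z) / G (hcoord V z)"
        unfolding E.eventually_germs[OF q0(2)] by blast
      obtain e K where K: "homog_poly V e K" "\<phi> q0 \<in> nonzero_locus V K" "nonzero_locus V K \<subseteq> U"
        using zariski_base[OF U(1,2)] .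
      obtain P where P: "\<And>x. F (\<lambda>v. \<alpha> v + x * \<beta> v) = poly P x" by (rule homog_poly_line[OF F(1), of \<alpha> \<beta>]) (rule that)
      obtain Q where Q: "\<And>x. G (\<lambda>v. \<alpha> v + x * \<beta> v) = poly Q x" by (rule homog_poly_line[OF F(2), of \<alpha> \<beta>]) (rule that)
      obtain R where R: "\<And>x. K (\<lambda>v. \<alpha> v + x * \<beta> v) = poly R x" by (rule homog_poly_line[OF K(1), of \<alpha> \<beta>]) (rule that)
      show ?thesis
      proof (rule exI[of _ P], rule exI[of _ Q], rule exI[of _ R], intro conjI allI impI)
        show "poly R x0 \<noteq> 0" using mem_nonzero_locus[OF fin_dim_V K(1) fl[of x0]] K(2) unfolding q0_def R by blast
        fix x assume "poly R x \<noteq> 0"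
        then have gU: "\<phi> (g x) \<in> U" using mem_nonzero_locus[OF fin_dim_V K(1) fl[of x]] K(3) unfolding R by blast
        have gx: "g x \<in> C" "\<phi> (g x) \<in> \<phi> ` C" using g(1)[of x] by auto
        have *: "G (hcoord V (\<phi> (g x))) \<noteq> 0" "f (g x) = F (hcoord V (\<phi> (g x))) / G (hcoord V (\<phi> (g x)))"
          using bspec[OF U(3) IntI[OF gU gx(2)]] unfolding \<psi>_\<phi>[OF gx(1)] by auto
        show "poly Q x \<noteq> 0"
          using *(1) homog_poly_functional[OF F(2) subspace_V E.hcoord[OF gx(2)] fl[of x]] unfolding Q by blast
        show "f (g x) = poly P x / poly Q x"
          using *(2) homog_poly_quotient_functional[OF F(1,2) subspace_V E.hcoord[OF gx(2)] fl[of x]] unfolding P Q by simp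
      qed
    qed
    from locally_rational_imp_polynomial[OF this] obtain P where P: "\<And>x. f (g x) = poly P x" by blast
    have "f q = poly P (b q / a q)" if "q \<in> C - {p}" for q using P[of "b q / a q"] g_inv[OF that] by simp
    then show ?thesis by blast
  qed
  have exp': "\<exists>s r. v = cscale s a + cscale r b" if "v \<in> V" for v using bas(6)[OF that] by blast
  show ?thesis by (rule that[OF ap bp bas(2,3) aq exp' surj poly])
qed

end

text \<open>The affine coordinates of the two lines are polynomials in each other, hence of degree one.\<close>

lemma line_systems_proportional:
  assumes "line_curve M C A V" "line_curve M C A' V'"
  obtains c where "\<And>q. q \<in> C \<Longrightarrow> c q \<noteq> 0" "\<And>v'. v' \<in> V' \<Longrightarrow> \<exists>v\<in>V. \<forall>q\<in>C. v' q = c q * v q"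
proof -
  interpret A: line_curve M C A V by fact
  interpret B: line_curve M C A' V' by fact
  obtain p where p: "p \<in> C" using A.irreducible unfolding irreducible_set_def by blast
  obtain a b where ab: "a p = 0" "b p \<noteq> 0" "a \<in> V" "b \<in> V" "\<And>q. q \<in> C - {p} \<Longrightarrow> a q \<noteq> 0"
    "\<And>v. v \<in> V \<Longrightarrow> \<exists>s r. v = cscale s a + cscale r b"
    "\<And>x. \<exists>q\<in>C - {p}. b q / a q = x"
    "\<And>f. \<forall>q\<in>C - {p}. A.regular q f \<Longrightarrow> \<exists>P. \<forall>q\<in>C - {p}. f q = poly P (b q / a q)"
    by (rule A.affine_coordinate[OF p], rule that, assumption+)
  obtain a' b' where ab': "a' p = 0" "b' p \<noteq> 0" "a' \<in> V'" "b' \<in> V'" "\<And>q. q \<in> C - {p} \<Longrightarrow> a' q \<noteq> 0"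
    "\<And>v. v \<in> V' \<Longrightarrow> \<exists>s r. v = cscale s a' + cscale r b'"
    "\<And>x. \<exists>q\<in>C - {p}. b' q / a' q = x"
    "\<And>f. \<forall>q\<in>C - {p}. A.regular q f \<Longrightarrow> \<exists>P. \<forall>q\<in>C - {p}. f q = poly P (b' q / a' q)"
    by (rule B.affine_coordinate[OF p], rule that, assumption+)
  have "\<exists>P. \<forall>q\<in>C - {p}. b' q / a' q = poly P (b q / a q)"
    by (rule ab(8)) (use B.regular_quotient[OF _ ab'(4,3)] ab'(5) in auto)
  then obtain P where P: "\<forall>q\<in>C - {p}. b' q / a' q = poly P (b q / a q)" by blast
  have "\<exists>P. \<forall>q\<in>C - {p}. b q / a q = poly P (b' q / a' q)"
    by (rule ab'(8)) (use A.regular_quotient[OF _ ab(4,3)] ab(5) in auto)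
  then obtain P' where P': "\<forall>q\<in>C - {p}. b q / a q = poly P' (b' q / a' q)" by blast
  have "poly (P' \<circ>\<^sub>p P) x = poly [:0, 1:] x" for x
  proof -
    obtain q where q: "q \<in> C - {p}" "b q / a q = x" using ab(7) by blast
    then have "poly P' (poly P x) = x" using P P' by metis
    then show ?thesis by (simp add: poly_pcompose)
  qed
  then have "P' \<circ>\<^sub>p P = [:0, 1:]" using poly_eq_poly_eq_iff by blast
  \<comment> \<open>Degrees multiply under composition, so mutually inverse polynomials are
    linear.\<close>
  then have "degree P' * degree P = 1" using degree_pcompose[of P' P] by simp
  then have deg: "degree P = 1" by simp
  define k m where "k = coeff P 0" and "m = coeff P 1"
  have m: "m \<noteq> 0" using deg unfolding m_def by (metis leading_coeff_0_iff degree_0 zero_neq_one)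
  have Px: "poly P x = k + m * x" for x
  proof -
    have "poly P x = (\<Sum>i\<le>1. coeff P i * x ^ i)" using poly_altdef[of P x] deg by simp
    then show ?thesis unfolding k_def m_def by simp
  qed
  \<comment> \<open>At \<open>p\<close> both \<open>a\<close> and \<open>a'\<close> vanish and their
    quotient gives nothing. The value there comes from the second relation
    \<open>b' = c * (k * a + m * b)\<close>.\<close>
  define c where "c q = (if q = p then b' p / (m * b p) else a' q / a q)" for q
  have rel: "a' q = c q * a q \<and> b' q = c q * (k * a q + m * b q)" if q: "q \<in> C" for q
  proof (cases "q = p")
    case True
    then show ?thesis using ab(1,2) ab'(1) m unfolding c_def by simp
  next
    case False
    then have q': "q \<in> C - {p}" using q by blast
    have "b' q / a' q = k + m * (b q / a q)" using P q' Px by auto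
    then show ?thesis using ab(5)[OF q'] ab'(5)[OF q'] False unfolding c_def by (simp add: field_simps)
  qed
  show ?thesis
  proof (rule that[of c])
    show "c q \<noteq> 0" if "q \<in> C" for q
      using that ab(2) ab(5)[of q] ab'(2) ab'(5)[of q] m unfolding c_def by auto
    fix v' assume "v' \<in> V'"
    then obtain s r where v': "v' = cscale s a' + cscale r b'" using ab'(6) by blast
    have "cscale (s + r * k) a + cscale (r * m) b \<in> V"
      using ab(3,4) A.subspace_V by (intro cfun.subspace_add cfun.subspace_scale)
    moreover have "\<forall>q\<in>C. v' q = c q * (cscale (s + r * k) a + cscale (r * m) b) q"
    proof
      fix q assume "q \<in> C"
      have "v' q = s * a' q + r * b' q" unfolding v' by (simp add: cscale_def)
      then show "v' q = c q * (cscale (s + r * k) a + cscale (r * m) b) q"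
        using rel[OF \<open>q \<in> C\<close>] by (simp add: cscale_def algebra_simps)
    qed
    ultimately show "\<exists>v\<in>V. \<forall>q\<in>C. v' q = c q * v q" by blast
  qed
qed

section \<open>Segre embeddings\<close>

lemma subspace_coord_hyperplane: "cfun.subspace (coord_hyperplane I c)"
  unfolding coord_hyperplane_def
  using subspace_ker[OF lin_lincomb[of I "\<lambda>i f. f i" c, OF lin_eval] subspace_coord_space] .

lemma coord_hyperplane_scale:
  assumes "t \<noteq> 0" "\<And>i. i \<in> I \<Longrightarrow> d i = t * c i" shows "coord_hyperplane I d = coord_hyperplane I c"
proof -
  have "(\<Sum>i\<in>I. d i * f i) = t * (\<Sum>i\<in>I. c i * f i)" for f
    unfolding sum_distrib_left by (intro sum.cong) (auto simp: assms(2))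
  then show ?thesis unfolding coord_hyperplane_def using assms(1) by auto
qed

text \<open>The span is the kernel of the tensor product of the functionals \<open>r\<close> and
  \<open>m\<close>, so the Segre map multiplies homogeneous coordinates.\<close>

lemma segre_map_coord:
  fixes r :: "'i \<Rightarrow> complex" and m :: "'j \<Rightarrow> complex"
  assumes I: "finite I" "\<exists>k\<in>I. r k \<noteq> 0" and J: "finite J" "\<exists>j\<in>J. m j \<noteq> 0"
  shows "segre_map (coord_space I) (coord_space J) (coord_hyperplane I r, coord_hyperplane J m) =
    coord_hyperplane (I \<times> J) (\<lambda>(k, j). r k * m j)"
proof -
  let ?S = "{tensor a b | a b. a \<in> coord_space I \<and> b \<in> coord_space J \<and> (a \<in> coord_hyperplane I r \<or> b \<in> coord_hyperplane J m)}"
  let ?H = "coord_hyperplane (I \<times> J) (\<lambda>(k, j). r k * m j)"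
  have "cfun.span ?S = ?H"
  proof
    have "?S \<subseteq> ?H"
    proof
      fix x assume "x \<in> ?S"
      then obtain a b where x: "x = tensor a b" and ab: "a \<in> coord_space I" "b \<in> coord_space J"
        "a \<in> coord_hyperplane I r \<or> b \<in> coord_hyperplane J m" by blast
      have "(\<Sum>i\<in>I \<times> J. (case i of (k, j) \<Rightarrow> r k * m j) * x i) = (\<Sum>k\<in>I. \<Sum>j\<in>J. (r k * a k) * (m j * b j))"
        unfolding x tensor_def sum.cartesian_product by (intro sum.cong) (auto simp: algebra_simps)
      also have "\<dots> = (\<Sum>k\<in>I. r k * a k) * (\<Sum>j\<in>J. m j * b j)" by (simp add: sum_product)
      also have "\<dots> = 0" using ab(3) unfolding coord_hyperplane_def by auto
      finally show "x \<in> ?H" using ab(1,2) unfolding coord_hyperplane_def coord_space_def x tensor_def by auto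
    qed
    then show "cfun.span ?S \<subseteq> ?H" by (rule cfun.span_minimal[OF _ subspace_coord_hyperplane])
  next
    obtain k0 where k0: "k0 \<in> I" "r k0 \<noteq> 0" using I(2) by blast
    obtain j0 where j0: "j0 \<in> J" "m j0 \<noteq> 0" using J(2) by blast
    \<comment> \<open>\<open>a0\<close> and \<open>b0\<close> have value 1 under the functionals
      \<open>r\<close> and \<open>m\<close>.\<close>
    define a0 where "a0 = cscale (inverse (r k0)) (unit_vec k0)"
    define b0 where "b0 = cscale (inverse (m j0)) (unit_vec j0)"
    have a0: "a0 \<in> coord_space I" unfolding a0_def
      by (rule cfun.subspace_scale[OF subspace_coord_space unit_vec_coord_space[OF k0(1)]])
    have b0: "b0 \<in> coord_space J" unfolding b0_def
      by (rule cfun.subspace_scale[OF subspace_coord_space unit_vec_coord_space[OF j0(1)]])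
    have ru: "(\<Sum>i\<in>I. r i * unit_vec k i) = r k" if "k \<in> I" for k
      using that I(1) by (simp add: unit_vec_def if_distrib[of "\<lambda>x. _ * x"] sum.delta cong: if_cong)
    have mu: "(\<Sum>i\<in>J. m i * unit_vec k i) = m k" if "k \<in> J" for k
      using that J(1) by (simp add: unit_vec_def if_distrib[of "\<lambda>x. _ * x"] sum.delta cong: if_cong)
    have lr: "lin (\<lambda>f. \<Sum>i\<in>I. r i * f i)" by (rule lin_lincomb[of I "\<lambda>i f. f i" r, OF lin_eval])
    have lm: "lin (\<lambda>f. \<Sum>i\<in>J. m i * f i)" by (rule lin_lincomb[of J "\<lambda>i f. f i" m, OF lin_eval])
    have ra0: "(\<Sum>i\<in>I. r i * a0 i) = 1" unfolding a0_def lin_scale[OF lr] ru[OF k0(1)] using k0 by simp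
    have mb0: "(\<Sum>i\<in>J. m i * b0 i) = 1" unfolding b0_def lin_scale[OF lm] mu[OF j0(1)] using j0 by simp
    \<comment> \<open>Modulo the span each tensor of unit vectors is its value under the functional
      times one fixed tensor. An element of the kernel then reduces to 0.\<close>
    have key: "tensor (unit_vec k) (unit_vec j) - cscale (r k * m j) (tensor a0 b0) \<in> cfun.span ?S"
      if k: "k \<in> I" and j: "j \<in> J" for k j
    proof -
      let ?a = "unit_vec k - cscale (r k) a0" and ?b = "unit_vec j - cscale (m j) b0"
      have "?a \<in> coord_space I" "?b \<in> coord_space J"
        using a0 b0 unit_vec_coord_space[OF k] unit_vec_coord_space[OF j]
        by (simp_all add: cfun.subspace_diff cfun.subspace_scale subspace_coord_space)
      moreover have "(\<Sum>i\<in>I. r i * ?a i) = 0" unfolding lin_diff[OF lr] lin_scale[OF lr] ru[OF k] ra0 by simp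
      moreover have "(\<Sum>i\<in>J. m i * ?b i) = 0" unfolding lin_diff[OF lm] lin_scale[OF lm] mu[OF j] mb0 by simp
      ultimately have "?a \<in> coord_hyperplane I r" "?b \<in> coord_hyperplane J m" unfolding coord_hyperplane_def by auto
      then have "tensor ?a (unit_vec j) \<in> cfun.span ?S" "tensor a0 ?b \<in> cfun.span ?S"
        using a0 unit_vec_coord_space[OF j] \<open>?a \<in> coord_space I\<close> \<open>?b \<in> coord_space J\<close> by (blast intro: cfun.span_base)+
      then have "tensor ?a (unit_vec j) + cscale (r k) (tensor a0 ?b) \<in> cfun.span ?S"
        by (intro cfun.span_add cfun.span_scale)
      moreover have "tensor (unit_vec k) (unit_vec j) - cscale (r k * m j) (tensor a0 b0) =
        tensor ?a (unit_vec j) + cscale (r k) (tensor a0 ?b)"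
        by (auto simp: tensor_def cscale_def fun_eq_iff algebra_simps)
      ultimately show ?thesis by simp
    qed
    show "?H \<subseteq> cfun.span ?S"
    proof
      fix h assume h: "h \<in> ?H"
      then have hc: "h \<in> coord_space (I \<times> J)" and h0: "(\<Sum>i\<in>I \<times> J. (case i of (k, j) \<Rightarrow> r k * m j) * h i) = 0"
        unfolding coord_hyperplane_def by auto
      have "(\<Sum>i\<in>I \<times> J. cscale (h i) (tensor (unit_vec (fst i)) (unit_vec (snd i)) - cscale (r (fst i) * m (snd i)) (tensor a0 b0))) \<in> cfun.span ?S"
        by (intro cfun.span_sum cfun.span_scale key) auto
      moreover have "(\<Sum>i\<in>I \<times> J. cscale (h i) (tensor (unit_vec (fst i)) (unit_vec (snd i)) - cscale (r (fst i) * m (snd i)) (tensor a0 b0))) = h"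
      proof -
        have u: "tensor (unit_vec (fst i)) (unit_vec (snd i)) = unit_vec i" for i :: "'i \<times> 'j"
          by (cases i) (auto simp: tensor_def unit_vec_def fun_eq_iff)
        have "(\<Sum>i\<in>I \<times> J. cscale (h i) (tensor (unit_vec (fst i)) (unit_vec (snd i)) - cscale (r (fst i) * m (snd i)) (tensor a0 b0)))
          = (\<Sum>i\<in>I \<times> J. cscale (h i) (unit_vec i)) - (\<Sum>i\<in>I \<times> J. cscale ((case i of (k, j) \<Rightarrow> r k * m j) * h i) (tensor a0 b0))"
          unfolding u sum_subtractf[symmetric] by (intro sum.cong) (auto simp: cscale_def fun_eq_iff algebra_simps)
        also have "(\<Sum>i\<in>I \<times> J. cscale (h i) (unit_vec i)) = h"
          by (rule coord_space_expand[OF finite_cartesian_product[OF I(1) J(1)] hc, symmetric])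
        also have "(\<Sum>i\<in>I \<times> J. cscale ((case i of (k, j) \<Rightarrow> r k * m j) * h i) (tensor a0 b0)) = 0"
          unfolding cfun.scale_sum_left[symmetric] h0 by simp
        finally show ?thesis by (simp only: diff_zero)
      qed
      ultimately show "h \<in> cfun.span ?S" by (simp only:)
    qed
  qed
  then show ?thesis unfolding segre_map_def by simp
qed

text \<open>A functional on \<open>W\<close> whose kernel contains that of \<open>T\<close> descends
  along the surjection \<open>T\<close> to a functional on \<open>U\<close>.\<close>

lemma image_Proj_linear:
  assumes W: "fin_dim W" and U: "fin_dim U" and T: "Vector_Spaces.linear cscale cscale T" and TW: "T ` W = U"
  shows "(\<lambda>H. {w \<in> W. T w \<in> H}) ` Proj U = Proj_quot W {w \<in> W. T w = 0}"
proof (intro equalityI subsetI)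
  fix x assume "x \<in> (\<lambda>H. {w \<in> W. T w \<in> H}) ` Proj U"
  then obtain H where H: "H \<in> Proj U" "x = {w \<in> W. T w \<in> H}" by blast
  have "functional_of W x (\<lambda>g. hcoord U H (T g))" unfolding H(2)
    by (rule functional_of_pullback[OF T TW hcoord_functional[OF U H(1)]])
  then have "x \<in> Proj W" by (rule functional_of_Proj[OF W])
  moreover have "0 \<in> H" using H(1) cfun.subspace_0 unfolding Proj_def by blast
  ultimately show "x \<in> Proj_quot W {w \<in> W. T w = 0}" unfolding Proj_quot_def H(2) by auto
next
  fix x assume "x \<in> Proj_quot W {w \<in> W. T w = 0}"
  then have x: "x \<in> Proj W" "{w \<in> W. T w = 0} \<subseteq> x" unfolding Proj_quot_def by auto
  obtain l where l: "lin l" "\<exists>w\<in>W. l w \<noteq> 0" "x = {w \<in> W. l w = 0}" using x(1) unfolding Proj_iff[OF W] by blast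
  obtain w0 where w0: "w0 \<in> W" "l w0 \<noteq> 0" using l(2) by blast
  interpret T: Vector_Spaces.linear cscale cscale T by fact
  have sx: "cfun.subspace x" "x \<subseteq> W" using x(1) unfolding Proj_def by auto
  have sW: "cfun.subspace W" by (rule fin_dim_imp_subspace[OF W])
  \<comment> \<open>Here the kernel of \<open>T\<close> is contained in \<open>x\<close>, so
    \<open>x\<close> is a union of fibres of \<open>T\<close> in \<open>W\<close>.\<close>
  have "T w0 \<notin> T ` x"
  proof
    assume "T w0 \<in> T ` x"
    then obtain w where w: "w \<in> x" "T w0 = T w" by blast
    then have "T (w0 - w) = 0" by (simp add: T.diff)
    moreover have "w0 - w \<in> W" using w0(1) w(1) sx(2) cfun.subspace_diff[OF sW] by blast
    ultimately have "w0 - w \<in> x" using x(2) by blast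
    then have "l (w0 - w) = 0" "l w = 0" using l(3) w(1) by auto
    then show False using w0(2) lin_diff[OF l(1), of w0 w] by simp
  qed
  from functional_exists[OF T.subspace_image[OF sx(1)] this]
  obtain l' where l': "lin l'" "\<And>y. y \<in> T ` x \<Longrightarrow> l' y = 0" "l' (T w0) = 1" by blast
  have eq: "l' (T w) = l w / l w0" if w: "w \<in> W" for w
  proof -
    have "w - cscale (l w / l w0) w0 \<in> x" unfolding l(3)
      using w w0 cfun.subspace_diff[OF sW w cfun.subspace_scale[OF sW w0(1)]] by (simp add: lin_diff[OF l(1)] lin_scale[OF l(1)])
    then have "l' (T (w - cscale (l w / l w0) w0)) = 0" using l'(2) by blast
    then show ?thesis using l'(3) by (simp add: T.diff T.scale lin_diff[OF l'(1)] lin_scale[OF l'(1)])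
  qed
  have "functional_of U {y \<in> U. l' y = 0} l'" unfolding functional_of_def
    using l' w0(1) TW by (auto intro!: bexI[of _ "T w0"])
  then have "{y \<in> U. l' y = 0} \<in> Proj U" by (rule functional_of_Proj[OF U])
  moreover have "T w \<in> U" if "w \<in> W" for w using TW that by blast
  then have "{w \<in> W. T w \<in> {y \<in> U. l' y = 0}} = x"
    unfolding l(3) using eq w0(2) by auto
  ultimately show "x \<in> (\<lambda>H. {w \<in> W. T w \<in> H}) ` Proj U" by (intro image_eqI[of _ _ "{y \<in> U. l' y = 0}"]) auto
qed

text \<open>Some section vanishes at one of the two points and not at the other, so the two
  evaluations are independent; as \<open>V\<close> has dimension 2, nothing but 0 vanishes at both.
  \<open>s1\<close> and \<open>s2\<close> form the dual basis.\<close>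

lemma (in line_curve) two_point_basis:
  assumes p: "p1 \<in> C" "p2 \<in> C" "p1 \<noteq> p2"
  obtains s1 s2 where "s1 \<in> V" "s2 \<in> V" "s1 p1 = 1" "s1 p2 = 0" "s2 p1 = 0" "s2 p2 = 1"
    "\<And>v q. v \<in> V \<Longrightarrow> v q = v p1 * s1 q + v p2 * s2 q"
proof -
  have ex: "\<exists>s\<in>V. s x = 0 \<and> s y = 1" if xy: "x \<in> C" "y \<in> C" "x \<noteq> y" for x y
  proof -
    have "\<not> \<phi> x \<subseteq> \<phi> y" using Proj_subset_eq[OF fin_dim_V, of "\<phi> x" "\<phi> y"] image_subset xy inj_\<phi> by blast
    then obtain s where s: "s \<in> V" "s x = 0" "s y \<noteq> 0" unfolding linsys_map_def by blast
    then show ?thesis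
      using cfun.subspace_scale[OF subspace_V s(1)] by (intro bexI[of _ "cscale (inverse (s y)) s"]) (auto simp: cscale_def)
  qed
  obtain s1 where s1: "s1 \<in> V" "s1 p2 = 0" "s1 p1 = 1" using ex[OF p(2,1)] p(3) by blast
  obtain s2 where s2: "s2 \<in> V" "s2 p1 = 0" "s2 p2 = 1" using ex[OF p] by blast
  define K where "K = {v \<in> V. v p1 = 0 \<and> v p2 = 0}"
  have K: "cfun.subspace K" unfolding K_def cfun.subspace_def
    using subspace_V by (auto simp: cscale_def cfun.subspace_0 cfun.subspace_add dest: cfun.subspace_scale)
  define e where "e b = (if b then s2 else s1)" for b
  have sum: "(\<Sum>b\<in>UNIV. cscale (c b) (e b)) = cscale (c False) s1 + cscale (c True) s2" for c
    by (simp add: UNIV_bool e_def add.commute)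
  have inK: "v - (cscale (v p1) s1 + cscale (v p2) s2) \<in> K" if "v \<in> V" for v
  proof -
    have "v - (cscale (v p1) s1 + cscale (v p2) s2) \<in> V"
      using that s1 s2 subspace_V by (intro cfun.subspace_diff cfun.subspace_add cfun.subspace_scale)
    then show ?thesis unfolding K_def using s1 s2 by (simp add: cscale_def)
  qed
  have "cfun.dim V = cfun.dim K + card (UNIV :: bool set)"
  proof (rule dim_complement[where e = e])
    show "\<And>i. e i \<in> V" using s1 s2 unfolding e_def by simp
    show "K \<subseteq> V" unfolding K_def by blast
    fix w assume "w \<in> V"
    from inK[OF this] show "\<exists>c. w - (\<Sum>i\<in>UNIV. cscale (c i) (e i)) \<in> K" unfolding sum
      by (intro exI[of _ "\<lambda>b. if b then w p2 else w p1"]) simp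
  next
    fix c assume "(\<Sum>i\<in>UNIV. cscale (c i) (e i)) \<in> K"
    then have "c False = 0" "c True = 0" unfolding sum K_def using s1 s2 by (auto simp: cscale_def)
    then show "\<forall>i\<in>UNIV. c i = 0" by (metis (full_types))
  qed (use fin_dim_V K in auto)
  then have "cfun.dim K = 0" using dim_V by simp
  have KV: "K \<subseteq> V" unfolding K_def by blast
  have "K = {0}"
  proof (rule ccontr)
    assume "K \<noteq> {0}"
    then have "{0} \<subset> K" using cfun.subspace_0[OF K] by blast
    from dim_strict_mono_fin[OF fin_dim_subspace[OF fin_dim_V K KV] _ this] show False
      using \<open>cfun.dim K = 0\<close> by simp
  qed
  have "v q = v p1 * s1 q + v p2 * s2 q" if "v \<in> V" for v q
  proof -
    have "v - (cscale (v p1) s1 + cscale (v p2) s2) = 0" using inK[OF that] \<open>K = {0}\<close> by blast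
    then have "(v - (cscale (v p1) s1 + cscale (v p2) s2)) q = 0" by simp
    then show ?thesis by (simp add: cscale_def)
  qed
  then show ?thesis using that[OF s1(1) s2(1) s1(3,2) s2(2,3)] by blast
qed

text \<open>All the line systems are proportional to the first, and a section of the first is
  determined by its values at two points. Evaluating each component at these points gives
  \<open>2 * s\<close> coordinates, in which a point of the stratum is a product of coordinates of
  the base point and of fibre coordinates.\<close>

lemma (in scroll) segre_stratum:
  assumes \<sigma>: "\<sigma> permutes {1..n}" and s: "1 \<le> s" "s \<le> n"
    and inf: "\<And>i q. i \<in> {1..s} \<Longrightarrow> q \<in> C \<Longrightarrow> infl (\<sigma> i) q"
  shows "segre_image_in W (pspan W (\<Union>i\<in>{1..s}. summand_incl n V (\<sigma> i) ` linsys_map (V (\<sigma> i)) ` C)) s (stratum C (\<sigma> ` {1..s}))"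
proof -
  have \<sigma>i: "\<sigma> i \<in> {1..n}" if "i \<in> {1..s}" for i
    using permutes_in_image[OF \<sigma>, of i] that s(2) by auto
  have inj: "\<sigma> i = \<sigma> j \<longleftrightarrow> i = j" for i j using permutes_inj[OF \<sigma>] by (simp add: inj_eq)
  let ?A = "\<sigma> ` {1..s}"
  have A: "?A \<subseteq> {1..n}" using \<sigma>i by blast
  have lc: "line_curve M C (L (\<sigma> i)) (V (\<sigma> i))" if "i \<in> {1..s}" for i
    by (rule line_curve.intro[OF embedded[OF \<sigma>i[OF that]]])
      (unfold_locales, use inf[OF that] in blast)
  have s1: "1 \<in> {1..s}" using s by simp
  interpret l1: line_curve M C "L (\<sigma> 1)" "V (\<sigma> 1)" by (rule lc[OF s1])
  obtain p1 where p1: "p1 \<in> C" using irreducible unfolding irreducible_set_def by blast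
  obtain p2 where p2: "p2 \<in> C" "p1 \<noteq> p2"
  proof -
    have "infinite (C - {p1})" using infinite_curve by simp
    then obtain x where "x \<in> C - {p1}" using infinite_imp_nonempty by blast
    then show ?thesis using that by blast
  qed
  have "\<forall>i\<in>{1..s}. \<exists>c. (\<forall>q\<in>C. c q \<noteq> 0) \<and> (\<forall>v'\<in>V (\<sigma> i). \<exists>v\<in>V (\<sigma> 1). \<forall>q\<in>C. v' q = c q * v q)"
  proof
    fix i assume "i \<in> {1..s}"
    from lc[OF this] show "\<exists>c. (\<forall>q\<in>C. c q \<noteq> 0) \<and> (\<forall>v'\<in>V (\<sigma> i). \<exists>v\<in>V (\<sigma> 1). \<forall>q\<in>C. v' q = c q * v q)"
      by (rule line_systems_proportional[OF lc[OF s1]]) blast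
  qed
  from bchoice[OF this] obtain c where c: "\<forall>i\<in>{1..s}. (\<forall>q\<in>C. c i q \<noteq> 0) \<and> (\<forall>v'\<in>V (\<sigma> i). \<exists>v\<in>V (\<sigma> 1). \<forall>q\<in>C. v' q = c i q * v q)"
    by (rule exE)
  obtain s1 s2 where ss: "s1 \<in> V (\<sigma> 1)" "s2 \<in> V (\<sigma> 1)" "s1 p1 = 1" "s1 p2 = 0" "s2 p1 = 0" "s2 p2 = 1"
    and sv: "\<And>v q. v \<in> V (\<sigma> 1) \<Longrightarrow> v q = v p1 * s1 q + v p2 * s2 q"
    by (rule l1.two_point_basis[OF p1 p2]) blast
  define pk where "pk k = (if k = (1::nat) then p1 else p2)" for k
  define r where "r q = (\<lambda>k::nat. if k = 1 then s1 q else s2 q)" for q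
  have pkC: "pk k \<in> C" for k using p1 p2 unfolding pk_def by simp
  have c0: "c j q \<noteq> 0" if "j \<in> {1..s}" "q \<in> C" for j q using c that by blast
  \<comment> \<open>Values at the two base points. Division by the proportionality factor
    \<open>c j\<close> turns the \<open>j\<close>-th component into a section of the first system
    before it is evaluated.\<close>
  define T where "T w = (\<lambda>(k, j). if k \<in> {1..2::nat} \<and> j \<in> {1..s} then w (\<sigma> j, pk k) / c j (pk k) else 0)"
    for w :: "nat \<times> 'x point \<Rightarrow> complex"
  let ?U = "coord_space ({1..2::nat} \<times> {1..s})"
  have I2: "{1..2} = {1, 2::nat}" by auto
  have r0: "\<exists>k\<in>{1..2}. r q k \<noteq> 0" if q: "q \<in> C" for q
  proof -
    obtain v where v: "v \<in> V (\<sigma> 1)" "v q \<noteq> 0" using l1.section_nonzero[OF q] by blast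
    then have "s1 q \<noteq> 0 \<or> s2 q \<noteq> 0" using sv[OF v(1), of q] by auto
    then show ?thesis unfolding I2 r_def by auto
  qed
  \<comment> \<open>Interpolation from the two base points: \<open>r q\<close> is the coordinate
    vector of \<open>q\<close> on the line, the same for all \<open>j\<close>, and the factor
    \<open>c j q\<close> can be moved into the fibre coordinate.\<close>
  have key: "w (\<sigma> j, q) = c j q * (\<Sum>k\<in>{1..2}. r q k * T w (k, j))" if w: "w \<in> W" and q: "q \<in> C" and j: "j \<in> {1..s}" for w q j
  proof -
    have "component (\<sigma> j) w \<in> V (\<sigma> j)" by (rule component_in_V[OF w \<sigma>i[OF j]])
    then obtain v where v: "v \<in> V (\<sigma> 1)" "\<forall>q\<in>C. component (\<sigma> j) w q = c j q * v q" using c j by blast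
    have wv: "w (\<sigma> j, x) = c j x * v x" if "x \<in> C" for x using v(2) that unfolding component_def by blast
    have "T w (1, j) = v p1" "T w (2, j) = v p2"
      unfolding T_def pk_def using j wv p1 p2 c0[OF j] by auto
    then show ?thesis unfolding wv[OF q] I2 using sv[OF v(1), of q] by (simp add: r_def algebra_simps)
  qed
  have T: "Vector_Spaces.linear cscale cscale T"
    unfolding Vector_Spaces.linear_iff T_def using cfun.vector_space_axioms cfun.vector_space_axioms
    by (auto simp: fun_eq_iff cscale_def add_divide_distrib)
  have TW: "T ` W = ?U"
  proof (intro equalityI subsetI)
    fix h assume "h \<in> T ` W"
    then show "h \<in> ?U" unfolding T_def coord_space_def by auto
  next
    fix h assume h: "h \<in> ?U"
    have "\<forall>j\<in>{1..s}. \<exists>v. v \<in> V (\<sigma> j) \<and> v p1 = c j p1 * h (1, j) \<and> v p2 = c j p2 * h (2, j)"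
    proof
      fix j assume j: "j \<in> {1..s}"
      obtain t1 t2 where t: "t1 \<in> V (\<sigma> j)" "t2 \<in> V (\<sigma> j)" "t1 p1 = 1" "t1 p2 = 0" "t2 p1 = 0" "t2 p2 = 1"
        by (rule line_curve.two_point_basis[OF lc[OF j] p1 p2]) blast
      then show "\<exists>v. v \<in> V (\<sigma> j) \<and> v p1 = c j p1 * h (1, j) \<and> v p2 = c j p2 * h (2, j)"
        using cfun.subspace_add[OF subspace_V[OF \<sigma>i[OF j]] cfun.subspace_scale[OF subspace_V[OF \<sigma>i[OF j]] t(1)]
          cfun.subspace_scale[OF subspace_V[OF \<sigma>i[OF j]] t(2)]]
        by (intro exI[of _ "cscale (c j p1 * h (1, j)) t1 + cscale (c j p2 * h (2, j)) t2"]) (auto simp: cscale_def)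
    qed
    from bchoice[OF this] obtain v where v: "\<forall>j\<in>{1..s}. v j \<in> V (\<sigma> j) \<and> v j p1 = c j p1 * h (1, j) \<and> v j p2 = c j p2 * h (2, j)"
      by (rule exE)
    define w where "w = (\<Sum>j\<in>{1..s}. incl (\<sigma> j) (v j))"
    have wW: "w \<in> W" unfolding w_def using v \<sigma>i by (intro cfun.subspace_sum[OF subspace_W] incl_in_W) auto
    have wj: "w (\<sigma> j, x) = v j x" if j: "j \<in> {1..s}" for j x
    proof -
      have "component (\<sigma> j) w = (\<Sum>i\<in>{1..s}. if i = j then v j else 0)"
        unfolding w_def component_sum component_incl by (intro sum.cong) (auto simp: inj)
      also have "\<dots> = v j" using j by (simp only: sum.delta finite_atLeastAtMost if_True)
      finally show ?thesis unfolding component_def by (rule fun_cong)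
    qed
    have "T w = h"
    proof
      fix x :: "nat \<times> nat" obtain k j where x: "x = (k, j)" by (cases x)
      show "T w x = h x"
      proof (cases "k \<in> {1..2} \<and> j \<in> {1..s}")
        case True
        then have "k = 1 \<or> k = 2" by auto
        then show ?thesis unfolding x T_def pk_def using True wj[of j] v c0[of j] p1 p2 by auto
      next
        case False
        then show ?thesis unfolding x T_def using h unfolding coord_space_def by auto
      qed
    qed
    then show "h \<in> T ` W" using wW by blast
  qed
  have hyp: "{w \<in> W. T w \<in> coord_hyperplane ({1..2} \<times> {1..s}) (\<lambda>(k, j). r q k * m j)} = pt q d"
    if q: "q \<in> C" and d: "\<forall>i\<in>{1..n} - ?A. d i = 0" "\<forall>j\<in>{1..s}. d (\<sigma> j) * c j q = m j" for q d m
  proof -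
    have "fl q d w = (\<Sum>i\<in>{1..2} \<times> {1..s}. (case i of (k, j) \<Rightarrow> r q k * m j) * T w i)" if w: "w \<in> W" for w
    proof -
      have "fl q d w = (\<Sum>i\<in>?A. d i * w (i, q))" unfolding fl_def
        by (rule sum.mono_neutral_right) (use A d(1) in auto)
      also have "\<dots> = (\<Sum>j\<in>{1..s}. d (\<sigma> j) * w (\<sigma> j, q))"
        by (subst sum.reindex) (use permutes_inj_on[OF \<sigma>] in auto)
      also have "\<dots> = (\<Sum>j\<in>{1..s}. \<Sum>k\<in>{1..2}. (r q k * m j) * T w (k, j))"
      proof (rule sum.cong)
        fix j assume j: "j \<in> {1..s}"
        have "d (\<sigma> j) * w (\<sigma> j, q) = (d (\<sigma> j) * c j q) * (\<Sum>k\<in>{1..2}. r q k * T w (k, j))"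
          unfolding key[OF w q j] by simp
        also have "d (\<sigma> j) * c j q = m j" using d(2) j by blast
        finally show "d (\<sigma> j) * w (\<sigma> j, q) = (\<Sum>k\<in>{1..2}. (r q k * m j) * T w (k, j))"
          by (simp add: sum_distrib_left mult_ac)
      qed simp
      also have "\<dots> = (\<Sum>k\<in>{1..2}. \<Sum>j\<in>{1..s}. (r q k * m j) * T w (k, j))" by (rule sum.swap)
      also have "\<dots> = (\<Sum>i\<in>{1..2} \<times> {1..s}. (case i of (k, j) \<Rightarrow> r q k * m j) * T w i)"
        unfolding sum.cartesian_product by (intro sum.cong) auto
      finally show ?thesis .
    qed
    then show ?thesis unfolding pt_def coord_hyperplane_def using TW by auto
  qed
  have fin: "finite ({1..2::nat} \<times> {1..s})" by simp
  let ?F = "\<lambda>H. {w \<in> W. T w \<in> H}"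
  have G: "stratum C ?A = ?F ` segre_map (coord_space {1..2}) (coord_space {1..s}) `
        (Proj (coord_space {1..2}) \<times> Proj (coord_space {1..s}))"
  proof (intro equalityI subsetI)
    fix x assume "x \<in> stratum C ?A"
    then obtain q d where x: "x = pt q d" "q \<in> C" "nonzero d" "\<forall>i\<in>{1..n} - ?A. d i = 0" unfolding stratum_def by blast
    define m where "m j = d (\<sigma> j) * c j q" for j
    have m0: "\<exists>j\<in>{1..s}. m j \<noteq> 0"
    proof -
      obtain i where "i \<in> {1..n}" "d i \<noteq> 0" using x(3) unfolding nonzero_def by blast
      then obtain j where "j \<in> {1..s}" "d (\<sigma> j) \<noteq> 0" using x(4) by blast
      then show ?thesis unfolding m_def using c0 x(2) by auto
    qed
    have "x = ?F (segre_map (coord_space {1..2}) (coord_space {1..s}) (coord_hyperplane {1..2} (r q), coord_hyperplane {1..s} m))"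
      unfolding x(1) segre_map_coord[OF finite_atLeastAtMost r0[OF x(2)] finite_atLeastAtMost m0]
      by (rule hyp[symmetric]) (use x m_def in auto)
    moreover have "coord_hyperplane {1..2} (r q) \<in> Proj (coord_space {1..2})" "coord_hyperplane {1..s} m \<in> Proj (coord_space {1..s})"
      unfolding Proj_coord_space[OF finite_atLeastAtMost] using r0[OF x(2)] m0 by blast+
    ultimately show "x \<in> ?F ` segre_map (coord_space {1..2}) (coord_space {1..s}) `
        (Proj (coord_space {1..2}) \<times> Proj (coord_space {1..s}))" by blast
  next
    fix x assume "x \<in> ?F ` segre_map (coord_space {1..2}) (coord_space {1..s}) `
        (Proj (coord_space {1..2}) \<times> Proj (coord_space {1..s}))"
    then obtain b m where x: "x = ?F (segre_map (coord_space {1..2}) (coord_space {1..s}) (coord_hyperplane {1..2} b, coord_hyperplane {1..s} m))"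
      and b0: "\<exists>k\<in>{1..2}. b k \<noteq> 0" and m0: "\<exists>j\<in>{1..s}. m j \<noteq> 0"
      unfolding Proj_coord_space[OF finite_atLeastAtMost] by blast
    \<comment> \<open>The point \<open>b\<close> of the projective line read as a combination of the
      two evaluations. Since the first curve fills its projective line, its kernel is that of
      evaluation at some \<open>q\<close>.\<close>
    let ?l = "\<lambda>v. b 1 * v p1 + b 2 * v p2"
    have ll: "lin ?l" by (intro lin_plus lin_smult lin_eval)
    have "\<exists>v\<in>V (\<sigma> 1). ?l v \<noteq> 0"
    proof -
      have "b 1 \<noteq> 0 \<or> b 2 \<noteq> 0" using b0 unfolding I2 by auto
      then show ?thesis using ss by (metis add.right_neutral add.left_neutral mult.right_neutral mult_zero_right)
    qed
    then have lf: "functional_of (V (\<sigma> 1)) {v \<in> V (\<sigma> 1). ?l v = 0} ?l" using ll unfolding functional_of_def by blast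
    then have "{v \<in> V (\<sigma> 1). ?l v = 0} \<in> l1.\<phi> ` C" unfolding l1.image_eq by (rule functional_of_Proj[OF l1.fin_dim_V])
    then obtain q where q: "q \<in> C" "{v \<in> V (\<sigma> 1). ?l v = 0} = l1.\<phi> q" by blast
    obtain t where t: "t \<noteq> 0" "\<And>v. v \<in> V (\<sigma> 1) \<Longrightarrow> v q = t * ?l v"
      by (rule functional_of_unique[OF l1.subspace_V lf, of "\<lambda>v. v q"]) (use l1.functional_eval[OF q(1)] q(2) in auto)
    have "r q k = t * b k" if "k \<in> {1..2}" for k
      using that t(2)[OF ss(1)] t(2)[OF ss(2)] ss unfolding I2 r_def by auto
    then have bq: "coord_hyperplane {1..2} b = coord_hyperplane {1..2} (r q)"
      using coord_hyperplane_scale[OF t(1), of "{1..2}" "r q" b] by simp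
    \<comment> \<open>Solves \<open>d (\<sigma> j) * c j q = m j\<close> for the fibre coordinates;
      the other coordinates are zero.\<close>
    define d where "d i = (if i \<in> ?A then m (inv \<sigma> i) / c (inv \<sigma> i) q else 0)" for i
    have d\<sigma>: "d (\<sigma> j) * c j q = m j" if "j \<in> {1..s}" for j
      unfolding d_def using that c0[OF that q(1)] permutes_inverses(2)[OF \<sigma>] by simp
    have "x = pt q d"
      unfolding x bq segre_map_coord[OF finite_atLeastAtMost r0[OF q(1)] finite_atLeastAtMost m0]
      by (rule hyp[OF q(1)]) (use d\<sigma> in \<open>auto simp: d_def\<close>)
    moreover have "nonzero d"
    proof -
      obtain j where j: "j \<in> {1..s}" "m j \<noteq> 0" using m0 by blast
      then have "d (\<sigma> j) \<noteq> 0" using d\<sigma>[OF j(1)] by auto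
      then show ?thesis unfolding nonzero_def using \<sigma>i[OF j(1)] by blast
    qed
    moreover have "\<forall>i\<in>{1..n} - ?A. d i = 0" unfolding d_def by simp
    ultimately show "x \<in> stratum C ?A" unfolding stratum_def using q(1) by blast
  qed
  have "pspan W (\<Union>i\<in>{1..s}. summand_incl n V (\<sigma> i) ` linsys_map (V (\<sigma> i)) ` C)
    = pspan W (\<Union>i\<in>?A. summand_incl n V i ` (linsys_map (V i) ` C))" by simp
  also have "\<dots> = Proj_quot W {w \<in> W. \<forall>i\<in>?A. \<forall>H\<in>linsys_map (V i) ` C. component i w \<in> H}"
    by (rule pspan_summands[OF A]) (use embedded_curve.image_subset[OF embedded] A in blast)
  also have "{w \<in> W. \<forall>i\<in>?A. \<forall>H\<in>linsys_map (V i) ` C. component i w \<in> H} = {w \<in> W. T w = 0}"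
  proof (intro Collect_cong conj_cong refl)
    fix w assume w: "w \<in> W"
    have "(\<forall>i\<in>?A. \<forall>H\<in>linsys_map (V i) ` C. component i w \<in> H) \<longleftrightarrow> (\<forall>j\<in>{1..s}. \<forall>q\<in>C. w (\<sigma> j, q) = 0)"
      using component_in_V[OF w] \<sigma>i unfolding linsys_map_def component_def by auto
    also have "\<dots> \<longleftrightarrow> T w = 0"
    proof
      assume z: "\<forall>j\<in>{1..s}. \<forall>q\<in>C. w (\<sigma> j, q) = 0"
      show "T w = 0" unfolding T_def using z pkC by (auto simp: fun_eq_iff)
    next
      assume "T w = 0"
      then show "\<forall>j\<in>{1..s}. \<forall>q\<in>C. w (\<sigma> j, q) = 0" using key[OF w] by simp
    qed
    finally show "(\<forall>i\<in>?A. \<forall>H\<in>linsys_map (V i) ` C. component i w \<in> H) \<longleftrightarrow> T w = 0" .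
  qed
  also have "Proj_quot W {w \<in> W. T w = 0} = ?F ` Proj ?U"
    by (rule image_Proj_linear[OF fin_dim_W fin_dim_coord_space[OF fin] T TW, symmetric])
  finally show ?thesis unfolding segre_image_in_def using T TW G by blast
qed

text \<open>A bijection from the initial segment to \<open>A\<close> and one between the complements
  are glued. This provides the reordering of the curves.\<close>

lemma permutes_initial_segment:
  assumes "A \<subseteq> {1..n::nat}" shows "\<exists>\<sigma>. \<sigma> permutes {1..n} \<and> \<sigma> ` {1..card A} = A"
proof -
  let ?s = "card A"
  have fA: "finite A" using assms finite_subset by blast
  have sn: "?s \<le> n" using card_mono[OF _ assms] by simp
  obtain f where f: "bij_betw f {1..?s} A" using finite_same_card_bij[of "{1..?s}" A] fA by auto
  have "card ({1..n} - {1..?s}) = card ({1..n} - A)"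
    using card_Diff_subset[of "{1..?s}" "{1..n}"] card_Diff_subset[OF fA assms] sn by simp
  then obtain g where g: "bij_betw g ({1..n} - {1..?s}) ({1..n} - A)"
    using finite_same_card_bij[of "{1..n} - {1..?s}" "{1..n} - A"] by auto
  define \<sigma> where "\<sigma> i = (if i \<in> {1..?s} then f i else if i \<in> {1..n} then g i else i)" for i
  have 1: "bij_betw \<sigma> {1..?s} A" using f by (rule bij_betw_cong[THEN iffD1, rotated]) (auto simp: \<sigma>_def)
  have 2: "bij_betw \<sigma> ({1..n} - {1..?s}) ({1..n} - A)"
    using g by (rule bij_betw_cong[THEN iffD1, rotated]) (auto simp: \<sigma>_def)
  have "bij_betw \<sigma> ({1..?s} \<union> ({1..n} - {1..?s})) (A \<union> ({1..n} - A))" by (rule bij_betw_combine[OF 1 2]) blast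
  moreover have "{1..?s} \<union> ({1..n} - {1..?s}) = {1..n}" "A \<union> ({1..n} - A) = {1..n}" using assms sn by auto
  ultimately have "bij_betw \<sigma> {1..n} {1..n}" by simp
  moreover have "\<And>x. x \<notin> {1..n} \<Longrightarrow> \<sigma> x = x" unfolding \<sigma>_def using sn by auto
  ultimately have "\<sigma> permutes {1..n}" by (rule bij_imp_permutes)
  then show ?thesis using bij_betw_imp_surj_on[OF 1] by blast
qed

theorem proposition4p2:
  fixes M :: "('a \<Rightarrow> complex) set"
    and C :: "'a point set"
    and n :: nat
    and L :: "nat \<Rightarrow> 'a frames"
    and V :: "nat \<Rightarrow> ('a point \<Rightarrow> complex) set"
    and X \<Phi> G :: "(nat \<times> 'a point) point set"
  assumes curve: "smooth_projective_curve M C"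
    and n: "n \<ge> 1"
    and bundles: "\<And>i. i \<in> {1..n} \<Longrightarrow> line_bundle M C (L i)"
    and ample: "\<And>i. i \<in> {1..n} \<Longrightarrow> very_ample M C (L i)"
    and systems: "\<And>i. i \<in> {1..n} \<Longrightarrow> embedding_system M C (L i) (V i)"
    and X: "X = decomposable_scroll n C V"
    and \<Phi>: "\<Phi> = inflectional_locus (sys_sum n V) n X 2"
    and proper: "\<Phi> \<noteq> X"
    and G: "irreducible_component (zariski (sys_sum n V)) \<Phi> G"
  shows "\<exists>\<sigma> s. \<sigma> permutes {1..n} \<and> 1 \<le> s \<and> s \<le> n \<and>
    ((\<exists>p\<in>C.
        G = point_span n V (\<sigma> ` {1..s}) p \<and> G \<subseteq> point_span n V {1..n} p \<and>
        (\<forall>x\<in>G. Osc (sys_sum n V) X 2 x = pspan (sys_sum n V)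
          (summand_incl n V (\<sigma> 1) ` Osc (V (\<sigma> 1)) (linsys_map (V (\<sigma> 1)) ` C) 2 (linsys_map (V (\<sigma> 1)) p) \<union>
           (\<Union>i\<in>{2..n}. summand_incl n V (\<sigma> i) `
              Osc (V (\<sigma> i)) (linsys_map (V (\<sigma> i)) ` C) 1 (linsys_map (V (\<sigma> i)) p)))))
     \<or>
     ((\<exists>f. isomorphism M C (coord_space {1..2::nat}) (Proj (coord_space {1..2})) f) \<and>
        (\<forall>i\<in>{1..s}. proj_line (V (\<sigma> i)) (linsys_map (V (\<sigma> i)) ` C)) \<and>
        G = (\<Union>p\<in>C. point_span n V (\<sigma> ` {1..s}) p) \<and>
        segre_image_in (sys_sum n V)
          (pspan (sys_sum n V)
            (\<Union>i\<in>{1..s}. summand_incl n V (\<sigma> i) ` linsys_map (V (\<sigma> i)) ` C)) s G \<and>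
        (\<forall>p\<in>C. \<forall>x\<in>G \<inter> point_span n V {1..n} p.
          Osc (sys_sum n V) X 2 x = pspan (sys_sum n V)
          (summand_incl n V (\<sigma> 1) ` Osc (V (\<sigma> 1)) (linsys_map (V (\<sigma> 1)) ` C) 2 (linsys_map (V (\<sigma> 1)) p) \<union>
           (\<Union>i\<in>{2..n}. summand_incl n V (\<sigma> i) `
              Osc (V (\<sigma> i)) (linsys_map (V (\<sigma> i)) ` C) 1 (linsys_map (V (\<sigma> i)) p)))))) \<and>
    (\<forall>x\<in>G. pdim (sys_sum n V) (Osc (sys_sum n V) X 2 x) = 2 * int n - 1)"
proof -
  have fin: "fin_dim M" and cl: "closedin (zariski M) C" and irr: "irreducible_set (zariski M) C" and sm: "smooth_of_dim M C 1"
    using curve unfolding smooth_projective_curve_def by auto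
  have CP: "C \<subseteq> Proj M" using closedin_subset[OF cl] by simp
  interpret S: scroll M C n L V
    by unfold_locales (use fin CP irr sm n systems in auto)
  have G': "irreducible_component (zariski (sys_sum n V)) (inflectional_locus (sys_sum n V) n (decomposable_scroll n C V) 2) G"
    using G unfolding \<Phi> X .
  have stratum_fibre: "S.stratum {p} I = point_span n V I p" if "p \<in> C" "I \<subseteq> {1..n}" for p I
    unfolding S.stratum_def S.point_span_eq[OF that(2,1)] by blast
  have pt_pt: "q = p" if "S.pt q c \<in> point_span n V {1..n} p" "q \<in> C" "p \<in> C" "S.nonzero c" for p q c
    using that S.pt_inj unfolding S.point_span_eq[OF subset_refl that(3)] by blast
  \<comment> \<open>Stated for any set \<open>I\<close> of inflectional indices over
    \<open>p\<close>, so that it serves both for a single fibre and for the sub-scroll.\<close>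
  have Osc_pt: "Osc (sys_sum n V) X 2 (S.pt p c) = pspan (sys_sum n V)
      (summand_incl n V (\<sigma> 1) ` Osc (V (\<sigma> 1)) (linsys_map (V (\<sigma> 1)) ` C) 2 (linsys_map (V (\<sigma> 1)) p) \<union>
       (\<Union>i\<in>{2..n}. summand_incl n V (\<sigma> i) `
          Osc (V (\<sigma> i)) (linsys_map (V (\<sigma> i)) ` C) 1 (linsys_map (V (\<sigma> i)) p)))"
    and pdim_pt: "pdim (sys_sum n V) (Osc (sys_sum n V) X 2 (S.pt p c)) = 2 * int n - 1"
    if p: "p \<in> C" and c: "S.nonzero c" "\<forall>i\<in>{1..n} - I. c i = 0" and I: "\<And>i. i \<in> I \<Longrightarrow> S.infl i p"
      and \<sigma>: "\<sigma> permutes {1..n}" "\<sigma> 1 \<in> I" for p c I \<sigma>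
  proof -
    have "S.pt p c \<in> inflectional_locus (sys_sum n V) n (decomposable_scroll n C V) 2"
      unfolding S.inflectional_iff[OF p c(1)] using c(2) I by blast
    then have O: "Osc (sys_sum n V) X 2 (S.pt p c) = Proj_quot (sys_sum n V) (S.first_order p)" unfolding X by (rule S.Osc_inflectional[OF p c(1)])
    show "Osc (sys_sum n V) X 2 (S.pt p c) = pspan (sys_sum n V)
      (summand_incl n V (\<sigma> 1) ` Osc (V (\<sigma> 1)) (linsys_map (V (\<sigma> 1)) ` C) 2 (linsys_map (V (\<sigma> 1)) p) \<union>
       (\<Union>i\<in>{2..n}. summand_incl n V (\<sigma> i) `
          Osc (V (\<sigma> i)) (linsys_map (V (\<sigma> i)) ` C) 1 (linsys_map (V (\<sigma> i)) p)))"
      unfolding O by (rule S.pspan_Osc[OF \<sigma>(1) p I[OF \<sigma>(2)], symmetric])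
    show "pdim (sys_sum n V) (Osc (sys_sum n V) X 2 (S.pt p c)) = 2 * int n - 1" unfolding O by (rule S.pdim_first_order[OF p])
  qed
  from S.inflectional_component_cases[OF G'] show ?thesis
  proof (elim disjE bexE conjE)
    fix p assume p: "p \<in> C" and ne: "{i\<in>{1..n}. S.infl i p} \<noteq> {}" and Gp: "G = S.stratum {p} {i\<in>{1..n}. S.infl i p}"
    let ?I = "{i\<in>{1..n}. S.infl i p}"
    have I: "?I \<subseteq> {1..n}" by blast
    \<comment> \<open>The inflectional indices are moved to the front: \<open>s\<close> is their
      number and \<open>\<sigma> 1\<close> is one of them.\<close>
    obtain \<sigma> where \<sigma>: "\<sigma> permutes {1..n}" "\<sigma> ` {1..card ?I} = ?I" using permutes_initial_segment[OF I] by blast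
    have s: "1 \<le> card ?I" "card ?I \<le> n"
      using ne card_gt_0_iff[of ?I] card_mono[OF finite_atLeastAtMost I] by auto
    have \<sigma>1: "\<sigma> 1 \<in> ?I" using \<sigma>(2) s(1) by (metis (no_types, lifting) atLeastAtMost_iff image_eqI le_refl)
    have x: "\<exists>c. S.nonzero c \<and> (\<forall>i\<in>{1..n} - ?I. c i = 0) \<and> x = S.pt p c" if "x \<in> G" for x
      using that unfolding Gp S.stratum_def by blast
    have O: "\<forall>x\<in>G. Osc (sys_sum n V) X 2 x = pspan (sys_sum n V)
      (summand_incl n V (\<sigma> 1) ` Osc (V (\<sigma> 1)) (linsys_map (V (\<sigma> 1)) ` C) 2 (linsys_map (V (\<sigma> 1)) p) \<union>
       (\<Union>i\<in>{2..n}. summand_incl n V (\<sigma> i) `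
          Osc (V (\<sigma> i)) (linsys_map (V (\<sigma> i)) ` C) 1 (linsys_map (V (\<sigma> i)) p)))"
      and D: "\<forall>x\<in>G. pdim (sys_sum n V) (Osc (sys_sum n V) X 2 x) = 2 * int n - 1"
      using x Osc_pt[OF p _ _ _ \<sigma>(1) \<sigma>1] pdim_pt[OF p _ _ _ \<sigma>(1) \<sigma>1] by blast+
    have "G = point_span n V (\<sigma> ` {1..card ?I}) p" unfolding \<sigma>(2) Gp by (rule stratum_fibre[OF p I])
    moreover have "G \<subseteq> point_span n V {1..n} p"
      unfolding Gp S.stratum_def S.point_span_eq[OF subset_refl p] by blast
    ultimately show ?thesis using \<sigma>(1) s O D p
      by (intro exI[of _ \<sigma>] exI[of _ "card ?I"] conjI disjI1 bexI[of _ p]) assumption+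
  next
    let ?I = "{i\<in>{1..n}. \<forall>q\<in>C. S.infl i q}"
    assume ne: "?I \<noteq> {}" and GI: "G = S.stratum C ?I"
    have I: "?I \<subseteq> {1..n}" by blast
    \<comment> \<open>The same reordering, now for the curves that are inflectional at every point,
      hence lines.\<close>
    obtain \<sigma> where \<sigma>: "\<sigma> permutes {1..n}" "\<sigma> ` {1..card ?I} = ?I" using permutes_initial_segment[OF I] by blast
    have s: "1 \<le> card ?I" "card ?I \<le> n"
      using ne card_gt_0_iff[of ?I] card_mono[OF finite_atLeastAtMost I] by auto
    have \<sigma>I: "\<sigma> i \<in> ?I" if "i \<in> {1..card ?I}" for i using \<sigma>(2) that by blast
    have \<sigma>1: "\<sigma> 1 \<in> ?I" using \<sigma>I s(1) by simp
    have lc: "line_curve M C (L (\<sigma> i)) (V (\<sigma> i))" if "i \<in> {1..card ?I}" for i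
      by (rule line_curve.intro[OF S.embedded]) (use \<sigma>I[OF that] in \<open>auto intro: line_curve_axioms.intro\<close>)
    have x: "\<exists>p c. p \<in> C \<and> S.nonzero c \<and> (\<forall>i\<in>{1..n} - ?I. c i = 0) \<and> x = S.pt p c" if "x \<in> G" for x
      using that unfolding GI S.stratum_def by blast
    have D: "\<forall>x\<in>G. pdim (sys_sum n V) (Osc (sys_sum n V) X 2 x) = 2 * int n - 1"
    proof
      fix x assume "x \<in> G"
      then obtain p c where p: "p \<in> C" "S.nonzero c" "\<forall>i\<in>{1..n} - ?I. c i = 0" "x = S.pt p c" using x by blast
      show "pdim (sys_sum n V) (Osc (sys_sum n V) X 2 x) = 2 * int n - 1" unfolding p(4)
        by (rule pdim_pt[OF p(1-3) _ \<sigma>(1) \<sigma>1]) (use p(1) in blast)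
    qed
    have O: "\<forall>p\<in>C. \<forall>x\<in>G \<inter> point_span n V {1..n} p. Osc (sys_sum n V) X 2 x = pspan (sys_sum n V)
      (summand_incl n V (\<sigma> 1) ` Osc (V (\<sigma> 1)) (linsys_map (V (\<sigma> 1)) ` C) 2 (linsys_map (V (\<sigma> 1)) p) \<union>
       (\<Union>i\<in>{2..n}. summand_incl n V (\<sigma> i) `
          Osc (V (\<sigma> i)) (linsys_map (V (\<sigma> i)) ` C) 1 (linsys_map (V (\<sigma> i)) p)))"
    proof (intro ballI)
      fix p x assume p: "p \<in> C" and "x \<in> G \<inter> point_span n V {1..n} p"
      then have xG: "x \<in> G" and xp: "x \<in> point_span n V {1..n} p" by auto
      obtain q c where q: "q \<in> C" "S.nonzero c" "\<forall>i\<in>{1..n} - ?I. c i = 0" "x = S.pt q c" using x[OF xG] by blast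
      \<comment> \<open>Distinct fibres are disjoint, so a point of \<open>G\<close> in the fibre
        over \<open>p\<close> has \<open>p\<close> as its base point.\<close>
      have "q = p" using pt_pt[OF _ q(1) p q(2)] xp q(4) by blast
      then show "Osc (sys_sum n V) X 2 x = pspan (sys_sum n V)
        (summand_incl n V (\<sigma> 1) ` Osc (V (\<sigma> 1)) (linsys_map (V (\<sigma> 1)) ` C) 2 (linsys_map (V (\<sigma> 1)) p) \<union>
         (\<Union>i\<in>{2..n}. summand_incl n V (\<sigma> i) `
            Osc (V (\<sigma> i)) (linsys_map (V (\<sigma> i)) ` C) 1 (linsys_map (V (\<sigma> i)) p)))"
        unfolding q(4) using Osc_pt[OF q(1-3) _ \<sigma>(1) \<sigma>1] q(1) by blast
    qed
    have iso: "\<exists>f. isomorphism M C (coord_space {1..2::nat}) (Proj (coord_space {1..2})) f"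
      by (rule line_curve.isomorphic_P1[OF lc[of 1]]) (use s in simp)
    have lines: "\<forall>i\<in>{1..card ?I}. proj_line (V (\<sigma> i)) (linsys_map (V (\<sigma> i)) ` C)"
      using line_curve.image_is_line[OF lc] by blast
    have "S.stratum C ?I = (\<Union>p\<in>C. S.stratum {p} ?I)" unfolding S.stratum_def by blast
    also have "\<dots> = (\<Union>p\<in>C. point_span n V ?I p)" by (rule SUP_cong[OF refl stratum_fibre[OF _ I]])
    finally have un: "G = (\<Union>p\<in>C. point_span n V (\<sigma> ` {1..card ?I}) p)" unfolding \<sigma>(2) GI .
    have segre: "segre_image_in (sys_sum n V) (pspan (sys_sum n V) (\<Union>i\<in>{1..card ?I}. summand_incl n V (\<sigma> i) ` linsys_map (V (\<sigma> i)) ` C)) (card ?I) G"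
    proof -
      have G\<sigma>: "G = S.stratum C (\<sigma> ` {1..card ?I})" unfolding \<sigma>(2) GI ..
      have inf: "S.infl (\<sigma> i) q" if "i \<in> {1..card ?I}" "q \<in> C" for i q using \<sigma>I[OF that(1)] that(2) by blast
      show ?thesis unfolding G\<sigma> by (rule S.segre_stratum[OF \<sigma>(1) s]) (fact inf)
    qed
    show ?thesis using \<sigma>(1) s O D iso lines un segre
      by (intro exI[of _ \<sigma>] exI[of _ "card ?I"] conjI disjI2) assumption+
  qed
qed

end
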